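(* Let $(X,\mu)$ and $(Y,\nu)$ be standard $\sigma$-finite measure spaces. A measurable function $\varphi:X\times Y\to\mathbb{C}$ is a w*-closable multiplier if and only if there exist $\omega$-continuous functions $t,s\in\mathcal{V}(X,Y)$ such that $s(x,y)\neq 0$ marginally almost everywhere on $X\times Y$ (that is, outside a marginally null set) and $\varphi(x,y)=\dfrac{t(x,y)}{s(x,y)}$ almost everywhere on $X\times Y$ with respect to $\mu\times\nu$.
   Context: Write $H_1=L^2(X,\mu)$, $H_2=L^2(Y,\nu)$; for $k\in L^2(X\times Y,\mu\times\nu)$ let $I_k:H_1\to H_2$ be the Hilbert–Schmidt operator $(I_k\xi)(y)=\int_X k(x,y)\xi(x)\,d\mu(x)$. For measurable $\varphi:X\times Y\to\mathbb{C}$ let $D(\varphi)=\{k\in L^2(X\times Y):\varphi k\in L^2(X\times Y)\}$ and let $S_\varphi$ be the densely defined operator on the space $\mathcal{K}(H_1,H_2)$ of compact operators with domain $\{I_k:k\in D(\varphi)\}$ given by $S_\varphi(I_k)=I_{\varphi k}$. The function $\varphi$ is a w*-closable multiplier if $S_\varphi$ is w*-closable: the weak* closure of its graph in $\mathcal{K}(H_1,H_2)^{**}\oplus\mathcal{K}(H_1,H_2)^{**}=\mathcal{B}(H_1,H_2)\oplus\mathcal{B}(H_1,H_2)$ is the graph of an operator (here the weak* topology on $\mathcal{B}(H_1,H_2)$ is the one given by the duality with the nuclear operators from $H_2$ to $H_1$). A rectangle is a set $\alpha\times\beta$ with $\alpha\subseteq X$, $\beta\subseteq Y$ measurable. A set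 $E\subseteq X\times Y$ is marginally null if $E\subseteq (X_0\times Y)\cup(X\times Y_0)$ with $\mu(X_0)=\nu(Y_0)=0$. A set is $\omega$-open if it differs from a countable union of rectangles by a marginally null set (symmetric difference marginally null). A measurable function $g:X\times Y\to\mathbb{C}$ is $\omega$-continuous if $g^{-1}(U)$ is $\omega$-open for every open $U\subseteq\mathbb{C}$. $\mathcal{V}(X,Y)$ is the set of all measurable functions $\psi:X\times Y\to\mathbb{C}$ for which there are measurable functions $a_i:X\to\mathbb{C}$, $b_i:Y\to\mathbb{C}$, $i\in\mathbb{N}$, with $\sum_i|a_i(x)|^2<\infty$ for almost all $x$, $\sum_i|b_i(y)|^2<\infty$ for almost all $y$, and $\psi(x,y)=\sum_i a_i(x)b_i(y)$ for almost all $(x,y)$. (Every element of $\mathcal{V}(X,Y)$ is almost everywhere equal to an $\omega$-continuous function, unique up to marginally null sets.) *)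

theory Defs
  imports "HOL-Analysis.Analysis"
begin

text \<open>A standard measure space carries the Borel sigma-algebra of some Polish topology;
  sigma-finiteness is required as well.\<close>

definition standard_sigma_finite :: "'a measure \<Rightarrow> bool" where
  "standard_sigma_finite M \<longleftrightarrow>
     sigma_finite_measure M \<and>
     (\<exists>T. topspace T = space M \<and> completely_metrizable_space T \<and> separable_space T \<and>
          sets M = sigma_sets (space M) {U. openin T U})"

subsection \<open>Complex L2 spaces and operators between them\<close>

text \<open>There is no type of L2 classes depending on a measure, so vectors are represented by
  square-integrable functions, and equality of vectors is equality almost everywhere. Accordingly,
  operators are maps on representatives, with linearity required almost everywhere, and
  \<open>op_eq\<close> is equality of operators. Linearity and boundedness together imply that an
  operator respects equality almost everywhere. What an operator does outside \<open>L2 M\<close> is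
  irrelevant.\<close>

definition L2 :: "'a measure \<Rightarrow> ('a \<Rightarrow> complex) set" where
  "L2 M = {f \<in> borel_measurable M. integrable M (\<lambda>x. (cmod (f x))\<^sup>2)}"

definition L2_inner :: "'a measure \<Rightarrow> ('a \<Rightarrow> complex) \<Rightarrow> ('a \<Rightarrow> complex) \<Rightarrow> complex" where
  "L2_inner M f g = (\<integral>x. f x * cnj (g x) \<partial>M)"

definition L2_norm :: "'a measure \<Rightarrow> ('a \<Rightarrow> complex) \<Rightarrow> real" where
  "L2_norm M f = sqrt (\<integral>x. (cmod (f x))\<^sup>2 \<partial>M)"

type_synonym ('a, 'b) operator = "('a \<Rightarrow> complex) \<Rightarrow> ('b \<Rightarrow> complex)"

definition bounded_ops :: "'a measure \<Rightarrow> 'b measure \<Rightarrow> ('a, 'b) operator set" where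
  "bounded_ops M N = {T.
     (\<forall>f\<in>L2 M. T f \<in> L2 N) \<and>
     (\<forall>f\<in>L2 M. \<forall>g\<in>L2 M. AE y in N. T (\<lambda>x. f x + g x) y = T f y + T g y) \<and>
     (\<forall>c. \<forall>f\<in>L2 M. AE y in N. T (\<lambda>x. c * f x) y = c * T f y) \<and>
     (\<exists>C. \<forall>f\<in>L2 M. L2_norm N (T f) \<le> C * L2_norm M f)}"

definition op_eq :: "'a measure \<Rightarrow> 'b measure \<Rightarrow> ('a, 'b) operator \<Rightarrow> ('a, 'b) operator \<Rightarrow> bool" where
  "op_eq M N S T \<longleftrightarrow> (\<forall>f\<in>L2 M. AE y in N. S f y = T f y)"

subsection \<open>Nuclear operators, trace, and the weak* topology\<close>

definition nuclear_ops :: "'a measure \<Rightarrow> 'b measure \<Rightarrow> ('a, 'b) operator set" where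
  "nuclear_ops M N = {A \<in> bounded_ops M N.
     \<exists>(g :: nat \<Rightarrow> 'a \<Rightarrow> complex) (f :: nat \<Rightarrow> 'b \<Rightarrow> complex).
       (\<forall>i. g i \<in> L2 M \<and> f i \<in> L2 N) \<and>
       summable (\<lambda>i. L2_norm M (g i) * L2_norm N (f i)) \<and>
       (\<forall>h\<in>L2 M. (\<lambda>n. L2_norm N (\<lambda>y. A h y - (\<Sum>i<n. L2_inner M h (g i) * f i y)))
                    \<longlonglongrightarrow> 0)}"

definition orthonormal_basis :: "'a measure \<Rightarrow> ('a \<Rightarrow> complex) set \<Rightarrow> bool" where
  "orthonormal_basis M E \<longleftrightarrow>
     E \<subseteq> L2 M \<and>
     (\<forall>e\<in>E. L2_norm M e = 1) \<and>
     (\<forall>e\<in>E. \<forall>e'\<in>E. e \<noteq> e' \<longrightarrow> L2_inner M e e' = 0) \<and>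
     (\<forall>f\<in>L2 M. (\<forall>e\<in>E. L2_inner M f e = 0) \<longrightarrow> (AE x in M. f x = 0))"

definition op_trace :: "'a measure \<Rightarrow> ('a, 'a) operator \<Rightarrow> complex" where
  "op_trace M C =
     (THE c. \<forall>E. orthonormal_basis M E \<longrightarrow> ((\<lambda>e. L2_inner M (C e) e) has_sum c) E)"

text \<open>The coarsest topology on the bounded operators from \<open>L2 M\<close> to \<open>L2 N\<close> for which
  all functionals \<open>T \<mapsto> tr (T A)\<close> are continuous, where \<open>A\<close> is nuclear from
  \<open>L2 N\<close> to \<open>L2 M\<close>.\<close>

definition weak_star_topology :: "'a measure \<Rightarrow> 'b measure \<Rightarrow> ('a, 'b) operator topology" where
  "weak_star_topology M N =
     pullback_topology (bounded_ops M N)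
       (\<lambda>T. \<lambda>A\<in>nuclear_ops N M. op_trace N (T \<circ> A))
       (product_topology (\<lambda>_. euclidean) (nuclear_ops N M))"

subsection \<open>Closable multipliers\<close>

text \<open>The operator \<open>I\<^sub>k\<close> is the integral operator with kernel \<open>k\<close>; being Hilbert-Schmidt, it is
  compact, and the canonical embedding of the compact operators into their bidual is the inclusion
  into the bounded operators.\<close>

definition integral_op :: "'a measure \<Rightarrow> ('a \<times> 'b \<Rightarrow> complex) \<Rightarrow> ('a, 'b) operator" where
  "integral_op M k = (\<lambda>\<xi> y. \<integral>x. k (x, y) * \<xi> x \<partial>M)"

definition multiplier_domain ::
    "'a measure \<Rightarrow> 'b measure \<Rightarrow> ('a \<times> 'b \<Rightarrow> complex) \<Rightarrow> ('a \<times> 'b \<Rightarrow> complex) set" where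
  "multiplier_domain M N \<phi> =
     {k \<in> L2 (M \<Otimes>\<^sub>M N). (\<lambda>p. \<phi> p * k p) \<in> L2 (M \<Otimes>\<^sub>M N)}"

definition multiplier_graph ::
    "'a measure \<Rightarrow> 'b measure \<Rightarrow> ('a \<times> 'b \<Rightarrow> complex) \<Rightarrow>
      (('a, 'b) operator \<times> ('a, 'b) operator) set" where
  "multiplier_graph M N \<phi> =
     (\<lambda>k. (integral_op M k, integral_op M (\<lambda>p. \<phi> p * k p))) ` multiplier_domain M N \<phi>"

text \<open>The graph of a (not necessarily everywhere defined) linear operator on the space of bounded
  operators: a linear subspace of the direct sum that is single-valued, both up to
  \<open>op_eq\<close>.\<close>

definition is_operator_graph ::
    "'a measure \<Rightarrow> 'b measure \<Rightarrow> (('a, 'b) operator \<times> ('a, 'b) operator) set \<Rightarrow> bool" where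
  "is_operator_graph M N G \<longleftrightarrow>
     G \<subseteq> bounded_ops M N \<times> bounded_ops M N \<and>
     ((\<lambda>_ _. 0), (\<lambda>_ _. 0)) \<in> G \<and>
     (\<forall>S T S' T'. (S, T) \<in> G \<longrightarrow> (S', T') \<in> G \<longrightarrow>
        ((\<lambda>f y. S f y + S' f y), (\<lambda>f y. T f y + T' f y)) \<in> G) \<and>
     (\<forall>c S T. (S, T) \<in> G \<longrightarrow> ((\<lambda>f y. c * S f y), (\<lambda>f y. c * T f y)) \<in> G) \<and>
     (\<forall>S T S' T'. (S, T) \<in> G \<longrightarrow> (S', T') \<in> G \<longrightarrow> op_eq M N S S' \<longrightarrow> op_eq M N T T')"

text \<open>The weak* topology of the direct sum is the product of the weak* topologies. Operators that
  are equal in the sense of \<open>op_eq\<close> are topologically indistinguishable, so the closure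
  below is the preimage of the closure taken in the space of actual operators.\<close>

definition weak_star_closable_multiplier ::
    "'a measure \<Rightarrow> 'b measure \<Rightarrow> ('a \<times> 'b \<Rightarrow> complex) \<Rightarrow> bool" where
  "weak_star_closable_multiplier M N \<phi> \<longleftrightarrow>
     is_operator_graph M N
       (prod_topology (weak_star_topology M N) (weak_star_topology M N)
          closure_of multiplier_graph M N \<phi>)"

subsection \<open>Marginally null sets and omega-continuity\<close>

definition marginally_null :: "'a measure \<Rightarrow> 'b measure \<Rightarrow> ('a \<times> 'b) set \<Rightarrow> bool" where
  "marginally_null M N E \<longleftrightarrow>
     (\<exists>X0\<in>null_sets M. \<exists>Y0\<in>null_sets N. E \<subseteq> (X0 \<times> space N) \<union> (space M \<times> Y0))"

definition omega_open :: "'a measure \<Rightarrow> 'b measure \<Rightarrow> ('a \<times> 'b) set \<Rightarrow> bool" where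
  "omega_open M N E \<longleftrightarrow>
     E \<subseteq> space M \<times> space N \<and>
     (\<exists>(\<alpha> :: nat \<Rightarrow> 'a set) (\<beta> :: nat \<Rightarrow> 'b set).
        (\<forall>i. \<alpha> i \<in> sets M \<and> \<beta> i \<in> sets N) \<and>
        marginally_null M N ((E - (\<Union>i. \<alpha> i \<times> \<beta> i)) \<union> ((\<Union>i. \<alpha> i \<times> \<beta> i) - E)))"

definition omega_continuous ::
    "'a measure \<Rightarrow> 'b measure \<Rightarrow> ('a \<times> 'b \<Rightarrow> complex) \<Rightarrow> bool" where
  "omega_continuous M N g \<longleftrightarrow>
     g \<in> borel_measurable (M \<Otimes>\<^sub>M N) \<and>
     (\<forall>U. open U \<longrightarrow> omega_open M N (g -` U \<inter> space (M \<Otimes>\<^sub>M N)))"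

definition V_functions :: "'a measure \<Rightarrow> 'b measure \<Rightarrow> ('a \<times> 'b \<Rightarrow> complex) set" where
  "V_functions M N = {\<psi> \<in> borel_measurable (M \<Otimes>\<^sub>M N).
     \<exists>(a :: nat \<Rightarrow> 'a \<Rightarrow> complex) (b :: nat \<Rightarrow> 'b \<Rightarrow> complex).
       (\<forall>i. a i \<in> borel_measurable M \<and> b i \<in> borel_measurable N) \<and>
       (AE x in M. summable (\<lambda>i. (cmod (a i x))\<^sup>2)) \<and>
       (AE y in N. summable (\<lambda>i. (cmod (b i y))\<^sup>2)) \<and>
       (AE p in M \<Otimes>\<^sub>M N. (\<lambda>i. a i (fst p) * b i (snd p)) sums \<psi> p)}"

end

theory Submission
  imports Defs
begin

text \<open>A nuclear operator \<open>A\<close> from \<open>L2 N\<close> to \<open>L2 M\<close> has a kernel \<open>h (x, y) = \<Sum>i. f i x * cnj (g i y)\<close> with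
  \<open>\<Sum>i. L2_norm M (f i) * L2_norm N (g i)\<close> finite, and the trace of \<open>T \<circ> A\<close> is
  \<open>\<Sum>i. L2_inner N (T (f i)) (g i)\<close>; for an integral operator \<open>T\<close> with kernel \<open>k\<close> it is the integral of
  \<open>k * h\<close>. The weak* closure of the graph of the multiplier is a bipolar for this pairing. Consequently
  \<open>\<phi>\<close> is closable if and only if only \<open>T = 0\<close> annihilates all nuclear kernels \<open>h\<close> for which \<open>\<phi> * h\<close> is
  again a nuclear kernel (\<open>closable_iff_annihilator_trivial\<close>). These \<open>h\<close> form the domain of the adjoint.

  Suppose that \<open>\<phi> = t / s\<close> and that \<open>T\<close> annihilates this domain. Multiplication by \<open>s\<close> or \<open>t\<close> maps an
  elementary tensor that lives where the representing families are bounded to a nuclear kernel. So the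
  domain contains \<open>s\<close> times such tensors, and \<open>s\<close> annihilates \<open>T\<close> as a Schur multiplier. Around a point where
  \<open>s\<close> does not vanish, there is a rectangle on which \<open>s\<close> is a nonzero constant plus a multiplier of smaller
  norm, and \<open>T\<close> vanishes on such a rectangle (\<open>vanishes_on_small_rectangle\<close>). Countably many of these
  rectangles cover the product up to a marginally null set. Regularity of finite measures on a Polish space
  reduces this to finite covers of slightly smaller rectangles, and \<open>T = 0\<close> follows
  (\<open>vanishing_on_countable_cover\<close>).

  Conversely, suppose that \<open>\<phi>\<close> is closable. The domain of the adjoint is then dense in the nuclear
  kernels for the projective tensor norm, because by Hahn-Banach and the Riesz representation a proper
  closed subspace would be annihilated by a nonzero bounded operator (\<open>closable_imp_dense\<close>). In
  particular a nowhere vanishing elementary tensor is a limit of some \<open>h n\<close> in the domain. Fast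
  convergence in norm implies convergence at every point outside a marginally null set, so that the
  \<open>h n\<close> have no common zero there. Since \<open>\<phi>\<close> is the quotient of \<open>\<phi> * h n\<close> by \<open>h n\<close> for every \<open>n\<close>, a suitably
  weighted sum of the functions \<open>h n * cnj (h n)\<close> is a denominator \<open>s\<close>, with the corresponding sum of
  \<open>\<phi> * h n * cnj (h n)\<close> as numerator (\<open>common_denominator\<close>). Products of square-summable families are
  omega-continuous (\<open>family_product_omega_continuous\<close>).\<close>

section \<open>Square-integrable functions\<close>

lemma borel_measurable_cnj [measurable]:
  "f \<in> borel_measurable M \<Longrightarrow> (\<lambda>x. cnj (f x)) \<in> borel_measurable M"
  by (rule borel_measurable_continuous_on[where f = cnj]) (auto intro!: continuous_intros)

lemma L2_measurable [measurable_dest]: "f \<in> L2 M \<Longrightarrow> f \<in> borel_measurable M"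
  by (simp add: L2_def)

lemma L2_integrable: "f \<in> L2 M \<Longrightarrow> integrable M (\<lambda>x. (cmod (f x))\<^sup>2)"
  by (simp add: L2_def)

lemma L2_norm_nonneg [simp]: "0 \<le> L2_norm M f"
  by (simp add: L2_norm_def)

lemma L2_norm_square: "(L2_norm M f)\<^sup>2 = (\<integral>x. (cmod (f x))\<^sup>2 \<partial>M)"
  by (simp add: L2_norm_def)

lemma L2_norm_cong_AE:
  assumes "f \<in> borel_measurable M" "g \<in> borel_measurable M" "AE x in M. f x = g x"
  shows "L2_norm M f = L2_norm M g"
  unfolding L2_norm_def
  by (intro arg_cong[where f = sqrt] integral_cong_AE) (use assms in auto)

lemma L2_bound:
  assumes [measurable]: "g \<in> borel_measurable M" and h: "h \<in> L2 M"
    and le: "AE x in M. cmod (g x) \<le> C * cmod (h x)"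
  shows "g \<in> L2 M"
proof -
  note [measurable] = L2_measurable[OF h]
  have "integrable M (\<lambda>x. C\<^sup>2 * (cmod (h x))\<^sup>2)"
    using L2_integrable[OF h] by simp
  then have "integrable M (\<lambda>x. (cmod (g x))\<^sup>2)"
  proof (rule Bochner_Integration.integrable_bound)
    show "AE x in M. norm ((cmod (g x))\<^sup>2) \<le> norm (C\<^sup>2 * (cmod (h x))\<^sup>2)"
      using le
    proof eventually_elim
      case (elim x)
      then have "(cmod (g x))\<^sup>2 \<le> (C * cmod (h x))\<^sup>2"
        by (intro power_mono) auto
      then show ?case by (simp add: power_mult_distrib)
    qed
  qed measurable
  then show ?thesis by (simp add: L2_def)
qed

lemma L2_zero [simp]: "(\<lambda>_. 0) \<in> L2 M"
  by (simp add: L2_def)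

lemma L2_add:
  assumes "f \<in> L2 M" "g \<in> L2 M"
  shows "(\<lambda>x. f x + g x) \<in> L2 M"
proof -
  note [measurable] = L2_measurable[OF assms(1)] L2_measurable[OF assms(2)]
  have "integrable M (\<lambda>x. 2 * (cmod (f x))\<^sup>2 + 2 * (cmod (g x))\<^sup>2)"
    using L2_integrable[OF assms(1)] L2_integrable[OF assms(2)] by simp
  then have "integrable M (\<lambda>x. (cmod (f x + g x))\<^sup>2)"
  proof (rule Bochner_Integration.integrable_bound)
    show "AE x in M. norm ((cmod (f x + g x))\<^sup>2) \<le> norm (2 * (cmod (f x))\<^sup>2 + 2 * (cmod (g x))\<^sup>2)"
    proof (rule AE_I2)
      fix x
      have "(cmod (f x + g x))\<^sup>2 \<le> (cmod (f x) + cmod (g x))\<^sup>2"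
        by (intro power_mono norm_triangle_ineq) auto
      also have "\<dots> \<le> 2 * (cmod (f x))\<^sup>2 + 2 * (cmod (g x))\<^sup>2"
        using sum_squares_bound[of "cmod (f x)" "cmod (g x)"] by (simp add: power2_sum)
      finally show "norm ((cmod (f x + g x))\<^sup>2) \<le> norm (2 * (cmod (f x))\<^sup>2 + 2 * (cmod (g x))\<^sup>2)"
        by simp
    qed
  qed measurable
  then show ?thesis by (simp add: L2_def)
qed

lemma L2_mult_bounded:
  assumes "f \<in> L2 M" "m \<in> borel_measurable M" "\<And>x. x \<in> space M \<Longrightarrow> cmod (m x) \<le> C"
  shows "(\<lambda>x. m x * f x) \<in> L2 M"
proof (rule L2_bound[OF _ assms(1), where C = C])
  show "AE x in M. cmod (m x * f x) \<le> C * cmod (f x)"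
    by (intro AE_I2) (use assms(3) in \<open>auto simp: norm_mult intro!: mult_right_mono\<close>)
qed (use assms in measurable)

lemma L2_scale: "f \<in> L2 M \<Longrightarrow> (\<lambda>x. c * f x) \<in> L2 M"
  by (rule L2_mult_bounded[where C = "cmod c"]) auto

lemma L2_uminus: "f \<in> L2 M \<Longrightarrow> (\<lambda>x. - f x) \<in> L2 M"
  using L2_scale[of f M "-1"] by simp

lemma L2_diff:
  assumes "f \<in> L2 M" "g \<in> L2 M"
  shows "(\<lambda>x. f x - g x) \<in> L2 M"
  using L2_add[OF assms(1) L2_uminus[OF assms(2)]] by simp

lemma L2_cnj: "f \<in> L2 M \<Longrightarrow> (\<lambda>x. cnj (f x)) \<in> L2 M"
  by (rule L2_bound[where h = f and C = 1]) auto

lemma L2_norm_cnj [simp]: "L2_norm M (\<lambda>x. cnj (f x)) = L2_norm M f"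
  by (simp add: L2_norm_def)

lemma L2_indicator:
  assumes "f \<in> L2 M" "A \<in> sets M"
  shows "(\<lambda>x. indicator A x * f x) \<in> L2 M"
  by (rule L2_mult_bounded[where C = 1]) (use assms in \<open>auto simp: indicator_def\<close>)

lemma L2_sum:
  assumes "\<And>i. i \<in> I \<Longrightarrow> f i \<in> L2 M"
  shows "(\<lambda>x. \<Sum>i\<in>I. f i x) \<in> L2 M"
  using assms by (induction I rule: infinite_finite_induct) (auto intro: L2_add)

lemma L2_norm_scale [simp]: "L2_norm M (\<lambda>x. c * f x) = cmod c * L2_norm M f"
  by (simp add: L2_norm_def norm_mult power_mult_distrib real_sqrt_mult)

lemma L2_norm_uminus [simp]: "L2_norm M (\<lambda>x. - f x) = L2_norm M f"
  by (simp add: L2_norm_def)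

lemma L2_norm_zero [simp]: "L2_norm M (\<lambda>x. 0) = 0"
  by (simp add: L2_norm_def)

lemma L2_nn_integral:
  assumes "f \<in> L2 M"
  shows "(\<integral>\<^sup>+x. ennreal ((cmod (f x))\<^sup>2) \<partial>M) = ennreal ((L2_norm M f)\<^sup>2)"
  unfolding L2_norm_square
  by (rule nn_integral_eq_integral[OF L2_integrable[OF assms]]) auto

lemma L2_nn_integralI:
  assumes [measurable]: "f \<in> borel_measurable M" and C: "0 \<le> C"
    and le: "(\<integral>\<^sup>+x. ennreal ((cmod (f x))\<^sup>2) \<partial>M) \<le> ennreal (C\<^sup>2)"
  shows "f \<in> L2 M" and "L2_norm M f \<le> C"
proof -
  have "integrable M (\<lambda>x. (cmod (f x))\<^sup>2)"
    by (rule integrableI_bounded) (use le in \<open>auto simp: ennreal_power intro: le_less_trans\<close>)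
  then show f: "f \<in> L2 M" by (simp add: L2_def)
  have "(L2_norm M f)\<^sup>2 \<le> C\<^sup>2"
    using le unfolding L2_nn_integral[OF f] by simp
  then show "L2_norm M f \<le> C"
    using C by (rule power2_le_imp_le)
qed

lemma L2_norm_eq_0_iff:
  assumes "f \<in> L2 M"
  shows "L2_norm M f = 0 \<longleftrightarrow> (AE x in M. f x = 0)"
  using integral_nonneg_eq_0_iff_AE[OF L2_integrable[OF assms]]
  by (simp add: L2_norm_def)

subsection \<open>The inner product\<close>

lemma integrable_mult_L2:
  assumes "f \<in> L2 M" "g \<in> L2 M"
  shows "integrable M (\<lambda>x. f x * g x)"
proof -
  note [measurable] = L2_measurable[OF assms(1)] L2_measurable[OF assms(2)]
  have "integrable M (\<lambda>x. (cmod (f x))\<^sup>2 + (cmod (g x))\<^sup>2)"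
    using L2_integrable[OF assms(1)] L2_integrable[OF assms(2)] by simp
  then show ?thesis
  proof (rule Bochner_Integration.integrable_bound)
    show "AE x in M. norm (f x * g x) \<le> norm ((cmod (f x))\<^sup>2 + (cmod (g x))\<^sup>2)"
    proof (rule AE_I2)
      fix x
      have "2 * (cmod (f x) * cmod (g x)) \<le> (cmod (f x))\<^sup>2 + (cmod (g x))\<^sup>2"
        using sum_squares_bound[of "cmod (f x)" "cmod (g x)"] by simp
      moreover have "0 \<le> cmod (f x) * cmod (g x)" by simp
      ultimately have "cmod (f x) * cmod (g x) \<le> (cmod (f x))\<^sup>2 + (cmod (g x))\<^sup>2"
        by linarith
      then show "norm (f x * g x) \<le> norm ((cmod (f x))\<^sup>2 + (cmod (g x))\<^sup>2)"
        by (simp add: norm_mult)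
    qed
  qed measurable
qed

lemma integrable_L2_inner:
  assumes "f \<in> L2 M" "g \<in> L2 M"
  shows "integrable M (\<lambda>x. f x * cnj (g x))"
  using integrable_mult_L2[OF assms(1) L2_cnj[OF assms(2)]] .

lemma L2_norm_0_product:
  assumes "f \<in> L2 M" "L2_norm M f = 0"
  shows "(\<integral>x. cmod (f x * g x) \<partial>M) = 0"
proof -
  have "AE x in M. f x = 0" using assms L2_norm_eq_0_iff by blast
  then have "AE x in M. cmod (f x * g x) = 0" by eventually_elim simp
  then show ?thesis by (rule integral_eq_zero_AE)
qed

lemma L2_Cauchy_Schwarz:
  assumes f: "f \<in> L2 M" and g: "g \<in> L2 M"
  shows "(\<integral>x. cmod (f x * g x) \<partial>M) \<le> L2_norm M f * L2_norm M g"
proof (cases "L2_norm M f = 0 \<or> L2_norm M g = 0")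
  case True
  then show ?thesis
    using L2_norm_0_product[OF f, of g] L2_norm_0_product[OF g, of f] by (auto simp: mult.commute)
next
  case False
  define a b where "a = L2_norm M f" and "b = L2_norm M g"
  have ab: "a > 0" "b > 0"
    using False by (auto simp: a_def b_def less_le)
  \<comment> \<open>The weights in the inequality between the means make both sides agree after integration.\<close>
  have "(\<integral>x. cmod (f x * g x) \<partial>M) \<le> (\<integral>x. (b / a * (cmod (f x))\<^sup>2 + a / b * (cmod (g x))\<^sup>2) / 2 \<partial>M)"
  proof (rule integral_mono)
    show "integrable M (\<lambda>x. cmod (f x * g x))"
      using integrable_mult_L2[OF f g] by simp
    show "integrable M (\<lambda>x. (b / a * (cmod (f x))\<^sup>2 + a / b * (cmod (g x))\<^sup>2) / 2)"
      using L2_integrable[OF f] L2_integrable[OF g] by simp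
    fix x
    have "0 \<le> (b * cmod (f x) - a * cmod (g x))\<^sup>2 / (2 * a * b)"
      using ab by simp
    also have "\<dots> = (b / a * (cmod (f x))\<^sup>2 + a / b * (cmod (g x))\<^sup>2) / 2 - cmod (f x) * cmod (g x)"
      using ab by (simp add: field_simps power2_eq_square)
    finally show "cmod (f x * g x) \<le> (b / a * (cmod (f x))\<^sup>2 + a / b * (cmod (g x))\<^sup>2) / 2"
      by (simp add: norm_mult)
  qed
  also have "\<dots> = (b / a * a\<^sup>2 + a / b * b\<^sup>2) / 2"
    using L2_integrable[OF f] L2_integrable[OF g] by (simp add: a_def b_def L2_norm_square)
  also have "\<dots> = a * b" using ab by (simp add: field_simps power2_eq_square)
  finally show ?thesis by (simp add: a_def b_def)
qed

lemma L2_inner_bound: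
  assumes f: "f \<in> L2 M" and g: "g \<in> L2 M"
  shows "cmod (L2_inner M f g) \<le> L2_norm M f * L2_norm M g"
proof -
  have "cmod (L2_inner M f g) \<le> (\<integral>x. cmod (f x * cnj (g x)) \<partial>M)"
    unfolding L2_inner_def by (rule integral_norm_bound)
  also have "\<dots> \<le> L2_norm M f * L2_norm M g"
    using L2_Cauchy_Schwarz[OF f L2_cnj[OF g]] by simp
  finally show ?thesis .
qed

lemma L2_norm_triangle:
  assumes f: "f \<in> L2 M" and g: "g \<in> L2 M"
  shows "L2_norm M (\<lambda>x. f x + g x) \<le> L2_norm M f + L2_norm M g"
proof -
  have i: "integrable M (\<lambda>x. (cmod (f x))\<^sup>2 + 2 * cmod (f x * g x) + (cmod (g x))\<^sup>2)"
    using L2_integrable[OF f] L2_integrable[OF g] integrable_mult_L2[OF f g] by simp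
  have "(L2_norm M (\<lambda>x. f x + g x))\<^sup>2 \<le>
        (\<integral>x. (cmod (f x))\<^sup>2 + 2 * cmod (f x * g x) + (cmod (g x))\<^sup>2 \<partial>M)"
    unfolding L2_norm_square
  proof (rule integral_mono[OF L2_integrable[OF L2_add[OF f g]] i])
    fix x
    have "(cmod (f x + g x))\<^sup>2 \<le> (cmod (f x) + cmod (g x))\<^sup>2"
      by (intro power_mono norm_triangle_ineq) auto
    then show "(cmod (f x + g x))\<^sup>2 \<le> (cmod (f x))\<^sup>2 + 2 * cmod (f x * g x) + (cmod (g x))\<^sup>2"
      by (simp add: power2_sum norm_mult)
  qed
  also have "\<dots> = (L2_norm M f)\<^sup>2 + 2 * (\<integral>x. cmod (f x * g x) \<partial>M) + (L2_norm M g)\<^sup>2"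
    using L2_integrable[OF f] L2_integrable[OF g] integrable_mult_L2[OF f g]
    by (simp add: L2_norm_square)
  also have "\<dots> \<le> (L2_norm M f + L2_norm M g)\<^sup>2"
    using L2_Cauchy_Schwarz[OF f g] by (simp add: power2_sum)
  finally show ?thesis by (rule power2_le_imp_le) simp
qed

lemma L2_norm_sum:
  assumes "\<And>i. i \<in> I \<Longrightarrow> f i \<in> L2 M"
  shows "L2_norm M (\<lambda>x. \<Sum>i\<in>I. f i x) \<le> (\<Sum>i\<in>I. L2_norm M (f i))"
  using assms
proof (induction I rule: infinite_finite_induct)
  case (insert i I)
  then show ?case
    using L2_norm_triangle[of "f i" M "\<lambda>x. \<Sum>i\<in>I. f i x"] by (simp add: L2_sum)
qed auto

lemma L2_inner_add_left:
  assumes "f \<in> L2 M" "g \<in> L2 M" "h \<in> L2 M"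
  shows "L2_inner M (\<lambda>x. f x + g x) h = L2_inner M f h + L2_inner M g h"
  using integrable_L2_inner[OF assms(1,3)] integrable_L2_inner[OF assms(2,3)]
  by (simp add: L2_inner_def distrib_right)

lemma L2_inner_scale_left: "L2_inner M (\<lambda>x. c * f x) h = c * L2_inner M f h"
  by (simp add: L2_inner_def mult.assoc)

lemma L2_inner_diff_left:
  assumes "f \<in> L2 M" "g \<in> L2 M" "h \<in> L2 M"
  shows "L2_inner M (\<lambda>x. f x - g x) h = L2_inner M f h - L2_inner M g h"
  using integrable_L2_inner[OF assms(1,3)] integrable_L2_inner[OF assms(2,3)]
  by (simp add: L2_inner_def left_diff_distrib)

lemma L2_inner_commute: "L2_inner M g f = cnj (L2_inner M f g)"
proof -
  have "cnj (L2_inner M f g) = (\<integral>x. cnj (f x * cnj (g x)) \<partial>M)"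
    unfolding L2_inner_def by (simp del: complex_cnj_mult complex_cnj_cnj)
  then show ?thesis by (simp add: L2_inner_def mult.commute)
qed

lemma L2_inner_add_right:
  assumes "f \<in> L2 M" "g \<in> L2 M" "h \<in> L2 M"
  shows "L2_inner M h (\<lambda>x. f x + g x) = L2_inner M h f + L2_inner M h g"
  using L2_inner_add_left[OF assms] by (simp add: L2_inner_commute[of M h])

lemma L2_inner_scale_right: "L2_inner M h (\<lambda>x. c * f x) = cnj c * L2_inner M h f"
  using L2_inner_scale_left[of M c f h] by (simp add: L2_inner_commute[of M h])

lemma L2_inner_zero [simp]: "L2_inner M (\<lambda>x. 0) f = 0" "L2_inner M f (\<lambda>x. 0) = 0"
  by (simp_all add: L2_inner_def)

lemma L2_inner_sum_left:
  assumes "\<And>i. i \<in> I \<Longrightarrow> f i \<in> L2 M" "g \<in> L2 M"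
  shows "L2_inner M (\<lambda>x. \<Sum>i\<in>I. f i x) g = (\<Sum>i\<in>I. L2_inner M (f i) g)"
  using assms
  by (induction I rule: infinite_finite_induct) (auto simp: L2_inner_add_left L2_sum)

lemma L2_inner_sum_right:
  assumes "\<And>i. i \<in> I \<Longrightarrow> f i \<in> L2 M" "g \<in> L2 M"
  shows "L2_inner M g (\<lambda>x. \<Sum>i\<in>I. f i x) = (\<Sum>i\<in>I. L2_inner M g (f i))"
  using assms
  by (induction I rule: infinite_finite_induct) (auto simp: L2_inner_add_right L2_sum)

lemma L2_inner_self: "L2_inner M f f = of_real ((L2_norm M f)\<^sup>2)"
proof -
  have "(\<lambda>x. f x * cnj (f x)) = (\<lambda>x. complex_of_real ((cmod (f x))\<^sup>2))"
    by (auto simp: complex_norm_square[symmetric])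
  then show ?thesis unfolding L2_inner_def L2_norm_square by (simp only: integral_complex_of_real)
qed

lemma L2_inner_cong_AE:
  assumes "AE x in M. f x = f' x" "AE x in M. g x = g' x"
    and "f \<in> borel_measurable M" "f' \<in> borel_measurable M"
    and "g \<in> borel_measurable M" "g' \<in> borel_measurable M"
  shows "L2_inner M f g = L2_inner M f' g'"
  unfolding L2_inner_def
proof (rule integral_cong_AE)
  show "AE x in M. f x * cnj (g x) = f' x * cnj (g' x)"
    using assms(1,2) by eventually_elim simp
qed (use assms in measurable)

lemma L2_inner_self_eq_0:
  assumes "f \<in> L2 M" "\<And>g. g \<in> L2 M \<Longrightarrow> L2_inner M f g = 0"
  shows "AE x in M. f x = 0"
proof -
  have "complex_of_real ((L2_norm M f)\<^sup>2) = 0"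
    using assms(2)[OF assms(1)] unfolding L2_inner_self .
  then have "L2_norm M f = 0" by simp
  then show ?thesis using L2_norm_eq_0_iff[OF assms(1)] by blast
qed

subsection \<open>Absolutely convergent series\<close>

text \<open>All appeals to completeness below go through this lemma. The partial sums of
  \<open>\<Sum>i. cmod (f i x)\<close> have norm at most \<open>\<Sum>i. L2_norm M (f i)\<close>, and monotone convergence carries the
  bound to the limit.\<close>

lemma L2_series:
  assumes f: "\<And>i::nat. f i \<in> L2 M" and sm: "summable (\<lambda>i. L2_norm M (f i))"
  shows "AE x in M. summable (\<lambda>i. cmod (f i x))"
    and "(\<lambda>x. \<Sum>i. f i x) \<in> L2 M"
    and "L2_norm M (\<lambda>x. \<Sum>i. f i x) \<le> (\<Sum>i. L2_norm M (f i))"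
proof -
  define S where "S = (\<Sum>i. L2_norm M (f i))"
  have S: "S \<ge> 0" unfolding S_def by (rule suminf_nonneg[OF sm]) simp
  have [measurable]: "\<And>i. f i \<in> borel_measurable M" using f by auto
  define G where "G n x = ennreal ((\<Sum>i<n. cmod (f i x))\<^sup>2)" for n x
  have [measurable]: "G n \<in> borel_measurable M" for n
    unfolding G_def by measurable
  have Gle: "(\<integral>\<^sup>+x. G n x \<partial>M) \<le> ennreal (S\<^sup>2)" for n
  proof -
    have a: "(\<lambda>x. complex_of_real (cmod (f i x))) \<in> L2 M" for i
      by (rule L2_bound[OF _ f[of i], where C = 1]) auto
    have b: "L2_norm M (\<lambda>x. complex_of_real (cmod (f i x))) = L2_norm M (f i)" for i
      by (simp add: L2_norm_def)
    have "L2_norm M (\<lambda>x. \<Sum>i<n. complex_of_real (cmod (f i x))) \<le> (\<Sum>i<n. L2_norm M (f i))"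
      using L2_norm_sum[of "{..<n}" "\<lambda>i x. complex_of_real (cmod (f i x))" M] a b by simp
    also have "\<dots> \<le> S"
      unfolding S_def by (rule sum_le_suminf[OF sm]) auto
    finally have le: "L2_norm M (\<lambda>x. \<Sum>i<n. complex_of_real (cmod (f i x))) \<le> S" .
    have "cmod (\<Sum>i<n. complex_of_real (cmod (f i x))) = (\<Sum>i<n. cmod (f i x))" for x
      unfolding of_real_sum[symmetric] norm_of_real by (simp add: sum_nonneg)
    then have "(\<integral>\<^sup>+x. G n x \<partial>M) = (\<integral>\<^sup>+x. ennreal ((cmod (\<Sum>i<n. complex_of_real (cmod (f i x))))\<^sup>2) \<partial>M)"
      unfolding G_def by simp
    also have "\<dots> = ennreal ((L2_norm M (\<lambda>x. \<Sum>i<n. complex_of_real (cmod (f i x))))\<^sup>2)"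
      by (rule L2_nn_integral) (rule L2_sum[OF a])
    also have "\<dots> \<le> ennreal (S\<^sup>2)"
      using le by (intro ennreal_leI power_mono) auto
    finally show ?thesis .
  qed
  have inc: "incseq G"
    unfolding incseq_def le_fun_def G_def
    by (intro allI impI ennreal_leI power_mono sum_mono2 sum_nonneg) auto
  have "(\<integral>\<^sup>+x. (SUP n. G n x) \<partial>M) = (SUP n. \<integral>\<^sup>+x. G n x \<partial>M)"
    by (rule nn_integral_monotone_convergence_SUP[OF inc]) measurable
  also have "\<dots> \<le> ennreal (S\<^sup>2)" by (rule SUP_least) (rule Gle)
  finally have sup: "(\<integral>\<^sup>+x. (SUP n. G n x) \<partial>M) \<le> ennreal (S\<^sup>2)" .
  have "AE x in M. (SUP n. G n x) \<noteq> \<infinity>"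
  proof (rule nn_integral_noteq_infinite)
    show "(\<integral>\<^sup>+x. (SUP n. G n x) \<partial>M) \<noteq> \<infinity>" using sup by (auto simp: top_unique)
  qed measurable
  then show ae: "AE x in M. summable (\<lambda>i. cmod (f i x))"
  proof eventually_elim
    case (elim x)
    then obtain r where r: "r \<ge> 0" "(SUP n. G n x) = ennreal r"
      by (cases "SUP n. G n x") auto
    have "(\<Sum>i<n. cmod (f i x)) \<le> sqrt r" for n
    proof -
      have "G n x \<le> ennreal r" unfolding r(2)[symmetric] by (rule SUP_upper) simp
      then have "(\<Sum>i<n. cmod (f i x))\<^sup>2 \<le> r" using r(1) by (simp add: G_def)
      then show ?thesis by (rule real_le_rsqrt)
    qed
    then show ?case by (intro summableI_nonneg_bounded) auto
  qed
  have "(\<integral>\<^sup>+x. ennreal ((cmod (\<Sum>i. f i x))\<^sup>2) \<partial>M) \<le> (\<integral>\<^sup>+x. (SUP n. G n x) \<partial>M)"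
  proof (rule nn_integral_mono_AE)
    show "AE x in M. ennreal ((cmod (\<Sum>i. f i x))\<^sup>2) \<le> (SUP n. G n x)"
      using ae
    proof eventually_elim
      case (elim x)
      have "(\<lambda>n. (\<Sum>i<n. cmod (f i x))\<^sup>2) \<longlonglongrightarrow> (\<Sum>i. cmod (f i x))\<^sup>2"
        by (intro tendsto_intros summable_LIMSEQ elim)
      then have "(\<lambda>n. G n x) \<longlonglongrightarrow> ennreal ((\<Sum>i. cmod (f i x))\<^sup>2)"
        unfolding G_def by (rule tendsto_ennrealI)
      moreover have "(\<lambda>n. G n x) \<longlonglongrightarrow> (SUP n. G n x)"
        by (rule LIMSEQ_SUP) (use inc in \<open>auto simp: incseq_def le_fun_def\<close>)
      ultimately have eq: "(SUP n. G n x) = ennreal ((\<Sum>i. cmod (f i x))\<^sup>2)"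
        using LIMSEQ_unique by blast
      show ?case unfolding eq by (intro ennreal_leI power_mono summable_norm elim) simp
    qed
  qed
  also note sup
  finally have le: "(\<integral>\<^sup>+x. ennreal ((cmod (\<Sum>i. f i x))\<^sup>2) \<partial>M) \<le> ennreal (S\<^sup>2)" .
  show "(\<lambda>x. \<Sum>i. f i x) \<in> L2 M" "L2_norm M (\<lambda>x. \<Sum>i. f i x) \<le> (\<Sum>i. L2_norm M (f i))"
    using L2_nn_integralI[OF _ S le] by (simp_all add: S_def)
qed

lemma L2_series_tail:
  assumes f: "\<And>i::nat. f i \<in> L2 M" and sm: "summable (\<lambda>i. L2_norm M (f i))"
  shows "L2_norm M (\<lambda>x. (\<Sum>i. f i x) - (\<Sum>i<n. f i x)) \<le> (\<Sum>i. L2_norm M (f (i + n)))"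
proof -
  have [measurable]: "\<And>i. f i \<in> borel_measurable M" using f by auto
  have "L2_norm M (\<lambda>x. (\<Sum>i. f i x) - (\<Sum>i<n. f i x)) = L2_norm M (\<lambda>x. \<Sum>i. f (i + n) x)"
  proof (rule L2_norm_cong_AE)
    show "AE x in M. (\<Sum>i. f i x) - (\<Sum>i<n. f i x) = (\<Sum>i. f (i + n) x)"
      using L2_series(1)[OF f sm]
    proof eventually_elim
      case (elim x)
      then have "summable (\<lambda>i. f i x)" by (rule summable_norm_cancel)
      then show ?case using suminf_minus_initial_segment[of "\<lambda>i. f i x" n] by simp
    qed
  qed measurable
  also have "\<dots> \<le> (\<Sum>i. L2_norm M (f (i + n)))"
    by (rule L2_series(3)) (use f sm summable_iff_shift[of "\<lambda>i. L2_norm M (f i)" n] in auto)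
  finally show ?thesis .
qed

lemma suminf_tail_tendsto_0:
  fixes f :: "nat \<Rightarrow> 'a::real_normed_vector"
  assumes "summable f"
  shows "(\<lambda>n. \<Sum>i. f (i + n)) \<longlonglongrightarrow> 0"
proof -
  have "(\<lambda>n. suminf f - (\<Sum>i<n. f i)) \<longlonglongrightarrow> suminf f - suminf f"
    by (intro tendsto_intros summable_LIMSEQ assms)
  then show ?thesis using suminf_minus_initial_segment[OF assms] by simp
qed

lemma L2_series_tendsto:
  assumes f: "\<And>i::nat. f i \<in> L2 M" and sm: "summable (\<lambda>i. L2_norm M (f i))"
  shows "(\<lambda>n. L2_norm M (\<lambda>x. (\<Sum>i. f i x) - (\<Sum>i<n. f i x))) \<longlonglongrightarrow> 0"
  by (rule tendsto_sandwich[OF _ _ tendsto_const suminf_tail_tendsto_0[OF sm]])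
    (use L2_series_tail[OF f sm] in auto)

lemma L2_norm_tendsto_inner:
  assumes "\<And>n. u n \<in> L2 M" "v \<in> L2 M" "g \<in> L2 M"
    and lim: "(\<lambda>n. L2_norm M (\<lambda>x. v x - u n x)) \<longlonglongrightarrow> 0"
  shows "(\<lambda>n. L2_inner M (u n) g) \<longlonglongrightarrow> L2_inner M v g"
proof (rule Lim_transform2[OF tendsto_const], rule Lim_null_comparison)
  show "\<forall>\<^sub>F n in sequentially. norm (L2_inner M v g - L2_inner M (u n) g)
      \<le> L2_norm M (\<lambda>x. v x - u n x) * L2_norm M g"
    using L2_inner_bound[OF L2_diff[OF assms(2,1)] assms(3)] assms
    by (auto simp: L2_inner_diff_left)
  show "(\<lambda>n. L2_norm M (\<lambda>x. v x - u n x) * L2_norm M g) \<longlonglongrightarrow> 0"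
    using tendsto_mult_right[OF lim, of "L2_norm M g"] by simp
qed

lemma L2_inner_series:
  assumes f: "\<And>i::nat. f i \<in> L2 M" and sm: "summable (\<lambda>i. L2_norm M (f i))" and g: "g \<in> L2 M"
  shows "(\<lambda>i. L2_inner M (f i) g) sums L2_inner M (\<lambda>x. \<Sum>i. f i x) g"
  unfolding sums_def
  using L2_norm_tendsto_inner[OF L2_sum[OF f] L2_series(2)[OF f sm] g L2_series_tendsto[OF f sm]] f g
  by (simp add: L2_inner_sum_left)

section \<open>Orthonormal bases and the Riesz representation\<close>

definition orthonormal :: "'a measure \<Rightarrow> ('a \<Rightarrow> complex) set \<Rightarrow> bool" where
  "orthonormal M E \<longleftrightarrow> E \<subseteq> L2 M \<and> (\<forall>e\<in>E. L2_norm M e = 1) \<and>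
     (\<forall>e\<in>E. \<forall>e'\<in>E. e \<noteq> e' \<longrightarrow> L2_inner M e e' = 0)"

lemma orthonormal_L2: "orthonormal M E \<Longrightarrow> e \<in> E \<Longrightarrow> e \<in> L2 M"
  by (auto simp: orthonormal_def)

lemma orthonormal_inner:
  "orthonormal M E \<Longrightarrow> e \<in> E \<Longrightarrow> e' \<in> E \<Longrightarrow> L2_inner M e e' = (if e = e' then 1 else 0)"
  by (auto simp: orthonormal_def L2_inner_self)

lemma orthonormal_basis_imp_orthonormal: "orthonormal_basis M E \<Longrightarrow> orthonormal M E"
  by (auto simp: orthonormal_def orthonormal_basis_def)

lemma orthonormal_combination_L2:
  assumes "orthonormal M E" "F \<subseteq> E"
  shows "(\<lambda>x. \<Sum>e\<in>F. c e * e x) \<in> L2 M"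
proof (rule L2_sum)
  fix e assume "e \<in> F"
  then show "(\<lambda>x. c e * e x) \<in> L2 M"
    using orthonormal_L2[OF assms(1), of e] assms(2) by (auto intro: L2_scale)
qed

lemma orthonormal_combination_norm:
  assumes on: "orthonormal M E" and F: "finite F" "F \<subseteq> E"
  shows "(L2_norm M (\<lambda>x. \<Sum>e\<in>F. c e * e x))\<^sup>2 = (\<Sum>e\<in>F. (cmod (c e))\<^sup>2)"
proof -
  let ?u = "\<lambda>x. \<Sum>e\<in>F. c e * e x"
  have L: "e \<in> F \<Longrightarrow> e \<in> L2 M" for e using on F orthonormal_L2 by blast
  have "complex_of_real ((L2_norm M ?u)\<^sup>2) = L2_inner M ?u ?u"
    by (simp only: L2_inner_self)
  also have "\<dots> = (\<Sum>e\<in>F. L2_inner M (\<lambda>x. c e * e x) ?u)"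
    by (rule L2_inner_sum_left) (auto intro: L2_scale L orthonormal_combination_L2[OF on F(2)])
  also have "\<dots> = (\<Sum>e\<in>F. \<Sum>e'\<in>F. L2_inner M (\<lambda>x. c e * e x) (\<lambda>x. c e' * e' x))"
    by (intro sum.cong refl L2_inner_sum_right) (auto intro: L2_scale L)
  also have "\<dots> = (\<Sum>e\<in>F. \<Sum>e'\<in>F. if e = e' then c e * cnj (c e') else 0)"
    by (intro sum.cong refl)
      (use F orthonormal_inner[OF on] in \<open>auto simp: L2_inner_scale_left L2_inner_scale_right subset_iff\<close>)
  also have "\<dots> = (\<Sum>e\<in>F. complex_of_real ((cmod (c e))\<^sup>2))"
    using F(1) by (simp add: sum.delta' complex_norm_square[symmetric])
  finally have "complex_of_real ((L2_norm M ?u)\<^sup>2) = complex_of_real (\<Sum>e\<in>F. (cmod (c e))\<^sup>2)"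
    by simp
  then show ?thesis by (simp only: of_real_eq_iff)
qed

text \<open>For the projection \<open>u\<close> of \<open>f\<close> and \<open>S = (L2_norm M u)\<^sup>2\<close> the Cauchy-Schwarz inequality gives
  \<open>S = L2_inner M f u \<le> L2_norm M f * sqrt S\<close>.\<close>

lemma Bessel_finite:
  assumes on: "orthonormal M E" and F: "finite F" "F \<subseteq> E" and f: "f \<in> L2 M"
  shows "(\<Sum>e\<in>F. (cmod (L2_inner M f e))\<^sup>2) \<le> (L2_norm M f)\<^sup>2"
proof -
  define S where "S = (\<Sum>e\<in>F. (cmod (L2_inner M f e))\<^sup>2)"
  let ?u = "\<lambda>x. \<Sum>e\<in>F. L2_inner M f e * e x"
  have S0: "S \<ge> 0" by (simp add: S_def sum_nonneg)
  have L: "e \<in> F \<Longrightarrow> e \<in> L2 M" for e using on F orthonormal_L2 by blast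
  have "L2_inner M f ?u = (\<Sum>e\<in>F. L2_inner M f (\<lambda>x. L2_inner M f e * e x))"
    by (rule L2_inner_sum_right) (auto intro: L2_scale L f)
  also have "\<dots> = of_real S"
    unfolding L2_inner_scale_right S_def of_real_sum complex_norm_square
    by (intro sum.cong refl mult.commute)
  finally have "S = cmod (L2_inner M f ?u)" using S0 by simp
  also have "\<dots> \<le> L2_norm M f * L2_norm M ?u"
    by (rule L2_inner_bound[OF f orthonormal_combination_L2[OF on F(2)]])
  finally have "S\<^sup>2 \<le> (L2_norm M f * L2_norm M ?u)\<^sup>2" using S0 by (intro power_mono)
  also have "\<dots> = (L2_norm M f)\<^sup>2 * S"
    using orthonormal_combination_norm[OF on F] by (simp add: power_mult_distrib S_def)
  finally have "S * S \<le> (L2_norm M f)\<^sup>2 * S" by (simp add: power2_eq_square)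
  then have "S \<le> (L2_norm M f)\<^sup>2"
    using S0 by (cases "S = 0") (auto simp: mult_le_cancel_right)
  then show ?thesis by (simp add: S_def)
qed

text \<open>The basis may be uncountable. Finite sets \<open>F n\<close> that leave out coefficients of total square at most
  \<open>(1/4) ^ n\<close> give partial sums with summable differences, and their limit is independent of the
  choice because it is tested against every \<open>g\<close>.\<close>

lemma Riesz_Fischer:
  assumes on: "orthonormal M E"
    and C: "\<And>F. finite F \<Longrightarrow> F \<subseteq> E \<Longrightarrow> (\<Sum>e\<in>F. (cmod (c e))\<^sup>2) \<le> C"
  shows "\<exists>u\<in>L2 M. \<exists>F. (\<forall>n::nat. finite (F n) \<and> F n \<subseteq> E) \<and>
    (\<lambda>n. L2_norm M (\<lambda>x. u x - (\<Sum>e\<in>F n. c e * e x))) \<longlonglongrightarrow> 0 \<and>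
    (\<forall>g\<in>L2 M. ((\<lambda>e. c e * L2_inner M e g) has_sum L2_inner M u g) E)"
proof -
  let ?q = "\<lambda>e. (cmod (c e))\<^sup>2"
  have sm: "?q summable_on E"
    by (rule nonneg_bdd_above_summable_on) (auto intro!: bdd_aboveI2[where M = C] C)
  define s where "s = infsum ?q E"
  have hs: "(?q has_sum s) E" unfolding s_def using sm by (rule has_sum_infsum)
  have upper: "sum ?q F \<le> s" if "finite F" "F \<subseteq> E" for F
    unfolding s_def by (rule finite_sum_le_infsum[OF sm that]) simp
  have "\<exists>F. finite F \<and> F \<subseteq> E \<and> s - (1/4) ^ n < sum ?q F" for n :: nat
  proof -
    have "\<forall>\<^sub>F F in finite_subsets_at_top E. s - (1/4) ^ n < sum ?q F"
      by (rule order_tendstoD(1)) (use hs in \<open>auto simp: has_sum_def\<close>)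
    then show ?thesis unfolding eventually_finite_subsets_at_top by blast
  qed
  then obtain H where H: "\<And>n. finite (H n) \<and> H n \<subseteq> E \<and> s - (1/4) ^ n < sum ?q (H n)"
    by metis
  define F where "F n = (\<Union>i\<le>n. H i)" for n
  have F: "finite (F n)" "F n \<subseteq> E" for n using H by (auto simp: F_def)
  have Finc: "F n \<subseteq> F (Suc n)" for n
    unfolding F_def by (rule UN_mono) auto
  have Fs: "s - (1/4) ^ n < sum ?q (F n)" for n
  proof -
    have "sum ?q (H n) \<le> sum ?q (F n)"
      by (intro sum_mono2 F) (auto simp: F_def)
    then show ?thesis using H[of n] by linarith
  qed
  have rest: "sum ?q (G - F n) \<le> (1/4) ^ n" if "finite G" "G \<subseteq> E" for G n
  proof -
    have "sum ?q (G - F n) + sum ?q (F n) = sum ?q (G \<union> F n)"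
      using that F by (subst sum.union_disjoint[symmetric]) (auto simp: Un_commute)
    also have "\<dots> \<le> s" by (rule upper) (use that F in auto)
    finally show ?thesis using Fs[of n] by linarith
  qed
  define v where "v n x = (\<Sum>e\<in>F n. c e * e x)" for n x
  have vL: "v n \<in> L2 M" for n unfolding v_def by (rule orthonormal_combination_L2[OF on F(2)])
  define w where "w n = (case n of 0 \<Rightarrow> v 0 | Suc k \<Rightarrow> (\<lambda>x. v (Suc k) x - v k x))" for n
  have wL: "w n \<in> L2 M" for n by (cases n) (auto simp: w_def vL intro: L2_diff)
  have wsum: "(\<Sum>i<Suc n. w i x) = v n x" for n x
    by (induction n) (auto simp: w_def)
  have combn: "L2_norm M (\<lambda>x. \<Sum>e\<in>G - F n. c e * e x) \<le> (1/2) ^ n" if "finite G" "G \<subseteq> E" for G n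
  proof (rule power2_le_imp_le)
    have "(L2_norm M (\<lambda>x. \<Sum>e\<in>G - F n. c e * e x))\<^sup>2 = sum ?q (G - F n)"
      by (rule orthonormal_combination_norm[OF on]) (use that in auto)
    also have "\<dots> \<le> (1/4) ^ n" by (rule rest[OF that])
    also have "\<dots> = ((1/2) ^ n)\<^sup>2" by (simp add: power2_eq_square flip: power_mult_distrib)
    finally show "(L2_norm M (\<lambda>x. \<Sum>e\<in>G - F n. c e * e x))\<^sup>2 \<le> ((1/2) ^ n)\<^sup>2" .
  qed simp
  have wn: "L2_norm M (w (Suc n)) \<le> (1/2) ^ n" for n
  proof -
    have "w (Suc n) = (\<lambda>x. \<Sum>e\<in>F (Suc n) - F n. c e * e x)"
      using sum_diff[OF F(1) Finc, where f = "\<lambda>e. c e * e _"] by (auto simp: w_def v_def fun_eq_iff)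
    then show ?thesis using combn[OF F] by simp
  qed
  have sw: "summable (\<lambda>n. L2_norm M (w n))"
    unfolding summable_Suc_iff[of "\<lambda>n. L2_norm M (w n)", symmetric]
    by (rule summable_comparison_test'[where g = "\<lambda>n. (1/2) ^ n" and N = 0])
      (auto intro: summable_geometric wn)
  define u where "u x = (\<Sum>i. w i x)" for x
  have uL: "u \<in> L2 M" unfolding u_def by (rule L2_series(2)[OF wL sw])
  have lim: "(\<lambda>n. L2_norm M (\<lambda>x. u x - v n x)) \<longlonglongrightarrow> 0"
    using LIMSEQ_Suc[OF L2_series_tendsto[OF wL sw]] by (simp only: wsum u_def)
  have hsu: "((\<lambda>e. c e * L2_inner M e g) has_sum L2_inner M u g) E" if g: "g \<in> L2 M" for g
    unfolding has_sum_def tendsto_iff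
  proof (intro allI impI)
    fix \<epsilon> :: real assume \<epsilon>: "\<epsilon> > 0"
    have "(\<lambda>n. ((1/2) ^ n + L2_norm M (\<lambda>x. u x - v n x)) * L2_norm M g) \<longlonglongrightarrow> (0 + 0) * L2_norm M g"
      by (intro tendsto_intros lim LIMSEQ_power_zero) auto
    then have "\<forall>\<^sub>F n in sequentially. ((1/2) ^ n + L2_norm M (\<lambda>x. u x - v n x)) * L2_norm M g < \<epsilon>"
      by (rule order_tendstoD) (use \<epsilon> in auto)
    then obtain n where n: "((1/2) ^ n + L2_norm M (\<lambda>x. u x - v n x)) * L2_norm M g < \<epsilon>"
      by (auto simp: eventually_sequentially)
    have "dist (\<Sum>e\<in>G. c e * L2_inner M e g) (L2_inner M u g) < \<epsilon>"
      if G: "finite G" "G \<subseteq> E" "F n \<subseteq> G" for G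
    proof -
      let ?d = "\<lambda>x. \<Sum>e\<in>G - F n. c e * e x"
      have L: "e \<in> G \<Longrightarrow> e \<in> L2 M" for e using on G orthonormal_L2 by blast
      have "(\<Sum>e\<in>G. c e * L2_inner M e g) = L2_inner M (\<lambda>x. \<Sum>e\<in>G. c e * e x) g"
        by (subst L2_inner_sum_left) (auto simp: g L2_inner_scale_left intro: L2_scale L)
      also have "(\<lambda>x. \<Sum>e\<in>G. c e * e x) = (\<lambda>x. ?d x + v n x)"
        using sum_diff[OF G(1,3), where f = "\<lambda>e. c e * e _"] by (auto simp: v_def fun_eq_iff)
      also have "L2_inner M \<dots> g = L2_inner M ?d g + L2_inner M (v n) g"
        by (intro L2_inner_add_left orthonormal_combination_L2[OF on] vL g) (use G in auto)
      finally have eq: "(\<Sum>e\<in>G. c e * L2_inner M e g) - L2_inner M u g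
          = L2_inner M ?d g - L2_inner M (\<lambda>x. u x - v n x) g"
        by (simp add: L2_inner_diff_left uL vL g)
      have "dist (\<Sum>e\<in>G. c e * L2_inner M e g) (L2_inner M u g)
          \<le> cmod (L2_inner M ?d g) + cmod (L2_inner M (\<lambda>x. u x - v n x) g)"
        unfolding dist_norm eq by (rule norm_triangle_ineq4)
      also have "\<dots> \<le> L2_norm M ?d * L2_norm M g + L2_norm M (\<lambda>x. u x - v n x) * L2_norm M g"
        by (intro add_mono L2_inner_bound g L2_diff uL vL orthonormal_combination_L2[OF on])
          (use G in auto)
      also have "\<dots> \<le> (1/2) ^ n * L2_norm M g + L2_norm M (\<lambda>x. u x - v n x) * L2_norm M g"
        by (intro add_right_mono mult_right_mono combn G) auto
      finally show ?thesis using n by (simp add: distrib_right)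
    qed
    then show "\<forall>\<^sub>F G in finite_subsets_at_top E.
        dist (\<Sum>e\<in>G. c e * L2_inner M e g) (L2_inner M u g) < \<epsilon>"
      unfolding eventually_finite_subsets_at_top using F[of n] by blast
  qed
  show ?thesis
    using uL F lim hsu unfolding v_def by blast
qed

lemma has_sum_orthonormal_coeff:
  assumes on: "orthonormal M E" and e: "e \<in> E"
    and hs: "((\<lambda>e'. c e' * L2_inner M e' e) has_sum a) E"
  shows "a = c e"
proof -
  have "((\<lambda>e'. c e' * L2_inner M e' e) has_sum (\<Sum>e'\<in>{e}. c e' * L2_inner M e' e)) E"
    by (rule has_sum_finite_neutralI[where B = "{e}"]) (use e orthonormal_inner[OF on] in auto)
  then have "a = (\<Sum>e'\<in>{e}. c e' * L2_inner M e' e)"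
    using hs has_sum_unique by blast
  then show ?thesis using orthonormal_inner[OF on e e] by simp
qed

text \<open>The function with the same coefficients as \<open>u\<close> provided by \<open>Riesz_Fischer\<close> differs from \<open>u\<close> by
  a function orthogonal to the basis.\<close>

lemma orthonormal_expansion:
  assumes onb: "orthonormal_basis M E" and u: "u \<in> L2 M"
  shows "\<exists>F. (\<forall>n::nat. finite (F n) \<and> F n \<subseteq> E) \<and>
    (\<lambda>n. L2_norm M (\<lambda>x. u x - (\<Sum>e\<in>F n. L2_inner M u e * e x))) \<longlonglongrightarrow> 0 \<and>
    (\<forall>g\<in>L2 M. ((\<lambda>e. L2_inner M u e * L2_inner M e g) has_sum L2_inner M u g) E)"
proof -
  have on: "orthonormal M E" by (rule orthonormal_basis_imp_orthonormal[OF onb])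
  obtain u' F where u': "u' \<in> L2 M" and F: "\<And>n::nat. finite (F n) \<and> F n \<subseteq> E"
    and lim: "(\<lambda>n. L2_norm M (\<lambda>x. u' x - (\<Sum>e\<in>F n. L2_inner M u e * e x))) \<longlonglongrightarrow> 0"
    and hs: "\<And>g. g \<in> L2 M \<Longrightarrow> ((\<lambda>e. L2_inner M u e * L2_inner M e g) has_sum L2_inner M u' g) E"
    using Riesz_Fischer[OF on Bessel_finite[OF on _ _ u]] by blast
  have "L2_inner M (\<lambda>x. u x - u' x) e = 0" if e: "e \<in> E" for e
  proof -
    have eL: "e \<in> L2 M" using orthonormal_L2[OF on e] .
    have "L2_inner M u' e = L2_inner M u e"
      by (rule has_sum_orthonormal_coeff[OF on e, of "\<lambda>e. L2_inner M u e"]) (rule hs[OF eL])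
    then show ?thesis by (simp add: L2_inner_diff_left u u' eL)
  qed
  then have "AE x in M. u x - u' x = 0"
    using onb L2_diff[OF u u'] unfolding orthonormal_basis_def by blast
  then have ae: "AE x in M. u x = u' x" by eventually_elim simp
  note [measurable] = L2_measurable[OF u] L2_measurable[OF u']
  have "L2_norm M (\<lambda>x. u x - (\<Sum>e\<in>F n. L2_inner M u e * e x)) =
      L2_norm M (\<lambda>x. u' x - (\<Sum>e\<in>F n. L2_inner M u e * e x))" for n
  proof (rule L2_norm_cong_AE)
    have [measurable]: "(\<lambda>x. \<Sum>e\<in>F n. L2_inner M u e * e x) \<in> borel_measurable M"
      by (rule L2_measurable[OF orthonormal_combination_L2[OF on]]) (use F in blast)
    show "(\<lambda>x. u x - (\<Sum>e\<in>F n. L2_inner M u e * e x)) \<in> borel_measurable M"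
      "(\<lambda>x. u' x - (\<Sum>e\<in>F n. L2_inner M u e * e x)) \<in> borel_measurable M"
      by measurable
    show "AE x in M. u x - (\<Sum>e\<in>F n. L2_inner M u e * e x) =
        u' x - (\<Sum>e\<in>F n. L2_inner M u e * e x)"
      using ae by eventually_elim simp
  qed
  then have lim': "(\<lambda>n. L2_norm M (\<lambda>x. u x - (\<Sum>e\<in>F n. L2_inner M u e * e x))) \<longlonglongrightarrow> 0"
    using lim by simp
  have "L2_inner M u' g = L2_inner M u g" if "g \<in> L2 M" for g

  proof (rule L2_inner_cong_AE)
    show "AE x in M. u' x = u x" using ae by eventually_elim simp
  qed (use L2_measurable[OF that] in auto)
  then show ?thesis using F lim' hs by auto
qed

text \<open>A maximal orthonormal set is a basis. Existence matters because \<open>op_trace\<close> is described by a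
  condition on all bases, which would hold for every number if there were none.\<close>

lemma orthonormal_basis_exists: "\<exists>E. orthonormal_basis M E"
proof -
  define \<A> where "\<A> = Collect (orthonormal M)"
  have "\<exists>E\<in>\<A>. \<forall>X\<in>\<A>. E \<subseteq> X \<longrightarrow> X = E"
  proof (rule subset_Zorn_nonempty)
    show "\<A> \<noteq> {}" unfolding \<A>_def by (auto simp: orthonormal_def)
    fix \<C> assume ne: "\<C> \<noteq> {}" and ch: "subset.chain \<A> \<C>"
    have o: "orthonormal M X" if "X \<in> \<C>" for X
      using ch that by (auto simp: subset_chain_def \<A>_def)
    have "L2_inner M e e' = 0"
      if "e \<in> X" "X \<in> \<C>" "e' \<in> Y" "Y \<in> \<C>" "e \<noteq> e'" for e e' X Y
    proof -
      have "X \<subseteq> Y \<or> Y \<subseteq> X" using ch that by (auto simp: subset_chain_def)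
      then show ?thesis using o[OF that(2)] o[OF that(4)] that unfolding orthonormal_def by blast
    qed
    moreover have "X \<subseteq> L2 M" "\<And>e. e \<in> X \<Longrightarrow> L2_norm M e = 1" if "X \<in> \<C>" for X
      using o[OF that] by (simp_all add: orthonormal_def)
    ultimately have "orthonormal M (\<Union>\<C>)"
      unfolding orthonormal_def by (intro conjI ballI impI Sup_least) (auto elim!: UnionE)
    then show "\<Union>\<C> \<in> \<A>" by (simp add: \<A>_def)
  qed
  then obtain E where E: "orthonormal M E" and mx: "\<And>X. orthonormal M X \<Longrightarrow> E \<subseteq> X \<Longrightarrow> X = E"
    by (auto simp: \<A>_def)
  have "AE x in M. f x = 0" if f: "f \<in> L2 M" and perp: "\<forall>e\<in>E. L2_inner M f e = 0" for f
  proof (rule ccontr)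
    assume "\<not> (AE x in M. f x = 0)"
    then have nz: "L2_norm M f \<noteq> 0" using L2_norm_eq_0_iff[OF f] by blast
    define e0 where "e0 = (\<lambda>x. complex_of_real (1 / L2_norm M f) * f x)"
    have e0: "e0 \<in> L2 M" "L2_norm M e0 = 1"
      using nz unfolding e0_def L2_norm_scale norm_of_real by (auto intro!: L2_scale f simp del: of_real_divide)
    have p1: "L2_inner M e0 e = 0" if "e \<in> E" for e
      using perp that unfolding e0_def L2_inner_scale_left by simp
    have p2: "L2_inner M e e0 = 0" if "e \<in> E" for e
      using p1[OF that] L2_inner_commute[of M e e0] by simp
    have "orthonormal M (insert e0 E)"
      using E e0 p1 p2 by (auto simp: orthonormal_def)
    then have "e0 \<in> E" using mx[of "insert e0 E"] by blast
    then have "L2_inner M e0 e0 = 0" by (rule p1)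
    then show False using e0(2) by (simp add: L2_inner_self)
  qed
  then have "\<forall>f\<in>L2 M. (\<forall>e\<in>E. L2_inner M f e = 0) \<longrightarrow> (AE x in M. f x = 0)"
    by (intro ballI impI)
  with E have "orthonormal_basis M E"
    unfolding orthonormal_basis_def orthonormal_def by (intro conjI) (elim conjE, assumption)+
  then show ?thesis by (rule exI)
qed

text \<open>The representing function is built from the coefficients \<open>cnj (G e)\<close>, whose squares are summable
  by testing \<open>G\<close> on \<open>\<Sum>e. cnj (G e) * e\<close>.\<close>

lemma Riesz_representation:
  assumes add: "\<And>f g. f \<in> L2 M \<Longrightarrow> g \<in> L2 M \<Longrightarrow> G (\<lambda>x. f x + g x) = G f + G g"
    and scale: "\<And>c f. f \<in> L2 M \<Longrightarrow> G (\<lambda>x. c * f x) = c * G f"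
    and bound: "\<And>f. f \<in> L2 M \<Longrightarrow> cmod (G f) \<le> C * L2_norm M f"
  obtains u where "u \<in> L2 M" "\<And>g. g \<in> L2 M \<Longrightarrow> G g = L2_inner M g u"
proof -
  obtain E where onb: "orthonormal_basis M E" using orthonormal_basis_exists by blast
  have on: "orthonormal M E" by (rule orthonormal_basis_imp_orthonormal[OF onb])
  have G0: "G (\<lambda>x. 0) = 0" using scale[of "\<lambda>x. 0" 0] by simp
  have Gsum: "G (\<lambda>x. \<Sum>e\<in>F. c e * e x) = (\<Sum>e\<in>F. c e * G e)" if "finite F" "F \<subseteq> E" for F c
    using that
  proof (induction F)
    case (insert e F)
    then have L: "e \<in> L2 M" using orthonormal_L2[OF on] by auto
    have "G (\<lambda>x. c e * e x + (\<Sum>e\<in>F. c e * e x)) = G (\<lambda>x. c e * e x) + G (\<lambda>x. \<Sum>e\<in>F. c e * e x)"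
      by (intro add L2_scale L orthonormal_combination_L2[OF on]) (use insert in auto)
    then show ?case using insert scale[OF L] by simp
  qed (simp add: G0)
  have bd: "(\<Sum>e\<in>F. (cmod (cnj (G e)))\<^sup>2) \<le> C\<^sup>2" if F: "finite F" "F \<subseteq> E" for F
  proof -
    define S where "S = (\<Sum>e\<in>F. (cmod (G e))\<^sup>2)"
    let ?u = "\<lambda>x. \<Sum>e\<in>F. cnj (G e) * e x"
    have S0: "S \<ge> 0" by (simp add: S_def sum_nonneg)
    have "G ?u = of_real S"
      unfolding Gsum[OF F] S_def of_real_sum complex_norm_square
      by (intro sum.cong refl mult.commute)
    then have "S = cmod (G ?u)" using S0 by simp
    also have "\<dots> \<le> C * L2_norm M ?u"
      by (rule bound[OF orthonormal_combination_L2[OF on F(2)]])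
    finally have "S\<^sup>2 \<le> (C * L2_norm M ?u)\<^sup>2" using S0 by (intro power_mono)
    also have "\<dots> = C\<^sup>2 * S"
      using orthonormal_combination_norm[OF on F] by (simp add: power_mult_distrib S_def)
    finally have "S * S \<le> C\<^sup>2 * S" by (simp add: power2_eq_square)
    then have "S \<le> C\<^sup>2"
      using S0 by (cases "S = 0") (auto simp: mult_le_cancel_right)
    then show ?thesis by (simp add: S_def)
  qed
  obtain u where u: "u \<in> L2 M"
    and hs: "\<And>g. g \<in> L2 M \<Longrightarrow> ((\<lambda>e. cnj (G e) * L2_inner M e g) has_sum L2_inner M u g) E"
    using Riesz_Fischer[OF on bd] by blast
  have coeff: "G e = L2_inner M e u" if e: "e \<in> E" for e
  proof -
    have "L2_inner M u e = cnj (G e)"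
      by (rule has_sum_orthonormal_coeff[OF on e, of "\<lambda>e. cnj (G e)"]) (rule hs[OF orthonormal_L2[OF on e]])
    then show ?thesis using L2_inner_commute[of M e u] by simp
  qed
  have "G g = L2_inner M g u" if g: "g \<in> L2 M" for g
  proof -
    obtain F where F: "\<And>n::nat. finite (F n) \<and> F n \<subseteq> E"
      and lim: "(\<lambda>n. L2_norm M (\<lambda>x. g x - (\<Sum>e\<in>F n. L2_inner M g e * e x))) \<longlonglongrightarrow> 0"
      using orthonormal_expansion[OF onb g] by blast
    define v where "v n x = (\<Sum>e\<in>F n. L2_inner M g e * e x)" for n x
    have vL: "v n \<in> L2 M" for n unfolding v_def by (rule orthonormal_combination_L2[OF on]) (use F in blast)
    have vG: "G (v n) = L2_inner M (v n) u" for n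
    proof -
      have "L2_inner M (v n) u = (\<Sum>e\<in>F n. L2_inner M g e * L2_inner M e u)"
        unfolding v_def by (subst L2_inner_sum_left)
          (use F orthonormal_L2[OF on] in \<open>auto simp: u L2_inner_scale_left intro!: L2_scale\<close>)
      also have "\<dots> = G (v n)"
        unfolding v_def using F[of n] by (subst Gsum) (auto intro!: sum.cong simp: coeff subset_iff)
      finally show ?thesis by simp
    qed
    have "(\<lambda>n. L2_inner M (v n) u) \<longlonglongrightarrow> L2_inner M g u"
      by (rule L2_norm_tendsto_inner[OF vL g u]) (use lim in \<open>simp add: v_def\<close>)
    moreover have "(\<lambda>n. G (v n)) \<longlonglongrightarrow> G g"
    proof (rule Lim_transform2[OF tendsto_const], rule Lim_null_comparison)
      have "G g - G (v n) = G (\<lambda>x. g x - v n x)" for n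
        using add[OF g L2_scale[OF vL], of "-1" n] scale[OF vL, of "-1" n] by simp
      then show "\<forall>\<^sub>F n in sequentially. norm (G g - G (v n)) \<le> C * L2_norm M (\<lambda>x. g x - v n x)"
        using bound[OF L2_diff[OF g vL]] by simp
      show "(\<lambda>n. C * L2_norm M (\<lambda>x. g x - v n x)) \<longlonglongrightarrow> 0"
        using tendsto_mult_left[OF lim, of C] by (simp add: v_def)
    qed
    ultimately show ?thesis unfolding vG using LIMSEQ_unique by blast
  qed
  then show ?thesis using that[OF u] by blast
qed

section \<open>Bounded operators, kernels and the trace pairing\<close>

subsection \<open>Bounded operators on representatives\<close>

lemma bounded_ops_L2: "T \<in> bounded_ops M N \<Longrightarrow> f \<in> L2 M \<Longrightarrow> T f \<in> L2 N"
  by (simp add: bounded_ops_def)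

lemma bounded_ops_add:
  "T \<in> bounded_ops M N \<Longrightarrow> f \<in> L2 M \<Longrightarrow> g \<in> L2 M \<Longrightarrow>
    AE y in N. T (\<lambda>x. f x + g x) y = T f y + T g y"
  by (simp add: bounded_ops_def)

lemma bounded_ops_scale:
  "T \<in> bounded_ops M N \<Longrightarrow> f \<in> L2 M \<Longrightarrow> AE y in N. T (\<lambda>x. c * f x) y = c * T f y"
  by (simp add: bounded_ops_def)

lemma bounded_ops_bound:
  assumes "T \<in> bounded_ops M N"
  obtains C where "C \<ge> 0" "\<And>f. f \<in> L2 M \<Longrightarrow> L2_norm N (T f) \<le> C * L2_norm M f"
proof -
  obtain C where C: "\<forall>f\<in>L2 M. L2_norm N (T f) \<le> C * L2_norm M f"
    using assms by (auto simp: bounded_ops_def)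
  have "L2_norm N (T f) \<le> max C 0 * L2_norm M f" if "f \<in> L2 M" for f
  proof -
    have "L2_norm N (T f) \<le> C * L2_norm M f" using C that by blast
    also have "\<dots> \<le> max C 0 * L2_norm M f" by (rule mult_right_mono) auto
    finally show ?thesis .
  qed
  then show ?thesis using that[of "max C 0"] by simp
qed

text \<open>Operators are handled through their sesquilinear forms \<open>L2_inner N (T f) g\<close>. These are additive
  and homogeneous in \<open>f\<close> exactly, whereas \<open>T f\<close> is so only almost everywhere.\<close>

lemma op_inner_add:
  assumes T: "T \<in> bounded_ops M N" and L: "f \<in> L2 M" "f' \<in> L2 M" "g \<in> L2 N"
  shows "L2_inner N (T (\<lambda>x. f x + f' x)) g = L2_inner N (T f) g + L2_inner N (T f') g"
proof -
  note B = bounded_ops_L2[OF T]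
  have "L2_inner N (T (\<lambda>x. f x + f' x)) g = L2_inner N (\<lambda>y. T f y + T f' y) g"
    by (rule L2_inner_cong_AE[OF bounded_ops_add[OF T L(1,2)]])
      (use L2_measurable[OF B[OF L(1)]] L2_measurable[OF B[OF L(2)]] L2_measurable[OF L(3)]
        L2_measurable[OF B[OF L2_add[OF L(1,2)]]] in auto)
  then show ?thesis by (simp add: L2_inner_add_left B L)
qed

lemma op_inner_scale:
  assumes T: "T \<in> bounded_ops M N" and L: "f \<in> L2 M" "g \<in> L2 N"
  shows "L2_inner N (T (\<lambda>x. c * f x)) g = c * L2_inner N (T f) g"
proof -
  note B = bounded_ops_L2[OF T]
  have "L2_inner N (T (\<lambda>x. c * f x)) g = L2_inner N (\<lambda>y. c * T f y) g"
    by (rule L2_inner_cong_AE[OF bounded_ops_scale[OF T L(1)]])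
      (use L2_measurable[OF B[OF L(1)]] L2_measurable[OF L(2)]
        L2_measurable[OF B[OF L2_scale[OF L(1)]]] in auto)
  then show ?thesis by (simp add: L2_inner_scale_left)
qed

lemma op_inner_diff:
  assumes T: "T \<in> bounded_ops M N" and L: "f \<in> L2 M" "f' \<in> L2 M" "g \<in> L2 N"
  shows "L2_inner N (T (\<lambda>x. f x - f' x)) g = L2_inner N (T f) g - L2_inner N (T f') g"
  using op_inner_add[OF T L(1) L2_scale[OF L(2), of "-1"] L(3)] op_inner_scale[OF T L(2,3), of "-1"]
  by simp

lemma op_inner_zero:
  assumes T: "T \<in> bounded_ops M N" and g: "g \<in> L2 N"
  shows "L2_inner N (T (\<lambda>x. 0)) g = 0"
  using op_inner_scale[OF T L2_zero g, of 0] by simp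

lemma op_inner_sum:
  assumes T: "T \<in> bounded_ops M N" and f: "\<And>i. i \<in> I \<Longrightarrow> f i \<in> L2 M" and g: "g \<in> L2 N"
  shows "L2_inner N (T (\<lambda>x. \<Sum>i\<in>I. f i x)) g = (\<Sum>i\<in>I. L2_inner N (T (f i)) g)"
  using f
  by (induction I rule: infinite_finite_induct)
    (auto simp: op_inner_zero[OF T g] op_inner_add[OF T _ _ g] L2_sum)

lemma op_inner_bound:
  assumes T: "T \<in> bounded_ops M N"
  obtains C where "C \<ge> 0"
    "\<And>f g. f \<in> L2 M \<Longrightarrow> g \<in> L2 N \<Longrightarrow> cmod (L2_inner N (T f) g) \<le> C * (L2_norm M f * L2_norm N g)"
proof -
  obtain C where C: "C \<ge> 0" "\<And>f. f \<in> L2 M \<Longrightarrow> L2_norm N (T f) \<le> C * L2_norm M f"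
    using bounded_ops_bound[OF T] by blast
  have "cmod (L2_inner N (T f) g) \<le> C * (L2_norm M f * L2_norm N g)" if "f \<in> L2 M" "g \<in> L2 N" for f g
  proof -
    have "cmod (L2_inner N (T f) g) \<le> L2_norm N (T f) * L2_norm N g"
      by (rule L2_inner_bound[OF bounded_ops_L2[OF T that(1)] that(2)])
    also have "\<dots> \<le> (C * L2_norm M f) * L2_norm N g"
      by (rule mult_right_mono[OF C(2)[OF that(1)]]) simp
    finally show ?thesis by (simp add: mult.assoc)
  qed
  then show ?thesis using that[OF C(1)] by blast
qed

lemma op_inner_tendsto:
  assumes T: "T \<in> bounded_ops M N" and u: "\<And>n. u n \<in> L2 M" and v: "v \<in> L2 M" and g: "g \<in> L2 N"
    and lim: "(\<lambda>n. L2_norm M (\<lambda>x. v x - u n x)) \<longlonglongrightarrow> 0"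
  shows "(\<lambda>n. L2_inner N (T (u n)) g) \<longlonglongrightarrow> L2_inner N (T v) g"
proof -
  obtain C where C: "C \<ge> 0"
    "\<And>f g. f \<in> L2 M \<Longrightarrow> g \<in> L2 N \<Longrightarrow> cmod (L2_inner N (T f) g) \<le> C * (L2_norm M f * L2_norm N g)"
    using op_inner_bound[OF T] by blast
  show ?thesis
  proof (rule Lim_transform2[OF tendsto_const], rule Lim_null_comparison)
    show "\<forall>\<^sub>F n in sequentially. norm (L2_inner N (T v) g - L2_inner N (T (u n)) g)
        \<le> C * (L2_norm M (\<lambda>x. v x - u n x) * L2_norm N g)"
      using C(2)[OF L2_diff[OF v u] g] by (simp add: op_inner_diff[OF T v u g])
    show "(\<lambda>n. C * (L2_norm M (\<lambda>x. v x - u n x) * L2_norm N g)) \<longlonglongrightarrow> 0"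
      using tendsto_mult_left[OF tendsto_mult_right[OF lim, of "L2_norm N g"], of C] by simp
  qed
qed

lemma op_eq_zeroI:
  assumes T: "T \<in> bounded_ops M N"
    and z: "\<And>f g. f \<in> L2 M \<Longrightarrow> g \<in> L2 N \<Longrightarrow> L2_inner N (T f) g = 0"
  shows "op_eq M N T (\<lambda>_ _. 0)"
  unfolding op_eq_def using L2_inner_self_eq_0[OF bounded_ops_L2[OF T]] z by blast

subsection \<open>Kernels of nuclear operators\<close>

text \<open>A nuclear operator from \<open>L2 N\<close> to \<open>L2 M\<close> is given by sequences \<open>f\<close>, \<open>g\<close> as
  \<open>h \<mapsto> \<Sum>i. L2_inner N h (g i) * f i\<close>; its kernel is \<open>rep_kernel f g\<close>. The trace of
  \<open>T \<circ> A\<close> depends only on this data and is \<open>pairing N T f g\<close>.\<close>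

definition nuclear_rep ::
    "'a measure \<Rightarrow> 'b measure \<Rightarrow> (nat \<Rightarrow> 'a \<Rightarrow> complex) \<Rightarrow> (nat \<Rightarrow> 'b \<Rightarrow> complex) \<Rightarrow> bool" where
  "nuclear_rep M N f g \<longleftrightarrow> (\<forall>i. f i \<in> L2 M) \<and> (\<forall>i. g i \<in> L2 N) \<and>
     summable (\<lambda>i. L2_norm M (f i) * L2_norm N (g i))"

definition tensor :: "('a \<Rightarrow> complex) \<Rightarrow> ('b \<Rightarrow> complex) \<Rightarrow> 'a \<times> 'b \<Rightarrow> complex" where
  "tensor f g = (\<lambda>p. f (fst p) * cnj (g (snd p)))"

definition rep_kernel ::
    "(nat \<Rightarrow> 'a \<Rightarrow> complex) \<Rightarrow> (nat \<Rightarrow> 'b \<Rightarrow> complex) \<Rightarrow> 'a \<times> 'b \<Rightarrow> complex" where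
  "rep_kernel f g = (\<lambda>p. \<Sum>i. tensor (f i) (g i) p)"

definition pairing ::
    "'b measure \<Rightarrow> ('a, 'b) operator \<Rightarrow> (nat \<Rightarrow> 'a \<Rightarrow> complex) \<Rightarrow> (nat \<Rightarrow> 'b \<Rightarrow> complex) \<Rightarrow> complex" where
  "pairing N T f g = (\<Sum>i. L2_inner N (T (f i)) (g i))"

lemma nuclear_repD:
  assumes "nuclear_rep M N f g"
  shows "f i \<in> L2 M" "g i \<in> L2 N" "summable (\<lambda>i. L2_norm M (f i) * L2_norm N (g i))"
  using assms by (auto simp: nuclear_rep_def)

lemma pairing_summable:
  assumes T: "T \<in> bounded_ops M N" and r: "nuclear_rep M N f g"
  shows "summable (\<lambda>i. cmod (L2_inner N (T (f i)) (g i)))"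
proof -
  obtain C where C: "C \<ge> 0"
    "\<And>f g. f \<in> L2 M \<Longrightarrow> g \<in> L2 N \<Longrightarrow> cmod (L2_inner N (T f) g) \<le> C * (L2_norm M f * L2_norm N g)"
    using op_inner_bound[OF T] by blast
  show ?thesis
    by (rule summable_comparison_test'[OF summable_mult[OF nuclear_repD(3)[OF r], of C], of 0])
      (use C(2) nuclear_repD(1,2)[OF r] in auto)
qed

lemma pairing_sums:
  assumes T: "T \<in> bounded_ops M N" and r: "nuclear_rep M N f g"
  shows "(\<lambda>i. L2_inner N (T (f i)) (g i)) sums pairing N T f g"
  unfolding pairing_def by (rule summable_sums[OF summable_norm_cancel[OF pairing_summable[OF T r]]])

lemma tensor_measurable [measurable]:
  assumes [measurable]: "f \<in> borel_measurable M" "g \<in> borel_measurable N"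
  shows "tensor f g \<in> borel_measurable (M \<Otimes>\<^sub>M N)"
  unfolding tensor_def by measurable

lemma tensor_L2:
  assumes N: "sigma_finite_measure N" and f: "f \<in> L2 M" and g: "g \<in> L2 N"
  shows "tensor f g \<in> L2 (M \<Otimes>\<^sub>M N)"
    and "L2_norm (M \<Otimes>\<^sub>M N) (tensor f g) \<le> L2_norm M f * L2_norm N g"
proof -
  interpret N: sigma_finite_measure N by fact
  note [measurable] = L2_measurable[OF f] L2_measurable[OF g]
  have "(\<integral>\<^sup>+p. ennreal ((cmod (tensor f g p))\<^sup>2) \<partial>(M \<Otimes>\<^sub>M N)) =
      (\<integral>\<^sup>+x. \<integral>\<^sup>+y. ennreal ((cmod (tensor f g (x, y)))\<^sup>2) \<partial>N \<partial>M)"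
    by (rule N.nn_integral_fst[symmetric]) measurable
  also have "\<dots> = (\<integral>\<^sup>+x. \<integral>\<^sup>+y. ennreal ((cmod (f x))\<^sup>2) * ennreal ((cmod (g y))\<^sup>2) \<partial>N \<partial>M)"
    by (simp add: tensor_def norm_mult power_mult_distrib ennreal_mult)
  also have "\<dots> = (\<integral>\<^sup>+x. ennreal ((cmod (f x))\<^sup>2) * ennreal ((L2_norm N g)\<^sup>2) \<partial>M)"
    by (simp add: nn_integral_cmult L2_nn_integral[OF g])
  also have "\<dots> = ennreal ((L2_norm M f)\<^sup>2) * ennreal ((L2_norm N g)\<^sup>2)"
    by (simp add: nn_integral_multc L2_nn_integral[OF f])
  also have "\<dots> = ennreal ((L2_norm M f * L2_norm N g)\<^sup>2)"
    by (simp add: power_mult_distrib ennreal_mult)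
  finally have le: "(\<integral>\<^sup>+p. ennreal ((cmod (tensor f g p))\<^sup>2) \<partial>(M \<Otimes>\<^sub>M N))
      \<le> ennreal ((L2_norm M f * L2_norm N g)\<^sup>2)" by simp
  show "tensor f g \<in> L2 (M \<Otimes>\<^sub>M N)"
    "L2_norm (M \<Otimes>\<^sub>M N) (tensor f g) \<le> L2_norm M f * L2_norm N g"
    using L2_nn_integralI[OF _ _ le] by simp_all
qed

text \<open>The norms of the terms of \<open>rep_kernel f g\<close> in \<open>L2 (M \<Otimes>\<^sub>M N)\<close> are summable, so that the kernel is
  square-integrable and its series converges almost everywhere.\<close>

lemma rep_tensors:
  assumes N: "sigma_finite_measure N" and r: "nuclear_rep M N f g"
  shows "\<And>i. tensor (f i) (g i) \<in> L2 (M \<Otimes>\<^sub>M N)"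
    and "summable (\<lambda>i. L2_norm (M \<Otimes>\<^sub>M N) (tensor (f i) (g i)))"
proof -
  show "tensor (f i) (g i) \<in> L2 (M \<Otimes>\<^sub>M N)" for i
    by (rule tensor_L2[OF N nuclear_repD(1,2)[OF r]])
  show "summable (\<lambda>i. L2_norm (M \<Otimes>\<^sub>M N) (tensor (f i) (g i)))"
    by (rule summable_comparison_test'[OF nuclear_repD(3)[OF r], of 0])
      (use tensor_L2(2)[OF N nuclear_repD(1,2)[OF r]] in auto)
qed

lemma rep_kernel_L2:
  assumes N: "sigma_finite_measure N" and r: "nuclear_rep M N f g"
  shows "rep_kernel f g \<in> L2 (M \<Otimes>\<^sub>M N)"
  unfolding rep_kernel_def by (rule L2_series(2)[OF rep_tensors[OF N r]])

lemma rep_kernel_sums_AE: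
  assumes N: "sigma_finite_measure N" and r: "nuclear_rep M N f g"
  shows "AE p in M \<Otimes>\<^sub>M N. (\<lambda>i. tensor (f i) (g i) p) sums rep_kernel f g p"
  using L2_series(1)[OF rep_tensors[OF N r]]
  by eventually_elim (auto simp: rep_kernel_def intro!: summable_sums intro: summable_norm_cancel)

subsection \<open>Integral operators\<close>

lemma integrable_kernel_tensor:
  assumes "sigma_finite_measure N" and "k \<in> L2 (M \<Otimes>\<^sub>M N)" "f \<in> L2 M" "g \<in> L2 N"
  shows "integrable (M \<Otimes>\<^sub>M N) (\<lambda>p. k p * tensor f g p)"
  by (intro integrable_mult_L2 tensor_L2 assms)

lemma L2_section_AE:
  assumes M: "sigma_finite_measure M" and N: "sigma_finite_measure N" and k: "k \<in> L2 (M \<Otimes>\<^sub>M N)"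
  shows "AE y in N. (\<lambda>x. k (x, y)) \<in> L2 M"
proof -
  interpret pair_sigma_finite M N using M N by (simp add: pair_sigma_finite_def)
  note [measurable] = L2_measurable[OF k]
  have "AE y in N. integrable M (\<lambda>x. (cmod (k (x, y)))\<^sup>2)"
    by (rule AE_integrable_snd) (use L2_integrable[OF k] in \<open>simp add: case_prod_unfold\<close>)
  moreover have "AE y in N. y \<in> space N" by simp
  ultimately show ?thesis
  proof eventually_elim
    case (elim y)
    then have "(\<lambda>x. k (x, y)) \<in> borel_measurable M" by measurable
    with elim show ?case by (simp add: L2_def)
  qed
qed

lemma integral_op_bounded:
  assumes M: "sigma_finite_measure M" and N: "sigma_finite_measure N" and k: "k \<in> L2 (M \<Otimes>\<^sub>M N)"
  shows "integral_op M k \<in> bounded_ops M N"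
proof -
  interpret pair_sigma_finite M N using M N by (simp add: pair_sigma_finite_def)
  note [measurable] = L2_measurable[OF k]
  note sec = L2_section_AE[OF M N k]
  have meas: "integral_op M k f \<in> borel_measurable N" if f: "f \<in> L2 M" for f
  proof -
    note [measurable] = L2_measurable[OF f]
    show ?thesis unfolding integral_op_def by measurable
  qed
  have main: "integral_op M k f \<in> L2 N \<and>
      L2_norm N (integral_op M k f) \<le> L2_norm (M \<Otimes>\<^sub>M N) k * L2_norm M f" if f: "f \<in> L2 M" for f
  proof -
    have i: "integrable (M \<Otimes>\<^sub>M N) (\<lambda>(x, y). (cmod (k (x, y)))\<^sup>2)"
      using L2_integrable[OF k] by (simp add: case_prod_unfold)
    have "(\<integral>\<^sup>+y. ennreal ((cmod (integral_op M k f y))\<^sup>2) \<partial>N) \<le>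
        (\<integral>\<^sup>+y. ennreal ((\<integral>x. (cmod (k (x, y)))\<^sup>2 \<partial>M) * (L2_norm M f)\<^sup>2) \<partial>N)"
    proof (rule nn_integral_mono_AE)
      show "AE y in N. ennreal ((cmod (integral_op M k f y))\<^sup>2) \<le>
          ennreal ((\<integral>x. (cmod (k (x, y)))\<^sup>2 \<partial>M) * (L2_norm M f)\<^sup>2)"
        using sec
      proof eventually_elim
        case (elim y)
        have "cmod (integral_op M k f y) \<le> L2_norm M (\<lambda>x. k (x, y)) * L2_norm M f"
          using L2_inner_bound[OF elim L2_cnj[OF f]] by (simp add: L2_inner_def integral_op_def)
        then have "(cmod (integral_op M k f y))\<^sup>2 \<le> (L2_norm M (\<lambda>x. k (x, y)) * L2_norm M f)\<^sup>2"
          by (intro power_mono) auto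
        then show ?case
          by (intro ennreal_leI) (simp add: power_mult_distrib L2_norm_square)
      qed
    qed
    also have "\<dots> = ennreal (\<integral>y. (\<integral>x. (cmod (k (x, y)))\<^sup>2 \<partial>M) * (L2_norm M f)\<^sup>2 \<partial>N)"
      by (rule nn_integral_eq_integral) (use integrable_snd[OF i] in auto)
    also have "(\<integral>y. (\<integral>x. (cmod (k (x, y)))\<^sup>2 \<partial>M) * (L2_norm M f)\<^sup>2 \<partial>N) =
        (L2_norm (M \<Otimes>\<^sub>M N) k * L2_norm M f)\<^sup>2"
      using integral_snd[OF i] by (simp add: power_mult_distrib L2_norm_square case_prod_unfold)
    finally have "(\<integral>\<^sup>+y. ennreal ((cmod (integral_op M k f y))\<^sup>2) \<partial>N) \<le>
        ennreal ((L2_norm (M \<Otimes>\<^sub>M N) k * L2_norm M f)\<^sup>2)" .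
    from L2_nn_integralI[OF meas[OF f] _ this] show ?thesis by simp
  qed
  have "AE y in N. integral_op M k (\<lambda>x. f x + g x) y = integral_op M k f y + integral_op M k g y"
    if "f \<in> L2 M" "g \<in> L2 M" for f g
    using sec
  proof eventually_elim
    case (elim y)
    show ?case
      using integrable_mult_L2[OF elim that(1)] integrable_mult_L2[OF elim that(2)]
      by (simp add: integral_op_def distrib_left)
  qed
  moreover have "integral_op M k (\<lambda>x. c * f x) y = c * integral_op M k f y" for c f y
  proof -
    have "(\<lambda>x. k (x, y) * (c * f x)) = (\<lambda>x. c * (k (x, y) * f x))" by (simp add: mult.left_commute)
    then show ?thesis by (simp add: integral_op_def)
  qed
  ultimately show ?thesis
    unfolding bounded_ops_def using main
    by (auto intro!: exI[of _ "L2_norm (M \<Otimes>\<^sub>M N) k"])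
qed

text \<open>Fubini: the form of an integral operator is the pairing of its kernel with elementary tensors.\<close>

lemma integral_op_inner:
  assumes M: "sigma_finite_measure M" and N: "sigma_finite_measure N" and k: "k \<in> L2 (M \<Otimes>\<^sub>M N)"
    and f: "f \<in> L2 M" and g: "g \<in> L2 N"
  shows "L2_inner N (integral_op M k f) g = L2_inner (M \<Otimes>\<^sub>M N) (tensor f g) (\<lambda>p. cnj (k p))"
proof -
  interpret pair_sigma_finite M N using M N by (simp add: pair_sigma_finite_def)
  have i: "integrable (M \<Otimes>\<^sub>M N) (\<lambda>(x, y). k (x, y) * (f x * cnj (g y)))"
    using integrable_kernel_tensor[OF N k f g] by (simp add: case_prod_unfold tensor_def)
  have "L2_inner N (integral_op M k f) g = (\<integral>y. (\<integral>x. k (x, y) * (f x * cnj (g y)) \<partial>M) \<partial>N)"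
    unfolding L2_inner_def integral_op_def by (simp flip: mult.assoc)
  also have "\<dots> = L2_inner (M \<Otimes>\<^sub>M N) (tensor f g) (\<lambda>p. cnj (k p))"
    unfolding integral_snd[OF i] by (simp add: L2_inner_def tensor_def case_prod_unfold mult.commute)
  finally show ?thesis .
qed

lemma pairing_integral_op:
  assumes M: "sigma_finite_measure M" and N: "sigma_finite_measure N" and k: "k \<in> L2 (M \<Otimes>\<^sub>M N)"
    and r: "nuclear_rep M N f g"
  shows "pairing N (integral_op M k) f g = (\<integral>p. k p * rep_kernel f g p \<partial>(M \<Otimes>\<^sub>M N))"
proof -
  have "(\<lambda>i. L2_inner (M \<Otimes>\<^sub>M N) (tensor (f i) (g i)) (\<lambda>p. cnj (k p))) sums
      L2_inner (M \<Otimes>\<^sub>M N) (rep_kernel f g) (\<lambda>p. cnj (k p))"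
    unfolding rep_kernel_def by (rule L2_inner_series[OF rep_tensors[OF N r] L2_cnj[OF k]])
  then have "pairing N (integral_op M k) f g = L2_inner (M \<Otimes>\<^sub>M N) (rep_kernel f g) (\<lambda>p. cnj (k p))"
    unfolding pairing_def integral_op_inner[OF M N k nuclear_repD(1,2)[OF r]] by (rule sums_unique[symmetric])
  then show ?thesis by (simp add: L2_inner_def mult.commute)
qed

subsection \<open>The trace formula\<close>

definition rep_operator ::
    "'b measure \<Rightarrow> (nat \<Rightarrow> 'a \<Rightarrow> complex) \<Rightarrow> (nat \<Rightarrow> 'b \<Rightarrow> complex) \<Rightarrow> ('b, 'a) operator" where
  "rep_operator N f g = (\<lambda>h x. \<Sum>i. L2_inner N h (g i) * f i x)"

definition represents ::
    "'a measure \<Rightarrow> 'b measure \<Rightarrow> ('b, 'a) operator \<Rightarrow>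
      (nat \<Rightarrow> 'a \<Rightarrow> complex) \<Rightarrow> (nat \<Rightarrow> 'b \<Rightarrow> complex) \<Rightarrow> bool" where
  "represents M N A f g \<longleftrightarrow> nuclear_rep M N f g \<and>
     (\<forall>h\<in>L2 N. (\<lambda>n. L2_norm M (\<lambda>x. A h x - (\<Sum>i<n. L2_inner N h (g i) * f i x))) \<longlonglongrightarrow> 0)"

lemma nuclear_ops_represents:
  "A \<in> nuclear_ops N M \<longleftrightarrow> A \<in> bounded_ops N M \<and> (\<exists>f g. represents M N A f g)"
  unfolding nuclear_ops_def represents_def nuclear_rep_def
  by (auto simp: mult.commute)

lemma rep_operator_represents:
  assumes r: "nuclear_rep M N f g"
  shows "rep_operator N f g \<in> bounded_ops N M" and "represents M N (rep_operator N f g) f g"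
proof -
  note L = nuclear_repD[OF r]
  have tL: "(\<lambda>x. L2_inner N h (g i) * f i x) \<in> L2 M" for h i by (rule L2_scale[OF L(1)])
  have term_le: "L2_norm M (\<lambda>x. L2_inner N h (g i) * f i x) \<le> L2_norm N h * (L2_norm M (f i) * L2_norm N (g i))"
    if "h \<in> L2 N" for h i
  proof -
    have "L2_norm M (\<lambda>x. L2_inner N h (g i) * f i x) \<le> (L2_norm N h * L2_norm N (g i)) * L2_norm M (f i)"
      unfolding L2_norm_scale by (rule mult_right_mono[OF L2_inner_bound[OF that L(2)]]) simp
    then show ?thesis by (simp add: mult_ac)
  qed
  have sm: "summable (\<lambda>i. L2_norm M (\<lambda>x. L2_inner N h (g i) * f i x))" if h: "h \<in> L2 N" for h
    by (rule summable_comparison_test'[OF summable_mult[OF L(3), of "L2_norm N h"], of 0])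
      (use term_le[OF h] in auto)
  have AEs: "AE x in M. summable (\<lambda>i. L2_inner N h (g i) * f i x)" if h: "h \<in> L2 N" for h
    using L2_series(1)[OF tL sm[OF h]] by eventually_elim (rule summable_norm_cancel)
  have "rep_operator N f g h \<in> L2 M" if "h \<in> L2 N" for h
    unfolding rep_operator_def by (rule L2_series(2)[OF tL sm[OF that]])
  moreover have "AE x in M. rep_operator N f g (\<lambda>x. h x + h' x) x =
      rep_operator N f g h x + rep_operator N f g h' x" if h: "h \<in> L2 N" "h' \<in> L2 N" for h h'
    using AEs[OF h(1)] AEs[OF h(2)]
  proof eventually_elim
    case (elim x)
    then show ?case
      unfolding rep_operator_def by (simp add: L2_inner_add_left h L(2) distrib_right suminf_add)
  qed
  moreover have "AE x in M. rep_operator N f g (\<lambda>x. c * h x) x = c * rep_operator N f g h x"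
    if h: "h \<in> L2 N" for h c
    using AEs[OF h]
  proof eventually_elim
    case (elim x)
    then show ?case
      unfolding rep_operator_def by (simp add: L2_inner_scale_left mult.assoc suminf_mult)
  qed
  moreover have "L2_norm M (rep_operator N f g h) \<le> (\<Sum>i. L2_norm M (f i) * L2_norm N (g i)) * L2_norm N h"
    if h: "h \<in> L2 N" for h
  proof -
    have "L2_norm M (rep_operator N f g h) \<le> (\<Sum>i. L2_norm M (\<lambda>x. L2_inner N h (g i) * f i x))"
      unfolding rep_operator_def by (rule L2_series(3)[OF tL sm[OF h]])
    also have "\<dots> \<le> (\<Sum>i. L2_norm N h * (L2_norm M (f i) * L2_norm N (g i)))"
      by (rule suminf_le[OF term_le[OF h] sm[OF h] summable_mult[OF L(3)]])
    also have "\<dots> = (\<Sum>i. L2_norm M (f i) * L2_norm N (g i)) * L2_norm N h"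
      by (simp add: suminf_mult[OF L(3)] mult.commute)
    finally show ?thesis .
  qed
  ultimately show "rep_operator N f g \<in> bounded_ops N M"
    unfolding bounded_ops_def
    by (auto intro!: exI[of _ "\<Sum>i. L2_norm M (f i) * L2_norm N (g i)"])
  show "represents M N (rep_operator N f g) f g"
    unfolding represents_def rep_operator_def
    using r L2_series_tendsto[OF tL sm] by blast
qed

lemma sum_product_le_of_squares:
  fixes a b :: "'i \<Rightarrow> real"
  assumes "\<And>i. a i \<ge> 0" "\<And>i. b i \<ge> 0" "(\<Sum>i\<in>I. (a i)\<^sup>2) \<le> A\<^sup>2" "(\<Sum>i\<in>I. (b i)\<^sup>2) \<le> B\<^sup>2" "A \<ge> 0" "B \<ge> 0"
  shows "(\<Sum>i\<in>I. a i * b i) \<le> A * B"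
proof -
  have "(\<Sum>i\<in>I. a i * b i) \<le> L2_set a I * L2_set b I"
    using L2_set_mult_ineq[of a b I] assms(1,2) by simp
  also have "\<dots> \<le> A * B"
    unfolding L2_set_def using assms
    by (intro mult_mono real_le_lsqrt) (auto intro!: sum_nonneg)
  finally show ?thesis .
qed

text \<open>Evaluating the trace in the basis \<open>E\<close> gives a double sum over \<open>i\<close> and \<open>e\<close>, absolutely convergent
  by Bessel's inequality. Summing over \<open>e\<close> first is Parseval's identity, and the basis disappears.\<close>

lemma trace_formula:
  assumes T: "T \<in> bounded_ops M N" and A: "A \<in> bounded_ops N M" and rA: "represents M N A f g"
    and onb: "orthonormal_basis N E"
  shows "((\<lambda>e. L2_inner N ((T \<circ> A) e) e) has_sum pairing N T f g) E"
proof -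
  have r: "nuclear_rep M N f g" using rA by (simp add: represents_def)
  note L = nuclear_repD[OF r]
  have on: "orthonormal N E" by (rule orthonormal_basis_imp_orthonormal[OF onb])
  note eL = orthonormal_L2[OF on]
  note TL = bounded_ops_L2[OF T L(1)]
  obtain C where C: "C \<ge> 0" "\<And>f. f \<in> L2 M \<Longrightarrow> L2_norm N (T f) \<le> C * L2_norm M f"
    using bounded_ops_bound[OF T] by blast
  define F where "F = (\<lambda>(i, e). L2_inner N e (g i) * L2_inner N (T (f i)) e)"
  have fin: "(\<Sum>e\<in>G. cmod (F (i, e))) \<le> L2_norm N (g i) * L2_norm N (T (f i))"
    if "finite G" "G \<subseteq> E" for G i
  proof -
    have "(\<Sum>e\<in>G. (cmod (L2_inner N e (g i)))\<^sup>2) = (\<Sum>e\<in>G. (cmod (L2_inner N (g i) e))\<^sup>2)"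
    proof (rule sum.cong[OF refl])
      fix e show "(cmod (L2_inner N e (g i)))\<^sup>2 = (cmod (L2_inner N (g i) e))\<^sup>2"
        by (subst L2_inner_commute) simp
    qed
    then have "(\<Sum>e\<in>G. (cmod (L2_inner N e (g i)))\<^sup>2) \<le> (L2_norm N (g i))\<^sup>2"
      using Bessel_finite[OF on that L(2)] by simp
    then show ?thesis
      unfolding F_def prod.case norm_mult
      by (intro sum_product_le_of_squares Bessel_finite[OF on that TL]) auto
  qed
  have col: "((\<lambda>e. F (i, e)) has_sum L2_inner N (T (f i)) (g i)) E" for i
    using orthonormal_expansion[OF onb TL, of i] L(2)[of i] by (auto simp: F_def mult.commute)
  have colabs: "(\<lambda>e. cmod (F (i, e))) summable_on E" for i
    by (rule nonneg_bdd_above_summable_on)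
      (auto intro!: bdd_aboveI2[where M = "L2_norm N (g i) * L2_norm N (T (f i))"] fin)
  have colle: "infsum (\<lambda>e. cmod (F (i, e))) E \<le> C * (L2_norm M (f i) * L2_norm N (g i))" for i
  proof -
    have "infsum (\<lambda>e. cmod (F (i, e))) E \<le> L2_norm N (g i) * L2_norm N (T (f i))"
      by (rule infsum_le_finite_sums[OF colabs fin])
    also have "\<dots> \<le> L2_norm N (g i) * (C * L2_norm M (f i))"
      by (rule mult_left_mono[OF C(2)[OF L(1)]]) simp
    finally show ?thesis by (simp add: mult_ac)
  qed
  have "(\<lambda>i. C * (L2_norm M (f i) * L2_norm N (g i))) summable_on UNIV"
    by (rule norm_summable_imp_summable_on) (use C(1) summable_mult[OF L(3), of C] in \<open>simp add: abs_mult\<close>)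
  then have rows: "(\<lambda>i. norm (infsum (\<lambda>e. cmod (F (i, e))) E)) summable_on UNIV"
    by (rule Infinite_Sum.abs_summable_on_comparison_test') (use colle in \<open>auto simp: infsum_nonneg\<close>)
  have "(\<lambda>x. norm (F x)) summable_on (UNIV \<times> E)"
    unfolding Infinite_Sum.abs_summable_on_Sigma_iff using colabs rows by simp
  then have Fs: "F summable_on (UNIV \<times> E)" by (rule Infinite_Sum.abs_summable_summable)
  have "((\<lambda>i. L2_inner N (T (f i)) (g i)) has_sum pairing N T f g) UNIV"
    by (rule norm_summable_imp_has_sum[OF pairing_summable[OF T r] pairing_sums[OF T r]])
  then have "(F has_sum pairing N T f g) (UNIV \<times> E)"
    by (rule has_sum_SigmaI[OF col _ Fs])
  then have "((\<lambda>(e, i). F (i, e)) has_sum pairing N T f g) (E \<times> UNIV)"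
    by (subst (asm) has_sum_swap)
  moreover have "((\<lambda>i. F (i, e)) has_sum L2_inner N ((T \<circ> A) e) e) UNIV" if e: "e \<in> E" for e
  proof -
    have "(\<lambda>i. F (i, e)) summable_on UNIV"
      using summable_on_SigmaD1[of "\<lambda>e i. F (i, e)" E "\<lambda>_. UNIV"] Fs e
      by (subst (asm) summable_on_swap) (auto simp: case_prod_unfold)
    then obtain s where s: "((\<lambda>i. F (i, e)) has_sum s) UNIV" by (auto simp: summable_on_def)
    then have "(\<lambda>i. F (i, e)) sums s" by (rule has_sum_imp_sums)
    then have lim: "(\<lambda>n. \<Sum>i<n. F (i, e)) \<longlonglongrightarrow> s" by (simp add: sums_def)
    let ?u = "\<lambda>n x. \<Sum>i<n. L2_inner N e (g i) * f i x"
    have uL: "?u n \<in> L2 M" for n by (intro L2_sum L2_scale L)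
    have "(\<lambda>n. L2_inner N (T (?u n)) e) \<longlonglongrightarrow> L2_inner N (T (A e)) e"
      by (rule op_inner_tendsto[OF T uL bounded_ops_L2[OF A eL[OF e]] eL[OF e]])
        (use rA eL[OF e] in \<open>simp add: represents_def\<close>)
    moreover have "L2_inner N (T (?u n)) e = (\<Sum>i<n. F (i, e))" for n
      by (simp add: op_inner_sum[OF T L2_scale[OF L(1)] eL[OF e]] op_inner_scale[OF T L(1) eL[OF e]] F_def)
    ultimately have "s = L2_inner N (T (A e)) e" using lim LIMSEQ_unique by auto
    then show ?thesis using s by simp
  qed
  ultimately show ?thesis
    using has_sum_SigmaD[where f = "\<lambda>(e, i). F (i, e)" and S = "pairing N T f g" and A = E
        and B = "\<lambda>_. UNIV" and g = "\<lambda>e. L2_inner N ((T \<circ> A) e) e"] by simp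
qed

text \<open>The number described in \<open>op_trace\<close> is unique because there is at least one basis to test it on.\<close>

lemma op_trace_eq_pairing:
  assumes T: "T \<in> bounded_ops M N" and A: "A \<in> bounded_ops N M" and r: "represents M N A f g"
  shows "op_trace N (T \<circ> A) = pairing N T f g"
  unfolding op_trace_def
proof (rule the_equality)
  show "\<forall>E. orthonormal_basis N E \<longrightarrow> ((\<lambda>e. L2_inner N ((T \<circ> A) e) e) has_sum pairing N T f g) E"
    using trace_formula[OF T A r] by blast
  fix c assume c: "\<forall>E. orthonormal_basis N E \<longrightarrow> ((\<lambda>e. L2_inner N ((T \<circ> A) e) e) has_sum c) E"
  obtain E where E: "orthonormal_basis N E" using orthonormal_basis_exists by blast
  from c[rule_format, OF E] trace_formula[OF T A r E] show "c = pairing N T f g"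
    by (rule has_sum_unique)
qed

section \<open>The weak* closure of the graph as a bipolar\<close>

subsection \<open>Separation in finite dimensions\<close>

text \<open>By induction on \<open>J\<close>: on the subspace where the coordinate \<open>i\<close> vanishes the remaining coordinates
  suffice, and any \<open>w\<close> is moved into this subspace by a multiple of a fixed \<open>w'\<close> with \<open>w' i \<noteq> 0\<close>.\<close>

lemma functional_on_common_kernel:
  fixes W :: "('i \<Rightarrow> complex) set"
  assumes "finite J"
    and "\<And>u v. u \<in> W \<Longrightarrow> v \<in> W \<Longrightarrow> (\<lambda>i. u i + v i) \<in> W"
    and "\<And>c u. u \<in> W \<Longrightarrow> (\<lambda>i. c * u i) \<in> W"
    and "\<And>w. w \<in> W \<Longrightarrow> (\<forall>i\<in>J. w i = 0) \<Longrightarrow> w j = 0"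
  shows "\<exists>c. \<forall>w\<in>W. w j = (\<Sum>i\<in>J. c i * w i)"
  using assms
proof (induction J arbitrary: W)
  case empty
  then show ?case by auto
next
  case (insert i J)
  define W0 where "W0 = {w \<in> W. w i = 0}"
  have "\<exists>c. \<forall>w\<in>W0. w j = (\<Sum>i\<in>J. c i * w i)"
    by (rule insert.IH) (use insert.prems in \<open>auto simp: W0_def\<close>)
  then obtain c where c: "\<And>w. w \<in> W0 \<Longrightarrow> w j = (\<Sum>i\<in>J. c i * w i)" by blast
  show ?case
  proof (cases "\<exists>w'\<in>W. w' i \<noteq> 0")
    case False
    then have "W = W0" by (auto simp: W0_def)
    then have "w j = (\<Sum>k\<in>insert i J. (c(i := 0)) k * w k)" if "w \<in> W" for w
      using insert.hyps c[of w] that by (simp add: sum.insert cong: sum.cong_simp) (auto intro!: sum.cong)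
    then show ?thesis by blast
  next
    case True
    then obtain w' where w': "w' \<in> W" "w' i \<noteq> 0" by blast
    define d where "d = (w' j - (\<Sum>k\<in>J. c k * w' k)) / w' i"
    have "w j = (\<Sum>k\<in>insert i J. (c(i := d)) k * w k)" if w: "w \<in> W" for w
    proof -
      define r where "r = w i / w' i"
      have "(\<lambda>k. w k + (- r) * w' k) \<in> W0"
        using insert.prems(1)[OF w insert.prems(2)[OF w'(1), of "- r"]] w'(2)
        by (simp add: W0_def r_def)
      from c[OF this] have "w j - r * w' j = (\<Sum>k\<in>J. c k * w k) - r * (\<Sum>k\<in>J. c k * w' k)"
        by (simp add: algebra_simps sum_subtractf sum_distrib_left)
      then have "w j = (\<Sum>k\<in>J. c k * w k) + d * w i"
        by (simp add: d_def r_def algebra_simps diff_divide_distrib)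
      also have "\<dots> = (\<Sum>k\<in>insert i J. (c(i := d)) k * w k)"
      proof -
        have "(\<Sum>k\<in>J. (c(i := d)) k * w k) = (\<Sum>k\<in>J. c k * w k)"
          by (rule sum.cong) (use insert.hyps in auto)
        then show ?thesis using insert.hyps by simp
      qed
      finally show ?thesis .
    qed
    then show ?thesis by blast
  qed
qed

text \<open>The extra coordinate \<open>None\<close> records the multiple of \<open>v\<close> in an element of the span of \<open>W\<close>
  and \<open>v\<close>. It vanishes on the common kernel of the coordinates in \<open>J\<close>, because \<open>v\<close> does not
  agree with an element of \<open>W\<close> there.\<close>

lemma finite_dimensional_separation:
  fixes W :: "('i \<Rightarrow> complex) set"
  assumes J: "finite J" and zero: "(\<lambda>_. 0) \<in> W"
    and add: "\<And>u v. u \<in> W \<Longrightarrow> v \<in> W \<Longrightarrow> (\<lambda>i. u i + v i) \<in> W"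
    and scale: "\<And>c u. u \<in> W \<Longrightarrow> (\<lambda>i. c * u i) \<in> W"
    and v: "\<And>w. w \<in> W \<Longrightarrow> \<exists>i\<in>J. w i \<noteq> v i"
  shows "\<exists>c. (\<forall>w\<in>W. (\<Sum>i\<in>J. c i * w i) = 0) \<and> (\<Sum>i\<in>J. c i * v i) = 1"
proof -
  define E where "E = (\<lambda>(w :: 'i \<Rightarrow> complex) l i'. case i' of None \<Rightarrow> l | Some i \<Rightarrow> w i + l * v i)"
  define W' where "W' = {E w l | w l. w \<in> W}"
  have "\<exists>c. \<forall>u\<in>W'. u None = (\<Sum>i\<in>Some ` J. c i * u i)"
  proof (rule functional_on_common_kernel)
    fix u u' assume "u \<in> W'" "u' \<in> W'"
    then obtain w l w' l' where "w \<in> W" "w' \<in> W" "u = E w l" "u' = E w' l'"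
      by (auto simp: W'_def)
    moreover have "(\<lambda>i. E w l i + E w' l' i) = E (\<lambda>i. w i + w' i) (l + l')"
      by (auto simp: E_def fun_eq_iff algebra_simps split: option.split)
    ultimately show "(\<lambda>i. u i + u' i) \<in> W'" unfolding W'_def using add by auto
  next
    fix u c assume "u \<in> W'"
    then obtain w l where "w \<in> W" "u = E w l" by (auto simp: W'_def)
    moreover have "(\<lambda>i. c * E w l i) = E (\<lambda>i. c * w i) (c * l)"
      by (auto simp: E_def fun_eq_iff algebra_simps split: option.split)
    ultimately show "(\<lambda>i. c * u i) \<in> W'" unfolding W'_def using scale by auto
  next
    fix u assume "u \<in> W'" and z: "\<forall>i\<in>Some ` J. u i = 0"
    then obtain w l where w: "w \<in> W" "u = E w l" by (auto simp: W'_def)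
    have "l = 0"
    proof (rule ccontr)
      assume l: "l \<noteq> 0"
      obtain i where i: "i \<in> J" "(- 1 / l) * w i \<noteq> v i" using v[OF scale[OF w(1), of "- 1 / l"]] by blast
      have "w i + l * v i = 0" using z i(1) by (auto simp: w(2) E_def)
      then have "w i = - (l * v i)" by (simp add: add_eq_0_iff2)
      with i(2) l show False by simp
    qed
    then show "u None = 0" by (simp add: w(2) E_def)
  qed (use J in simp)
  then obtain c where c': "\<forall>u\<in>W'. u None = (\<Sum>i\<in>Some ` J. c i * u i)" by blast
  have c: "l = (\<Sum>i\<in>J. c (Some i) * (w i + l * v i))" if "w \<in> W" for w l
  proof -
    have "E w l \<in> W'" using that by (auto simp: W'_def)
    from c'[rule_format, OF this] show ?thesis by (simp add: E_def sum.reindex)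
  qed
  have "(\<Sum>i\<in>J. c (Some i) * w i) = 0" if "w \<in> W" for w
    using c[OF that, of 0] by simp
  moreover have "(\<Sum>i\<in>J. c (Some i) * v i) = 1"
    using c[OF zero, of 1] by simp
  ultimately show ?thesis by (intro exI[of _ "\<lambda>i. c (Some i)"]) blast
qed

subsection \<open>Linear combinations of nuclear operators\<close>

definition interleave :: "(nat \<Rightarrow> 'c) \<Rightarrow> (nat \<Rightarrow> 'c) \<Rightarrow> nat \<Rightarrow> 'c" where
  "interleave u v = (\<lambda>n. if even n then u (n div 2) else v ((n - 1) div 2))"

lemma sums_interleave_complex:
  fixes u v :: "nat \<Rightarrow> complex"
  assumes "u sums a" "v sums b"
  shows "interleave u v sums (a + b)"
proof -
  have "(\<lambda>n. if even n then Re (u (n div 2)) else Re (v ((n - 1) div 2))) sums (Re b + Re a)"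
    "(\<lambda>n. if even n then Im (u (n div 2)) else Im (v ((n - 1) div 2))) sums (Im b + Im a)"
    by (rule sums_if; use assms in \<open>simp add: sums_complex_iff\<close>)+
  then show ?thesis
    unfolding sums_complex_iff interleave_def by (simp add: if_distrib add.commute)
qed

text \<open>A sum of two nuclear operators is represented by listing the terms of both alternately.\<close>

lemma rep_add:
  assumes N: "sigma_finite_measure N" and r: "nuclear_rep M N f g" "nuclear_rep M N f' g'"
  shows "nuclear_rep M N (interleave f f') (interleave g g')"
    and "AE p in M \<Otimes>\<^sub>M N. rep_kernel (interleave f f') (interleave g g') p
           = rep_kernel f g p + rep_kernel f' g' p"
    and "T \<in> bounded_ops M N \<Longrightarrow> pairing N T (interleave f f') (interleave g g') =
           pairing N T f g + pairing N T f' g'"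
proof -
  note L = nuclear_repD[OF r(1)] nuclear_repD[OF r(2)]
  have "(\<lambda>n. if even n then L2_norm M (f (n div 2)) * L2_norm N (g (n div 2))
      else L2_norm M (f' ((n - 1) div 2)) * L2_norm N (g' ((n - 1) div 2))) sums
      ((\<Sum>i. L2_norm M (f' i) * L2_norm N (g' i)) + (\<Sum>i. L2_norm M (f i) * L2_norm N (g i)))"
    by (rule sums_if) (intro summable_sums L)+
  then have "summable (\<lambda>n. L2_norm M (interleave f f' n) * L2_norm N (interleave g g' n))"
    by (auto simp: interleave_def sums_iff if_distrib[of "L2_norm _"] cong: if_cong
        elim!: back_subst[of summable] intro!: ext)
  then show "nuclear_rep M N (interleave f f') (interleave g g')"
    using L by (auto simp: nuclear_rep_def interleave_def)
  show "AE p in M \<Otimes>\<^sub>M N. rep_kernel (interleave f f') (interleave g g') p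
      = rep_kernel f g p + rep_kernel f' g' p"
    using rep_kernel_sums_AE[OF N r(1)] rep_kernel_sums_AE[OF N r(2)]
  proof eventually_elim
    case (elim p)
    have "(\<lambda>i. tensor (interleave f f' i) (interleave g g' i) p) =
        interleave (\<lambda>i. tensor (f i) (g i) p) (\<lambda>i. tensor (f' i) (g' i) p)"
      by (auto simp: interleave_def)
    then show ?case
      using sums_interleave_complex[OF elim] by (simp add: rep_kernel_def sums_iff)
  qed
  show "pairing N T (interleave f f') (interleave g g') = pairing N T f g + pairing N T f' g'"
    if T: "T \<in> bounded_ops M N"
  proof -
    have "(\<lambda>i. L2_inner N (T (interleave f f' i)) (interleave g g' i)) =
        interleave (\<lambda>i. L2_inner N (T (f i)) (g i)) (\<lambda>i. L2_inner N (T (f' i)) (g' i))"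
      by (auto simp: interleave_def)
    then show ?thesis
      using sums_interleave_complex[OF pairing_sums[OF T r(1)] pairing_sums[OF T r(2)]]
      by (simp add: pairing_def sums_iff)
  qed
qed

lemma rep_scale:
  assumes N: "sigma_finite_measure N" and r: "nuclear_rep M N f g"
  shows "nuclear_rep M N (\<lambda>i x. c * f i x) g"
    and "AE p in M \<Otimes>\<^sub>M N. rep_kernel (\<lambda>i x. c * f i x) g p = c * rep_kernel f g p"
    and "T \<in> bounded_ops M N \<Longrightarrow> pairing N T (\<lambda>i x. c * f i x) g = c * pairing N T f g"
proof -
  note L = nuclear_repD[OF r]
  show "nuclear_rep M N (\<lambda>i x. c * f i x) g"
    using L summable_mult[OF L(3), of "cmod c"] by (auto simp: nuclear_rep_def mult.assoc intro: L2_scale)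
  show "AE p in M \<Otimes>\<^sub>M N. rep_kernel (\<lambda>i x. c * f i x) g p = c * rep_kernel f g p"
    using rep_kernel_sums_AE[OF N r]
  proof eventually_elim
    case (elim p)
    have "(\<lambda>i. tensor (\<lambda>x. c * f i x) (g i) p) = (\<lambda>i. c * tensor (f i) (g i) p)"
      by (simp add: tensor_def mult.assoc)
    then show ?case using sums_mult[OF elim, of c] by (simp add: rep_kernel_def sums_iff)
  qed
  show "pairing N T (\<lambda>i x. c * f i x) g = c * pairing N T f g" if T: "T \<in> bounded_ops M N"
    using sums_mult[OF pairing_sums[OF T r], of c]
    by (simp add: op_inner_scale[OF T L(1,2)] pairing_def sums_iff)
qed

lemma rep_zero:
  shows "nuclear_rep M N (\<lambda>i x. 0) (\<lambda>i y. 0)" and "rep_kernel (\<lambda>i x. 0) (\<lambda>i y. 0) = (\<lambda>p. 0)"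
    and "pairing N T (\<lambda>i x. 0) (\<lambda>i y. 0) = 0"
  by (auto simp: nuclear_rep_def rep_kernel_def tensor_def pairing_def)

lemma rep_combination:
  assumes N: "sigma_finite_measure N" and F: "finite F" and r: "\<And>A. A \<in> F \<Longrightarrow> nuclear_rep M N (f A) (g A)"
  shows "\<exists>f' g'. nuclear_rep M N f' g' \<and>
    (AE p in M \<Otimes>\<^sub>M N. rep_kernel f' g' p = (\<Sum>A\<in>F. c A * rep_kernel (f A) (g A) p)) \<and>
    (\<forall>T\<in>bounded_ops M N. pairing N T f' g' = (\<Sum>A\<in>F. c A * pairing N T (f A) (g A)))"
  using F r
proof (induction F)
  case empty
  show ?case
    by (intro exI[of _ "\<lambda>i x. 0"] conjI ballI) (simp_all add: rep_zero)
next
  case (insert A F)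
  then obtain f' g' where r': "nuclear_rep M N f' g'"
    and k': "AE p in M \<Otimes>\<^sub>M N. rep_kernel f' g' p = (\<Sum>A\<in>F. c A * rep_kernel (f A) (g A) p)"
    and p': "\<And>T. T \<in> bounded_ops M N \<Longrightarrow> pairing N T f' g' = (\<Sum>A\<in>F. c A * pairing N T (f A) (g A))"
    by auto
  have rA: "nuclear_rep M N (f A) (g A)" using insert.prems by simp
  note s = rep_scale[OF N rA, where c = "c A"]
  note a = rep_add[OF N s(1) r']
  show ?case
  proof (intro exI conjI ballI)
    show "nuclear_rep M N (interleave (\<lambda>i x. c A * f A i x) f') (interleave (g A) g')" by (rule a(1))
    show "AE p in M \<Otimes>\<^sub>M N. rep_kernel (interleave (\<lambda>i x. c A * f A i x) f') (interleave (g A) g') p =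
        (\<Sum>A\<in>insert A F. c A * rep_kernel (f A) (g A) p)"
      using a(2) s(2) k' by eventually_elim (use insert.hyps in simp)
    show "pairing N T (interleave (\<lambda>i x. c A * f A i x) f') (interleave (g A) g') =
        (\<Sum>A\<in>insert A F. c A * pairing N T (f A) (g A))" if T: "T \<in> bounded_ops M N" for T
      using insert.hyps by (simp add: a(3)[OF T] s(3)[OF T] p'[OF T])
  qed
qed

subsection \<open>The multiplier domain separates\<close>

lemma multiplier_domain_zero: "(\<lambda>_. 0) \<in> multiplier_domain M N \<phi>"
  by (simp add: multiplier_domain_def)

lemma multiplier_domain_add:
  "k \<in> multiplier_domain M N \<phi> \<Longrightarrow> k' \<in> multiplier_domain M N \<phi> \<Longrightarrow>
    (\<lambda>p. k p + k' p) \<in> multiplier_domain M N \<phi>"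
  by (auto simp: multiplier_domain_def distrib_left intro: L2_add)

lemma multiplier_domain_scale:
  "k \<in> multiplier_domain M N \<phi> \<Longrightarrow> (\<lambda>p. c * k p) \<in> multiplier_domain M N \<phi>"
  by (auto simp: multiplier_domain_def mult.left_commute[of _ c] intro: L2_scale)

text \<open>Testing against \<open>k = cnj h\<close> cut down to \<open>cmod (\<phi> p) \<le> n\<close>, where \<open>h = h1 + \<phi> h2\<close>, shows
  that \<open>h\<close> vanishes on that set.\<close>

lemma multiplier_domain_separates:
  assumes \<phi>: "\<phi> \<in> borel_measurable (M \<Otimes>\<^sub>M N)"
    and h: "h1 \<in> L2 (M \<Otimes>\<^sub>M N)" "h2 \<in> L2 (M \<Otimes>\<^sub>M N)"
    and z: "\<And>k. k \<in> multiplier_domain M N \<phi> \<Longrightarrow>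
      (\<integral>p. k p * h1 p \<partial>(M \<Otimes>\<^sub>M N)) + (\<integral>p. \<phi> p * k p * h2 p \<partial>(M \<Otimes>\<^sub>M N)) = 0"
  shows "AE p in M \<Otimes>\<^sub>M N. h1 p + \<phi> p * h2 p = 0"
proof -
  let ?P = "M \<Otimes>\<^sub>M N"
  note [measurable] = \<phi> L2_measurable[OF h(1)] L2_measurable[OF h(2)]
  have "AE p in ?P. cmod (\<phi> p) \<le> real n \<longrightarrow> h1 p + \<phi> p * h2 p = 0" for n :: nat
  proof -
    define cut :: "'a \<times> 'b \<Rightarrow> complex" where "cut p = (if cmod (\<phi> p) \<le> real n then 1 else 0)" for p
    have [measurable]: "cut \<in> borel_measurable ?P" unfolding cut_def by measurable
    define h where "h p = cut p * h1 p + (cut p * \<phi> p) * h2 p" for p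
    have cut_b: "cmod (cut p * \<phi> p) \<le> real n" "cmod (cut p) \<le> 1" for p by (auto simp: cut_def)
    have hL: "h \<in> L2 ?P"
      unfolding h_def
      by (intro L2_add L2_mult_bounded[OF assms(2) _ cut_b(2)] L2_mult_bounded[OF assms(3) _ cut_b(1)]) measurable
    note [measurable] = L2_measurable[OF hL]
    have cut_h: "cut p * h p = h p" for p by (simp add: h_def cut_def)
    define k where "k p = cnj (h p)" for p
    have kL: "k \<in> L2 ?P" unfolding k_def by (rule L2_cnj[OF hL])
    have cut_k: "cut p * k p = k p" for p
      unfolding k_def using cut_h[of p] by (simp add: cut_def split: if_splits)
    have "(\<lambda>p. (cut p * \<phi> p) * k p) \<in> L2 ?P"
      by (rule L2_mult_bounded[OF kL _ cut_b(1)]) measurable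
    moreover have "(\<lambda>p. (cut p * \<phi> p) * k p) = (\<lambda>p. \<phi> p * k p)"
      by (rule ext) (metis cut_k mult.commute mult.assoc)
    ultimately have \<phi>kL: "(\<lambda>p. \<phi> p * k p) \<in> L2 ?P" by simp
    then have kD: "k \<in> multiplier_domain M N \<phi>" using kL by (simp add: multiplier_domain_def)
    have "L2_inner ?P h h = (\<integral>p. k p * h1 p + \<phi> p * k p * h2 p \<partial>?P)"
      unfolding L2_inner_def
    proof (rule Bochner_Integration.integral_cong[OF refl])
      fix p
      have "h p * cnj (h p) = (cut p * k p) * h1 p + \<phi> p * (cut p * k p) * h2 p"
        unfolding h_def k_def by (simp add: algebra_simps)
      then show "h p * cnj (h p) = k p * h1 p + \<phi> p * k p * h2 p" by (simp only: cut_k)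
    qed
    also have "\<dots> = 0"
      using z[OF kD] integrable_mult_L2[OF kL assms(2)] integrable_mult_L2[OF \<phi>kL assms(3)] by simp
    finally have "L2_norm ?P h = 0" by (simp add: L2_inner_self)
    then have "AE p in ?P. h p = 0" using L2_norm_eq_0_iff[OF hL] by simp
    then show ?thesis by eventually_elim (auto simp: h_def cut_def)
  qed
  then have "AE p in ?P. \<forall>n::nat. cmod (\<phi> p) \<le> real n \<longrightarrow> h1 p + \<phi> p * h2 p = 0"
    unfolding AE_all_countable by (rule allI)
  then show ?thesis
  proof eventually_elim
    case (elim p)
    obtain n where "cmod (\<phi> p) \<le> real n" using real_arch_simple by blast
    then show ?case using elim by blast
  qed
qed

subsection \<open>The weak* topology\<close>

lemma topspace_weak_star: "topspace (weak_star_topology M N) = bounded_ops M N"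
  unfolding weak_star_topology_def topspace_pullback_topology by auto

lemma continuous_map_trace:
  assumes "A \<in> nuclear_ops N M"
  shows "continuous_map (weak_star_topology M N) euclidean (\<lambda>T. op_trace N (T \<circ> A))"
proof -
  have "continuous_map (weak_star_topology M N) euclidean
      ((\<lambda>x. x A) \<circ> (\<lambda>T. \<lambda>A\<in>nuclear_ops N M. op_trace N (T \<circ> A)))"
    unfolding weak_star_topology_def
    by (rule continuous_map_pullback) (rule continuous_map_product_projection[OF assms])
  then show ?thesis by (rule continuous_map_eq) (use assms in auto)
qed

text \<open>The exact equality of finitely many traces is enough to stay in a neighbourhood, so that no
  approximation is needed to show that a point belongs to a closure.\<close>

lemma weak_star_neighbourhood:
  assumes U: "openin (weak_star_topology M N) U" and T: "T \<in> U"
  shows "\<exists>F. finite F \<and> F \<subseteq> nuclear_ops N M \<and>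
    (\<forall>T'\<in>bounded_ops M N. (\<forall>A\<in>F. op_trace N (T' \<circ> A) = op_trace N (T \<circ> A)) \<longrightarrow> T' \<in> U)"
proof -
  let ?t = "\<lambda>T. \<lambda>A\<in>nuclear_ops N M. op_trace N (T \<circ> A)"
  obtain V where V: "openin (product_topology (\<lambda>_. euclidean) (nuclear_ops N M)) V"
    and UV: "U = ?t -` V \<inter> bounded_ops M N"
    using U unfolding weak_star_topology_def openin_pullback_topology by blast
  have "?t T \<in> V" using T UV by blast
  then obtain B where B: "finite {A \<in> nuclear_ops N M. B A \<noteq> UNIV}"
      "?t T \<in> Pi\<^sub>E (nuclear_ops N M) B" "Pi\<^sub>E (nuclear_ops N M) B \<subseteq> V"
    using V[unfolded openin_product_topology_alt, rule_format, OF \<open>?t T \<in> V\<close>] by (auto simp only: topspace_euclidean)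
  show ?thesis
  proof (intro exI[of _ "{A \<in> nuclear_ops N M. B A \<noteq> UNIV}"] conjI B ballI impI)
    fix T' assume T': "T' \<in> bounded_ops M N"
      and eq: "\<forall>A\<in>{A \<in> nuclear_ops N M. B A \<noteq> UNIV}. op_trace N (T' \<circ> A) = op_trace N (T \<circ> A)"
    have "?t T' \<in> Pi\<^sub>E (nuclear_ops N M) B"
    proof (rule PiE_I)
      fix A assume A: "A \<in> nuclear_ops N M"
      show "?t T' A \<in> B A"
      proof (cases "B A = UNIV")
        case False
        then have "?t T' A = ?t T A" using eq A by simp
        then show ?thesis using PiE_mem[OF B(2) A] by simp
      qed simp
    qed simp
    then show "T' \<in> U" using B(3) T' UV by blast
  qed blast
qed

lemma zero_bounded_op: "(\<lambda>_ _. 0) \<in> bounded_ops M N"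
  by (auto simp: bounded_ops_def intro!: exI[of _ 0])

lemma bounded_ops_plus:
  assumes S: "S \<in> bounded_ops M N" and T: "T \<in> bounded_ops M N"
  shows "(\<lambda>f y. S f y + T f y) \<in> bounded_ops M N"
proof -
  obtain C where C: "\<And>f. f \<in> L2 M \<Longrightarrow> L2_norm N (S f) \<le> C * L2_norm M f"
    using bounded_ops_bound[OF S] by blast
  obtain D where D: "\<And>f. f \<in> L2 M \<Longrightarrow> L2_norm N (T f) \<le> D * L2_norm M f"
    using bounded_ops_bound[OF T] by blast
  note L = bounded_ops_L2[OF S] bounded_ops_L2[OF T]
  have "AE y in N. S (\<lambda>x. f x + g x) y + T (\<lambda>x. f x + g x) y = S f y + T f y + (S g y + T g y)"
    if "f \<in> L2 M" "g \<in> L2 M" for f g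
    using bounded_ops_add[OF S that] bounded_ops_add[OF T that] by eventually_elim simp
  moreover have "AE y in N. S (\<lambda>x. c * f x) y + T (\<lambda>x. c * f x) y = c * (S f y + T f y)"
    if "f \<in> L2 M" for f c
    using bounded_ops_scale[OF S that, of c] bounded_ops_scale[OF T that, of c]
    by eventually_elim (simp add: distrib_left)
  moreover have "L2_norm N (\<lambda>y. S f y + T f y) \<le> (C + D) * L2_norm M f" if "f \<in> L2 M" for f
    using L2_norm_triangle[OF L(1)[OF that] L(2)[OF that]] C[OF that] D[OF that]
    by (simp add: distrib_right)
  ultimately show ?thesis
    unfolding bounded_ops_def by (auto intro!: L2_add L exI[of _ "C + D"])
qed

lemma bounded_ops_times:
  assumes T: "T \<in> bounded_ops M N"
  shows "(\<lambda>f y. c * T f y) \<in> bounded_ops M N"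
proof -
  obtain D where D: "\<And>f. f \<in> L2 M \<Longrightarrow> L2_norm N (T f) \<le> D * L2_norm M f"
    using bounded_ops_bound[OF T] by blast
  note L = bounded_ops_L2[OF T]
  have "AE y in N. c * T (\<lambda>x. f x + g x) y = c * T f y + c * T g y"
    if "f \<in> L2 M" "g \<in> L2 M" for f g
    using bounded_ops_add[OF T that] by eventually_elim (simp add: distrib_left)
  moreover have "AE y in N. c * T (\<lambda>x. b * f x) y = b * (c * T f y)"
    if "f \<in> L2 M" for f b
    using bounded_ops_scale[OF T that, of b] by eventually_elim simp
  moreover have "L2_norm N (\<lambda>y. c * T f y) \<le> (cmod c * D) * L2_norm M f" if "f \<in> L2 M" for f
    using mult_left_mono[OF D[OF that], of "cmod c"] by (simp add: mult.assoc)
  ultimately show ?thesis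
    unfolding bounded_ops_def by (auto intro!: L2_scale L exI[of _ "cmod c * D"])
qed

lemma pairing_plus:
  assumes S: "S \<in> bounded_ops M N" and T: "T \<in> bounded_ops M N" and r: "nuclear_rep M N f g"
  shows "pairing N (\<lambda>f y. S f y + T f y) f g = pairing N S f g + pairing N T f g"
proof -
  have "L2_inner N (\<lambda>y. S (f i) y + T (f i) y) (g i) = L2_inner N (S (f i)) (g i) + L2_inner N (T (f i)) (g i)" for i
    by (intro L2_inner_add_left bounded_ops_L2[OF S] bounded_ops_L2[OF T] nuclear_repD[OF r])
  then show ?thesis
    using sums_add[OF pairing_sums[OF S r] pairing_sums[OF T r]] by (simp add: pairing_def sums_iff)
qed

lemma pairing_times:
  assumes T: "T \<in> bounded_ops M N" and r: "nuclear_rep M N f g"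
  shows "pairing N (\<lambda>f y. c * T f y) f g = c * pairing N T f g"
  using sums_mult[OF pairing_sums[OF T r], of c] by (simp add: pairing_def sums_iff L2_inner_scale_left)

lemma pairing_op_eq:
  assumes S: "S \<in> bounded_ops M N" and T: "T \<in> bounded_ops M N" and eq: "op_eq M N S T"
    and r: "nuclear_rep M N f g"
  shows "pairing N S f g = pairing N T f g"
proof -
  have "L2_inner N (S (f i)) (g i) = L2_inner N (T (f i)) (g i)" for i
  proof (rule L2_inner_cong_AE)
    show "AE y in N. S (f i) y = T (f i) y"
      using eq nuclear_repD(1)[OF r] unfolding op_eq_def by auto
  qed (use L2_measurable[OF bounded_ops_L2[OF S nuclear_repD(1)[OF r]]]
      L2_measurable[OF bounded_ops_L2[OF T nuclear_repD(1)[OF r]]]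
      L2_measurable[OF nuclear_repD(2)[OF r]] in auto)
  then show ?thesis by (simp add: pairing_def)
qed

abbreviation graph_closure ::
    "'a measure \<Rightarrow> 'b measure \<Rightarrow> ('a \<times> 'b \<Rightarrow> complex) \<Rightarrow> (('a, 'b) operator \<times> ('a, 'b) operator) set" where
  "graph_closure M N \<phi> \<equiv> prod_topology (weak_star_topology M N) (weak_star_topology M N)
     closure_of multiplier_graph M N \<phi>"

text \<open>The pairing is a weak* continuous function of \<open>(S, T)\<close>. On the graph it equals
  \<open>\<integral> k * (rep_kernel f g + \<phi> * rep_kernel f' g')\<close>.\<close>

lemma graph_closure_annihilated:
  assumes M: "sigma_finite_measure M" and N: "sigma_finite_measure N"
    and ST: "(S, T) \<in> graph_closure M N \<phi>"
    and r: "nuclear_rep M N f g" "nuclear_rep M N f' g'"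
    and ker: "AE p in M \<Otimes>\<^sub>M N. rep_kernel f g p + \<phi> p * rep_kernel f' g' p = 0"
  shows "pairing N S f g + pairing N T f' g' = 0"
proof -
  let ?X = "weak_star_topology M N"
  let ?P = "M \<Otimes>\<^sub>M N"
  define A where "A = rep_operator N f g"
  define B where "B = rep_operator N f' g'"
  note A = rep_operator_represents[OF r(1), folded A_def]
  note B = rep_operator_represents[OF r(2), folded B_def]
  have AB: "A \<in> nuclear_ops N M" "B \<in> nuclear_ops N M"
    using A B by (auto simp: nuclear_ops_represents)
  define \<Phi> where "\<Phi> q = op_trace N (fst q \<circ> A) + op_trace N (snd q \<circ> B)" for q
  have "continuous_map (prod_topology ?X ?X) euclidean ((\<lambda>T. op_trace N (T \<circ> A)) \<circ> fst)"
    "continuous_map (prod_topology ?X ?X) euclidean ((\<lambda>T. op_trace N (T \<circ> B)) \<circ> snd)"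
    by (rule continuous_map_compose[OF continuous_map_fst continuous_map_trace[OF AB(1)]],
        rule continuous_map_compose[OF continuous_map_snd continuous_map_trace[OF AB(2)]])
  then have "continuous_map (prod_topology ?X ?X) euclidean \<Phi>"
    unfolding \<Phi>_def comp_def by (rule continuous_map_add)
  then have cl: "closedin (prod_topology ?X ?X) {q \<in> topspace (prod_topology ?X ?X). \<Phi> q \<in> {0}}"
    by (rule closedin_continuous_map_preimage) simp
  have \<Phi>: "\<Phi> (S, T) = pairing N S f g + pairing N T f' g'"
    if "S \<in> bounded_ops M N" "T \<in> bounded_ops M N" for S T
    using op_trace_eq_pairing[OF that(1) A] op_trace_eq_pairing[OF that(2) B] by (simp add: \<Phi>_def)
  have "multiplier_graph M N \<phi> \<subseteq> {q \<in> topspace (prod_topology ?X ?X). \<Phi> q \<in> {0}}"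
  proof
    fix q assume "q \<in> multiplier_graph M N \<phi>"
    then obtain k where k: "k \<in> L2 ?P" "(\<lambda>p. \<phi> p * k p) \<in> L2 ?P"
      and q: "q = (integral_op M k, integral_op M (\<lambda>p. \<phi> p * k p))"
      by (auto simp: multiplier_graph_def multiplier_domain_def)
    note b = integral_op_bounded[OF M N k(1)] integral_op_bounded[OF M N k(2)]
    note kL = rep_kernel_L2[OF N r(1)] rep_kernel_L2[OF N r(2)]
    have "\<Phi> q = (\<integral>p. k p * rep_kernel f g p \<partial>?P) + (\<integral>p. \<phi> p * k p * rep_kernel f' g' p \<partial>?P)"
      using \<Phi>[OF b] pairing_integral_op[OF M N k(1) r(1)] pairing_integral_op[OF M N k(2) r(2)]
      by (simp add: q)
    also have "\<dots> = (\<integral>p. k p * rep_kernel f g p + \<phi> p * k p * rep_kernel f' g' p \<partial>?P)"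
      using integrable_mult_L2[OF k(1) kL(1)] integrable_mult_L2[OF k(2) kL(2)] by simp
    also have "\<dots> = 0"
    proof (rule integral_eq_zero_AE)
      show "AE p in ?P. k p * rep_kernel f g p + \<phi> p * k p * rep_kernel f' g' p = 0"
        using ker
      proof eventually_elim
        case (elim p)
        have "k p * rep_kernel f g p + \<phi> p * k p * rep_kernel f' g' p =
            k p * (rep_kernel f g p + \<phi> p * rep_kernel f' g' p)" by (simp add: algebra_simps)
        then show ?case using elim by simp
      qed
    qed
    finally show "q \<in> {q \<in> topspace (prod_topology ?X ?X). \<Phi> q \<in> {0}}"
      using b by (simp add: q topspace_weak_star)
  qed
  from closure_of_minimal[OF this cl] have "(S, T) \<in> {q \<in> topspace (prod_topology ?X ?X). \<Phi> q \<in> {0}}"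
    using ST by blast
  then show ?thesis using \<Phi>[of S T] by (simp add: topspace_weak_star)
qed

text \<open>A weak* neighbourhood of \<open>(S, T)\<close> constrains only finitely many traces. If no element of the
  graph has the same values there, a linear combination of these traces vanishes on the graph but
  not at \<open>(S, T)\<close>. A combination of traces is the pairing with a nuclear operator.\<close>

lemma graph_closure_bipolar:
  assumes M: "sigma_finite_measure M" and N: "sigma_finite_measure N"
    and \<phi>: "\<phi> \<in> borel_measurable (M \<Otimes>\<^sub>M N)"
    and S: "S \<in> bounded_ops M N" and T: "T \<in> bounded_ops M N"
    and ann: "\<And>f g f' g'. nuclear_rep M N f g \<Longrightarrow> nuclear_rep M N f' g' \<Longrightarrow>
      AE p in M \<Otimes>\<^sub>M N. rep_kernel f g p + \<phi> p * rep_kernel f' g' p = 0 \<Longrightarrow>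
      pairing N S f g + pairing N T f' g' = 0"
  shows "(S, T) \<in> graph_closure M N \<phi>"
  unfolding in_closure_of
proof (intro conjI allI impI)
  let ?X = "weak_star_topology M N"
  let ?P = "M \<Otimes>\<^sub>M N"
  let ?D = "multiplier_domain M N \<phi>"
  show "(S, T) \<in> topspace (prod_topology ?X ?X)" using S T by (simp add: topspace_weak_star)
  fix O' assume O': "(S, T) \<in> O' \<and> openin (prod_topology ?X ?X) O'"
  then obtain U V where U: "openin ?X U" "S \<in> U" and V: "openin ?X V" "T \<in> V" and UV: "U \<times> V \<subseteq> O'"
    unfolding openin_prod_topology_alt by blast
  obtain F1 where F1: "finite F1" "F1 \<subseteq> nuclear_ops N M"
    and F1U: "\<And>T'. T' \<in> bounded_ops M N \<Longrightarrow> (\<forall>A\<in>F1. op_trace N (T' \<circ> A) = op_trace N (S \<circ> A)) \<Longrightarrow> T' \<in> U"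
    using weak_star_neighbourhood[OF U] by blast
  obtain F2 where F2: "finite F2" "F2 \<subseteq> nuclear_ops N M"
    and F2V: "\<And>T'. T' \<in> bounded_ops M N \<Longrightarrow> (\<forall>A\<in>F2. op_trace N (T' \<circ> A) = op_trace N (T \<circ> A)) \<Longrightarrow> T' \<in> V"
    using weak_star_neighbourhood[OF V] by blast
  have "\<forall>A. \<exists>fg. A \<in> nuclear_ops N M \<longrightarrow> represents M N A (fst fg) (snd fg)"
    by (auto simp: nuclear_ops_represents)
  then obtain fg where fg: "\<And>A. A \<in> nuclear_ops N M \<Longrightarrow> represents M N A (fst (fg A)) (snd (fg A))"
    by metis
  define rf where "rf A = fst (fg A)" for A
  define rg where "rg A = snd (fg A)" for A
  have rep: "represents M N A (rf A) (rg A)" "nuclear_rep M N (rf A) (rg A)"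
    "A \<in> bounded_ops N M" if "A \<in> nuclear_ops N M" for A
    using fg[OF that] that by (auto simp: rf_def rg_def represents_def nuclear_ops_represents)
  have tr: "op_trace N (R \<circ> A) = pairing N R (rf A) (rg A)"
    if "R \<in> bounded_ops M N" "A \<in> nuclear_ops N M" for R A
    by (rule op_trace_eq_pairing[OF that(1) rep(3,1)[OF that(2)]])
  define w where "w k = (\<lambda>(b, A). if A \<in> nuclear_ops N M
    then \<integral>p. (if b then k p else \<phi> p * k p) * rep_kernel (rf A) (rg A) p \<partial>?P else 0)" for k
  define v where "v = (\<lambda>(b, A). pairing N (if b then S else T) (rf A) (rg A))"
  define J where "J = Pair True ` F1 \<union> Pair False ` F2"
  have J: "finite J" using F1 F2 by (simp add: J_def)
  have sumJ: "(\<Sum>j\<in>J. G j) = (\<Sum>A\<in>F1. G (True, A)) + (\<Sum>A\<in>F2. G (False, A))" for G :: "bool \<times> _ \<Rightarrow> complex"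
    unfolding J_def using F1 F2
    by (subst sum.union_disjoint) (auto simp: sum.reindex inj_on_def)
  have intg: "integrable ?P (\<lambda>p. k p * rep_kernel (rf A) (rg A) p)"
      "integrable ?P (\<lambda>p. \<phi> p * k p * rep_kernel (rf A) (rg A) p)"
    if "k \<in> ?D" "A \<in> nuclear_ops N M" for k A
    using that by (auto simp: multiplier_domain_def intro!: integrable_mult_L2 rep_kernel_L2[OF N rep(2)])
  have "\<exists>k\<in>?D. \<forall>j\<in>J. w k j = v j"
  proof (rule ccontr)
    assume neg: "\<not> (\<exists>k\<in>?D. \<forall>j\<in>J. w k j = v j)"
    have "\<exists>c. (\<forall>u\<in>w ` ?D. (\<Sum>j\<in>J. c j * u j) = 0) \<and> (\<Sum>j\<in>J. c j * v j) = 1"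
    proof (rule finite_dimensional_separation[OF J])
      have "w (\<lambda>_. 0) = (\<lambda>_. 0)" by (auto simp: w_def fun_eq_iff cong: if_cong)
      then show "(\<lambda>_. 0) \<in> w ` ?D" using multiplier_domain_zero[of M N \<phi>] by (metis image_eqI)
    next
      fix u u' assume "u \<in> w ` ?D" "u' \<in> w ` ?D"
      then obtain k k' where k: "k \<in> ?D" "k' \<in> ?D" "u = w k" "u' = w k'" by blast
      have "w k (b, A) + w k' (b, A) = w (\<lambda>p. k p + k' p) (b, A)" for b A
        using intg[OF k(1), of A] intg[OF k(2), of A]
        by (cases b) (auto simp: w_def distrib_left distrib_right)
      then have "(\<lambda>i. w k i + w k' i) = w (\<lambda>p. k p + k' p)" by (auto simp: fun_eq_iff)
      then show "(\<lambda>i. u i + u' i) \<in> w ` ?D" using k multiplier_domain_add[OF k(1,2)] by simp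
    next
      fix c u assume "u \<in> w ` ?D"
      then obtain k where k: "k \<in> ?D" "u = w k" by blast
      have "c * w k (b, A) = w (\<lambda>p. c * k p) (b, A)" for b A
      proof -
        have "(\<lambda>p. (if b then c * k p else \<phi> p * (c * k p)) * rep_kernel (rf A) (rg A) p) =
            (\<lambda>p. c * ((if b then k p else \<phi> p * k p) * rep_kernel (rf A) (rg A) p))"
          by (auto simp: mult_ac)
        then show ?thesis by (simp add: w_def)
      qed
      then have "(\<lambda>i. c * w k i) = w (\<lambda>p. c * k p)" by (auto simp: fun_eq_iff)
      then show "(\<lambda>i. c * u i) \<in> w ` ?D" using k multiplier_domain_scale[OF k(1)] by simp
    next
      fix u assume "u \<in> w ` ?D"
      then show "\<exists>j\<in>J. u j \<noteq> v j" using neg by auto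
    qed
    then obtain c where c0: "\<And>k. k \<in> ?D \<Longrightarrow> (\<Sum>j\<in>J. c j * w k j) = 0" and c1: "(\<Sum>j\<in>J. c j * v j) = 1"
      by blast
    have r1: "\<And>A. A \<in> F1 \<Longrightarrow> nuclear_rep M N (rf A) (rg A)" using rep(2) F1 by blast
    have r2: "\<And>A. A \<in> F2 \<Longrightarrow> nuclear_rep M N (rf A) (rg A)" using rep(2) F2 by blast
    obtain f g where fg: "nuclear_rep M N f g"
      and kfg: "AE p in ?P. rep_kernel f g p = (\<Sum>A\<in>F1. c (True, A) * rep_kernel (rf A) (rg A) p)"
      and pfg: "\<And>T. T \<in> bounded_ops M N \<Longrightarrow> pairing N T f g = (\<Sum>A\<in>F1. c (True, A) * pairing N T (rf A) (rg A))"
      using rep_combination[OF N F1(1), where f = rf and g = rg and c = "\<lambda>A. c (True, A)", OF r1] by auto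
    obtain f' g' where fg': "nuclear_rep M N f' g'"
      and kfg': "AE p in ?P. rep_kernel f' g' p = (\<Sum>A\<in>F2. c (False, A) * rep_kernel (rf A) (rg A) p)"
      and pfg': "\<And>T. T \<in> bounded_ops M N \<Longrightarrow> pairing N T f' g' = (\<Sum>A\<in>F2. c (False, A) * pairing N T (rf A) (rg A))"
      using rep_combination[OF N F2(1), where f = rf and g = rg and c = "\<lambda>A. c (False, A)", OF r2] by auto
    have "AE p in ?P. rep_kernel f g p + \<phi> p * rep_kernel f' g' p = 0"
    proof (rule multiplier_domain_separates[OF \<phi> rep_kernel_L2[OF N fg] rep_kernel_L2[OF N fg']])
      fix k assume k: "k \<in> ?D"
      then have kL: "k \<in> L2 ?P" "(\<lambda>p. \<phi> p * k p) \<in> L2 ?P" by (auto simp: multiplier_domain_def)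
      have "(\<integral>p. k p * rep_kernel f g p \<partial>?P) = pairing N (integral_op M k) f g"
        by (rule pairing_integral_op[OF M N kL(1) fg, symmetric])
      also have "\<dots> = (\<Sum>A\<in>F1. c (True, A) * w k (True, A))"
        unfolding pfg[OF integral_op_bounded[OF M N kL(1)]]
        using F1(2) by (intro sum.cong refl) (auto simp: w_def pairing_integral_op[OF M N kL(1) r1])
      finally have e1: "(\<integral>p. k p * rep_kernel f g p \<partial>?P) = (\<Sum>A\<in>F1. c (True, A) * w k (True, A))" .
      have "(\<integral>p. \<phi> p * k p * rep_kernel f' g' p \<partial>?P) = pairing N (integral_op M (\<lambda>p. \<phi> p * k p)) f' g'"
        by (rule pairing_integral_op[OF M N kL(2) fg', symmetric])
      also have "\<dots> = (\<Sum>A\<in>F2. c (False, A) * w k (False, A))"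
        unfolding pfg'[OF integral_op_bounded[OF M N kL(2)]]
        using F2(2) by (intro sum.cong refl) (auto simp: w_def pairing_integral_op[OF M N kL(2) r2])
      finally show "(\<integral>p. k p * rep_kernel f g p \<partial>?P) + (\<integral>p. \<phi> p * k p * rep_kernel f' g' p \<partial>?P) = 0"
        using c0[OF k] e1 by (simp add: sumJ)
    qed
    then have "pairing N S f g + pairing N T f' g' = 0" by (rule ann[OF fg fg'])
    moreover have "pairing N S f g + pairing N T f' g' = 1"
      using c1 by (simp add: pfg[OF S] pfg'[OF T] sumJ v_def)
    ultimately show False by simp
  qed
  then obtain k where k: "k \<in> ?D" and eq: "\<And>j. j \<in> J \<Longrightarrow> w k j = v j" by blast
  have kL: "k \<in> L2 ?P" "(\<lambda>p. \<phi> p * k p) \<in> L2 ?P" using k by (auto simp: multiplier_domain_def)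
  note b = integral_op_bounded[OF M N kL(1)] integral_op_bounded[OF M N kL(2)]
  have "integral_op M k \<in> U"
  proof (rule F1U[OF b(1)], rule ballI)
    fix A assume A: "A \<in> F1"
    then have A': "A \<in> nuclear_ops N M" using F1 by blast
    have "(True, A) \<in> J" using A by (simp add: J_def)
    from eq[OF this] show "op_trace N (integral_op M k \<circ> A) = op_trace N (S \<circ> A)"
      using A' by (simp add: tr[OF b(1) A'] tr[OF S A'] pairing_integral_op[OF M N kL(1) rep(2)] w_def v_def)
  qed
  moreover have "integral_op M (\<lambda>p. \<phi> p * k p) \<in> V"
  proof (rule F2V[OF b(2)], rule ballI)
    fix A assume A: "A \<in> F2"
    then have A': "A \<in> nuclear_ops N M" using F2 by blast
    have "(False, A) \<in> J" using A by (simp add: J_def)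
    from eq[OF this] show "op_trace N (integral_op M (\<lambda>p. \<phi> p * k p) \<circ> A) = op_trace N (T \<circ> A)"
      using A' by (simp add: tr[OF b(2) A'] tr[OF T A'] pairing_integral_op[OF M N kL(2) rep(2)] w_def v_def)
  qed
  ultimately have "(integral_op M k, integral_op M (\<lambda>p. \<phi> p * k p)) \<in> O'" using UV by blast
  moreover have "(integral_op M k, integral_op M (\<lambda>p. \<phi> p * k p)) \<in> multiplier_graph M N \<phi>"
    using k by (simp add: multiplier_graph_def)
  ultimately show "\<exists>y. y \<in> multiplier_graph M N \<phi> \<and> y \<in> O'" by blast
qed

text \<open>By the description as a bipolar, the closure is always a linear subspace, and only the operators
  \<open>T\<close> with \<open>(0, T)\<close> in the closure matter. They are those that annihilate every nuclear kernel \<open>h\<close> for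
  which \<open>\<phi> * h\<close> is again a nuclear kernel.\<close>

theorem closable_iff_annihilator_trivial:
  assumes M: "sigma_finite_measure M" and N: "sigma_finite_measure N"
    and \<phi>: "\<phi> \<in> borel_measurable (M \<Otimes>\<^sub>M N)"
  shows "weak_star_closable_multiplier M N \<phi> \<longleftrightarrow>
    (\<forall>T\<in>bounded_ops M N.
       (\<forall>f g f' g'. nuclear_rep M N f g \<longrightarrow> nuclear_rep M N f' g' \<longrightarrow>
          (AE p in M \<Otimes>\<^sub>M N. \<phi> p * rep_kernel f g p = rep_kernel f' g' p) \<longrightarrow> pairing N T f g = 0) \<longrightarrow>
       op_eq M N T (\<lambda>_ _. 0))"
    (is "?L \<longleftrightarrow> ?R")
proof
  assume ?L
  then have G: "is_operator_graph M N (graph_closure M N \<phi>)"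
    unfolding weak_star_closable_multiplier_def .
  show ?R
  proof (intro ballI impI)
    fix T assume T: "T \<in> bounded_ops M N" and
      ann: "\<forall>f g f' g'. nuclear_rep M N f g \<longrightarrow> nuclear_rep M N f' g' \<longrightarrow>
          (AE p in M \<Otimes>\<^sub>M N. \<phi> p * rep_kernel f g p = rep_kernel f' g' p) \<longrightarrow> pairing N T f g = 0"
    have "((\<lambda>_ _. 0), T) \<in> graph_closure M N \<phi>"
    proof (rule graph_closure_bipolar[OF M N \<phi> zero_bounded_op T])
      fix f g f' g' assume r: "nuclear_rep M N f g" "nuclear_rep M N f' g'"
        and k: "AE p in M \<Otimes>\<^sub>M N. rep_kernel f g p + \<phi> p * rep_kernel f' g' p = 0"
      note s = rep_scale[OF N r(1), where c = "-1"]
      have "AE p in M \<Otimes>\<^sub>M N. \<phi> p * rep_kernel f' g' p = rep_kernel (\<lambda>i x. -1 * f i x) g p"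
        using s(2) k
      proof eventually_elim
        case (elim p)
        have "\<phi> p * rep_kernel f' g' p = - rep_kernel f g p"
          using elim(2) by (simp only: add_eq_0_iff)
        then show ?case using elim(1) by simp
      qed
      from ann[rule_format, OF r(2) s(1) this] have "pairing N T f' g' = 0" .
      then show "pairing N (\<lambda>_ _. 0) f g + pairing N T f' g' = 0" by (simp add: pairing_def)
    qed
    moreover have "((\<lambda>_ _. 0), (\<lambda>_ _. 0)) \<in> graph_closure M N \<phi>"
      using G by (simp add: is_operator_graph_def)
    moreover have "op_eq M N (\<lambda>_ _. 0) (\<lambda>_ _. 0)" by (simp add: op_eq_def)
    ultimately show "op_eq M N T (\<lambda>_ _. 0)"
      using G[unfolded is_operator_graph_def, THEN conjunct2, THEN conjunct2, THEN conjunct2, THEN conjunct2]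
      by (elim allE impE) assumption+
  qed
next
  assume R: ?R
  have sub: "graph_closure M N \<phi> \<subseteq> bounded_ops M N \<times> bounded_ops M N"
    using closure_of_subset_topspace[of "prod_topology (weak_star_topology M N) (weak_star_topology M N)"]
    by (simp add: topspace_weak_star)
  have b: "S \<in> bounded_ops M N" "T \<in> bounded_ops M N" if "(S, T) \<in> graph_closure M N \<phi>" for S T
    using sub that by auto
  have zero: "((\<lambda>_ _. 0), (\<lambda>_ _. 0)) \<in> graph_closure M N \<phi>"
    by (rule graph_closure_bipolar[OF M N \<phi> zero_bounded_op zero_bounded_op]) (simp add: pairing_def)
  have add: "((\<lambda>f y. S f y + S' f y), (\<lambda>f y. T f y + T' f y)) \<in> graph_closure M N \<phi>"
    if ST: "(S, T) \<in> graph_closure M N \<phi>" "(S', T') \<in> graph_closure M N \<phi>" for S T S' T'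
  proof (rule graph_closure_bipolar[OF M N \<phi>])
    note B = b[OF ST(1)] b[OF ST(2)]
    show "(\<lambda>f y. S f y + S' f y) \<in> bounded_ops M N" "(\<lambda>f y. T f y + T' f y) \<in> bounded_ops M N"
      by (intro bounded_ops_plus B)+
    fix f g f' g' assume r: "nuclear_rep M N f g" "nuclear_rep M N f' g'"
      and k: "AE p in M \<Otimes>\<^sub>M N. rep_kernel f g p + \<phi> p * rep_kernel f' g' p = 0"
    show "pairing N (\<lambda>f y. S f y + S' f y) f g + pairing N (\<lambda>f y. T f y + T' f y) f' g' = 0"
      using graph_closure_annihilated[OF M N ST(1) r k] graph_closure_annihilated[OF M N ST(2) r k]
      by (simp add: pairing_plus[OF B(1,3) r(1)] pairing_plus[OF B(2,4) r(2)])
        (metis add.assoc add.left_commute add_cancel_left_left)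
  qed
  have scale: "((\<lambda>f y. c * S f y), (\<lambda>f y. c * T f y)) \<in> graph_closure M N \<phi>"
    if ST: "(S, T) \<in> graph_closure M N \<phi>" for S T c
  proof (rule graph_closure_bipolar[OF M N \<phi>])
    note B = b[OF ST]
    show "(\<lambda>f y. c * S f y) \<in> bounded_ops M N" "(\<lambda>f y. c * T f y) \<in> bounded_ops M N"
      by (intro bounded_ops_times B)+
    fix f g f' g' assume r: "nuclear_rep M N f g" "nuclear_rep M N f' g'"
      and k: "AE p in M \<Otimes>\<^sub>M N. rep_kernel f g p + \<phi> p * rep_kernel f' g' p = 0"
    show "pairing N (\<lambda>f y. c * S f y) f g + pairing N (\<lambda>f y. c * T f y) f' g' = 0"
      using graph_closure_annihilated[OF M N ST r k]
      by (simp add: pairing_times[OF B(1) r(1)] pairing_times[OF B(2) r(2)] flip: distrib_left)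
  qed
  have single: "op_eq M N T T'"
    if ST: "(S, T) \<in> graph_closure M N \<phi>" "(S', T') \<in> graph_closure M N \<phi>" and eq: "op_eq M N S S'"
    for S T S' T'
  proof -
    note B = b[OF ST(1)] b[OF ST(2)]
    define R where "R = (\<lambda>f y. T f y + (-1) * T' f y)"
    have RB: "R \<in> bounded_ops M N" unfolding R_def by (intro bounded_ops_plus bounded_ops_times B)
    have "pairing N R f g = 0" if r: "nuclear_rep M N f g" "nuclear_rep M N f' g'"
      and k: "AE p in M \<Otimes>\<^sub>M N. \<phi> p * rep_kernel f g p = rep_kernel f' g' p" for f g f' g'
    proof -
      note s = rep_scale[OF N r(2), where c = "-1"]
      have k': "AE p in M \<Otimes>\<^sub>M N. rep_kernel (\<lambda>i x. -1 * f' i x) g' p + \<phi> p * rep_kernel f g p = 0"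
        using s(2) k by eventually_elim simp
      have "pairing N T f g = pairing N T' f g"
        using graph_closure_annihilated[OF M N ST(1) s(1) r(1) k']
          graph_closure_annihilated[OF M N ST(2) s(1) r(1) k'] pairing_op_eq[OF B(1,3) eq s(1)]
        by (metis add_left_cancel)
      then show ?thesis
        unfolding R_def pairing_plus[OF B(2) bounded_ops_times[OF B(4)] r(1)] pairing_times[OF B(4) r(1)]
        by simp
    qed
    then have "op_eq M N R (\<lambda>_ _. 0)" by (intro R[rule_format, OF RB])
    then show ?thesis unfolding op_eq_def R_def by simp
  qed
  show ?L
    unfolding weak_star_closable_multiplier_def is_operator_graph_def
    by (intro conjI allI impI) (rule sub zero | erule (1) add | erule scale | erule (2) single)+
qed

section \<open>Omega-topology\<close>

subsection \<open>Marginally null sets\<close>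

lemma marginally_null_subset: "marginally_null M N E \<Longrightarrow> F \<subseteq> E \<Longrightarrow> marginally_null M N F"
  unfolding marginally_null_def by (meson subset_trans)

lemma marginally_null_empty [simp]: "marginally_null M N {}"
  unfolding marginally_null_def by (auto intro!: bexI[of _ "{}"])

lemma marginally_null_UN:
  assumes "\<And>n::nat. marginally_null M N (E n)"
  shows "marginally_null M N (\<Union>n. E n)"
proof -
  have "\<forall>n. \<exists>X. X \<in> null_sets M \<and> (\<exists>Y. Y \<in> null_sets N \<and> E n \<subseteq> (X \<times> space N) \<union> (space M \<times> Y))"
    using assms unfolding marginally_null_def Bex_def by (rule allI)
  from choice[OF this] obtain X
    where X: "\<forall>n. X n \<in> null_sets M \<and> (\<exists>Y. Y \<in> null_sets N \<and> E n \<subseteq> (X n \<times> space N) \<union> (space M \<times> Y))"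
    by (elim exE) (rule that)
  then have "\<forall>n. \<exists>Y. Y \<in> null_sets N \<and> E n \<subseteq> (X n \<times> space N) \<union> (space M \<times> Y)" by simp
  from choice[OF this] obtain Y
    where Y: "\<forall>n. Y n \<in> null_sets N \<and> E n \<subseteq> (X n \<times> space N) \<union> (space M \<times> Y n)"
    by (elim exE) (rule that)
  show ?thesis
    unfolding marginally_null_def
  proof (intro bexI)
    show "(\<Union>n. X n) \<in> null_sets M" "(\<Union>n. Y n) \<in> null_sets N"
      using X Y by (auto intro: null_sets_UN)
    show "(\<Union>n. E n) \<subseteq> (\<Union>n. X n) \<times> space N \<union> space M \<times> (\<Union>n. Y n)"
    proof (rule UN_least)
      fix n
      have "E n \<subseteq> (X n \<times> space N) \<union> (space M \<times> Y n)" using Y by simp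
      also have "\<dots> \<subseteq> (\<Union>n. X n) \<times> space N \<union> space M \<times> (\<Union>n. Y n)" by auto
      finally show "E n \<subseteq> (\<Union>n. X n) \<times> space N \<union> space M \<times> (\<Union>n. Y n)" .
    qed
  qed
qed

lemma marginally_null_Un:
  assumes "marginally_null M N E" "marginally_null M N F"
  shows "marginally_null M N (E \<union> F)"
proof -
  have "marginally_null M N (\<Union>n::nat. if n = 0 then E else F)"
    by (rule marginally_null_UN) (use assms in auto)
  moreover have "E \<union> F \<subseteq> (\<Union>n::nat. if n = 0 then E else F)"
    by (auto split: if_splits)
  ultimately show ?thesis by (rule marginally_null_subset)
qed

lemma marginally_nullI_AE:
  assumes "AE x in M. P x" "AE y in N. Q y"
    and "\<And>x y. (x, y) \<in> E \<Longrightarrow> x \<in> space M \<and> y \<in> space N \<and> \<not> (P x \<and> Q y)"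
  shows "marginally_null M N E"
proof -
  obtain X0 where X0: "X0 \<in> null_sets M" "{x \<in> space M. \<not> P x} \<subseteq> X0"
    using assms(1) by (auto simp: eventually_ae_filter)
  obtain Y0 where Y0: "Y0 \<in> null_sets N" "{x \<in> space N. \<not> Q x} \<subseteq> Y0"
    using assms(2) by (auto simp: eventually_ae_filter)
  show ?thesis
    unfolding marginally_null_def using X0 Y0 assms(3)
    by (intro bexI[of _ X0] bexI[of _ Y0] subsetI) auto
qed

lemma marginally_null_imp_AE:
  assumes N: "sigma_finite_measure N" and E: "marginally_null M N E"
  shows "AE p in M \<Otimes>\<^sub>M N. p \<notin> E"
proof -
  interpret N: sigma_finite_measure N by fact
  obtain X0 Y0 where X0: "X0 \<in> null_sets M" and Y0: "Y0 \<in> null_sets N"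
    and sub: "E \<subseteq> (X0 \<times> space N) \<union> (space M \<times> Y0)"
    using E unfolding marginally_null_def by blast
  have "X0 \<times> space N \<in> null_sets (M \<Otimes>\<^sub>M N)" "space M \<times> Y0 \<in> null_sets (M \<Otimes>\<^sub>M N)"
    using X0 Y0 by (auto simp: null_sets_def N.emeasure_pair_measure_Times)
  then have "(X0 \<times> space N) \<union> (space M \<times> Y0) \<in> null_sets (M \<Otimes>\<^sub>M N)" by (rule null_sets.Un)
  from AE_not_in[OF this] show ?thesis by eventually_elim (use sub in blast)
qed

subsection \<open>Omega-open sets\<close>

definition rectangle_union :: "'a measure \<Rightarrow> 'b measure \<Rightarrow> ('a \<times> 'b) set \<Rightarrow> bool" where
  "rectangle_union M N R \<longleftrightarrow> (\<exists>(\<alpha> :: nat \<Rightarrow> 'a set) (\<beta> :: nat \<Rightarrow> 'b set).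
     (\<forall>i. \<alpha> i \<in> sets M \<and> \<beta> i \<in> sets N) \<and> R = (\<Union>i. \<alpha> i \<times> \<beta> i))"

lemma rectangle_unionE:
  assumes "rectangle_union M N R"
  obtains \<alpha> \<beta> where "\<And>i::nat. \<alpha> i \<in> sets M" "\<And>i. \<beta> i \<in> sets N" "R = (\<Union>i. \<alpha> i \<times> \<beta> i)"
  using assms[unfolded rectangle_union_def]
proof (elim exE conjE)
  fix \<alpha> \<beta> assume "\<forall>i::nat. \<alpha> i \<in> sets M \<and> \<beta> i \<in> sets N" "R = (\<Union>i. \<alpha> i \<times> \<beta> i)"
  then show ?thesis using that[of \<alpha> \<beta>] by simp
qed

lemma rectangle_union_rectangle:
  "A \<in> sets M \<Longrightarrow> B \<in> sets N \<Longrightarrow> rectangle_union M N (A \<times> B)"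
  unfolding rectangle_union_def by (intro exI[of _ "\<lambda>_. A"] exI[of _ "\<lambda>_. B"]) auto

lemma rectangle_union_UN:
  assumes "\<And>n::nat. rectangle_union M N (R n)"
  shows "rectangle_union M N (\<Union>n. R n)"
proof -
  have ex: "\<forall>n. \<exists>ab. \<forall>i::nat. fst ab i \<in> sets M \<and> snd ab i \<in> sets N \<and> R n = (\<Union>i. fst ab i \<times> snd ab i)"
    (is "\<forall>n. ?P n")
  proof (rule allI)
    fix n show "?P n"
    proof (rule rectangle_unionE[OF assms[of n]])
    fix \<alpha> \<beta> assume "\<And>i::nat. \<alpha> i \<in> sets M" "\<And>i. \<beta> i \<in> sets N" "R n = (\<Union>i. \<alpha> i \<times> \<beta> i)"
    then show "?P n" by (intro exI[of _ "(\<alpha>, \<beta>)"]) simp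
    qed
  qed
  obtain ab where ab':
    "\<forall>n. \<forall>i::nat. fst (ab n) i \<in> sets M \<and> snd (ab n) i \<in> sets N \<and> R n = (\<Union>i. fst (ab n) i \<times> snd (ab n) i)"
    using choice[OF ex] by (elim exE) (rule that)
  define \<alpha> where "\<alpha> n = fst (ab n)" for n
  define \<beta> where "\<beta> n = snd (ab n)" for n
  have ab: "\<And>n i. \<alpha> n i \<in> sets M" "\<And>n i. \<beta> n i \<in> sets N" "\<And>n. R n = (\<Union>i::nat. \<alpha> n i \<times> \<beta> n i)"
    using ab' unfolding \<alpha>_def \<beta>_def by auto
  show ?thesis
    unfolding rectangle_union_def
  proof (intro exI conjI allI)
    show "case_prod \<alpha> (prod_decode i) \<in> sets M" "case_prod \<beta> (prod_decode i) \<in> sets N" for i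
      using ab by (auto split: prod.split)
    have "(\<Union>i. case_prod \<alpha> (prod_decode i) \<times> case_prod \<beta> (prod_decode i)) =
        (\<Union>q\<in>range prod_decode. case_prod \<alpha> q \<times> case_prod \<beta> q)" by auto
    also have "\<dots> = (\<Union>n. \<Union>i. \<alpha> n i \<times> \<beta> n i)" by (auto simp: surj_prod_decode)
    finally show "(\<Union>n. R n) = (\<Union>i. case_prod \<alpha> (prod_decode i) \<times> case_prod \<beta> (prod_decode i))"
      using ab(3) by simp
  qed
qed

lemma rectangle_union_Int:
  assumes "rectangle_union M N R" "rectangle_union M N S"
  shows "rectangle_union M N (R \<inter> S)"
proof -
  obtain \<alpha> \<beta> where ab: "\<And>i. \<alpha> i \<in> sets M" "\<And>i. \<beta> i \<in> sets N" "R = (\<Union>i::nat. \<alpha> i \<times> \<beta> i)"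
    by (rule rectangle_unionE[OF assms(1)], rule that; simp)
  obtain \<gamma> \<delta> where cd: "\<And>i. \<gamma> i \<in> sets M" "\<And>i. \<delta> i \<in> sets N" "S = (\<Union>i::nat. \<gamma> i \<times> \<delta> i)"
    by (rule rectangle_unionE[OF assms(2)], rule that; simp)
  have "R \<inter> S = (\<Union>i. \<Union>j. (\<alpha> i \<inter> \<gamma> j) \<times> (\<beta> i \<inter> \<delta> j))"
    unfolding ab cd by blast
  also have "rectangle_union M N \<dots>"
    by (intro rectangle_union_UN rectangle_union_rectangle sets.Int ab cd)
  finally show ?thesis .
qed

lemma rectangle_union_subset: "rectangle_union M N R \<Longrightarrow> R \<subseteq> space M \<times> space N"
  by (erule rectangle_unionE) (simp only:, intro UN_least Sigma_mono sets.sets_into_space)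

lemma omega_open_alt:
  "omega_open M N E \<longleftrightarrow> E \<subseteq> space M \<times> space N \<and>
     (\<exists>R. rectangle_union M N R \<and> marginally_null M N ((E - R) \<union> (R - E)))"
  unfolding omega_open_def rectangle_union_def by blast

lemma omega_open_nearI:
  assumes "E \<subseteq> space M \<times> space N" "rectangle_union M N R" "marginally_null M N ((E - R) \<union> (R - E))"
  shows "omega_open M N E"
  unfolding omega_open_alt using assms by (intro conjI exI)

lemma omega_openE:
  assumes "omega_open M N E"
  obtains R where "E \<subseteq> space M \<times> space N" "rectangle_union M N R"
    "marginally_null M N ((E - R) \<union> (R - E))"
  using assms unfolding omega_open_alt by (elim conjE exE) (rule that)

lemma omega_openI:
  "rectangle_union M N R \<Longrightarrow> omega_open M N R"
  by (rule omega_open_nearI) (auto dest: rectangle_union_subset)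

lemma omega_open_UN:
  assumes "\<And>n::nat. omega_open M N (E n)"
  shows "omega_open M N (\<Union>n. E n)"
proof -
  have "\<forall>n. \<exists>R. rectangle_union M N R \<and> marginally_null M N ((E n - R) \<union> (R - E n))"
    using assms unfolding omega_open_alt by (intro allI) (rule conjunct2)
  from choice[OF this] obtain R where R: "\<And>n. rectangle_union M N (R n)"
      "\<And>n. marginally_null M N ((E n - R n) \<union> (R n - E n))" by auto
  have "marginally_null M N (((\<Union>n. E n) - (\<Union>n. R n)) \<union> ((\<Union>n. R n) - (\<Union>n. E n)))"
    by (rule marginally_null_subset[OF
          marginally_null_UN[where E = "\<lambda>n. (E n - R n) \<union> (R n - E n)", OF R(2)]]) blast
  moreover have "(\<Union>n. E n) \<subseteq> space M \<times> space N"
    using assms unfolding omega_open_alt by (intro UN_least) (rule conjunct1)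
  ultimately show ?thesis by (intro omega_open_nearI[OF _ rectangle_union_UN[where R = R, OF R(1)]])
qed

lemma omega_open_Int:
  assumes "omega_open M N E" "omega_open M N F"
  shows "omega_open M N (E \<inter> F)"
proof -
  obtain R where R: "rectangle_union M N R" "marginally_null M N ((E - R) \<union> (R - E))"
    by (rule omega_openE[OF assms(1)])
  obtain S where S: "rectangle_union M N S" "marginally_null M N ((F - S) \<union> (S - F))"
    by (rule omega_openE[OF assms(2)])
  have "marginally_null M N ((E \<inter> F - R \<inter> S) \<union> (R \<inter> S - E \<inter> F))"
    by (rule marginally_null_subset[OF marginally_null_Un[OF R(2) S(2)]]) blast
  moreover have "E \<inter> F \<subseteq> space M \<times> space N" by (rule omega_openE[OF assms(1)]) blast
  ultimately show ?thesis by (intro omega_open_nearI[OF _ rectangle_union_Int[OF R(1) S(1)]])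
qed

text \<open>A rectangle that is null for the product measure has a null side, so that a null
  omega-open set is marginally null.\<close>

lemma omega_open_null:
  assumes N: "sigma_finite_measure N" and E: "omega_open M N E" and ae: "AE p in M \<Otimes>\<^sub>M N. p \<notin> E"
  shows "marginally_null M N E"
proof -
  interpret N: sigma_finite_measure N by fact
  obtain R where R: "rectangle_union M N R" and n: "marginally_null M N ((E - R) \<union> (R - E))"
    by (rule omega_openE[OF E])
  obtain \<alpha> \<beta> where ab: "\<And>i. \<alpha> i \<in> sets M" "\<And>i. \<beta> i \<in> sets N" "R = (\<Union>i::nat. \<alpha> i \<times> \<beta> i)"
    by (rule rectangle_unionE[OF R], rule that; simp)
  have aeR: "AE p in M \<Otimes>\<^sub>M N. p \<notin> R"
    using ae marginally_null_imp_AE[OF N n] by eventually_elim blast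
  have "marginally_null M N (\<alpha> i \<times> \<beta> i)" for i
  proof -
    have m: "\<alpha> i \<times> \<beta> i \<in> sets (M \<Otimes>\<^sub>M N)" using ab by simp
    have "AE p in M \<Otimes>\<^sub>M N. p \<notin> \<alpha> i \<times> \<beta> i" using aeR by eventually_elim (use ab(3) in blast)
    then have "emeasure (M \<Otimes>\<^sub>M N) (\<alpha> i \<times> \<beta> i) = 0"
      using AE_iff_null_sets[OF m] by (auto simp: null_sets_def)
    then have "emeasure M (\<alpha> i) * emeasure N (\<beta> i) = 0"
      using ab by (simp add: N.emeasure_pair_measure_Times)
    then consider "\<alpha> i \<in> null_sets M" | "\<beta> i \<in> null_sets N"
      using ab by (auto simp: null_sets_def)
    then show ?thesis
    proof cases
      case 1
      then show ?thesis unfolding marginally_null_def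
        using sets.sets_into_space[OF ab(2)] by (intro bexI[of _ "\<alpha> i"] bexI[of _ "{}"]) auto
    next
      case 2
      then show ?thesis unfolding marginally_null_def
        using sets.sets_into_space[OF ab(1)] by (intro bexI[of _ "{}"] bexI[of _ "\<beta> i"]) auto
    qed
  qed
  then have "marginally_null M N R" unfolding ab(3) by (rule marginally_null_UN)
  from marginally_null_Un[OF this n] show ?thesis by (rule marginally_null_subset) blast
qed

subsection \<open>Omega-continuous functions\<close>

lemma open_prod_countable_boxes:
  fixes U :: "('a::second_countable_topology \<times> 'b::second_countable_topology) set"
  assumes "open U"
  obtains A B where "\<And>n::nat. open (A n)" "\<And>n::nat. open (B n)" "U = (\<Union>n. A n \<times> B n)"
proof -
  obtain \<A> :: "'a set set" where A: "countable \<A>" "topological_basis \<A>"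
    using ex_countable_basis by blast
  obtain \<B> :: "'b set set" where B: "countable \<B>" "topological_basis \<B>"
    using ex_countable_basis by blast
  define Q where "Q = {(a, b) \<in> \<A> \<times> \<B>. a \<times> b \<subseteq> U}"
  have Qc: "countable Q"
    by (rule countable_subset[of _ "\<A> \<times> \<B>"]) (auto simp: Q_def intro: A B)
  have "\<exists>q\<in>Q. p \<in> fst q \<times> snd q" if p: "p \<in> U" for p
  proof -
    obtain S T where ST: "open S" "open T" "p \<in> S \<times> T" "S \<times> T \<subseteq> U"
      by (rule open_prod_elim[OF assms p])
    have pS: "fst p \<in> S" "snd p \<in> T" using ST(3) by auto
    obtain a where a: "a \<in> \<A>" "fst p \<in> a" "a \<subseteq> S"
      by (rule topological_basisE[OF A(2) ST(1) pS(1)])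
    obtain b where b: "b \<in> \<B>" "snd p \<in> b" "b \<subseteq> T"
      by (rule topological_basisE[OF B(2) ST(2) pS(2)])
    have "(a, b) \<in> Q" using a b ST(4) by (auto simp: Q_def)
    then show ?thesis using a b by (intro bexI[of _ "(a, b)"]) (auto simp: mem_Times_iff)
  qed
  then have U: "U = (\<Union>q\<in>Q. fst q \<times> snd q)" by (auto simp: Q_def)
  define q where "q n = (if Q = {} then ({}, {}) else from_nat_into Q n)" for n
  show ?thesis
  proof (rule that[of "\<lambda>n. fst (q n)" "\<lambda>n. snd (q n)"])
    have "open (fst (q n)) \<and> open (snd (q n))" for n
    proof (cases "Q = {}")
      case False
      then have "q n \<in> Q" by (simp add: q_def from_nat_into)
      then show ?thesis
        using topological_basis_open[OF A(2)] topological_basis_open[OF B(2)] by (auto simp: Q_def)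
    qed (simp add: q_def)
    then show "open (fst (q n))" "open (snd (q n))" for n by auto
    show "U = (\<Union>n. fst (q n) \<times> snd (q n))"
    proof (cases "Q = {}")
      case False
      then have "range q = Q" using range_from_nat_into[OF False Qc] by (simp add: q_def[abs_def])
      then show ?thesis unfolding U by auto
    qed (simp add: U q_def)
  qed
qed

lemma omega_continuous_measurable: "omega_continuous M N f \<Longrightarrow> f \<in> borel_measurable (M \<Otimes>\<^sub>M N)"
  by (simp add: omega_continuous_def)

lemma omega_continuous_open:
  "omega_continuous M N f \<Longrightarrow> open U \<Longrightarrow> omega_open M N (f -` U \<inter> space (M \<Otimes>\<^sub>M N))"
  by (simp add: omega_continuous_def)

text \<open>An open subset of the plane is a countable union of open boxes, and the preimage of a box is the
  intersection of two omega-open sets.\<close>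

lemma omega_open_pair_vimage:
  assumes f: "omega_continuous M N f" and g: "omega_continuous M N g" and U: "open U"
  shows "omega_open M N ((\<lambda>p. (f p, g p)) -` U \<inter> space (M \<Otimes>\<^sub>M N))"
proof -
  obtain A B where AB: "\<And>n::nat. open (A n)" "\<And>n::nat. open (B n)" "U = (\<Union>n. A n \<times> B n)"
    by (rule open_prod_countable_boxes[OF U], rule that; simp)
  have "(\<lambda>p. (f p, g p)) -` U \<inter> space (M \<Otimes>\<^sub>M N) =
      (\<Union>n. (f -` A n \<inter> space (M \<Otimes>\<^sub>M N)) \<inter> (g -` B n \<inter> space (M \<Otimes>\<^sub>M N)))"
    unfolding AB(3) by auto
  also have "omega_open M N \<dots>"
    by (rule omega_open_UN, rule omega_open_Int)
      (rule omega_continuous_open[OF f AB(1)], rule omega_continuous_open[OF g AB(2)])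
  finally show ?thesis .
qed

lemma omega_continuous_compose2:
  assumes f: "omega_continuous M N f" and g: "omega_continuous M N g"
    and F: "continuous_on UNIV (\<lambda>(z, w). F z w)"
  shows "omega_continuous M N (\<lambda>p. F (f p) (g p))"
proof -
  note [measurable] = omega_continuous_measurable[OF f] omega_continuous_measurable[OF g]
  have "(\<lambda>p. (\<lambda>(z, w). F z w) (f p, g p)) \<in> borel_measurable (M \<Otimes>\<^sub>M N)"
    by (rule borel_measurable_continuous_on[OF F]) measurable
  then have "(\<lambda>p. F (f p) (g p)) \<in> borel_measurable (M \<Otimes>\<^sub>M N)" by simp
  moreover have "omega_open M N ((\<lambda>p. F (f p) (g p)) -` U \<inter> space (M \<Otimes>\<^sub>M N))" if "open U" for U
  proof -
    have "open ((\<lambda>(z, w). F z w) -` U)" using F that by (simp add: continuous_on_open_vimage)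
    from omega_open_pair_vimage[OF f g this] show ?thesis
      by (rule back_subst[where P = "omega_open M N"]) auto
  qed
  ultimately show ?thesis by (simp add: omega_continuous_def)
qed

lemma omega_continuous_fst:
  assumes [measurable]: "a \<in> borel_measurable M"
  shows "omega_continuous M N (\<lambda>p. a (fst p))"
  unfolding omega_continuous_def
proof (intro conjI allI impI)
  show "(\<lambda>p. a (fst p)) \<in> borel_measurable (M \<Otimes>\<^sub>M N)" by measurable
  fix U :: "complex set" assume [measurable]: "open U"
  have "(\<lambda>p. a (fst p)) -` U \<inter> space (M \<Otimes>\<^sub>M N) = (a -` U \<inter> space M) \<times> space N"
    by (auto simp: space_pair_measure)
  moreover have "a -` U \<inter> space M \<in> sets M" by measurable
  ultimately show "omega_open M N ((\<lambda>p. a (fst p)) -` U \<inter> space (M \<Otimes>\<^sub>M N))"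
    by (simp add: omega_openI rectangle_union_rectangle)
qed

lemma omega_continuous_snd:
  assumes [measurable]: "b \<in> borel_measurable N"
  shows "omega_continuous M N (\<lambda>p. b (snd p))"
  unfolding omega_continuous_def
proof (intro conjI allI impI)
  show "(\<lambda>p. b (snd p)) \<in> borel_measurable (M \<Otimes>\<^sub>M N)" by measurable
  fix U :: "complex set" assume [measurable]: "open U"
  have "(\<lambda>p. b (snd p)) -` U \<inter> space (M \<Otimes>\<^sub>M N) = space M \<times> (b -` U \<inter> space N)"
    by (auto simp: space_pair_measure)
  moreover have "b -` U \<inter> space N \<in> sets N" by measurable
  ultimately show "omega_open M N ((\<lambda>p. b (snd p)) -` U \<inter> space (M \<Otimes>\<^sub>M N))"
    by (simp add: omega_openI rectangle_union_rectangle)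
qed

lemma omega_continuous_add:
  "omega_continuous M N f \<Longrightarrow> omega_continuous M N g \<Longrightarrow> omega_continuous M N (\<lambda>p. f p + g p)"
  by (rule omega_continuous_compose2[where F = "(+)"]) (auto intro!: continuous_intros simp: case_prod_unfold)

lemma omega_continuous_mult:
  "omega_continuous M N f \<Longrightarrow> omega_continuous M N g \<Longrightarrow> omega_continuous M N (\<lambda>p. f p * g p)"
  by (rule omega_continuous_compose2[where F = "(*)"]) (auto intro!: continuous_intros simp: case_prod_unfold)

lemma omega_continuous_const: "omega_continuous M N (\<lambda>p. c)"
  by (rule omega_continuous_fst[where a = "\<lambda>_. c"]) auto

lemma omega_continuous_sum:
  "finite I \<Longrightarrow> (\<And>i. i \<in> I \<Longrightarrow> omega_continuous M N (f i)) \<Longrightarrow> omega_continuous M N (\<lambda>p. \<Sum>i\<in>I. f i p)"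
  by (induction I rule: finite_induct) (auto intro: omega_continuous_const omega_continuous_add)

text \<open>The convergence need not be uniform. A point \<open>p\<close> satisfies \<open>f p \<in> U\<close> if and only if for some \<open>n\<close>
  the distance of \<open>u n p\<close> to the complement of \<open>U\<close> exceeds \<open>cmod (e n p)\<close>, and this is an open condition
  on the pair \<open>(u n p, e n p)\<close>.\<close>

lemma omega_continuous_limit:
  assumes f: "f \<in> borel_measurable (M \<Otimes>\<^sub>M N)"
    and u: "\<And>n. omega_continuous M N (u n)" and e: "\<And>n. omega_continuous M N (e n)"
    and le: "\<And>n p. cmod (f p - u n p) \<le> cmod (e n p)"
    and lim: "\<And>p. (\<lambda>n. e n p) \<longlonglongrightarrow> 0"
  shows "omega_continuous M N f"
  unfolding omega_continuous_def
proof (intro conjI f allI impI)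
  fix U :: "complex set" assume U: "open U"
  let ?S = "space (M \<Otimes>\<^sub>M N)"
  show "omega_open M N (f -` U \<inter> ?S)"
  proof (cases "- U = {}")
    case True
    then have "f -` U \<inter> ?S = space M \<times> space N" by (auto simp: space_pair_measure)
    then show ?thesis by (simp add: omega_openI rectangle_union_rectangle)
  next
    case ne: False
    define W where "W = {q :: complex \<times> complex. cmod (snd q) < infdist (fst q) (- U)}"
    have "open W" unfolding W_def
      by (intro open_Collect_less continuous_intros)
    have "f p \<in> U \<longleftrightarrow> (\<exists>n. (u n p, e n p) \<in> W)" for p
    proof
      assume "f p \<in> U"
      then have "infdist (f p) (- U) > 0"
        using in_closed_iff_infdist_zero[of "- U" "f p"] U ne infdist_nonneg[of "f p" "- U"]
        by (auto simp: closed_def less_le)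
      moreover have "(\<lambda>n. 2 * cmod (e n p)) \<longlonglongrightarrow> 2 * cmod 0"
        by (intro tendsto_intros lim)
      ultimately have "\<forall>\<^sub>F n in sequentially. 2 * cmod (e n p) < infdist (f p) (- U)"
        by (intro order_tendstoD) auto
      then obtain n where n: "2 * cmod (e n p) < infdist (f p) (- U)"
        by (auto simp: eventually_sequentially)
      have "infdist (f p) (- U) \<le> infdist (u n p) (- U) + dist (f p) (u n p)"
        by (rule infdist_triangle)
      then have "cmod (e n p) < infdist (u n p) (- U)"
        using n le[of p n] by (simp add: dist_norm)
      then show "\<exists>n. (u n p, e n p) \<in> W" by (auto simp: W_def)
    next
      assume "\<exists>n. (u n p, e n p) \<in> W"
      then obtain n where n: "cmod (e n p) < infdist (u n p) (- U)" by (auto simp: W_def)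
      show "f p \<in> U"
      proof (rule ccontr)
        assume "f p \<notin> U"
        then have "infdist (u n p) (- U) \<le> dist (u n p) (f p)" by (intro infdist_le) simp
        then show False using n le[of p n] by (simp add: dist_norm norm_minus_commute)
      qed
    qed
    then have "f -` U \<inter> ?S = (\<Union>n. (\<lambda>p. (u n p, e n p)) -` W \<inter> ?S)" by auto
    also have "omega_open M N \<dots>"
      by (intro omega_open_UN omega_open_pair_vimage u e \<open>open W\<close>)
    finally show ?thesis .
  qed
qed

text \<open>This is the uniqueness of the omega-continuous representative of an element of
  \<open>V_functions M N\<close>.\<close>

lemma omega_continuous_eq_marginally:
  assumes N: "sigma_finite_measure N" and f: "omega_continuous M N f" and g: "omega_continuous M N g"
    and ae: "AE p in M \<Otimes>\<^sub>M N. f p = g p"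
  shows "marginally_null M N {p \<in> space (M \<Otimes>\<^sub>M N). f p \<noteq> g p}"
proof (rule omega_open_null[OF N])
  have "open {q :: complex \<times> complex. fst q \<noteq> snd q}"
    by (intro open_Collect_neq continuous_intros)
  from omega_open_pair_vimage[OF f g this]
  show "omega_open M N {p \<in> space (M \<Otimes>\<^sub>M N). f p \<noteq> g p}"
    by (rule back_subst[where P = "omega_open M N"]) auto
  show "AE p in M \<Otimes>\<^sub>M N. p \<notin> {p \<in> space (M \<Otimes>\<^sub>M N). f p \<noteq> g p}"
    using ae by eventually_elim simp
qed

section \<open>Inner products of square-summable families\<close>

definition l2_norm :: "(nat \<Rightarrow> complex) \<Rightarrow> real" where
  "l2_norm u = sqrt (\<Sum>i. (cmod (u i))\<^sup>2)"

abbreviation l2 :: "(nat \<Rightarrow> complex) \<Rightarrow> bool" where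
  "l2 u \<equiv> summable (\<lambda>i. (cmod (u i))\<^sup>2)"

lemma l2_norm_nonneg: "l2 u \<Longrightarrow> l2_norm u \<ge> 0"
  unfolding l2_norm_def by (simp add: suminf_nonneg)

lemma l2_norm_square: "l2 u \<Longrightarrow> (l2_norm u)\<^sup>2 = (\<Sum>i. (cmod (u i))\<^sup>2)"
  unfolding l2_norm_def by (simp add: suminf_nonneg)

lemma l2_partial:
  assumes "l2 u" "finite I"
  shows "(\<Sum>i\<in>I. (cmod (u i))\<^sup>2) \<le> (l2_norm u)\<^sup>2"
  unfolding l2_norm_square[OF assms(1)] by (rule sum_le_suminf[OF assms]) auto

lemma l2_normI:
  assumes "\<And>n. (\<Sum>i<n. (cmod (u i))\<^sup>2) \<le> C\<^sup>2" "C \<ge> 0"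
  shows "l2 u" and "l2_norm u \<le> C"
proof -
  show s: "l2 u" by (rule summableI_nonneg_bounded[where x = "C\<^sup>2"]) (use assms in auto)
  have "(l2_norm u)\<^sup>2 \<le> C\<^sup>2"
    unfolding l2_norm_square[OF s] by (rule suminf_le_const[OF s]) (rule assms)
  then show "l2_norm u \<le> C" using assms(2) by (rule power2_le_imp_le)
qed

lemma l2_product:
  assumes u: "l2 u" and v: "l2 v"
  shows "summable (\<lambda>i. cmod (u i * v i))" and "(\<Sum>i. cmod (u i * v i)) \<le> l2_norm u * l2_norm v"
    and "cmod (\<Sum>i. u i * v i) \<le> l2_norm u * l2_norm v"
proof -
  have fin: "(\<Sum>i<n. cmod (u i * v i)) \<le> l2_norm u * l2_norm v" for n
    unfolding norm_mult
    by (rule sum_product_le_of_squares) (auto intro: l2_partial u v l2_norm_nonneg)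
  show s: "summable (\<lambda>i. cmod (u i * v i))"
    by (rule summableI_nonneg_bounded[OF _ fin]) auto
  show le: "(\<Sum>i. cmod (u i * v i)) \<le> l2_norm u * l2_norm v"
    by (rule suminf_le_const[OF s fin])
  show "cmod (\<Sum>i. u i * v i) \<le> l2_norm u * l2_norm v"
    using summable_norm[OF s] le by linarith
qed

lemma l2_shift: "l2 u \<Longrightarrow> l2 (\<lambda>i. u (i + n))"
  using summable_iff_shift[of "\<lambda>i. (cmod (u i))\<^sup>2" n] by simp

lemma l2_norm_tail_tendsto: "l2 u \<Longrightarrow> (\<lambda>n. l2_norm (\<lambda>i. u (i + n))) \<longlonglongrightarrow> 0"
  unfolding l2_norm_def using tendsto_real_sqrt[OF suminf_tail_tendsto_0[of "\<lambda>i. (cmod (u i))\<^sup>2"]] by simp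

definition l2_family :: "'a measure \<Rightarrow> (nat \<Rightarrow> 'a \<Rightarrow> complex) \<Rightarrow> bool" where
  "l2_family M a \<longleftrightarrow> (\<forall>i. a i \<in> borel_measurable M) \<and> (\<forall>x. l2 (\<lambda>i. a i x))"

definition family_product :: "(nat \<Rightarrow> 'a \<Rightarrow> complex) \<Rightarrow> (nat \<Rightarrow> 'b \<Rightarrow> complex) \<Rightarrow> 'a \<times> 'b \<Rightarrow> complex" where
  "family_product a b p = (\<Sum>i. a i (fst p) * b i (snd p))"

lemma l2_familyD: "l2_family M a \<Longrightarrow> a i \<in> borel_measurable M" "l2_family M a \<Longrightarrow> l2 (\<lambda>i. a i x)"
  by (auto simp: l2_family_def)

lemma family_product_sums:
  assumes "l2_family M a" "l2_family N b"
  shows "(\<lambda>i. a i (fst p) * b i (snd p)) sums family_product a b p"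
  unfolding family_product_def
  by (rule summable_sums, rule summable_norm_cancel, rule l2_product(1))
    (rule l2_familyD(2)[OF assms(1)], rule l2_familyD(2)[OF assms(2)])

lemma l2_norm_measurable [measurable (raw)]:
  assumes [measurable]: "\<And>i. a i \<in> borel_measurable M"
  shows "(\<lambda>x. l2_norm (\<lambda>i. a i x)) \<in> borel_measurable M"
  unfolding l2_norm_def by measurable

lemma family_product_measurable:
  assumes a: "l2_family M a" and b: "l2_family N b"
  shows "family_product a b \<in> borel_measurable (M \<Otimes>\<^sub>M N)"
proof -
  note [measurable] = l2_familyD(1)[OF a] l2_familyD(1)[OF b]
  show ?thesis unfolding family_product_def[abs_def] by measurable
qed

text \<open>The error of a partial sum is at most the product of the norms of the two tails, which is a
  function of \<open>x\<close> times a function of \<open>y\<close> and therefore omega-continuous.\<close>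

lemma family_product_omega_continuous:
  assumes a: "l2_family M a" and b: "l2_family N b"
  shows "omega_continuous M N (family_product a b)"
proof -
  note [measurable] = l2_familyD(1)[OF a] l2_familyD(1)[OF b]
  note l2 = l2_familyD(2)[OF a] l2_familyD(2)[OF b]
  define A where "A n x = complex_of_real (l2_norm (\<lambda>i. a (i + n) x))" for n x
  define B where "B n y = complex_of_real (l2_norm (\<lambda>i. b (i + n) y))" for n y
  have [measurable]: "A n \<in> borel_measurable M" "B n \<in> borel_measurable N" for n
    unfolding A_def B_def by measurable
  show ?thesis
  proof (rule omega_continuous_limit[where u = "\<lambda>n p. \<Sum>i<n. a i (fst p) * b i (snd p)"
        and e = "\<lambda>n p. A n (fst p) * B n (snd p)"])
    show "family_product a b \<in> borel_measurable (M \<Otimes>\<^sub>M N)" by (rule family_product_measurable[OF a b])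
    show "omega_continuous M N (\<lambda>p. \<Sum>i<n. a i (fst p) * b i (snd p))" for n
      by (intro omega_continuous_sum omega_continuous_mult omega_continuous_fst omega_continuous_snd) auto
    show "omega_continuous M N (\<lambda>p. A n (fst p) * B n (snd p))" for n
      by (intro omega_continuous_mult omega_continuous_fst omega_continuous_snd) auto
    fix p
    show "cmod (family_product a b p - (\<Sum>i<n. a i (fst p) * b i (snd p))) \<le> cmod (A n (fst p) * B n (snd p))" for n
    proof -
      have "family_product a b p - (\<Sum>i<n. a i (fst p) * b i (snd p)) =
          (\<Sum>i. a (i + n) (fst p) * b (i + n) (snd p))"
        using suminf_minus_initial_segment[OF sums_summable[OF family_product_sums[OF a b, of p]], of n]
        by (simp add: family_product_def)
      then show ?thesis
        using l2_product(3)[OF l2_shift[OF l2(1)] l2_shift[OF l2(2)], of n "fst p" n "snd p"]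
          l2_norm_nonneg[OF l2_shift[OF l2(1)], of n "fst p"] l2_norm_nonneg[OF l2_shift[OF l2(2)], of n "snd p"]
        by (simp add: A_def B_def norm_mult)
    qed
    have "(\<lambda>n. A n (fst p) * B n (snd p)) \<longlonglongrightarrow> of_real 0 * of_real 0"
      unfolding A_def B_def by (intro tendsto_intros l2_norm_tail_tendsto l2)
    then show "(\<lambda>n. A n (fst p) * B n (snd p)) \<longlonglongrightarrow> 0" by simp
  qed
qed

lemma family_product_V:
  assumes a: "l2_family M a" and b: "l2_family N b"
  shows "family_product a b \<in> V_functions M N"
  unfolding V_functions_def
  by (intro CollectI conjI exI[of _ a] exI[of _ b] allI AE_I2 family_product_measurable[OF a b]
      l2_familyD[OF a] l2_familyD[OF b] family_product_sums[OF a b])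

text \<open>Families that are square-summable only almost everywhere are set to zero on a null set, so that
  no exceptional sets have to be carried along.\<close>

lemma l2_family_modify:
  assumes [measurable]: "\<And>i. a i \<in> borel_measurable M" and ae: "AE x in M. l2 (\<lambda>i. a i x)"
  obtains a' where "l2_family M a'" "AE x in M. \<forall>i. a' i x = a i x"
proof -
  define S where "S = {x \<in> space M. l2 (\<lambda>i. a i x)}"
  have "l2 (\<lambda>i. a i x) \<longleftrightarrow> (\<Sum>i. ennreal ((cmod (a i x))\<^sup>2)) \<noteq> top" for x
  proof
    assume "l2 (\<lambda>i. a i x)"
    then show "(\<Sum>i. ennreal ((cmod (a i x))\<^sup>2)) \<noteq> top"
      by (rule ennreal_suminf_neq_top) simp
  next
    assume "(\<Sum>i. ennreal ((cmod (a i x))\<^sup>2)) \<noteq> top"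
    then show "l2 (\<lambda>i. a i x)"
      by (intro summable_suminf_not_top) simp_all
  qed
  then have "S = {x \<in> space M. (\<Sum>i. ennreal ((cmod (a i x))\<^sup>2)) \<noteq> top}"
    unfolding S_def by simp
  also have "\<dots> \<in> sets M" by measurable
  finally have [measurable]: "S \<in> sets M" .
  define a' where "a' i x = indicator S x * a i x" for i x
  have "l2 (\<lambda>i. a' i x)" for x
    by (cases "x \<in> S") (auto simp: a'_def S_def)
  moreover have "a' i \<in> borel_measurable M" for i unfolding a'_def[abs_def] by measurable
  ultimately have "l2_family M a'" by (simp add: l2_family_def)
  moreover have "AE x in M. \<forall>i. a' i x = a i x"
    using ae AE_space by eventually_elim (simp add: a'_def S_def)
  ultimately show ?thesis by (rule that)
qed

lemma AE_fst:
  assumes "AE x in M. P x" and N: "sigma_finite_measure N"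
  shows "AE p in M \<Otimes>\<^sub>M N. P (fst p)"
proof -
  have "marginally_null M N {p \<in> space M \<times> space N. \<not> P (fst p)}"
    by (rule marginally_nullI_AE[OF assms(1), where Q = "\<lambda>_. True"]) auto
  from marginally_null_imp_AE[OF N this] AE_space show ?thesis
    by eventually_elim (auto simp: space_pair_measure)
qed

lemma AE_snd:
  assumes "AE y in N. P y" and N: "sigma_finite_measure N"
  shows "AE p in M \<Otimes>\<^sub>M N. P (snd p)"
proof -
  have "marginally_null M N {p \<in> space M \<times> space N. \<not> P (snd p)}"
    by (rule marginally_nullI_AE[OF _ assms(1), where P = "\<lambda>_. True"]) auto
  from marginally_null_imp_AE[OF N this] AE_space show ?thesis
    by eventually_elim (auto simp: space_pair_measure)
qed

lemma family_product_modify: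
  assumes N: "sigma_finite_measure N"
    and a: "\<And>i. a i \<in> borel_measurable M" "AE x in M. l2 (\<lambda>i. a i x)"
    and b: "\<And>i. b i \<in> borel_measurable N" "AE y in N. l2 (\<lambda>i. b i y)"
  obtains a' b' where "l2_family M a'" "l2_family N b'"
    "AE p in M \<Otimes>\<^sub>M N. family_product a' b' p = family_product a b p"
    "AE x in M. \<forall>i. a' i x = a i x" "AE y in N. \<forall>i. b' i y = b i y"
proof -
  obtain a' where a': "l2_family M a'" "AE x in M. \<forall>i. a' i x = a i x"
    by (rule l2_family_modify[OF a])
  obtain b' where b': "l2_family N b'" "AE y in N. \<forall>i. b' i y = b i y"
    by (rule l2_family_modify[OF b])
  have "AE p in M \<Otimes>\<^sub>M N. family_product a' b' p = family_product a b p"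
    using AE_fst[OF a'(2) N] AE_snd[OF b'(2) N] by eventually_elim (simp add: family_product_def)
  then show ?thesis using that[of a' b'] a' b' by simp
qed

lemma V_functions_family:
  fixes M :: "'a measure" and N :: "'b measure"
  assumes N: "sigma_finite_measure N" and \<psi>: "\<psi> \<in> V_functions M N"
  obtains a b where "l2_family M a" "l2_family N b" "AE p in M \<Otimes>\<^sub>M N. \<psi> p = family_product a b p"
proof -
  obtain a :: "nat \<Rightarrow> 'a \<Rightarrow> complex" and b :: "nat \<Rightarrow> 'b \<Rightarrow> complex"
    where ab: "\<And>i. a i \<in> borel_measurable M" "\<And>i. b i \<in> borel_measurable N"
      "AE x in M. l2 (\<lambda>i. a i x)" "AE y in N. l2 (\<lambda>i. b i y)"
      "AE p in M \<Otimes>\<^sub>M N. (\<lambda>i. a i (fst p) * b i (snd p)) sums \<psi> p"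
    using \<psi> unfolding V_functions_def by blast
  obtain a' b' where "l2_family M a'" "l2_family N b'"
    and ae: "AE p in M \<Otimes>\<^sub>M N. family_product a' b' p = family_product a b p"
    by (rule family_product_modify[OF N ab(1,3,2,4)])
  moreover have "AE p in M \<Otimes>\<^sub>M N. \<psi> p = family_product a' b' p"
    using ae ab(5) by eventually_elim (simp add: family_product_def sums_iff)
  ultimately show ?thesis by - (rule that)
qed

subsection \<open>Weighted sums of products\<close>

lemma double_series_prod_decode:
  fixes F :: "nat \<Rightarrow> nat \<Rightarrow> 'c::banach"
  assumes s1: "\<And>n. summable (\<lambda>m. norm (F n m))" and s2: "summable (\<lambda>n. \<Sum>m. norm (F n m))"
  shows "summable (\<lambda>i. norm (case_prod F (prod_decode i)))"
    and "(\<lambda>i. case_prod F (prod_decode i)) sums (\<Sum>n. \<Sum>m. F n m)"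
proof -
  have rows: "((\<lambda>m. F n m) has_sum (\<Sum>m. F n m)) UNIV" for n
    by (rule norm_summable_imp_has_sum[OF s1 summable_sums[OF summable_norm_cancel[OF s1]]])
  have nrows: "((\<lambda>m. norm (F n m)) has_sum (\<Sum>m. norm (F n m))) UNIV" for n
    by (rule norm_summable_imp_has_sum) (use s1[of n] in \<open>auto intro: summable_sums\<close>)
  have nn: "0 \<le> (\<Sum>m. norm (F n m))" for n by (rule suminf_nonneg[OF s1]) simp
  have "(\<lambda>n. norm (\<Sum>m. norm (F n m))) summable_on UNIV"
    using norm_summable_imp_summable_on[of "\<lambda>n. \<Sum>m. norm (F n m)"] s2 nn by simp
  then have "(\<lambda>q. norm (case_prod F q)) summable_on (UNIV \<times> UNIV)"
    unfolding Infinite_Sum.abs_summable_on_Sigma_iff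
    using nrows by (auto simp: infsumI[OF nrows] summable_on_def)
  then have ns: "(\<lambda>q. norm (case_prod F q)) summable_on UNIV" by simp
  then have "(\<lambda>i. norm (case_prod F (prod_decode i))) summable_on UNIV"
    using summable_on_reindex_bij_betw[OF bij_prod_decode, of "\<lambda>q. norm (case_prod F q)"] by simp
  then show "summable (\<lambda>i. norm (case_prod F (prod_decode i)))" by (rule summable_on_imp_summable)
  have "norm (\<Sum>m. F n m) \<le> (\<Sum>m. norm (F n m))" for n by (rule summable_norm[OF s1])
  then have sn: "summable (\<lambda>n. norm (\<Sum>m. F n m))"
    by (intro summable_comparison_test'[OF s2, of 0]) simp
  have "((\<lambda>n. \<Sum>m. F n m) has_sum (\<Sum>n. \<Sum>m. F n m)) UNIV"
    by (rule norm_summable_imp_has_sum[OF sn summable_sums[OF summable_norm_cancel[OF sn]]])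
  then have "(case_prod F has_sum (\<Sum>n. \<Sum>m. F n m)) (UNIV \<times> UNIV)"
    by (intro has_sum_SigmaI[where g = "\<lambda>n. \<Sum>m. F n m"])
      (use rows ns in \<open>auto intro: Infinite_Sum.abs_summable_summable\<close>)
  then have "((\<lambda>i. case_prod F (prod_decode i)) has_sum (\<Sum>n. \<Sum>m. F n m)) UNIV"
    using has_sum_reindex_bij_betw[OF bij_prod_decode, of "case_prod F"] by simp
  then show "(\<lambda>i. case_prod F (prod_decode i)) sums (\<Sum>n. \<Sum>m. F n m)" by (rule has_sum_imp_sums)
qed

lemma product_series_prod_decode:
  fixes p q :: "nat \<Rightarrow> 'c::{banach, real_normed_div_algebra}"
  assumes p: "summable (\<lambda>j. norm (p j))" and q: "summable (\<lambda>k. norm (q k))"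
  shows "summable (\<lambda>m. norm (case prod_decode m of (j, k) \<Rightarrow> p j * q k))"
    and "(\<lambda>m. case prod_decode m of (j, k) \<Rightarrow> p j * q k) sums ((\<Sum>j. p j) * (\<Sum>k. q k))"
proof -
  have s1: "summable (\<lambda>k. norm (p j * q k))" for j
    unfolding norm_mult by (rule summable_mult[OF q])
  have "(\<Sum>k. norm (p j * q k)) = norm (p j) * (\<Sum>k. norm (q k))" for j
    unfolding norm_mult by (rule suminf_mult[OF q])
  then have s2: "summable (\<lambda>j. \<Sum>k. norm (p j * q k))" using summable_mult2[OF p] by simp
  have "(\<Sum>k. p j * q k) = p j * (\<Sum>k. q k)" for j
    by (rule suminf_mult[OF summable_norm_cancel[OF q]])
  moreover have "(\<Sum>j. p j * (\<Sum>k. q k)) = (\<Sum>j. p j) * (\<Sum>k. q k)"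
    by (rule suminf_mult2[OF summable_norm_cancel[OF p], symmetric])
  ultimately show "(\<lambda>m. case prod_decode m of (j, k) \<Rightarrow> p j * q k) sums ((\<Sum>j. p j) * (\<Sum>k. q k))"
    using double_series_prod_decode(2)[OF s1 s2] by simp
  show "summable (\<lambda>m. norm (case prod_decode m of (j, k) \<Rightarrow> p j * q k))"
    using double_series_prod_decode(1)[OF s1 s2] by simp
qed

text \<open>The index \<open>i\<close> encodes a triple \<open>(n, j, k)\<close>, and \<open>x\<close> and \<open>y\<close> contribute a factor \<open>(1/2) ^ n\<close> each to the
  product \<open>\<Sum>n. (1/4) ^ n * (\<Sum>j. u n j * u' n j) * (\<Sum>k. v n k * v' n k)\<close> of two such families.\<close>

definition weighted :: "(nat \<Rightarrow> nat \<Rightarrow> 'a \<Rightarrow> complex) \<Rightarrow> (nat \<Rightarrow> nat \<Rightarrow> 'a \<Rightarrow> complex) \<Rightarrow> nat \<Rightarrow> 'a \<Rightarrow> complex" where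
  "weighted u v i x = (case prod_decode i of (n, m) \<Rightarrow>
     (1/2) ^ n * (case prod_decode m of (j, k) \<Rightarrow> u n j x * v n k x))"

lemma weighted_series:
  fixes p q :: "nat \<Rightarrow> nat \<Rightarrow> complex"
  assumes p: "\<And>n. summable (\<lambda>j. cmod (p n j))" "\<And>n. (\<Sum>j. cmod (p n j)) \<le> 1"
    and q: "\<And>n. summable (\<lambda>j. cmod (q n j))" "\<And>n. (\<Sum>j. cmod (q n j)) \<le> 1"
  defines "F \<equiv> \<lambda>n m. (1/4) ^ n * (case prod_decode m of (j, k) \<Rightarrow> p n j * q n k)"
  shows "summable (\<lambda>i. cmod (case_prod F (prod_decode i)))"
    and "(\<lambda>i. case_prod F (prod_decode i)) sums (\<Sum>n. (1/4) ^ n * ((\<Sum>j. p n j) * (\<Sum>k. q n k)))"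
    and "summable (\<lambda>n. (1/4) ^ n * ((\<Sum>j. p n j) * (\<Sum>k. q n k)))"
proof -
  have normF: "cmod (F n m) = (1/4) ^ n * cmod (case prod_decode m of (j, k) \<Rightarrow> p n j * q n k)" for n m
    by (simp add: F_def norm_mult norm_power)
  have s1: "summable (\<lambda>m. cmod (F n m))" for n
    unfolding normF by (rule summable_mult[OF product_series_prod_decode(1)[OF p(1) q(1)]])
  have np: "(\<lambda>m. cmod (case prod_decode m of (j, k) \<Rightarrow> p n j * q n k)) sums
      ((\<Sum>j. cmod (p n j)) * (\<Sum>k. cmod (q n k)))" for n
    using product_series_prod_decode(2)[of "\<lambda>j. cmod (p n j)" "\<lambda>k. cmod (q n k)"] p(1)[of n] q(1)[of n]
    by (simp add: prod.case_distrib[of cmod] norm_mult)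
  have sF: "(\<Sum>m. cmod (F n m)) \<le> (1/4) ^ n" for n
  proof -
    have "(\<Sum>m. cmod (F n m)) = (1/4) ^ n * ((\<Sum>j. cmod (p n j)) * (\<Sum>k. cmod (q n k)))"
      unfolding normF using sums_mult[OF np, of "(1/4) ^ n" n] by (simp add: sums_iff)
    also have "\<dots> \<le> (1/4) ^ n * (1 * 1)"
      by (intro mult_left_mono mult_mono p(2) q(2) suminf_nonneg q(1)) auto
    finally show ?thesis by simp
  qed
  have s2: "summable (\<lambda>n. \<Sum>m. cmod (F n m))"
    by (rule summable_comparison_test'[where g = "\<lambda>n. (1/4) ^ n" and N = 0])
      (use sF suminf_nonneg[OF s1] in \<open>auto intro: summable_geometric\<close>)
  show "summable (\<lambda>i. cmod (case_prod F (prod_decode i)))"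
    by (rule double_series_prod_decode(1)[OF s1 s2])
  have inner: "(\<Sum>m. F n m) = (1/4) ^ n * ((\<Sum>j. p n j) * (\<Sum>k. q n k))" for n
    unfolding F_def
    using sums_mult[OF product_series_prod_decode(2)[OF p(1) q(1)], of "(1/4) ^ n" n n] by (simp add: sums_iff)
  then show "(\<lambda>i. case_prod F (prod_decode i)) sums (\<Sum>n. (1/4) ^ n * ((\<Sum>j. p n j) * (\<Sum>k. q n k)))"
    using double_series_prod_decode(2)[OF s1 s2] by simp
  have "cmod (\<Sum>m. F n m) \<le> (\<Sum>m. cmod (F n m))" for n by (rule summable_norm[OF s1])
  then have "summable (\<lambda>n. \<Sum>m. F n m)"
    by (intro summable_comparison_test'[OF s2, of 0]) simp
  then show "summable (\<lambda>n. (1/4) ^ n * ((\<Sum>j. p n j) * (\<Sum>k. q n k)))" unfolding inner .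
qed

lemma weighted_family:
  assumes u: "\<And>n. l2_family M (u n)" "\<And>n x. l2_norm (\<lambda>j. u n j x) \<le> 1"
    and v: "\<And>n. l2_family M (v n)" "\<And>n x. l2_norm (\<lambda>j. v n j x) \<le> 1"
  shows "l2_family M (weighted u v)"
proof -
  have le: "(\<Sum>j. (cmod (w n j x))\<^sup>2) \<le> 1" if "\<And>n. l2_family M (w n)" "\<And>n x. l2_norm (\<lambda>j. w n j x) \<le> 1"
    for w :: "nat \<Rightarrow> nat \<Rightarrow> 'a \<Rightarrow> complex" and n x
  proof -
    note l = l2_familyD(2)[OF that(1)]
    have "(l2_norm (\<lambda>j. w n j x))\<^sup>2 \<le> 1\<^sup>2" by (intro power_mono that(2) l2_norm_nonneg l)
    then show ?thesis by (simp add: l2_norm_square[OF l])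
  qed
  have "l2 (\<lambda>i. weighted u v i x)" for x
  proof -
    let ?p = "\<lambda>n j. complex_of_real ((cmod (u n j x))\<^sup>2)" and ?q = "\<lambda>n k. complex_of_real ((cmod (v n k x))\<^sup>2)"
    have np: "cmod (?p n j) = (cmod (u n j x))\<^sup>2" "cmod (?q n j) = (cmod (v n j x))\<^sup>2" for n j
      by (simp_all add: norm_power)
    have "summable (\<lambda>i. cmod (case_prod (\<lambda>n m. (1/4) ^ n *
        (case prod_decode m of (j, k) \<Rightarrow> ?p n j * ?q n k)) (prod_decode i)))"
      by (rule weighted_series(1); unfold np; intro le u v l2_familyD(2)[OF u(1)] l2_familyD(2)[OF v(1)])
    moreover have "cmod (case_prod (\<lambda>n m. (1/4) ^ n *
        (case prod_decode m of (j, k) \<Rightarrow> ?p n j * ?q n k)) (prod_decode i)) = (cmod (weighted u v i x))\<^sup>2" for i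
      by (cases "prod_decode i", cases "prod_decode (snd (prod_decode i))")
        (simp add: weighted_def norm_mult norm_power power_mult_distrib norm_divide power_divide
          power2_eq_square flip: power_mult_distrib)
    ultimately show ?thesis by simp
  qed
  moreover have "weighted u v i \<in> borel_measurable M" for i
  proof -
    obtain n m where nm: "prod_decode i = (n, m)" by (cases "prod_decode i")
    obtain j k where jk: "prod_decode m = (j, k)" by (cases "prod_decode m")
    have [measurable]: "u n j \<in> borel_measurable M" "v n k \<in> borel_measurable M"
      using l2_familyD(1)[OF u(1)] l2_familyD(1)[OF v(1)] by auto
    have "weighted u v i = (\<lambda>x. (1/2) ^ n * (u n j x * v n k x))"
      by (simp add: weighted_def nm jk fun_eq_iff)
    then show ?thesis by simp
  qed
  ultimately show ?thesis by (simp add: l2_family_def)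
qed

lemma weighted_product:
  assumes u: "\<And>n. l2_family M (u n)" "\<And>n x. l2_norm (\<lambda>j. u n j x) \<le> 1"
    and v: "\<And>n. l2_family M (v n)" "\<And>n x. l2_norm (\<lambda>j. v n j x) \<le> 1"
    and u': "\<And>n. l2_family N (u' n)" "\<And>n x. l2_norm (\<lambda>j. u' n j x) \<le> 1"
    and v': "\<And>n. l2_family N (v' n)" "\<And>n x. l2_norm (\<lambda>j. v' n j x) \<le> 1"
  shows "(\<lambda>n. (1/4) ^ n * (family_product (u n) (u' n) p * family_product (v n) (v' n) p)) sums
    family_product (weighted u v) (weighted u' v') p"
proof -
  obtain x y where p: "p = (x, y)" by (cases p)
  have b: "summable (\<lambda>j. cmod (w n j x * w' n j y))" "(\<Sum>j. cmod (w n j x * w' n j y)) \<le> 1"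
    if w: "\<And>n. l2_family M (w n)" "\<And>n x. l2_norm (\<lambda>j. w n j x) \<le> 1"
      "\<And>n. l2_family N (w' n)" "\<And>n x. l2_norm (\<lambda>j. w' n j x) \<le> 1"
    for w :: "nat \<Rightarrow> nat \<Rightarrow> 'a \<Rightarrow> complex" and w' :: "nat \<Rightarrow> nat \<Rightarrow> 'b \<Rightarrow> complex" and n
  proof -
    note l = l2_familyD(2)[OF w(1)] l2_familyD(2)[OF w(3)]
    show "summable (\<lambda>j. cmod (w n j x * w' n j y))" by (rule l2_product(1)[OF l])
    have "(\<Sum>j. cmod (w n j x * w' n j y)) \<le> l2_norm (\<lambda>j. w n j x) * l2_norm (\<lambda>j. w' n j y)"
      by (rule l2_product(2)[OF l])
    also have "\<dots> \<le> 1 * 1" by (intro mult_mono w l2_norm_nonneg l) simp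
    finally show "(\<Sum>j. cmod (w n j x * w' n j y)) \<le> 1" by simp
  qed
  note ser = weighted_series[of "\<lambda>n j. u n j x * u' n j y" "\<lambda>n j. v n j x * v' n j y",
      OF b[where w = u and w' = u', OF u u'] b[where w = v and w' = v', OF v v']]
  have "case_prod (\<lambda>n m. (1/4) ^ n * (case prod_decode m of (j, k) \<Rightarrow>
      (u n j x * u' n j y) * (v n k x * v' n k y))) (prod_decode i) =
      weighted u v i x * weighted u' v' i y" for i
  proof -
    obtain n m where nm: "prod_decode i = (n, m)" by (cases "prod_decode i")
    obtain j k where jk: "prod_decode m = (j, k)" by (cases "prod_decode m")
    have "(1/4 :: complex) ^ n = (1/2) ^ n * (1/2) ^ n" by (simp flip: power_mult_distrib)
    then show ?thesis by (simp add: weighted_def nm jk mult_ac)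
  qed
  with ser(2) have "(\<lambda>i. weighted u v i x * weighted u' v' i y) sums
      (\<Sum>n. (1/4) ^ n * ((\<Sum>j. u n j x * u' n j y) * (\<Sum>k. v n k x * v' n k y)))"
    by simp
  then show ?thesis
    using summable_sums[OF ser(3)] by (simp add: family_product_def p sums_iff)
qed

definition normalized ::
    "('a \<Rightarrow> real) \<Rightarrow> (nat \<Rightarrow> 'a \<Rightarrow> complex) \<Rightarrow> nat \<Rightarrow> 'a \<Rightarrow> complex" where
  "normalized r a j x = a j x / complex_of_real (r x)"

lemma normalized_family:
  assumes a: "l2_family M a" and [measurable]: "r \<in> borel_measurable M"
    and r: "\<And>x. r x > 0" "\<And>x. l2_norm (\<lambda>j. a j x) \<le> r x"
  shows "l2_family M (normalized r a)" and "l2_norm (\<lambda>j. normalized r a j x) \<le> 1"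
    and "l2_family M (\<lambda>j x. cnj (normalized r a j x))" and "l2_norm (\<lambda>j. cnj (normalized r a j x)) \<le> 1"
proof -
  note [measurable] = l2_familyD(1)[OF a]
  note l = l2_familyD(2)[OF a]
  have le: "(\<Sum>j<n. (cmod (normalized r a j x))\<^sup>2) \<le> 1\<^sup>2" for n x
  proof -
    have "(\<Sum>j<n. (cmod (normalized r a j x))\<^sup>2) = (\<Sum>j<n. (cmod (a j x))\<^sup>2) / (r x)\<^sup>2"
      using r(1)[of x] by (simp add: normalized_def norm_divide power_divide sum_divide_distrib)
    also have "\<dots> \<le> (r x)\<^sup>2 / (r x)\<^sup>2"
      using l2_partial[OF l, of "{..<n}" x] power_mono[OF r(2) l2_norm_nonneg[OF l], of x 2]
      by (intro divide_right_mono) auto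
    finally show ?thesis using r(1)[of x] by simp
  qed
  have m: "normalized r a j \<in> borel_measurable M" for j
    unfolding normalized_def[abs_def] by measurable
  show "l2_family M (normalized r a)"
    using m l2_normI(1)[OF le] by (simp add: l2_family_def)
  show "l2_norm (\<lambda>j. normalized r a j x) \<le> 1" by (rule l2_normI(2)[OF le]) simp
  show "l2_family M (\<lambda>j x. cnj (normalized r a j x))"
    using m l2_normI(1)[OF le] by (simp add: l2_family_def)
  show "l2_norm (\<lambda>j. cnj (normalized r a j x)) \<le> 1"
    by (rule l2_normI(2)) (use le in auto)
qed

lemma family_product_normalized:
  assumes "l2_family M a" "l2_family N b"
  shows "family_product (normalized r a) (normalized r' b) p =
    family_product a b p / complex_of_real (r (fst p) * r' (snd p))"
proof -
  let ?c = "1 / complex_of_real (r (fst p) * r' (snd p))"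
  have "(\<lambda>i. normalized r a i (fst p) * normalized r' b i (snd p)) = (\<lambda>i. ?c * (a i (fst p) * b i (snd p)))"
    by (simp add: normalized_def)
  then show ?thesis
    using sums_mult[OF family_product_sums[OF assms, of p], of ?c] by (simp add: family_product_def sums_iff)
qed

lemma family_product_cnj:
  assumes "l2_family M a" "l2_family N b"
  shows "family_product (\<lambda>j x. cnj (a j x)) (\<lambda>j y. cnj (b j y)) p = cnj (family_product a b p)"
proof -
  have "(\<lambda>i. cnj (a i (fst p) * b i (snd p))) sums cnj (family_product a b p)"
    using family_product_sums[OF assms, of p] by (simp only: sums_cnj)
  then show ?thesis by (simp add: family_product_def sums_iff)
qed

text \<open>Let \<open>s n\<close> and \<open>t n\<close> be the products of \<open>a n\<close>, \<open>b n\<close> and of \<open>c n\<close>, \<open>d n\<close>, both divided by the same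
  function of \<open>x\<close> and the same function of \<open>y\<close>; this does not affect the quotient \<open>z\<close> and bounds the norms
  of all families by one. A common denominator is \<open>\<Sum>n. (1/4) ^ n * s n * cnj (s n)\<close>, which vanishes only
  where all \<open>s n\<close> do, with the numerator \<open>\<Sum>n. (1/4) ^ n * t n * cnj (s n)\<close>.\<close>

lemma common_denominator:
  assumes a: "\<And>n::nat. l2_family M (a n)" and b: "\<And>n. l2_family N (b n)"
    and c: "\<And>n. l2_family M (c n)" and d: "\<And>n. l2_family N (d n)"
  obtains A B C D where "l2_family M A" "l2_family N B" "l2_family M C" "l2_family N D"
    "\<And>p n. family_product (a n) (b n) p \<noteq> 0 \<Longrightarrow> family_product A B p \<noteq> 0"
    "\<And>p z. (\<And>n. z * family_product (a n) (b n) p = family_product (c n) (d n) p) \<Longrightarrow>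
       z * family_product A B p = family_product C D p"
proof -
  define r where "r n x = 1 + l2_norm (\<lambda>j. a n j x) + l2_norm (\<lambda>j. c n j x)" for n x
  define r' where "r' n y = 1 + l2_norm (\<lambda>j. b n j y) + l2_norm (\<lambda>j. d n j y)" for n y
  note nn = l2_norm_nonneg[OF l2_familyD(2)[OF a]] l2_norm_nonneg[OF l2_familyD(2)[OF b]]
    l2_norm_nonneg[OF l2_familyD(2)[OF c]] l2_norm_nonneg[OF l2_familyD(2)[OF d]]
  note [measurable] = l2_familyD(1)[OF a] l2_familyD(1)[OF b] l2_familyD(1)[OF c] l2_familyD(1)[OF d]
  have rm: "r n \<in> borel_measurable M" for n unfolding r_def[abs_def] by measurable
  have rm': "r' n \<in> borel_measurable N" for n unfolding r'_def[abs_def] by measurable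
  have rpos: "r n x > 0" "l2_norm (\<lambda>j. a n j x) \<le> r n x" "l2_norm (\<lambda>j. c n j x) \<le> r n x" for n x
    using nn(1)[of n x] nn(3)[of n x] by (auto simp: r_def)
  have rpos': "r' n x > 0" "l2_norm (\<lambda>j. b n j x) \<le> r' n x" "l2_norm (\<lambda>j. d n j x) \<le> r' n x" for n x
    using nn(2)[of n x] nn(4)[of n x] by (auto simp: r'_def)
  note na = normalized_family[OF a rm rpos(1) rpos(2)]
  note nb = normalized_family[OF b rm' rpos'(1) rpos'(2)]
  note nc = normalized_family[OF c rm rpos(1) rpos(3)]
  note nd = normalized_family[OF d rm' rpos'(1) rpos'(3)]
  define a1 where "a1 n = normalized (r n) (a n)" for n
  define b1 where "b1 n = normalized (r' n) (b n)" for n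
  define c1 where "c1 n = normalized (r n) (c n)" for n
  define d1 where "d1 n = normalized (r' n) (d n)" for n
  define a2 where "a2 n j x = cnj (a1 n j x)" for n j x
  define b2 where "b2 n j x = cnj (b1 n j x)" for n j x
  have A1: "l2_family M (a1 n)" "l2_norm (\<lambda>j. a1 n j x) \<le> 1" for n x unfolding a1_def by (rule na)+
  have B1: "l2_family N (b1 n)" "l2_norm (\<lambda>j. b1 n j y) \<le> 1" for n y unfolding b1_def by (rule nb)+
  have C1: "l2_family M (c1 n)" "l2_norm (\<lambda>j. c1 n j x) \<le> 1" for n x unfolding c1_def by (rule nc)+
  have D1: "l2_family N (d1 n)" "l2_norm (\<lambda>j. d1 n j y) \<le> 1" for n y unfolding d1_def by (rule nd)+
  have A2: "l2_family M (a2 n)" "l2_norm (\<lambda>j. a2 n j x) \<le> 1" for n x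
    unfolding a2_def[abs_def] a1_def by (rule na)+
  have B2: "l2_family N (b2 n)" "l2_norm (\<lambda>j. b2 n j y) \<le> 1" for n y
    unfolding b2_def[abs_def] b1_def by (rule nb)+
  define h where "h n p = family_product (a1 n) (b1 n) p" for n p
  have h2: "family_product (a2 n) (b2 n) p = cnj (h n p)" for n p
    unfolding a2_def[abs_def] b2_def[abs_def] h_def by (rule family_product_cnj[OF A1(1) B1(1)])
  have hh: "h n p = family_product (a n) (b n) p / of_real (r n (fst p) * r' n (snd p))" for n p
    unfolding h_def a1_def b1_def by (rule family_product_normalized[OF a b])
  have tt: "family_product (c1 n) (d1 n) p = family_product (c n) (d n) p / of_real (r n (fst p) * r' n (snd p))" for n p
    unfolding c1_def d1_def by (rule family_product_normalized[OF c d])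
  let ?A = "weighted a1 a2" and ?B = "weighted b1 b2" and ?C = "weighted c1 a2" and ?D = "weighted d1 b2"
  have sS: "(\<lambda>n. (1/4) ^ n * (h n p * cnj (h n p))) sums family_product ?A ?B p" for p
    using weighted_product[where u = a1 and v = a2 and u' = b1 and v' = b2 and p = p, OF A1 A2 B1 B2] unfolding h2 h_def .
  have sT: "(\<lambda>n. (1/4) ^ n * (family_product (c1 n) (d1 n) p * cnj (h n p))) sums family_product ?C ?D p" for p
    using weighted_product[where u = c1 and v = a2 and u' = d1 and v' = b2 and p = p, OF C1 A2 D1 B2] unfolding h2 .
  show ?thesis
  proof (rule that)
    show "l2_family M ?A" by (rule weighted_family[OF A1 A2])
    show "l2_family N ?B" by (rule weighted_family[OF B1 B2])
    show "l2_family M ?C" by (rule weighted_family[OF C1 A2])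
    show "l2_family N ?D" by (rule weighted_family[OF D1 B2])
    fix p
    show "family_product ?A ?B p \<noteq> 0" if nz: "family_product (a n) (b n) p \<noteq> 0" for n
    proof
      assume z: "family_product ?A ?B p = 0"
      have "(\<lambda>n. complex_of_real ((1/4) ^ n * (cmod (h n p))\<^sup>2)) sums complex_of_real 0"
        using sS[of p] unfolding z by (simp add: complex_norm_square[symmetric])
      then have s0: "(\<lambda>n. (1/4) ^ n * (cmod (h n p))\<^sup>2) sums 0" by (simp only: sums_of_real_iff)
      have "(1/4) ^ n * (cmod (h n p))\<^sup>2 = 0"
        using suminf_eq_zero_iff[OF sums_summable[OF s0]] s0 by (auto simp: sums_iff)
      then have "h n p = 0" by simp
      then show False using nz rpos(1)[of n "fst p"] rpos'(1)[of n "snd p"] by (simp add: hh)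
    qed
    show "z * family_product ?A ?B p = family_product ?C ?D p"
      if e: "\<And>n. z * family_product (a n) (b n) p = family_product (c n) (d n) p" for z
    proof -
      have "family_product (c1 n) (d1 n) p = z * h n p" for n
        unfolding tt hh e[symmetric] by simp
      then have "(\<lambda>n. z * ((1/4) ^ n * (h n p * cnj (h n p)))) sums family_product ?C ?D p"
        using sT[of p] by (simp add: mult_ac)
      then show ?thesis using sums_mult[OF sS, of z p] sums_unique2 by blast
    qed
  qed
qed

section \<open>Operators vanishing on a countable cover by rectangles\<close>

subsection \<open>Regularity of finite measures on Polish spaces\<close>

text \<open>The sets that can be squeezed between a closed and an open set form a sigma-algebra, which contains
  the open sets because they are increasing unions of closed ones.\<close>

lemma borel_regular:
  assumes T: "topspace T = space M" "metrizable_space T" "sets M = sigma_sets (space M) {U. openin T U}"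
    and R: "finite_measure R" "sets R = sets M" and A: "A \<in> sets M" and e: "0 < (e::real)"
  shows "\<exists>C U. closedin T C \<and> openin T U \<and> C \<subseteq> A \<and> A \<subseteq> U \<and> measure R (U - C) < e"
proof -
  interpret R: finite_measure R by fact
  have op: "U \<in> sets R" if "openin T U" for U
    using that T(3) R(2) by auto
  have cl: "C \<in> sets R" if C: "closedin T C" for C
  proof -
    have "C = space R - (topspace T - C)"
      using closedin_subset[OF C] sets_eq_imp_space_eq[OF R(2)] T(1) by auto
    also have "\<dots> \<in> sets R" using op[of "topspace T - C"] C by (auto simp: closedin_def)
    finally show ?thesis .
  qed
  have "A \<in> sigma_sets (space M) {U. openin T U}" using A T(3) by simp
  then show ?thesis using e
  proof (induction A arbitrary: e)
    case (Basic a)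
    then have a: "openin T a" by simp
    obtain C where C: "\<And>n::nat. closedin T (C n)" "\<And>n. C n \<subseteq> C (Suc n)" "\<Union> (range C) = a"
      using open_imp_fsigma_in[OF T(2) a] unfolding fsigma_in_ascending by blast
    have "(\<lambda>n. measure R (a - C n)) \<longlonglongrightarrow> measure R (\<Inter>n. a - C n)"
    proof (rule R.finite_Lim_measure_decseq)
      show "range (\<lambda>n. a - C n) \<subseteq> sets R" using op[OF a] cl[OF C(1)] by auto
      show "decseq (\<lambda>n. a - C n)" using C(2) by (intro decseq_SucI) auto
    qed
    moreover have "(\<Inter>n. a - C n) = {}" using C(3) by auto
    ultimately have "(\<lambda>n. measure R (a - C n)) \<longlonglongrightarrow> 0" by (simp only: measure_empty)
    then have "\<forall>\<^sub>F n in sequentially. measure R (a - C n) < e"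
      by (rule order_tendstoD) (rule Basic.prems)
    then obtain n where "measure R (a - C n) < e" by (auto simp: eventually_sequentially)
    then show ?case using C a by - (rule exI[of _ "C n"], rule exI[of _ a], auto)
  next
    case Empty
    then show ?case by (intro exI[of _ "{}"]) auto
  next
    case (Compl a)
    obtain C U where CU: "closedin T C" "openin T U" "C \<subseteq> a" "a \<subseteq> U" "measure R (U - C) < e"
      using Compl.IH[OF Compl.prems] by (elim exE conjE)
    have "measure R ((topspace T - C) - (topspace T - U)) \<le> measure R (U - C)"
      by (rule R.finite_measure_mono) (use op[OF CU(2)] cl[OF CU(1)] in auto)
    then show ?case
      using CU T(1) openin_diff[OF openin_topspace CU(1)] closedin_diff[OF closedin_topspace CU(2)] by - (rule exI[of _ "topspace T - U"], rule exI[of _ "topspace T - C"], auto)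
  next
    case (Union a)
    have "\<forall>i. \<exists>CU. closedin T (fst CU) \<and> openin T (snd CU) \<and> fst CU \<subseteq> a i \<and> a i \<subseteq> snd CU \<and>
        measure R (snd CU - fst CU) < e / 4 * (1/2) ^ i"
    proof (rule allI)
      fix i
      have "0 < e / 4 * (1/2) ^ i" using Union.prems by simp
      from Union.IH[OF this, of i] obtain C U where "closedin T C \<and> openin T U \<and> C \<subseteq> a i \<and> a i \<subseteq> U \<and>
          measure R (U - C) < e / 4 * (1/2) ^ i"
        by (elim exE) (rule that)
      then show "\<exists>CU. closedin T (fst CU) \<and> openin T (snd CU) \<and> fst CU \<subseteq> a i \<and>
          a i \<subseteq> snd CU \<and> measure R (snd CU - fst CU) < e / 4 * (1/2) ^ i"
        by (intro exI[of _ "(C, U)"]) simp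
    qed
    from choice[OF this] obtain CU where CU: "\<forall>i. closedin T (fst (CU i)) \<and> openin T (snd (CU i)) \<and>
        fst (CU i) \<subseteq> a i \<and> a i \<subseteq> snd (CU i) \<and> measure R (snd (CU i) - fst (CU i)) < e / 4 * (1/2) ^ i"
      by (elim exE) (rule that)
    define C where "C i = fst (CU i)" for i
    define U where "U i = snd (CU i)" for i
    have C: "closedin T (C i)" "C i \<subseteq> a i" and U: "openin T (U i)" "a i \<subseteq> U i"
      and le: "measure R (U i - C i) < e / 4 * (1/2) ^ i" for i
      using CU by (auto simp: C_def U_def)
    note [measurable] = op[OF U(1)] cl[OF C(1)]
    have g: "(\<lambda>i. e / 4 * (1/2) ^ i) sums (e / 4 * 2)"
      using sums_mult[OF geometric_sums[of "1/2 :: real"], of "e / 4"] by simp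
    have s: "summable (\<lambda>i. measure R (U i - C i))"
      by (rule summable_comparison_test'[OF sums_summable[OF g], of 0]) (use le in \<open>simp add: less_imp_le\<close>)
    have "measure R ((\<Union>i. U i) - (\<Union>i. C i)) \<le> measure R (\<Union>i. U i - C i)"
      by (rule R.finite_measure_mono) (auto intro!: sets.countable_UN)
    also have "\<dots> \<le> (\<Sum>i. measure R (U i - C i))"
      by (rule R.finite_measure_subadditive_countably[OF _ s]) auto
    also have "\<dots> \<le> (\<Sum>i. e / 4 * (1/2) ^ i)"
      by (rule suminf_le[OF _ s sums_summable[OF g]]) (use le in \<open>simp add: less_imp_le\<close>)
    also have "\<dots> < e" using g Union.prems by (simp add: sums_iff)
    finally have lt: "measure R ((\<Union>i. U i) - (\<Union>i. C i)) < e" .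
    have "(\<lambda>n. measure R ((\<Union>i. U i) - (\<Union>i<n. C i))) \<longlonglongrightarrow> measure R (\<Inter>n. (\<Union>i. U i) - (\<Union>i<n. C i))"
    proof (rule R.finite_Lim_measure_decseq)
      show "range (\<lambda>n. (\<Union>i. U i) - (\<Union>i<n. C i)) \<subseteq> sets R" by auto
      show "decseq (\<lambda>n. (\<Union>i. U i) - (\<Union>i<n. C i))" by (rule decseq_SucI) auto
    qed
    moreover have "(\<Inter>n. (\<Union>i. U i) - (\<Union>i<n. C i)) = (\<Union>i. U i) - (\<Union>i. C i)" by auto
    ultimately have "\<forall>\<^sub>F n in sequentially. measure R ((\<Union>i. U i) - (\<Union>i<n. C i)) < e"
      using lt by (intro order_tendstoD) auto
    then obtain n where n: "measure R ((\<Union>i. U i) - (\<Union>i<n. C i)) < e" by (auto simp: eventually_sequentially)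
    have "closedin T (\<Union>i<n. C i)" using C(1) by (intro closedin_Union) auto
    moreover have "openin T (\<Union>i. U i)" using U(1) by (intro openin_Union) auto
    ultimately show ?case
      using n C(2) U(2) by - (rule exI[of _ "\<Union>i<n. C i"], rule exI[of _ "\<Union>i. U i"], intro conjI; fast)
  qed
qed

text \<open>For each radius \<open>r n\<close> finitely many balls around points of a dense sequence cover all but a small part
  of the space. The intersection of these finite unions of balls is closed and totally bounded.\<close>

lemma borel_tight:
  assumes T: "topspace T = space M" "completely_metrizable_space T" "separable_space T"
      "sets M = sigma_sets (space M) {U. openin T U}"
    and R: "finite_measure R" "sets R = sets M" and e: "0 < (e::real)"
  shows "\<exists>K. compactin T K \<and> closedin T K \<and> measure R (space M - K) < e"
proof -
  interpret R: finite_measure R by fact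
  obtain m d where md: "Metric_space m d" "Metric_space.mcomplete m d" "T = Metric_space.mtopology m d"
    using T(2) unfolding completely_metrizable_space_def by (elim exE conjE)
  interpret Metric_space m d by (rule md(1))
  have m: "m = space M" using T(1) md(3) by simp
  have spR: "space R = m" using sets_eq_imp_space_eq[OF R(2)] m by simp
  have cl: "C \<in> sets R" if C: "closedin mtopology C" for C
  proof -
    have "C = space R - (m - C)" using closedin_subset[OF C] spR by auto
    also have "\<dots> \<in> sets R"
      using C T(4) R(2) by (intro sets.compl_sets) (auto simp: closedin_def md(3))
    finally show ?thesis .
  qed
  obtain D where D: "countable D" "D \<subseteq> m" "mtopology closure_of D = m"
    using T(3) unfolding separable_space_def md(3) by (auto simp del: closure_of_eq_topspace)
  show ?thesis
  proof (cases "D = {}")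
    case True
    then have "m = {}" using D(3) by simp
    then show ?thesis using e by (intro exI[of _ "{}"]) (simp add: m[symmetric])
  next
    case False
    define c where "c = from_nat_into D"
    have c: "range c = D" unfolding c_def by (rule range_from_nat_into[OF False D(1)])
    define r where "r n = 1 / (real n + 1)" for n :: nat
    have r: "r n > 0" for n by (simp add: r_def)
    define B where "B n k = (\<Union>i<k. mcball (c i) (r n))" for n k
    have Bcl: "closedin mtopology (B n k)" for n k
      unfolding B_def by (intro closedin_Union) auto
    have "\<exists>k. measure R (m - B n k) < e / 4 * (1/2) ^ n" for n
    proof -
      have "(\<lambda>k. measure R (m - B n k)) \<longlonglongrightarrow> measure R (\<Inter>k. m - B n k)"
      proof (rule R.finite_Lim_measure_decseq)
        show "range (\<lambda>k. m - B n k) \<subseteq> sets R" using cl[OF Bcl] by (auto simp flip: spR)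
        show "decseq (\<lambda>k. m - B n k)" by (rule decseq_SucI) (auto simp: B_def)
      qed
      moreover have "(\<Inter>k. m - B n k) = {}"
      proof -
        have "\<exists>k. x \<in> B n k" if x: "x \<in> m" for x
        proof -
          have "x \<in> mtopology closure_of D" using D(3) x by simp
          then obtain y where y: "y \<in> D" "y \<in> mball x (r n)"
            unfolding metric_closure_of using r[of n] by auto
          then obtain i where "y = c i" using c by auto
          then have "x \<in> mcball (c i) (r n)" using y x by (auto simp: commute)
          then show ?thesis unfolding B_def by (intro exI[of _ "Suc i"]) auto
        qed
        then show ?thesis by auto
      qed
      ultimately have "(\<lambda>k. measure R (m - B n k)) \<longlonglongrightarrow> 0" by (simp only: measure_empty)
      then have "\<forall>\<^sub>F k in sequentially. measure R (m - B n k) < e / 4 * (1/2) ^ n"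
        by (rule order_tendstoD) (use e in simp)
      then show ?thesis by (auto simp: eventually_sequentially)
    qed
    then obtain k where k: "\<And>n. measure R (m - B n (k n)) < e / 4 * (1/2) ^ n" by metis
    define K where "K = (\<Inter>n. B n (k n))"
    have Kcl: "closedin mtopology K" unfolding K_def using Bcl by (intro closedin_Inter) auto
    have Km: "K \<subseteq> m" using closedin_subset[OF Kcl] by simp
    have "mtotally_bounded K"
      unfolding mtotally_bounded_def
    proof (intro allI impI)
      fix \<epsilon> :: real assume "\<epsilon> > 0"
      then obtain n where n: "2 * r n < \<epsilon>"
        using reals_Archimedean[of "\<epsilon> / 2"] by (auto simp: r_def inverse_eq_divide field_simps)
      define S where "S = {i. i < k n \<and> mcball (c i) (r n) \<inter> K \<noteq> {}}"
      define w where "w i = (SOME x. x \<in> mcball (c i) (r n) \<inter> K)" for i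
      have w: "w i \<in> mcball (c i) (r n) \<inter> K" if "i \<in> S" for i
        unfolding w_def by (rule someI_ex) (use that in \<open>auto simp: S_def\<close>)
      have cov: "x \<in> (\<Union>y\<in>w ` S. mball y \<epsilon>)" if x: "x \<in> K" for x
      proof -
        obtain i where i: "i < k n" "x \<in> mcball (c i) (r n)" using x unfolding K_def B_def by blast
        then have iS: "i \<in> S" using x by (auto simp: S_def)
        have "d (w i) x \<le> d (w i) (c i) + d (c i) x" using w[OF iS] i by (intro triangle) auto
        also have "\<dots> \<le> r n + r n" using w[OF iS] i by (intro add_mono) (auto simp: commute)
        finally have "x \<in> mball (w i) \<epsilon>" using w[OF iS] i n by auto
        then show ?thesis using iS by blast
      qed
      have "finite (w ` S)" by (simp add: S_def)
      moreover have "w ` S \<subseteq> K" using w by auto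
      moreover have "K \<subseteq> (\<Union>x\<in>w ` S. mball x \<epsilon>)" by (rule subsetI) (rule cov)
      ultimately show "\<exists>F. finite F \<and> F \<subseteq> K \<and> K \<subseteq> (\<Union>x\<in>F. mball x \<epsilon>)"
        by (intro exI conjI)
    qed
    then have "compactin mtopology (mtopology closure_of K)"
      using mtotally_bounded_eq_compact_closure_of[OF md(2)] by blast
    then have Kc: "compactin mtopology K" using Kcl by (simp add: closure_of_closedin)
    have g: "(\<lambda>i. e / 4 * (1/2) ^ i) sums (e / 4 * 2)"
      using sums_mult[OF geometric_sums[of "1/2 :: real"], of "e / 4"] by simp
    have s: "summable (\<lambda>n. measure R (m - B n (k n)))"
      by (rule summable_comparison_test'[OF sums_summable[OF g], of 0]) (use k in \<open>simp add: less_imp_le\<close>)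
    have [measurable]: "B n i \<in> sets R" "m \<in> sets R" for n i using cl[OF Bcl] spR by auto
    have "measure R (m - K) = measure R (\<Union>n. m - B n (k n))" by (simp add: K_def)
    also have "\<dots> \<le> (\<Sum>n. measure R (m - B n (k n)))"
      by (rule R.finite_measure_subadditive_countably[OF _ s]) auto
    also have "\<dots> \<le> (\<Sum>i. e / 4 * (1/2) ^ i)"
      by (rule suminf_le[OF _ s sums_summable[OF g]]) (use k in \<open>simp add: less_imp_le\<close>)
    also have "\<dots> < e" using g e by (simp add: sums_iff)
    finally have "measure R (space M - K) < e" by (simp add: m)
    then show ?thesis using Kc Kcl unfolding md(3) by blast
  qed
qed

text \<open>Each \<open>\<alpha> k\<close> lies between a closed set \<open>C k\<close> and an open set \<open>U k\<close> with \<open>U k - C k\<close> of small measure.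
  Outside the open sets \<open>U k - C k\<close> the sets \<open>\<alpha> k\<close> and \<open>U k\<close> agree, so that on a compact set covers by
  sets \<open>\<alpha> k\<close> have finite subcovers.\<close>

lemma finite_subcovers_up_to_small_measure:
  assumes std: "standard_sigma_finite M" and R: "finite_measure R" "sets R = sets M"
    and \<alpha>: "\<And>k::nat. \<alpha> k \<in> sets M" and X0: "X0 \<in> sets M" "measure R X0 = 0" and e: "0 < (e::real)"
  shows "\<exists>K\<in>sets M. K \<inter> X0 = {} \<and> measure R (space M - K) < e \<and>
    (\<forall>J. K \<subseteq> (\<Union>k\<in>J. \<alpha> k) \<longrightarrow> (\<exists>J'\<subseteq>J. finite J' \<and> K \<subseteq> (\<Union>k\<in>J'. \<alpha> k)))"
proof -
  interpret R: finite_measure R by fact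
  obtain T where T: "topspace T = space M" "completely_metrizable_space T" "separable_space T"
      "sets M = sigma_sets (space M) {U. openin T U}"
    using std unfolding standard_sigma_finite_def by (elim exE conjE)
  note reg = borel_regular[OF T(1) completely_metrizable_imp_metrizable_space[OF T(2)] T(4) R]
  have op: "U \<in> sets R" if "openin T U" for U using that T(4) R(2) by auto
  have cl: "C \<in> sets R" if C: "closedin T C" for C
  proof -
    have "C = space R - (topspace T - C)"
      using closedin_subset[OF C] sets_eq_imp_space_eq[OF R(2)] T(1) by auto
    also have "\<dots> \<in> sets R" using op[of "topspace T - C"] C by (auto simp: closedin_def)
    finally show ?thesis .
  qed
  have "0 < e / 4" using e by simp
  from borel_tight[OF T R this] obtain K0 where K0: "compactin T K0" "closedin T K0" "measure R (space M - K0) < e / 4"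
    by (elim exE conjE)
  from reg[OF X0(1) \<open>0 < e / 4\<close>] obtain C0 U0
    where CU0: "closedin T C0" "openin T U0" "C0 \<subseteq> X0" "X0 \<subseteq> U0" "measure R (U0 - C0) < e / 4"
    by (elim exE conjE)
  have X0R: "X0 \<in> sets R" using X0 R(2) by simp
  have "measure R U0 \<le> measure R ((U0 - C0) \<union> X0)"
    by (rule R.finite_measure_mono) (use CU0 X0R op[OF CU0(2)] cl[OF CU0(1)] in auto)
  also have "\<dots> \<le> measure R (U0 - C0) + measure R X0"
    by (rule measure_Un_le) (use CU0 X0R op[OF CU0(2)] cl[OF CU0(1)] in auto)
  finally have U0: "measure R U0 < e / 4" using CU0(5) X0(2) by simp
  have "\<forall>i. \<exists>CU. closedin T (fst CU) \<and> openin T (snd CU) \<and> fst CU \<subseteq> \<alpha> i \<and> \<alpha> i \<subseteq> snd CU \<and>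
      measure R (snd CU - fst CU) < e / 8 * (1/2) ^ i"
  proof (rule allI)
    fix i
    have "0 < e / 8 * (1/2) ^ i" using e by simp
    from reg[OF \<alpha> this, of i] obtain C U where "closedin T C \<and> openin T U \<and> C \<subseteq> \<alpha> i \<and> \<alpha> i \<subseteq> U \<and>
        measure R (U - C) < e / 8 * (1/2) ^ i"
      by (elim exE) (rule that)
    then show "\<exists>CU. closedin T (fst CU) \<and> openin T (snd CU) \<and> fst CU \<subseteq> \<alpha> i \<and>
        \<alpha> i \<subseteq> snd CU \<and> measure R (snd CU - fst CU) < e / 8 * (1/2) ^ i"
      by (intro exI[of _ "(C, U)"]) simp
  qed
  from choice[OF this] obtain CU where CU: "\<forall>i. closedin T (fst (CU i)) \<and> openin T (snd (CU i)) \<and>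
      fst (CU i) \<subseteq> \<alpha> i \<and> \<alpha> i \<subseteq> snd (CU i) \<and> measure R (snd (CU i) - fst (CU i)) < e / 8 * (1/2) ^ i"
    by (elim exE) (rule that)
  define C where "C i = fst (CU i)" for i
  define U where "U i = snd (CU i)" for i
  have C: "closedin T (C i)" "C i \<subseteq> \<alpha> i" and U: "openin T (U i)" "\<alpha> i \<subseteq> U i"
    and le: "measure R (U i - C i) < e / 8 * (1/2) ^ i" for i
    using CU by (auto simp: C_def U_def)
  define K where "K = K0 - (U0 \<union> (\<Union>i. U i - C i))"
  have Kc: "compactin T K"
  proof (rule closed_compactin[OF K0(1)])
    show "K \<subseteq> K0" by (auto simp: K_def)
    show "closedin T K"
      unfolding K_def
      by (intro closedin_diff[OF K0(2)] openin_Un CU0 openin_Union) (use U C in \<open>auto intro: openin_diff\<close>)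
  qed
  have [measurable]: "U0 \<in> sets R" "K0 \<in> sets R" "U i - C i \<in> sets R" "space M \<in> sets R" for i
    using op[OF CU0(2)] cl[OF K0(2)] op[OF U(1)] cl[OF C(1)] R(2) by auto
  have g: "(\<lambda>i. e / 8 * (1/2) ^ i) sums (e / 8 * 2)"
    using sums_mult[OF geometric_sums[of "1/2 :: real"], of "e / 8"] by simp
  have s: "summable (\<lambda>i. measure R (U i - C i))"
    by (rule summable_comparison_test'[OF sums_summable[OF g], of 0]) (use le in \<open>simp add: less_imp_le\<close>)
  have "measure R (\<Union>i. U i - C i) \<le> (\<Sum>i. measure R (U i - C i))"
    by (rule R.finite_measure_subadditive_countably[OF _ s]) auto
  also have "\<dots> \<le> (\<Sum>i. e / 8 * (1/2) ^ i)"
    by (rule suminf_le[OF _ s sums_summable[OF g]]) (use le in \<open>simp add: less_imp_le\<close>)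
  also have "\<dots> = e / 4" using g by (simp add: sums_iff)
  finally have UC: "measure R (\<Union>i. U i - C i) \<le> e / 4" .
  have "measure R (space M - K) \<le> measure R ((space M - K0) \<union> (U0 \<union> (\<Union>i. U i - C i)))"
    by (rule R.finite_measure_mono) (auto simp: K_def)
  also have "\<dots> \<le> measure R (space M - K0) + measure R (U0 \<union> (\<Union>i. U i - C i))"
    by (rule measure_Un_le) auto
  also have "measure R (U0 \<union> (\<Union>i. U i - C i)) \<le> measure R U0 + measure R (\<Union>i. U i - C i)"
    by (rule measure_Un_le) auto
  finally have meas: "measure R (space M - K) < e" using K0(3) U0 UC e by linarith
  have KM: "K \<in> sets M" unfolding R(2)[symmetric] K_def by measurable
  have "\<exists>J'\<subseteq>J. finite J' \<and> K \<subseteq> (\<Union>k\<in>J'. \<alpha> k)" if J: "K \<subseteq> (\<Union>k\<in>J. \<alpha> k)" for J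
  proof -
    have "K \<subseteq> \<Union>(U ` J)" using J U(2) by blast
    from compactinD[OF Kc _ this] obtain \<F> where F: "finite \<F>" "\<F> \<subseteq> U ` J" "K \<subseteq> \<Union>\<F>"
      using U(1) by auto
    obtain J' where J': "J' \<subseteq> J" "finite J'" "\<F> = U ` J'"
      using finite_subset_image[OF F(1,2)] by auto
    have "K \<subseteq> (\<Union>k\<in>J'. \<alpha> k)"
    proof
      fix x assume x: "x \<in> K"
      then obtain k where k: "k \<in> J'" "x \<in> U k" using F(3) J'(3) by auto
      have "x \<notin> U k - C k" using x by (auto simp: K_def)
      then have "x \<in> \<alpha> k" using k(2) C(2) by auto
      then show "x \<in> (\<Union>k\<in>J'. \<alpha> k)" using k(1) by auto
    qed
    then show ?thesis using J' by auto
  qed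
  moreover have "K \<inter> X0 = {}" using CU0(4) by (auto simp: K_def)
  ultimately show ?thesis using KM meas by blast
qed

subsection \<open>Mass of a square-integrable function\<close>

text \<open>The finite measure \<open>\<bar>f\<bar>\<^sup>2 M\<close>, for which regularity is available although \<open>M\<close> may be infinite.\<close>

lemma L2_mass:
  assumes f: "f \<in> L2 M"
  defines "R \<equiv> density M (\<lambda>x. ennreal ((cmod (f x))\<^sup>2))"
  shows "finite_measure R" and "sets R = sets M"
    and "A \<in> sets M \<Longrightarrow> measure R A = (L2_norm M (\<lambda>x. indicator A x * f x))\<^sup>2"
    and "A \<in> null_sets M \<Longrightarrow> measure R A = 0"
proof -
  note [measurable] = L2_measurable[OF f]
  show "sets R = sets M" by (simp add: R_def)
  have em: "emeasure R A = ennreal ((L2_norm M (\<lambda>x. indicator A x * f x))\<^sup>2)" if A: "A \<in> sets M" for A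
  proof -
    have "emeasure R A = (\<integral>\<^sup>+x. ennreal ((cmod (f x))\<^sup>2) * indicator A x \<partial>M)"
      unfolding R_def by (rule emeasure_density) (use A in auto)
    also have "\<dots> = (\<integral>\<^sup>+x. ennreal ((cmod (indicator A x * f x))\<^sup>2) \<partial>M)"
      by (rule nn_integral_cong) (simp add: indicator_def)
    also have "\<dots> = ennreal ((L2_norm M (\<lambda>x. indicator A x * f x))\<^sup>2)"
      by (rule L2_nn_integral[OF L2_indicator[OF f A]])
    finally show ?thesis .
  qed
  show "finite_measure R"
    by (rule finite_measureI) (use em[of "space M"] in \<open>simp add: R_def\<close>)
  show m: "measure R A = (L2_norm M (\<lambda>x. indicator A x * f x))\<^sup>2" if "A \<in> sets M" for A
    using em[OF that] by (simp add: measure_def)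
  show "measure R A = 0" if A: "A \<in> null_sets M"
  proof -
    have "AE x in M. indicator A x * f x = 0"
      using AE_not_in[OF A] by eventually_elim simp
    then have "L2_norm M (\<lambda>x. indicator A x * f x) = 0"
      using L2_norm_eq_0_iff[OF L2_indicator[OF f null_setsD2[OF A]]] by simp
    then show ?thesis using m[OF null_setsD2[OF A]] by simp
  qed
qed

lemma L2_cut_tendsto_0:
  assumes f: "f \<in> L2 M" and S: "\<And>n::nat. S n \<in> sets M" "decseq S" "(\<Inter>n. S n) \<in> null_sets M"
  shows "(\<lambda>n. L2_norm M (\<lambda>x. indicator (S n) x * f x)) \<longlonglongrightarrow> 0"
proof -
  define R where "R = density M (\<lambda>x. ennreal ((cmod (f x))\<^sup>2))"
  note m = L2_mass[OF f, folded R_def]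
  interpret R: finite_measure R by (rule m)
  have "(\<lambda>n. measure R (S n)) \<longlonglongrightarrow> measure R (\<Inter>n. S n)"
    by (rule R.finite_Lim_measure_decseq) (use S m(2) in auto)
  then have "(\<lambda>n. (L2_norm M (\<lambda>x. indicator (S n) x * f x))\<^sup>2) \<longlonglongrightarrow> 0"
    using m(3)[OF S(1)] m(4)[OF S(3)] by simp
  from tendsto_real_sqrt[OF this] show ?thesis by simp
qed

subsection \<open>Vanishing on rectangles\<close>

text \<open>For \<open>A\<close> and \<open>B\<close> measurable this says that \<open>T\<close>, cut down to \<open>A\<close> and \<open>B\<close>, is zero.\<close>

definition vanishes_on ::
    "'a measure \<Rightarrow> 'b measure \<Rightarrow> ('a, 'b) operator \<Rightarrow> 'a set \<Rightarrow> 'b set \<Rightarrow> bool" where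
  "vanishes_on M N T A B \<longleftrightarrow> (\<forall>f\<in>L2 M. \<forall>g\<in>L2 N.
     (\<forall>x\<in>space M - A. f x = 0) \<longrightarrow> (\<forall>y\<in>space N - B. g y = 0) \<longrightarrow> L2_inner N (T f) g = 0)"

lemma vanishes_onD:
  "vanishes_on M N T A B \<Longrightarrow> f \<in> L2 M \<Longrightarrow> g \<in> L2 N \<Longrightarrow> (\<And>x. x \<in> space M - A \<Longrightarrow> f x = 0) \<Longrightarrow>
    (\<And>y. y \<in> space N - B \<Longrightarrow> g y = 0) \<Longrightarrow> L2_inner N (T f) g = 0"
  unfolding vanishes_on_def by simp

lemma vanishes_onI:
  assumes "\<And>f g. f \<in> L2 M \<Longrightarrow> g \<in> L2 N \<Longrightarrow> (\<And>x. x \<in> space M - A \<Longrightarrow> f x = 0) \<Longrightarrow>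
    (\<And>y. y \<in> space N - B \<Longrightarrow> g y = 0) \<Longrightarrow> L2_inner N (T f) g = 0"
  shows "vanishes_on M N T A B"
  unfolding vanishes_on_def using assms by simp

lemma vanishes_on_mono:
  assumes v: "vanishes_on M N T A B" and sub: "A' \<subseteq> A" "B' \<subseteq> B"
  shows "vanishes_on M N T A' B'"
proof (rule vanishes_onI)
  fix f g assume L: "f \<in> L2 M" "g \<in> L2 N"
    and z: "\<And>x. x \<in> space M - A' \<Longrightarrow> f x = 0" "\<And>y. y \<in> space N - B' \<Longrightarrow> g y = 0"
  show "L2_inner N (T f) g = 0"
    by (rule vanishes_onD[OF v L]) (use z sub in auto)
qed

lemma vanishes_on_empty:
  assumes T: "T \<in> bounded_ops M N"
  shows "vanishes_on M N T {} B" and "vanishes_on M N T A {}"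
proof -
  show "vanishes_on M N T {} B"
  proof (rule vanishes_onI)
    fix f g assume f: "f \<in> L2 M" and g: "g \<in> L2 N" and z: "\<And>x. x \<in> space M - {} \<Longrightarrow> f x = 0"
    obtain C where C: "\<And>f g. f \<in> L2 M \<Longrightarrow> g \<in> L2 N \<Longrightarrow> cmod (L2_inner N (T f) g) \<le> C * (L2_norm M f * L2_norm N g)"
      using op_inner_bound[OF T] by blast
    have "L2_norm M f = 0" unfolding L2_norm_eq_0_iff[OF f] by (rule AE_I2) (use z in simp)
    then show "L2_inner N (T f) g = 0" using C[OF f g] by simp
  qed
  show "vanishes_on M N T A {}"
  proof (rule vanishes_onI)
    fix f g assume f: "f \<in> L2 M" and g: "g \<in> L2 N" and z: "\<And>x. x \<in> space N - {} \<Longrightarrow> g x = 0"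
    have "L2_norm N g = 0" unfolding L2_norm_eq_0_iff[OF g] by (rule AE_I2) (use z in simp)
    then show "L2_inner N (T f) g = 0" using L2_inner_bound[OF bounded_ops_L2[OF T f] g] by simp
  qed
qed

lemma vanishes_on_Un_left:
  assumes T: "T \<in> bounded_ops M N" and A: "A \<in> sets M" and v: "vanishes_on M N T A B" "vanishes_on M N T A' B"
  shows "vanishes_on M N T (A \<union> A') B"
proof (rule vanishes_onI)
  fix f g assume f: "f \<in> L2 M" and g: "g \<in> L2 N"
    and z: "\<And>x. x \<in> space M - (A \<union> A') \<Longrightarrow> f x = 0" "\<And>y. y \<in> space N - B \<Longrightarrow> g y = 0"
  let ?f1 = "\<lambda>x. indicator A x * f x" and ?f2 = "\<lambda>x. f x - indicator A x * f x"
  have L: "?f1 \<in> L2 M" "?f2 \<in> L2 M" by (intro L2_indicator L2_diff f A)+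
  have "L2_inner N (T ?f1) g = 0" by (rule vanishes_onD[OF v(1) L(1) g]) (use z in auto)
  moreover have "L2_inner N (T ?f2) g = 0"
    by (rule vanishes_onD[OF v(2) L(2) g]) (use z in \<open>auto simp: indicator_def\<close>)
  ultimately show "L2_inner N (T f) g = 0" using op_inner_add[OF T L g] by simp
qed

lemma vanishes_on_Un_right:
  assumes T: "T \<in> bounded_ops M N" and B: "B \<in> sets N" and v: "vanishes_on M N T A B" "vanishes_on M N T A B'"
  shows "vanishes_on M N T A (B \<union> B')"
proof (rule vanishes_onI)
  fix f g assume f: "f \<in> L2 M" and g: "g \<in> L2 N"
    and z: "\<And>x. x \<in> space M - A \<Longrightarrow> f x = 0" "\<And>y. y \<in> space N - (B \<union> B') \<Longrightarrow> g y = 0"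
  let ?g1 = "\<lambda>x. indicator B x * g x" and ?g2 = "\<lambda>x. g x - indicator B x * g x"
  have L: "?g1 \<in> L2 N" "?g2 \<in> L2 N" by (intro L2_indicator L2_diff g B)+
  have "L2_inner N (T f) ?g1 = 0" by (rule vanishes_onD[OF v(1) f L(1)]) (use z in auto)
  moreover have "L2_inner N (T f) ?g2 = 0"
    by (rule vanishes_onD[OF v(2) f L(2)]) (use z in \<open>auto simp: indicator_def\<close>)
  ultimately show "L2_inner N (T f) g = 0" using L2_inner_add_right[OF L bounded_ops_L2[OF T f]] by simp
qed

lemma vanishes_on_UN_left:
  assumes T: "T \<in> bounded_ops M N" and I: "finite I" and A: "\<And>i. i \<in> I \<Longrightarrow> A i \<in> sets M"
    and v: "\<And>i. i \<in> I \<Longrightarrow> vanishes_on M N T (A i) B"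
  shows "vanishes_on M N T (\<Union>i\<in>I. A i) B"
  using I A v
proof (induction I)
  case empty
  show ?case using vanishes_on_empty(1)[OF T] by simp
next
  case (insert i I)
  have "vanishes_on M N T (A i \<union> (\<Union>i\<in>I. A i)) B"
    by (rule vanishes_on_Un_left[OF T]) (use insert in simp_all)
  then show ?case by simp
qed

lemma vanishes_on_UN_right:
  assumes T: "T \<in> bounded_ops M N" and I: "finite I" and B: "\<And>i. i \<in> I \<Longrightarrow> B i \<in> sets N"
    and v: "\<And>i. i \<in> I \<Longrightarrow> vanishes_on M N T A (B i)"
  shows "vanishes_on M N T A (\<Union>i\<in>I. B i)"
  using I B v
proof (induction I)
  case empty
  show ?case using vanishes_on_empty(2)[OF T] by simp
next
  case (insert i I)
  have "vanishes_on M N T A (B i \<union> (\<Union>i\<in>I. B i))"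
    by (rule vanishes_on_Un_right[OF T]) (use insert in simp_all)
  then show ?case by simp
qed

text \<open>This goes back to Arveson. For finitely many rectangles it is \<open>vanishes_on_UN_left\<close> and
  \<open>vanishes_on_UN_right\<close>. On a set \<open>K\<close> provided by \<open>finite_subcovers_up_to_small_measure\<close>, each \<open>y\<close> needs only finitely many \<open>\<alpha> k\<close> with \<open>y \<in> \<beta> k\<close> to cover
  \<open>K\<close>, and the set \<open>Y m\<close> of those \<open>y\<close> for which the first \<open>m\<close> indices suffice exhausts the space.\<close>

theorem vanishing_on_countable_cover:
  assumes std: "standard_sigma_finite M" and T: "T \<in> bounded_ops M N"
    and ab: "\<And>k::nat. \<alpha> k \<in> sets M" "\<And>k. \<beta> k \<in> sets N" and v: "\<And>k. vanishes_on M N T (\<alpha> k) (\<beta> k)"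
    and X0: "X0 \<in> null_sets M" and Y0: "Y0 \<in> null_sets N"
    and cover: "\<And>x y. x \<in> space M - X0 \<Longrightarrow> y \<in> space N - Y0 \<Longrightarrow> \<exists>k. x \<in> \<alpha> k \<and> y \<in> \<beta> k"
    and f: "f \<in> L2 M" and g: "g \<in> L2 N"
  shows "L2_inner N (T f) g = 0"
proof -
  obtain C where C: "C \<ge> 0"
    "\<And>f g. f \<in> L2 M \<Longrightarrow> g \<in> L2 N \<Longrightarrow> cmod (L2_inner N (T f) g) \<le> C * (L2_norm M f * L2_norm N g)"
    using op_inner_bound[OF T] by blast
  have step: "L2_inner N (T (\<lambda>x. indicator K x * f x)) g = 0"
    if K: "K \<in> sets M" "K \<inter> X0 = {}"
      and fc: "\<And>J. K \<subseteq> (\<Union>k\<in>J. \<alpha> k) \<Longrightarrow> \<exists>J'\<subseteq>J. finite J' \<and> K \<subseteq> (\<Union>k\<in>J'. \<alpha> k)" for K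
  proof -
    define \<J> where "\<J> m = {J \<in> Pow {..<m}. K \<subseteq> (\<Union>k\<in>J. \<alpha> k)}" for m :: nat
    define \<beta>' where "\<beta>' J = space N \<inter> (\<Inter>k\<in>J. \<beta> k)" for J
    define Y where "Y m = (\<Union>J\<in>\<J> m. \<beta>' J)" for m
    define S where "S m = space N - Y m" for m
    have fin: "finite (\<J> m)" "J \<in> \<J> m \<Longrightarrow> finite J" for m J
      by (auto simp: \<J>_def intro: finite_subset)
    have \<beta>': "\<beta>' J \<in> sets N" if "finite J" for J
    proof (cases "J = {}")
      case False
      then show ?thesis unfolding \<beta>'_def using that ab(2) by (intro sets.Int sets.finite_INT) auto
    qed (simp add: \<beta>'_def)
    have Sm: "S m \<in> sets N" for m
      unfolding S_def Y_def using fin \<beta>' by (intro sets.compl_sets sets.finite_UN) auto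
    have vY: "vanishes_on M N T K (Y m)" for m
      unfolding Y_def
    proof (rule vanishes_on_UN_right[OF T fin(1)])
      fix J assume J: "J \<in> \<J> m"
      show "\<beta>' J \<in> sets N" by (rule \<beta>'[OF fin(2)[OF J]])
      have "vanishes_on M N T (\<Union>k\<in>J. \<alpha> k) (\<beta>' J)"
        by (rule vanishes_on_UN_left[OF T fin(2)[OF J] ab(1)], rule vanishes_on_mono[OF v]) (auto simp: \<beta>'_def)
      then show "vanishes_on M N T K (\<beta>' J)"
        by (rule vanishes_on_mono) (use J in \<open>auto simp: \<J>_def\<close>)
    qed
    have dec: "decseq S"
    proof (rule decseq_SucI)
      fix m
      have "\<J> m \<subseteq> \<J> (Suc m)" by (auto simp: \<J>_def)
      then show "S (Suc m) \<subseteq> S m" unfolding S_def Y_def by blast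
    qed
    have "y \<notin> (\<Inter>m. S m)" if y: "y \<in> space N - Y0" for y
    proof -
      have "K \<subseteq> (\<Union>k\<in>{k. y \<in> \<beta> k}. \<alpha> k)"
      proof
        fix x assume "x \<in> K"
        then have "x \<in> space M - X0" using K sets.sets_into_space by blast
        then show "x \<in> (\<Union>k\<in>{k. y \<in> \<beta> k}. \<alpha> k)" using cover[OF _ y] by auto
      qed
      from fc[OF this] obtain J where J: "J \<subseteq> {k. y \<in> \<beta> k}" "finite J" "K \<subseteq> (\<Union>k\<in>J. \<alpha> k)"
        by (elim exE conjE)
      obtain m where "J \<subseteq> {..<m}" using J(2) finite_nat_iff_bounded by auto
      then have "J \<in> \<J> m" using J(3) by (simp add: \<J>_def)
      moreover have "y \<in> \<beta>' J" using J(1) y by (auto simp: \<beta>'_def)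
      ultimately have "y \<in> Y m" unfolding Y_def by blast
      then show ?thesis by (auto simp: S_def)
    qed
    then have "(\<Inter>m. S m) \<subseteq> Y0" unfolding S_def by auto
    moreover have "(\<Inter>m. S m) \<in> sets N" using Sm by auto
    ultimately have null: "(\<Inter>m. S m) \<in> null_sets N" using null_sets_subset[OF Y0] by blast
    let ?f = "\<lambda>x. indicator K x * f x"
    have fL: "?f \<in> L2 M" by (rule L2_indicator[OF f K(1)])
    have le: "cmod (L2_inner N (T ?f) g) \<le> C * (L2_norm M ?f * L2_norm N (\<lambda>y. indicator (S m) y * g y))" for m
    proof -
      let ?g1 = "\<lambda>y. indicator (S m) y * g y" and ?g2 = "\<lambda>y. g y - indicator (S m) y * g y"
      have L: "?g1 \<in> L2 N" "?g2 \<in> L2 N" by (intro L2_indicator L2_diff g Sm)+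
      have "L2_inner N (T ?f) ?g2 = 0"
        by (rule vanishes_onD[OF vY[of m] fL L(2)]) (auto simp: S_def indicator_def)
      then have "L2_inner N (T ?f) g = L2_inner N (T ?f) ?g1"
        using L2_inner_add_right[OF L bounded_ops_L2[OF T fL]] by simp
      then show ?thesis using C(2)[OF fL L(1)] by simp
    qed
    have "(\<lambda>m. C * (L2_norm M ?f * L2_norm N (\<lambda>y. indicator (S m) y * g y))) \<longlonglongrightarrow> C * (L2_norm M ?f * 0)"
      by (intro tendsto_intros L2_cut_tendsto_0[OF g Sm dec null])
    then have "cmod (L2_inner N (T ?f) g) \<le> C * (L2_norm M ?f * 0)"
      by (rule LIMSEQ_le_const) (use le in blast)
    then show ?thesis by simp
  qed
  define R where "R = density M (\<lambda>x. ennreal ((cmod (f x))\<^sup>2))"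
  note m = L2_mass[OF f, folded R_def]
  have "cmod (L2_inner N (T f) g) \<le> \<delta> * (C * L2_norm N g)" if \<delta>: "\<delta> > 0" for \<delta>
  proof -
    have "0 < \<delta>\<^sup>2" using \<delta> by simp
    from finite_subcovers_up_to_small_measure[where \<alpha> = \<alpha>, OF std m(1,2) ab(1) null_setsD2[OF X0] m(4)[OF X0] this]
    obtain K where K: "K \<in> sets M" "K \<inter> X0 = {}" "measure R (space M - K) < \<delta>\<^sup>2"
      and fc: "\<forall>J. K \<subseteq> (\<Union>k\<in>J. \<alpha> k) \<longrightarrow> (\<exists>J'\<subseteq>J. finite J' \<and> K \<subseteq> (\<Union>k\<in>J'. \<alpha> k))"
      by (elim bexE conjE)
    let ?f1 = "\<lambda>x. indicator K x * f x" and ?f2 = "\<lambda>x. f x - indicator K x * f x"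
    have L: "?f1 \<in> L2 M" "?f2 \<in> L2 M" by (intro L2_indicator L2_diff f K)+
    have "L2_inner N (T ?f1) g = 0" by (rule step[OF K(1,2)]) (use fc in blast)
    then have eq: "L2_inner N (T f) g = L2_inner N (T ?f2) g" using op_inner_add[OF T L g] by simp
    have "L2_norm M ?f2 = L2_norm M (\<lambda>x. indicator (space M - K) x * f x)"
    proof (rule L2_norm_cong_AE)
      show "(\<lambda>x. indicator (space M - K) x * f x) \<in> borel_measurable M"
        using L2_measurable[OF f] K(1) by auto
    qed (use L2_measurable[OF L(2)] in \<open>auto simp: indicator_def intro!: AE_I2\<close>)
    then have "(L2_norm M ?f2)\<^sup>2 = measure R (space M - K)" using m(3)[of "space M - K"] K(1) by auto
    then have "(L2_norm M ?f2)\<^sup>2 \<le> \<delta>\<^sup>2" using K(3) by simp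
    then have n: "L2_norm M ?f2 \<le> \<delta>" by (rule power2_le_imp_le) (use \<delta> in simp)
    have "cmod (L2_inner N (T f) g) \<le> C * (L2_norm M ?f2 * L2_norm N g)"
      unfolding eq by (rule C(2)[OF L(2) g])
    also have "\<dots> \<le> C * (\<delta> * L2_norm N g)"
      by (intro mult_left_mono mult_right_mono n C(1)) simp
    finally show ?thesis by (simp add: mult_ac)
  qed
  moreover have "((\<lambda>\<delta>. \<delta> * (C * L2_norm N g)) \<longlongrightarrow> 0 * (C * L2_norm N g)) (at_right 0)"
    by (intro tendsto_intros)
  ultimately have "cmod (L2_inner N (T f) g) \<le> 0 * (C * L2_norm N g)"
    by (intro tendsto_lowerbound[where F = "at_right 0"]) (auto simp: eventually_at_right_less elim!: eventually_mono[OF eventually_at_right_less])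
  then show ?thesis by simp
qed

section \<open>Quotients are closable\<close>

subsection \<open>Multiplying square-integrable functions by square-summable families\<close>

lemma family_times_L2:
  assumes c: "l2_family M c" and f: "f \<in> L2 M" and C: "C \<ge> 0"
    and le: "\<forall>x\<in>space M. f x \<noteq> 0 \<longrightarrow> l2_norm (\<lambda>i. c i x) \<le> C"
  shows "(\<lambda>x. c i x * f x) \<in> L2 M" and "(\<Sum>i<n. (L2_norm M (\<lambda>x. c i x * f x))\<^sup>2) \<le> (C * L2_norm M f)\<^sup>2"
proof -
  note [measurable] = l2_familyD(1)[OF c] L2_measurable[OF f]
  note l = l2_familyD(2)[OF c]
  have part: "(\<Sum>i\<in>I. (cmod (c i x))\<^sup>2) \<le> C\<^sup>2" if "finite I" "x \<in> space M" "f x \<noteq> 0" for I x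
  proof -
    have "(\<Sum>i\<in>I. (cmod (c i x))\<^sup>2) \<le> (l2_norm (\<lambda>i. c i x))\<^sup>2" by (rule l2_partial[OF l that(1)])
    also have "\<dots> \<le> C\<^sup>2" by (intro power_mono le[rule_format] that l2_norm_nonneg l)
    finally show ?thesis .
  qed
  have L: "(\<lambda>x. c i x * f x) \<in> L2 M" for i
  proof (rule L2_bound[OF _ f, where C = C])
    show "AE x in M. cmod (c i x * f x) \<le> C * cmod (f x)"
    proof (rule AE_I2)
      fix x assume x: "x \<in> space M"
      show "cmod (c i x * f x) \<le> C * cmod (f x)"
      proof (cases "f x = 0")
        case False
        have "(cmod (c i x))\<^sup>2 \<le> C\<^sup>2" using part[of "{i}" x] x False by simp
        then have "cmod (c i x) \<le> C" by (rule power2_le_imp_le[OF _ C])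
        then show ?thesis by (simp add: norm_mult mult_right_mono)
      qed simp
    qed
  qed measurable
  show "(\<lambda>x. c i x * f x) \<in> L2 M" by (rule L)
  have "(\<Sum>i<n. (L2_norm M (\<lambda>x. c i x * f x))\<^sup>2) = (\<integral>x. (\<Sum>i<n. (cmod (c i x * f x))\<^sup>2) \<partial>M)"
    using L2_integrable[OF L] by (simp add: L2_norm_square)
  also have "\<dots> \<le> (\<integral>x. C\<^sup>2 * (cmod (f x))\<^sup>2 \<partial>M)"
  proof (rule integral_mono)
    show "integrable M (\<lambda>x. \<Sum>i<n. (cmod (c i x * f x))\<^sup>2)" using L2_integrable[OF L] by simp
    show "integrable M (\<lambda>x. C\<^sup>2 * (cmod (f x))\<^sup>2)" using L2_integrable[OF f] by simp
    fix x assume x: "x \<in> space M"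
    have "(\<Sum>i<n. (cmod (c i x * f x))\<^sup>2) = (\<Sum>i<n. (cmod (c i x))\<^sup>2) * (cmod (f x))\<^sup>2"
      by (simp add: norm_mult power_mult_distrib sum_distrib_right)
    also have "\<dots> \<le> C\<^sup>2 * (cmod (f x))\<^sup>2"
      using part[of "{..<n}" x] x by (cases "f x = 0") (auto intro: mult_right_mono)
    finally show "(\<Sum>i<n. (cmod (c i x * f x))\<^sup>2) \<le> C\<^sup>2 * (cmod (f x))\<^sup>2" .
  qed
  also have "\<dots> = (C * L2_norm M f)\<^sup>2" by (simp add: power_mult_distrib L2_norm_square)
  finally show "(\<Sum>i<n. (L2_norm M (\<lambda>x. c i x * f x))\<^sup>2) \<le> (C * L2_norm M f)\<^sup>2" .
qed

lemma l2_family_cnj: "l2_family M c \<Longrightarrow> l2_family M (\<lambda>i x. cnj (c i x))"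
  by (auto simp: l2_family_def intro: borel_measurable_cnj)

text \<open>Locally, where the families are bounded, the product with \<open>family_product c d\<close> maps an elementary
  tensor to a nuclear kernel, with control of the projective norm.\<close>

lemma family_times_rep:
  assumes c: "l2_family M c" and d: "l2_family N d" and f: "f \<in> L2 M" and g: "g \<in> L2 N"
    and C: "C \<ge> 0" "\<forall>x\<in>space M. f x \<noteq> 0 \<longrightarrow> l2_norm (\<lambda>i. c i x) \<le> C"
    and D: "D \<ge> 0" "\<forall>y\<in>space N. g y \<noteq> 0 \<longrightarrow> l2_norm (\<lambda>i. d i y) \<le> D"
  shows "nuclear_rep M N (\<lambda>i x. c i x * f x) (\<lambda>i y. cnj (d i y) * g y)"
    and "(\<Sum>i. L2_norm M (\<lambda>x. c i x * f x) * L2_norm N (\<lambda>y. cnj (d i y) * g y))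
          \<le> (C * L2_norm M f) * (D * L2_norm N g)"
    and "rep_kernel (\<lambda>i x. c i x * f x) (\<lambda>i y. cnj (d i y) * g y) p = family_product c d p * tensor f g p"
proof -
  have Dc: "\<forall>y\<in>space N. g y \<noteq> 0 \<longrightarrow> l2_norm (\<lambda>i. cnj (d i y)) \<le> D"
    using D(2) by (simp add: l2_norm_def)
  note F = family_times_L2[OF c f C] family_times_L2[OF l2_family_cnj[OF d] g D(1) Dc]
  have fin: "(\<Sum>i<n. L2_norm M (\<lambda>x. c i x * f x) * L2_norm N (\<lambda>y. cnj (d i y) * g y))
      \<le> (C * L2_norm M f) * (D * L2_norm N g)" for n
    by (rule sum_product_le_of_squares) (use F C(1) D(1) in auto)
  have s: "summable (\<lambda>i. L2_norm M (\<lambda>x. c i x * f x) * L2_norm N (\<lambda>y. cnj (d i y) * g y))"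
    by (rule summableI_nonneg_bounded[OF _ fin]) simp
  show "nuclear_rep M N (\<lambda>i x. c i x * f x) (\<lambda>i y. cnj (d i y) * g y)"
    unfolding nuclear_rep_def using F s by simp
  show "(\<Sum>i. L2_norm M (\<lambda>x. c i x * f x) * L2_norm N (\<lambda>y. cnj (d i y) * g y))
      \<le> (C * L2_norm M f) * (D * L2_norm N g)"
    by (rule suminf_le_const[OF s fin])
  have "(\<lambda>i. tensor (\<lambda>x. c i x * f x) (\<lambda>y. cnj (d i y) * g y) p) =
      (\<lambda>i. (c i (fst p) * d i (snd p)) * tensor f g p)"
    by (simp add: tensor_def mult_ac)
  then show "rep_kernel (\<lambda>i x. c i x * f x) (\<lambda>i y. cnj (d i y) * g y) p = family_product c d p * tensor f g p"
    using sums_mult2[OF family_product_sums[OF c d, of p], of "tensor f g p"]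
    by (simp add: rep_kernel_def sums_iff)
qed

lemma pairing_bound:
  assumes T: "T \<in> bounded_ops M N" and r: "nuclear_rep M N f g" and K: "K \<ge> 0"
    and le: "\<And>i. cmod (L2_inner N (T (f i)) (g i)) \<le> K * (L2_norm M (f i) * L2_norm N (g i))"
    and S: "(\<Sum>i. L2_norm M (f i) * L2_norm N (g i)) \<le> S"
  shows "cmod (pairing N T f g) \<le> K * S"
proof -
  note s = pairing_summable[OF T r] and L = nuclear_repD(3)[OF r]
  have "cmod (pairing N T f g) \<le> (\<Sum>i. cmod (L2_inner N (T (f i)) (g i)))"
    unfolding pairing_def by (rule summable_norm[OF s])
  also have "\<dots> \<le> (\<Sum>i. K * (L2_norm M (f i) * L2_norm N (g i)))"
    by (rule suminf_le[OF le s summable_mult[OF L]])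
  also have "\<dots> = K * (\<Sum>i. L2_norm M (f i) * L2_norm N (g i))" by (rule suminf_mult[OF L])
  also have "\<dots> \<le> K * S" by (rule mult_left_mono[OF S K])
  finally show ?thesis .
qed

lemma l2_triangle:
  assumes u: "l2 u" and v: "l2 v"
  shows "l2 (\<lambda>i. u i + v i)" and "l2_norm (\<lambda>i. u i + v i) \<le> l2_norm u + l2_norm v"
proof -
  have "(\<Sum>i<n. (cmod (u i + v i))\<^sup>2) \<le> (l2_norm u + l2_norm v)\<^sup>2" for n
  proof -
    have "L2_set (\<lambda>i. cmod (u i + v i)) {..<n} \<le> L2_set (\<lambda>i. cmod (u i) + cmod (v i)) {..<n}"
      by (rule L2_set_mono) (auto intro: norm_triangle_ineq)
    also have "\<dots> \<le> L2_set (\<lambda>i. cmod (u i)) {..<n} + L2_set (\<lambda>i. cmod (v i)) {..<n}"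
      by (rule L2_set_triangle_ineq)
    also have "\<dots> \<le> l2_norm u + l2_norm v"
      unfolding L2_set_def
      by (intro add_mono real_le_lsqrt l2_norm_nonneg u v l2_partial) auto
    finally have "(L2_set (\<lambda>i. cmod (u i + v i)) {..<n})\<^sup>2 \<le> (l2_norm u + l2_norm v)\<^sup>2"
      by (intro power_mono) auto
    then show ?thesis by (simp add: L2_set_def sum_nonneg)
  qed
  from l2_normI[OF this] show "l2 (\<lambda>i. u i + v i)" "l2_norm (\<lambda>i. u i + v i) \<le> l2_norm u + l2_norm v"
    using l2_norm_nonneg[OF u] l2_norm_nonneg[OF v] by auto
qed

lemma l2_diff: "l2 u \<Longrightarrow> l2 v \<Longrightarrow> l2 (\<lambda>i. u i - v i)"
  using l2_triangle(1)[of u "\<lambda>i. - v i"] by simp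

lemma l2_norm_diff_commute: "l2_norm (\<lambda>i. u i - v i) = l2_norm (\<lambda>i. v i - u i)"
  by (simp add: l2_norm_def norm_minus_commute)

text \<open>On the rectangle, multiplication by \<open>family_product c d\<close> is the number \<open>\<Sum>i. p i * q i\<close> plus a
  perturbation whose effect on the form \<open>L2_inner N (T f) g\<close> is smaller. If the product annihilates
  the form, any bound \<open>K\<close> for the form therefore improves to \<open>\<theta> * K\<close> with a fixed \<open>\<theta> < 1\<close>.\<close>

lemma vanishes_on_small_rectangle:
  assumes T: "T \<in> bounded_ops M N" and c: "l2_family M c" and d: "l2_family N d"
    and p: "l2 p" and q: "l2 q" and e: "e \<ge> 0" and r: "r \<ge> 0"
    and cp: "\<And>x. x \<in> \<alpha> \<Longrightarrow> l2_norm (\<lambda>i. c i x) \<le> r" "\<And>x. x \<in> \<alpha> \<Longrightarrow> l2_norm (\<lambda>i. c i x - p i) \<le> e"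
    and dq: "\<And>y. y \<in> \<beta> \<Longrightarrow> l2_norm (\<lambda>i. d i y) \<le> r" "\<And>y. y \<in> \<beta> \<Longrightarrow> l2_norm (\<lambda>i. d i y - q i) \<le> e"
    and large: "e * (r + l2_norm p) < cmod (\<Sum>i. p i * q i)"
    and ann: "\<And>f g. f \<in> L2 M \<Longrightarrow> g \<in> L2 N \<Longrightarrow> (\<And>x. x \<in> space M - \<alpha> \<Longrightarrow> f x = 0) \<Longrightarrow>
      (\<And>y. y \<in> space N - \<beta> \<Longrightarrow> g y = 0) \<Longrightarrow>
      pairing N T (\<lambda>i x. c i x * f x) (\<lambda>i y. cnj (d i y) * g y) = 0"
  shows "vanishes_on M N T \<alpha> \<beta>"
proof (rule vanishes_onI)
  define z where "z = (\<Sum>i. p i * q i)"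
  define \<theta> where "\<theta> = e * (r + l2_norm p) / cmod z"
  note pn = l2_norm_nonneg[OF p]
  have nn: "0 \<le> e * (r + l2_norm p)" using e r pn by simp
  then have z: "cmod z > 0" using large unfolding z_def[symmetric] by (rule le_less_trans)
  have \<theta>: "0 \<le> \<theta>" "\<theta> < 1"
    using large z nn unfolding \<theta>_def z_def[symmetric] by (simp_all only: divide_nonneg_pos divide_less_eq_1_pos)
  obtain C where C: "C \<ge> 0"
    "\<And>f g. f \<in> L2 M \<Longrightarrow> g \<in> L2 N \<Longrightarrow> cmod (L2_inner N (T f) g) \<le> C * (L2_norm M f * L2_norm N g)"
    using op_inner_bound[OF T] by blast
  define P where "P K \<longleftrightarrow> (\<forall>f\<in>L2 M. \<forall>g\<in>L2 N. (\<forall>x\<in>space M - \<alpha>. f x = 0) \<longrightarrow> (\<forall>y\<in>space N - \<beta>. g y = 0) \<longrightarrow>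
    cmod (L2_inner N (T f) g) \<le> K * (L2_norm M f * L2_norm N g))" for K
  have pf: "l2_family M (\<lambda>i x. p i)" using p by (simp add: l2_family_def)
  have qf: "l2_family N (\<lambda>i x. q i)" using q by (simp add: l2_family_def)
  have cpf: "l2_family M (\<lambda>i x. c i x - p i)"
    using l2_familyD[OF c] l2_diff[OF _ p] by (simp add: l2_family_def)
  have dqf: "l2_family N (\<lambda>i x. d i x - q i)"
    using l2_familyD[OF d] l2_diff[OF _ q] by (simp add: l2_family_def)
  have improve: "P (\<theta> * K)" if PK: "P K" and K: "K \<ge> 0" for K
    unfolding P_def
  proof (intro ballI impI)
    fix f g assume f: "f \<in> L2 M" and g: "g \<in> L2 N"
      and sf: "\<forall>x\<in>space M - \<alpha>. f x = 0" and sg: "\<forall>y\<in>space N - \<beta>. g y = 0"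
    have inA: "x \<in> \<alpha>" if "x \<in> space M" "f x \<noteq> 0" for x using sf that by blast
    have inB: "y \<in> \<beta>" if "y \<in> space N" "g y \<noteq> 0" for y using sg that by blast
    have use: "cmod (L2_inner N (T (\<lambda>x. m i x * f x)) (\<lambda>y. cnj (n i y) * g y)) \<le>
        K * (L2_norm M (\<lambda>x. m i x * f x) * L2_norm N (\<lambda>y. cnj (n i y) * g y))"
      if "nuclear_rep M N (\<lambda>i x. m i x * f x) (\<lambda>i y. cnj (n i y) * g y)" for m n i
      using PK[unfolded P_def, rule_format, OF nuclear_repD(1)[OF that, of i] nuclear_repD(2)[OF that, of i]] sf sg
      by simp
    have bu: "0 \<le> e" "\<forall>x\<in>space M. f x \<noteq> 0 \<longrightarrow> l2_norm (\<lambda>i. c i x - p i) \<le> e"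
      "0 \<le> r" "\<forall>y\<in>space N. g y \<noteq> 0 \<longrightarrow> l2_norm (\<lambda>i. d i y) \<le> r"
      using e r cp(2)[OF inA] dq(1)[OF inB] by auto
    have bv: "0 \<le> l2_norm p" "\<forall>x\<in>space M. f x \<noteq> 0 \<longrightarrow> l2_norm (\<lambda>i. p i) \<le> l2_norm p"
      "0 \<le> e" "\<forall>y\<in>space N. g y \<noteq> 0 \<longrightarrow> l2_norm (\<lambda>i. d i y - q i) \<le> e"
      using e pn dq(2)[OF inB] by auto
    have ba: "0 \<le> r" "\<forall>x\<in>space M. f x \<noteq> 0 \<longrightarrow> l2_norm (\<lambda>i. c i x) \<le> r"
      "0 \<le> r" "\<forall>y\<in>space N. g y \<noteq> 0 \<longrightarrow> l2_norm (\<lambda>i. d i y) \<le> r"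
      using r cp(1)[OF inA] dq(1)[OF inB] by auto
    have bw: "0 \<le> l2_norm p" "\<forall>x\<in>space M. f x \<noteq> 0 \<longrightarrow> l2_norm (\<lambda>i. p i) \<le> l2_norm p"
      "0 \<le> l2_norm q" "\<forall>y\<in>space N. g y \<noteq> 0 \<longrightarrow> l2_norm (\<lambda>i. q i) \<le> l2_norm q"
      using pn l2_norm_nonneg[OF q] by auto
    note ru = family_times_rep[OF cpf d f g bu]
    note rv = family_times_rep[OF pf dqf f g bv]
    note ra = family_times_rep[OF c d f g ba]
    note rw = family_times_rep[OF pf qf f g bw]
    let ?I = "\<lambda>m n i. L2_inner N (T (\<lambda>x. m i x * f x)) (\<lambda>y. cnj (n i y) * g y)"
    \<comment> \<open>The decomposition \<open>c i * d i = (c i - p i) * d i + p i * (d i - q i) + p i * q i\<close>.\<close>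
    have split: "?I c d i = ?I (\<lambda>i x. c i x - p i) d i + ?I (\<lambda>i x. p i) (\<lambda>i y. d i y - q i) i +
        p i * q i * L2_inner N (T f) g" for i
    proof -
      have "?I c d i = ?I (\<lambda>i x. c i x - p i) d i + ?I (\<lambda>i x. p i) d i"
        using op_inner_add[OF T nuclear_repD(1)[OF ru(1), of i] nuclear_repD(1)[OF rv(1), of i] nuclear_repD(2)[OF ra(1), of i]]
        by (simp add: algebra_simps)
      moreover have "?I (\<lambda>i x. p i) d i = ?I (\<lambda>i x. p i) (\<lambda>i y. d i y - q i) i + ?I (\<lambda>i x. p i) (\<lambda>i y. q i) i"
        using L2_inner_add_right[OF nuclear_repD(2)[OF rv(1), of i] nuclear_repD(2)[OF rw(1), of i]
            bounded_ops_L2[OF T nuclear_repD(1)[OF rv(1), of i]]]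
        by (simp add: algebra_simps)
      moreover have "?I (\<lambda>i x. p i) (\<lambda>i y. q i) i = p i * q i * L2_inner N (T f) g"
        using op_inner_scale[OF T f nuclear_repD(2)[OF rw(1), of i], of "p i"]
          L2_inner_scale_right[of N "T f" "cnj (q i)" g] by simp
      ultimately show ?thesis by simp
    qed
    have "(\<lambda>i. p i * q i) sums z"
      unfolding z_def by (rule summable_sums[OF summable_norm_cancel[OF l2_product(1)[OF p q]]])
    from sums_add[OF sums_add[OF pairing_sums[OF T ru(1)] pairing_sums[OF T rv(1)]] sums_mult2[OF this, of "L2_inner N (T f) g"]]
    have "(\<lambda>i. ?I c d i) sums (pairing N T (\<lambda>i x. (c i x - p i) * f x) (\<lambda>i y. cnj (d i y) * g y) +
        pairing N T (\<lambda>i x. p i * f x) (\<lambda>i y. cnj (d i y - q i) * g y) + z * L2_inner N (T f) g)"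
      unfolding split .
    moreover have "(\<lambda>i. ?I c d i) sums 0"
    proof -
      have "pairing N T (\<lambda>i x. c i x * f x) (\<lambda>i y. cnj (d i y) * g y) = 0"
        by (rule ann[OF f g]) (use sf sg in auto)
      then show ?thesis using pairing_sums[OF T ra(1)] by simp
    qed
    ultimately have "pairing N T (\<lambda>i x. (c i x - p i) * f x) (\<lambda>i y. cnj (d i y) * g y) +
        pairing N T (\<lambda>i x. p i * f x) (\<lambda>i y. cnj (d i y - q i) * g y) + z * L2_inner N (T f) g = 0"
      (is "?X + ?Y + _ = 0") by (rule sums_unique2)
    then have zI: "z * L2_inner N (T f) g = - (?X + ?Y)" by (simp only: add_eq_0_iff)
    have "cmod z * cmod (L2_inner N (T f) g) = cmod (?X + ?Y)"
      unfolding norm_mult[symmetric] zI by (rule norm_minus_cancel)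
    also have "\<dots> \<le> cmod ?X + cmod ?Y" by (rule norm_triangle_ineq)
    also have "\<dots> \<le> K * ((e * L2_norm M f) * (r * L2_norm N g)) + K * ((l2_norm p * L2_norm M f) * (e * L2_norm N g))"
      by (intro add_mono pairing_bound[OF T ru(1) K _ ru(2)] pairing_bound[OF T rv(1) K _ rv(2)]
          use[OF ru(1)] use[OF rv(1)])
    also have "\<dots> = cmod z * (\<theta> * K * (L2_norm M f * L2_norm N g))"
      using z by (simp add: \<theta>_def field_simps)
    finally show "cmod (L2_inner N (T f) g) \<le> \<theta> * K * (L2_norm M f * L2_norm N g)"
      using z by (simp add: mult_le_cancel_left_pos)
  qed
  have PC: "P (\<theta> ^ n * C) \<and> 0 \<le> \<theta> ^ n * C" for n
  proof (induction n)
    case 0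
    then show ?case using C by (simp add: P_def)
  next
    case (Suc n)
    then show ?case using improve[of "\<theta> ^ n * C"] \<theta>(1) C(1) by (simp add: mult.assoc)
  qed
  fix f g assume f: "f \<in> L2 M" and g: "g \<in> L2 N"
    and s: "\<And>x. x \<in> space M - \<alpha> \<Longrightarrow> f x = 0" "\<And>y. y \<in> space N - \<beta> \<Longrightarrow> g y = 0"
  have le: "cmod (L2_inner N (T f) g) \<le> \<theta> ^ n * C * (L2_norm M f * L2_norm N g)" for n
    using PC[of n] f g s unfolding P_def by simp
  have "(\<lambda>n. \<theta> ^ n * C * (L2_norm M f * L2_norm N g)) \<longlonglongrightarrow> 0 * C * (L2_norm M f * L2_norm N g)"
    by (intro tendsto_intros LIMSEQ_power_zero) (use \<theta> in auto)
  then have "cmod (L2_inner N (T f) g) \<le> 0 * C * (L2_norm M f * L2_norm N g)"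
    by (rule LIMSEQ_le_const) (use le in blast)
  then show "L2_inner N (T f) g = 0" by simp
qed

subsection \<open>A countable dense set of square-summable sequences\<close>

lemma l2_countable_dense:
  obtains Q :: "(nat \<Rightarrow> complex) set" where "countable Q" "\<And>p. p \<in> Q \<Longrightarrow> l2 p"
    "\<And>u e. l2 u \<Longrightarrow> (0::real) < e \<Longrightarrow> \<exists>p\<in>Q. l2_norm (\<lambda>i. u i - p i) \<le> e"
proof -
  obtain D :: "complex set" where D: "countable D" "\<And>X. open X \<Longrightarrow> X \<noteq> {} \<Longrightarrow> \<exists>d\<in>D. d \<in> X"
    by (rule countable_dense_setE) blast
  define s where "s xs i = (if i < length xs then xs ! i else 0)" for xs :: "complex list" and i
  define Q where "Q = s ` lists D"
  show ?thesis
  proof (rule that[of Q])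
    show "countable Q" unfolding Q_def by (intro countable_image countable_lists D)
    show "l2 p" if p: "p \<in> Q" for p
    proof -
      obtain xs where "p = s xs" using p by (auto simp: Q_def)
      then have "(cmod (p i))\<^sup>2 = 0" if "i \<notin> {..<length xs}" for i using that by (simp add: s_def)
      then show ?thesis by (intro summable_finite[of "{..<length xs}"]) auto
    qed
    fix u and e :: real assume u: "l2 u" and e: "0 < e"
    have e2: "e\<^sup>2 / 2 > 0" using e by simp
    have "\<forall>\<^sub>F n in sequentially. (\<Sum>i. (cmod (u (i + n)))\<^sup>2) < e\<^sup>2 / 2"
      by (rule order_tendstoD(2)[OF suminf_tail_tendsto_0[OF u] e2])
    then obtain n where n: "(\<Sum>i. (cmod (u (i + n)))\<^sup>2) < e\<^sup>2 / 2" by (auto simp: eventually_sequentially)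
    \<comment> \<open>The first \<open>n\<close> coordinates and the tail contribute at most \<open>e\<^sup>2 / 2\<close> each.\<close>
    define \<delta> where "\<delta> = e / sqrt (2 * (real n + 1))"
    have \<delta>: "\<delta> > 0" using e by (simp add: \<delta>_def)
    have \<delta>2: "\<delta>\<^sup>2 = e\<^sup>2 / (2 * (real n + 1))" by (simp add: \<delta>_def power_divide)
    have "\<exists>d. d \<in> D \<and> cmod (u i - d) < \<delta>" for i
      using D(2)[of "ball (u i) \<delta>"] \<delta> by (auto simp: dist_norm)
    then obtain d where d: "\<And>i. d i \<in> D" "\<And>i. cmod (u i - d i) < \<delta>" by metis
    define p where "p = s (map d [0..<n])"
    have pi: "p i = (if i < n then d i else 0)" for i by (simp add: p_def s_def)
    have pQ: "p \<in> Q" unfolding Q_def p_def by (intro imageI) (use d in auto)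
    let ?v = "\<lambda>i. (cmod (u i - p i))\<^sup>2"
    have tail: "(\<lambda>i. ?v (i + n)) = (\<lambda>i. (cmod (u (i + n)))\<^sup>2)" by (simp add: pi)
    have s': "summable (\<lambda>i. ?v (i + n))" unfolding tail using l2_shift[OF u] .
    then have sv: "summable ?v" by (subst (asm) summable_iff_shift)
    have "(\<Sum>i<n. ?v i) \<le> (\<Sum>i<n. \<delta>\<^sup>2)"
      by (intro sum_mono power_mono) (use d(2) in \<open>auto simp: pi less_imp_le\<close>)
    also have "\<dots> = e\<^sup>2 / 2 * (real n / (real n + 1))" by (simp add: \<delta>2)
    also have "\<dots> \<le> e\<^sup>2 / 2 * 1" by (intro mult_left_mono) auto
    finally have "(\<Sum>i. ?v i) \<le> e\<^sup>2"
      using suminf_split_initial_segment[OF sv, of n] n unfolding tail by simp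
    then have "l2_norm (\<lambda>i. u i - p i) \<le> e"
      unfolding l2_norm_def using e by (intro real_le_lsqrt) (auto intro: suminf_nonneg[OF sv])
    then show "\<exists>p\<in>Q. l2_norm (\<lambda>i. u i - p i) \<le> e" using pQ by blast
  qed
qed

subsection \<open>The sufficiency of the condition\<close>

text \<open>At a point where \<open>family_product c d\<close> does not vanish, the values of \<open>c\<close> and \<open>d\<close> are approximated by
  members \<open>p\<close>, \<open>q\<close> of a countable dense set so well that the point lies in a rectangle to which
  \<open>vanishes_on_small_rectangle\<close> applies. Hence countably many such rectangles suffice. Bounding \<open>a\<close> and \<open>b\<close>
  on them as well ensures that \<open>\<phi>\<close> maps the kernels used there to nuclear kernels.\<close>

lemma quotient_annihilator_trivial:
  assumes std: "standard_sigma_finite M" and N: "sigma_finite_measure N"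
    and a: "l2_family M a" and b: "l2_family N b" and c: "l2_family M c" and d: "l2_family N d"
    and quot: "AE p in M \<Otimes>\<^sub>M N. \<phi> p * family_product c d p = family_product a b p"
    and null: "marginally_null M N {p \<in> space (M \<Otimes>\<^sub>M N). family_product c d p = 0}"
    and T: "T \<in> bounded_ops M N"
    and ann: "\<And>f g f' g'. nuclear_rep M N f g \<Longrightarrow> nuclear_rep M N f' g' \<Longrightarrow>
      AE p in M \<Otimes>\<^sub>M N. \<phi> p * rep_kernel f g p = rep_kernel f' g' p \<Longrightarrow> pairing N T f g = 0"
  shows "op_eq M N T (\<lambda>_ _. 0)"
proof (rule op_eq_zeroI[OF T])
  note [measurable] = l2_familyD(1)[OF a] l2_familyD(1)[OF b] l2_familyD(1)[OF c] l2_familyD(1)[OF d]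
  note l2 = l2_familyD(2)[OF a] l2_familyD(2)[OF b] l2_familyD(2)[OF c] l2_familyD(2)[OF d]
  obtain Q :: "(nat \<Rightarrow> complex) set" where Q: "countable Q" "\<And>p. p \<in> Q \<Longrightarrow> l2 p"
    "\<And>u e. l2 u \<Longrightarrow> (0::real) < e \<Longrightarrow> \<exists>p\<in>Q. l2_norm (\<lambda>i. u i - p i) \<le> e"
    by (rule l2_countable_dense) blast
  define I where "I = Q \<times> Q \<times> (UNIV :: nat set) \<times> (UNIV :: nat set)"
  have Ic: "countable I" unfolding I_def using Q(1) by (intro countable_SIGMA) auto
  have "Q \<noteq> {}" using Q(3)[of "\<lambda>_. 0" 1] by auto
  then have Ine: "I \<noteq> {}" by (auto simp: I_def)
  define ep where "ep m = 1 / (real m + 1)" for m :: nat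
  have ep: "ep m > 0" for m by (simp add: ep_def)
  define good where "good = (\<lambda>(p, q, m, n). ep m * (real n + l2_norm p) < cmod (\<Sum>i. p i * q i))"
  define A where "A = (\<lambda>(p, q :: nat \<Rightarrow> complex, m, n). {x \<in> space M. l2_norm (\<lambda>i. a i x) \<le> real n \<and>
    l2_norm (\<lambda>i. c i x) \<le> real n \<and> l2_norm (\<lambda>i. c i x - p i) \<le> ep m})"
  define B where "B = (\<lambda>(p :: nat \<Rightarrow> complex, q, m, n). {y \<in> space N. l2_norm (\<lambda>i. b i y) \<le> real n \<and>
    l2_norm (\<lambda>i. d i y) \<le> real n \<and> l2_norm (\<lambda>i. d i y - q i) \<le> ep m})"
  have AM: "A (p, q, m, n) \<in> sets M" for p q m n unfolding A_def prod.case by measurable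
  have BN: "B (p, q, m, n) \<in> sets N" for p q m n unfolding B_def prod.case by measurable
  have vanish: "vanishes_on M N T (A t) (B t)" if t: "t \<in> I" "good t" for t
  proof -
    obtain p q m n where pq: "t = (p, q, m, n)" "p \<in> Q" "q \<in> Q" using t(1) by (auto simp: I_def)
    show ?thesis
    proof (rule vanishes_on_small_rectangle[OF T c d Q(2)[OF pq(2)] Q(2)[OF pq(3)], where e = "ep m" and r = "real n"])
      show "ep m * (real n + l2_norm p) < cmod (\<Sum>i. p i * q i)" using t(2) by (simp add: good_def pq)
      fix f g assume f: "f \<in> L2 M" and g: "g \<in> L2 N"
        and sf: "\<And>x. x \<in> space M - A t \<Longrightarrow> f x = 0" and sg: "\<And>y. y \<in> space N - B t \<Longrightarrow> g y = 0"
      have inA: "x \<in> A t" if "x \<in> space M" "f x \<noteq> 0" for x using sf that by blast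
      have inB: "y \<in> B t" if "y \<in> space N" "g y \<noteq> 0" for y using sg that by blast
      have lc: "\<forall>x\<in>space M. f x \<noteq> 0 \<longrightarrow> l2_norm (\<lambda>i. c i x) \<le> real n"
        "\<forall>x\<in>space M. f x \<noteq> 0 \<longrightarrow> l2_norm (\<lambda>i. a i x) \<le> real n"
        using inA by (auto simp: A_def pq)
      have ld: "\<forall>y\<in>space N. g y \<noteq> 0 \<longrightarrow> l2_norm (\<lambda>i. d i y) \<le> real n"
        "\<forall>y\<in>space N. g y \<noteq> 0 \<longrightarrow> l2_norm (\<lambda>i. b i y) \<le> real n"
        using inB by (auto simp: B_def pq)
      note r1 = family_times_rep[OF c d f g of_nat_0_le_iff lc(1) of_nat_0_le_iff ld(1)]
      note r2 = family_times_rep[OF a b f g of_nat_0_le_iff lc(2) of_nat_0_le_iff ld(2)]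
      have "AE p in M \<Otimes>\<^sub>M N. \<phi> p * rep_kernel (\<lambda>i x. c i x * f x) (\<lambda>i y. cnj (d i y) * g y) p =
          rep_kernel (\<lambda>i x. a i x * f x) (\<lambda>i y. cnj (b i y) * g y) p"
        using quot by eventually_elim (simp add: r1(3) r2(3) flip: mult.assoc)
      then show "pairing N T (\<lambda>i x. c i x * f x) (\<lambda>i y. cnj (d i y) * g y) = 0"
        by (rule ann[OF r1(1) r2(1)])
    qed (auto simp: A_def B_def pq less_imp_le[OF ep])
  qed
  define t where "t k = from_nat_into I k" for k
  have tI: "t k \<in> I" for k unfolding t_def by (rule from_nat_into[OF Ine])
  define \<alpha> where "\<alpha> k = (if good (t k) then A (t k) else {})" for k
  define \<beta> where "\<beta> k = B (t k)" for k
  have tk: "\<exists>p q m n. t k = (p, q, m, n)" for k by (cases "t k") auto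
  have \<alpha>M: "\<alpha> k \<in> sets M" and \<beta>N: "\<beta> k \<in> sets N" for k
    using tk[of k] AM BN by (auto simp: \<alpha>_def \<beta>_def)
  have v: "vanishes_on M N T (\<alpha> k) (\<beta> k)" for k
    using vanish[OF tI] vanishes_on_empty(1)[OF T] by (simp add: \<alpha>_def \<beta>_def)
  have cover: "\<exists>k. x \<in> \<alpha> k \<and> y \<in> \<beta> k"
    if x: "x \<in> space M" and y: "y \<in> space N" and nz: "family_product c d (x, y) \<noteq> 0" for x y
  proof -
    let ?c = "\<lambda>i. c i x" and ?d = "\<lambda>i. d i y"
    define s where "s = cmod (family_product c d (x, y))"
    obtain n :: nat where n: "l2_norm (\<lambda>i. a i x) + l2_norm (\<lambda>i. b i y) + l2_norm ?c + l2_norm ?d \<le> real n"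
      using real_arch_simple by blast
    have nn: "0 \<le> l2_norm (\<lambda>i. a i x)" "0 \<le> l2_norm (\<lambda>i. b i y)" "0 \<le> l2_norm ?c" "0 \<le> l2_norm ?d"
      by (intro l2_norm_nonneg l2)+
    \<comment> \<open>One summand \<open>ep m * (2 * n + 1)\<close> bounds the error of \<open>\<Sum>i. p i * q i\<close>, the other one the required lower bound.\<close>
    obtain m where m: "ep m * (4 * real n + 2) < s"
    proof -
      have "s / (4 * real n + 2) > 0" using nz by (simp add: s_def)
      then obtain m where "inverse (real (Suc m)) < s / (4 * real n + 2)" using reals_Archimedean by blast
      then have "ep m < s / (4 * real n + 2)" by (simp add: ep_def inverse_eq_divide add.commute)
      then show ?thesis by (intro that[of m]) (simp add: pos_less_divide_eq)
    qed
    obtain p where p: "p \<in> Q" "l2_norm (\<lambda>i. ?c i - p i) \<le> ep m" using Q(3)[OF l2(3) ep] by blast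
    obtain q where q: "q \<in> Q" "l2_norm (\<lambda>i. ?d i - q i) \<le> ep m" using Q(3)[OF l2(4) ep] by blast
    note pl = Q(2)[OF p(1)] and ql = Q(2)[OF q(1)]
    note cp = l2_diff[OF l2(3) pl, of x] and dq = l2_diff[OF l2(4) ql, of y]
    have ep1: "ep m \<le> 1" by (simp add: ep_def)
    have "l2_norm p \<le> l2_norm ?c + l2_norm (\<lambda>i. p i - ?c i)"
      using l2_triangle(2)[OF l2(3) l2_diff[OF pl l2(3)], of x x] by simp
    then have pn: "l2_norm p \<le> real n + 1"
      using p(2) n nn ep1 l2_norm_diff_commute[of p ?c] by linarith
    have "family_product c d (x, y) - (\<Sum>i. p i * q i) = (\<Sum>i. (?c i - p i) * ?d i) + (\<Sum>i. p i * (?d i - q i))"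
    proof -
      have s1: "summable (\<lambda>i. (?c i - p i) * ?d i)" "summable (\<lambda>i. p i * (?d i - q i))" "summable (\<lambda>i. p i * q i)"
        by (intro summable_norm_cancel[OF l2_product(1)] cp dq pl ql l2)+
      have "(\<Sum>i. ?c i * ?d i) = (\<Sum>i. ((?c i - p i) * ?d i + p i * (?d i - q i)) + p i * q i)"
        by (simp add: algebra_simps)
      also have "\<dots> = (\<Sum>i. (?c i - p i) * ?d i) + (\<Sum>i. p i * (?d i - q i)) + (\<Sum>i. p i * q i)"
        by (simp add: suminf_add[symmetric] s1 summable_add)
      finally show ?thesis by (simp add: family_product_def)
    qed
    then have "cmod (family_product c d (x, y) - (\<Sum>i. p i * q i)) \<le>
        cmod (\<Sum>i. (?c i - p i) * ?d i) + cmod (\<Sum>i. p i * (?d i - q i))"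
      by (simp add: norm_triangle_ineq)
    also have "\<dots> \<le> l2_norm (\<lambda>i. ?c i - p i) * l2_norm ?d + l2_norm p * l2_norm (\<lambda>i. ?d i - q i)"
      by (intro add_mono l2_product(3) cp dq pl l2)
    also have "\<dots> \<le> ep m * real n + (real n + 1) * ep m"
      by (intro add_mono mult_mono p q pn l2_norm_nonneg dq l2) (use n nn ep[of m] in auto)
    finally have "s - cmod (\<Sum>i. p i * q i) \<le> ep m * (2 * real n + 1)"
      using norm_triangle_ineq2[of "family_product c d (x, y)" "\<Sum>i. p i * q i"]
      by (simp add: s_def algebra_simps)
    moreover have "ep m * (real n + l2_norm p) \<le> ep m * (2 * real n + 1)"
      using pn ep[of m] by (intro mult_left_mono) auto
    moreover have "ep m * (4 * real n + 2) = ep m * (2 * real n + 1) + ep m * (2 * real n + 1)"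
      by (simp add: algebra_simps)
    ultimately have "ep m * (real n + l2_norm p) < cmod (\<Sum>i. p i * q i)" using m by linarith
    then have g: "good (p, q, m, n)" by (simp add: good_def)
    have "(p, q, m, n) \<in> I" using p q by (simp add: I_def)
    then obtain k where k: "t k = (p, q, m, n)"
      using from_nat_into_surj[OF Ic] unfolding t_def by blast
    have "x \<in> \<alpha> k" using x p(2) n nn g by (simp add: \<alpha>_def k A_def)
    moreover have "y \<in> \<beta> k" using y q(2) n nn by (simp add: \<beta>_def k B_def)
    ultimately show ?thesis by blast
  qed
  obtain X0 Y0 where X0: "X0 \<in> null_sets M" and Y0: "Y0 \<in> null_sets N"
    and sub: "{p \<in> space (M \<Otimes>\<^sub>M N). family_product c d p = 0} \<subseteq> (X0 \<times> space N) \<union> (space M \<times> Y0)"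
    using null unfolding marginally_null_def by (elim bexE)
  fix f g assume f: "f \<in> L2 M" and g: "g \<in> L2 N"
  show "L2_inner N (T f) g = 0"
  proof (rule vanishing_on_countable_cover[OF std T \<alpha>M \<beta>N v X0 Y0 _ f g])
    fix x y assume xy: "x \<in> space M - X0" "y \<in> space N - Y0"
    then have "(x, y) \<notin> {p \<in> space (M \<Otimes>\<^sub>M N). family_product c d p = 0}" using sub by blast
    then have "family_product c d (x, y) \<noteq> 0" using xy by (simp add: space_pair_measure)
    then show "\<exists>k. x \<in> \<alpha> k \<and> y \<in> \<beta> k" using cover xy by simp
  qed
qed

text \<open>The omega-continuity of \<open>s\<close> transfers the absence of zeros from \<open>s\<close> to the product of families that
  equals \<open>s\<close> almost everywhere.\<close>

lemma quotient_imp_closable: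
  assumes M: "standard_sigma_finite M" and N: "standard_sigma_finite N"
    and \<phi>: "\<phi> \<in> borel_measurable (M \<Otimes>\<^sub>M N)"
    and t: "t \<in> V_functions M N"
    and s: "s \<in> V_functions M N" "omega_continuous M N s"
    and null: "marginally_null M N {p \<in> space (M \<Otimes>\<^sub>M N). s p = 0}"
    and quot: "AE p in M \<Otimes>\<^sub>M N. \<phi> p = t p / s p"
  shows "weak_star_closable_multiplier M N \<phi>"
proof -
  have sM: "sigma_finite_measure M" and sN: "sigma_finite_measure N"
    using M N by (auto simp: standard_sigma_finite_def)
  obtain a b where ab: "l2_family M a" "l2_family N b" "AE p in M \<Otimes>\<^sub>M N. t p = family_product a b p"
    by (rule V_functions_family[OF sN t])
  obtain c d where cd: "l2_family M c" "l2_family N d" "AE p in M \<Otimes>\<^sub>M N. s p = family_product c d p"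
    by (rule V_functions_family[OF sN s(1)])
  have "marginally_null M N ({p \<in> space (M \<Otimes>\<^sub>M N). s p = 0} \<union>
      {p \<in> space (M \<Otimes>\<^sub>M N). s p \<noteq> family_product c d p})"
    by (intro marginally_null_Un null
        omega_continuous_eq_marginally[OF sN s(2) family_product_omega_continuous[OF cd(1,2)] cd(3)])
  then have null': "marginally_null M N {p \<in> space (M \<Otimes>\<^sub>M N). family_product c d p = 0}"
    by (rule marginally_null_subset) auto
  have "AE p in M \<Otimes>\<^sub>M N. \<phi> p * family_product c d p = family_product a b p"
    using quot ab(3) cd(3) marginally_null_imp_AE[OF sN null] AE_space by eventually_elim auto
  note triv = quotient_annihilator_trivial[OF M sN ab(1,2) cd(1,2) this null']
  show ?thesis
    unfolding closable_iff_annihilator_trivial[OF sM sN \<phi>]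
  proof (intro ballI impI)
    fix T assume T: "T \<in> bounded_ops M N" and
      ann: "\<forall>f g f' g'. nuclear_rep M N f g \<longrightarrow> nuclear_rep M N f' g' \<longrightarrow>
        (AE p in M \<Otimes>\<^sub>M N. \<phi> p * rep_kernel f g p = rep_kernel f' g' p) \<longrightarrow> pairing N T f g = 0"
    show "op_eq M N T (\<lambda>_ _. 0)" by (rule triv[OF T ann[rule_format]])
  qed
qed

section \<open>Hahn-Banach for sublinear functionals\<close>

definition real_subspace :: "('z \<Rightarrow> complex) set \<Rightarrow> bool" where
  "real_subspace G \<longleftrightarrow> (\<lambda>_. 0) \<in> G \<and> (\<forall>u\<in>G. \<forall>v\<in>G. (\<lambda>z. u z + v z) \<in> G) \<and>
     (\<forall>r::real. \<forall>u\<in>G. (\<lambda>z. of_real r * u z) \<in> G)"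

definition sublinear_on :: "('z \<Rightarrow> complex) set \<Rightarrow> (('z \<Rightarrow> complex) \<Rightarrow> real) \<Rightarrow> bool" where
  "sublinear_on G q \<longleftrightarrow> (\<forall>u\<in>G. \<forall>v\<in>G. q (\<lambda>z. u z + v z) \<le> q u + q v) \<and>
     (\<forall>r\<ge>0. \<forall>u\<in>G. q (\<lambda>z. of_real r * u z) = r * q u)"

lemma real_subspaceD:
  assumes "real_subspace G"
  shows "(\<lambda>_. 0) \<in> G" "u \<in> G \<Longrightarrow> v \<in> G \<Longrightarrow> (\<lambda>z. u z + v z) \<in> G"
    "u \<in> G \<Longrightarrow> (\<lambda>z. of_real r * u z) \<in> G" "u \<in> G \<Longrightarrow> (\<lambda>z. - u z) \<in> G"
proof -
  show "(\<lambda>_. 0) \<in> G" "u \<in> G \<Longrightarrow> v \<in> G \<Longrightarrow> (\<lambda>z. u z + v z) \<in> G"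
    and s: "u \<in> G \<Longrightarrow> (\<lambda>z. of_real r * u z) \<in> G" for r
    using assms unfolding real_subspace_def by simp_all
  show "u \<in> G \<Longrightarrow> (\<lambda>z. - u z) \<in> G" using s[of "- 1"] by simp
qed

lemma sublinear_onD:
  assumes "sublinear_on G q"
  shows "u \<in> G \<Longrightarrow> v \<in> G \<Longrightarrow> q (\<lambda>z. u z + v z) \<le> q u + q v"
    "0 \<le> r \<Longrightarrow> u \<in> G \<Longrightarrow> q (\<lambda>z. of_real r * u z) = r * q u"
  using assms unfolding sublinear_on_def by simp_all

lemma sublinear_on_zero:
  assumes G: "real_subspace G" and q: "sublinear_on G q"
  shows "q (\<lambda>_. 0) = 0"
  using sublinear_onD(2)[OF q, of 0 "\<lambda>_. 0"] real_subspaceD(1)[OF G] by simp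

lemma sublinear_on_neg:
  assumes G: "real_subspace G" and q: "sublinear_on G q" and u: "u \<in> G"
  shows "- q (\<lambda>z. - u z) \<le> q u"
  using sublinear_onD(1)[OF q u real_subspaceD(4)[OF G u]] sublinear_on_zero[OF G q] by simp

lemma sublinear_onI:
  assumes G: "real_subspace G" and add: "\<And>u v. u \<in> G \<Longrightarrow> v \<in> G \<Longrightarrow> q (\<lambda>z. u z + v z) \<le> q u + q v"
    and zero: "q (\<lambda>_. 0) = 0"
    and scale: "\<And>r u. r > 0 \<Longrightarrow> u \<in> G \<Longrightarrow> q (\<lambda>z. of_real r * u z) \<le> r * q u"
  shows "sublinear_on G q"
proof -
  have "q (\<lambda>z. of_real r * u z) = r * q u" if r: "r \<ge> 0" and u: "u \<in> G" for r u
  proof (cases "r = 0")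
    case False
    then have rp: "r > 0" using r by simp
    have "q (\<lambda>z. of_real (1/r) * (of_real r * u z)) \<le> (1/r) * q (\<lambda>z. of_real r * u z)"
      using rp u real_subspaceD(3)[OF G] by (intro scale) auto
    moreover have "(\<lambda>z. of_real (1/r) * (of_real r * u z)) = u" using rp by (simp add: fun_eq_iff)
    ultimately have "q u \<le> (1/r) * q (\<lambda>z. of_real r * u z)" by (simp only:)
    then have "r * q u \<le> q (\<lambda>z. of_real r * u z)" using rp by (simp add: field_simps)
    then show ?thesis using scale[OF rp u] by simp
  qed (simp add: zero)
  then show ?thesis using add by (simp add: sublinear_on_def)
qed

text \<open>Lowering \<open>p\<close> along \<open>y\<close> as far as sublinearity permits.\<close>

lemma sublinear_shift:
  assumes G: "real_subspace G" and p: "sublinear_on G p" and y: "y \<in> G"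
  defines "p' \<equiv> \<lambda>x. INF t\<in>{0..}. p (\<lambda>z. x z + of_real t * y z) - t * p y"
  shows "sublinear_on G p'" and "\<And>x. x \<in> G \<Longrightarrow> p' x \<le> p x" and "p' (\<lambda>z. - y z) \<le> - p y"
proof -
  note Gc = real_subspaceD[OF G]
  have ty: "(\<lambda>z. of_real t * y z) \<in> G" for t :: real by (rule Gc(3)[OF y])
  have inG: "(\<lambda>z. x z + of_real t * y z) \<in> G" if "x \<in> G" for x and t :: real by (rule Gc(2)[OF that ty])
  have lower: "- p (\<lambda>z. - x z) \<le> p (\<lambda>z. x z + of_real t * y z) - t * p y" if x: "x \<in> G" and t: "t \<ge> 0" for x t
  proof -
    have "p (\<lambda>z. of_real t * y z) = p (\<lambda>z. (x z + of_real t * y z) + - x z)" by simp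
    also have "\<dots> \<le> p (\<lambda>z. x z + of_real t * y z) + p (\<lambda>z. - x z)"
      by (rule sublinear_onD(1)[OF p inG[OF x] Gc(4)[OF x]])
    finally show ?thesis using sublinear_onD(2)[OF p t y] by simp
  qed
  have bdd: "bdd_below ((\<lambda>t. p (\<lambda>z. x z + of_real t * y z) - t * p y) ` {0..})" if "x \<in> G" for x
    by (rule bdd_belowI2[where m = "- p (\<lambda>z. - x z)"]) (use lower[OF that] in auto)
  have le: "p' x \<le> p (\<lambda>z. x z + of_real t * y z) - t * p y" if "x \<in> G" "t \<ge> 0" for x t
    unfolding p'_def by (rule cINF_lower[OF bdd[OF that(1)]]) (use that in simp)
  have ge: "m \<le> p' x" if "\<And>t. t \<ge> 0 \<Longrightarrow> m \<le> p (\<lambda>z. x z + of_real t * y z) - t * p y" for m x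
    unfolding p'_def by (rule cINF_greatest) (use that in auto)
  show "sublinear_on G p'"
  proof (rule sublinear_onI[OF G])
    fix u v assume u: "u \<in> G" and v: "v \<in> G"
    have key: "p' (\<lambda>z. u z + v z) \<le> (p (\<lambda>z. u z + of_real t * y z) - t * p y) + (p (\<lambda>z. v z + of_real s * y z) - s * p y)"
      if t: "t \<ge> 0" and s: "s \<ge> 0" for t s
    proof -
      have "p' (\<lambda>z. u z + v z) \<le> p (\<lambda>z. (u z + v z) + of_real (t + s) * y z) - (t + s) * p y"
        by (rule le) (use Gc(2)[OF u v] t s in auto)
      also have "(\<lambda>z. (u z + v z) + of_real (t + s) * y z) =
          (\<lambda>z. (u z + of_real t * y z) + (v z + of_real s * y z))"
        by (simp add: fun_eq_iff algebra_simps)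
      also have "p \<dots> \<le> p (\<lambda>z. u z + of_real t * y z) + p (\<lambda>z. v z + of_real s * y z)"
        by (rule sublinear_onD(1)[OF p inG[OF u] inG[OF v]])
      finally show ?thesis by (simp add: algebra_simps)
    qed
    have key': "p' (\<lambda>z. u z + v z) - (p (\<lambda>z. u z + of_real t * y z) - t * p y) \<le> p' v" if t: "t \<ge> 0" for t
    proof (rule ge)
      fix s :: real assume "0 \<le> s"
      then show "p' (\<lambda>z. u z + v z) - (p (\<lambda>z. u z + of_real t * y z) - t * p y) \<le>
          p (\<lambda>z. v z + of_real s * y z) - s * p y"
        using key[OF t, of s] by linarith
    qed
    have "p' (\<lambda>z. u z + v z) - p' v \<le> p' u"
    proof (rule ge)
      fix t :: real assume "0 \<le> t"
      then show "p' (\<lambda>z. u z + v z) - p' v \<le> p (\<lambda>z. u z + of_real t * y z) - t * p y"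
        using key'[of t] by linarith
    qed
    then show "p' (\<lambda>z. u z + v z) \<le> p' u + p' v" by simp
  next
    have "p (\<lambda>z. 0 + of_real t * y z) - t * p y = 0" if "t \<ge> 0" for t
      using sublinear_onD(2)[OF p that y] by simp
    then have "p' (\<lambda>_. 0) \<le> 0" "0 \<le> p' (\<lambda>_. 0)"
      using le[OF Gc(1), of 0] ge[of 0 "\<lambda>_. 0"] sublinear_on_zero[OF G p] by auto
    then show "p' (\<lambda>_. 0) = 0" by simp
  next
    fix r :: real and u assume r: "r > 0" and u: "u \<in> G"
    have "p' (\<lambda>z. of_real r * u z) / r \<le> p (\<lambda>z. u z + of_real t * y z) - t * p y" if t: "t \<ge> 0" for t
    proof -
      have "p' (\<lambda>z. of_real r * u z) \<le> p (\<lambda>z. of_real r * u z + of_real (r * t) * y z) - (r * t) * p y"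
        by (rule le) (use Gc(3)[OF u] r t in auto)
      also have "(\<lambda>z. of_real r * u z + of_real (r * t) * y z) = (\<lambda>z. of_real r * (u z + of_real t * y z))"
        by (simp add: fun_eq_iff algebra_simps)
      also have "p \<dots> = r * p (\<lambda>z. u z + of_real t * y z)"
        by (rule sublinear_onD(2)[OF p _ inG[OF u]]) (use r in simp)
      finally show ?thesis using r by (simp add: field_simps)
    qed
    then have "p' (\<lambda>z. of_real r * u z) / r \<le> p' u" by (rule ge)
    then show "p' (\<lambda>z. of_real r * u z) \<le> r * p' u" using r by (simp add: field_simps)
  qed
  show "p' x \<le> p x" if "x \<in> G" for x using le[OF that, of 0] by simp
  show "p' (\<lambda>z. - y z) \<le> - p y"
    using le[OF Gc(4)[OF y], of 1] sublinear_on_zero[OF G p] by simp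
qed

text \<open>A minimal sublinear functional is linear, because it cannot be lowered along any \<open>y\<close>.
  Zorn's lemma yields one below \<open>q\<close>, and lowering \<open>q\<close> along \<open>h\<close> beforehand fixes its value at \<open>h\<close>.\<close>

theorem Hahn_Banach_sublinear:
  assumes G: "real_subspace G" and q: "sublinear_on G q" and h: "h \<in> G"
  obtains F where "\<And>u. u \<in> G \<Longrightarrow> F u \<le> q u" "\<And>u v. u \<in> G \<Longrightarrow> v \<in> G \<Longrightarrow> F (\<lambda>z. u z + v z) = F u + F v"
    "\<And>r u. u \<in> G \<Longrightarrow> F (\<lambda>z. of_real r * u z) = r * F u" "F h = q h"
proof -
  note Gc = real_subspaceD[OF G]
  define low where "low p y = (\<lambda>x. if x \<in> G then INF t\<in>{0..}. p (\<lambda>z. x z + complex_of_real t * y z) - t * p y else 0)"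
    for p :: "('a \<Rightarrow> complex) \<Rightarrow> real" and y
  have low: "sublinear_on G (low p y)" "\<And>x. x \<in> G \<Longrightarrow> low p y x \<le> p x" "low p y (\<lambda>z. - y z) \<le> - p y"
    "\<And>x. x \<notin> G \<Longrightarrow> low p y x = 0" if "sublinear_on G p" "y \<in> G" for p y
  proof -
    note s = sublinear_shift[OF G that]
    show "sublinear_on G (low p y)"
      using s(1) Gc unfolding sublinear_on_def low_def by auto
    show "\<And>x. x \<in> G \<Longrightarrow> low p y x \<le> p x" using s(2) by (simp add: low_def)
    show "low p y (\<lambda>z. - y z) \<le> - p y" using s(3) Gc(4)[OF that(2)] by (simp add: low_def)
    show "\<And>x. x \<notin> G \<Longrightarrow> low p y x = 0" by (simp add: low_def)
  qed
  define q1 where "q1 = low q h"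
  note q1 = low[OF q h, folded q1_def]
  define A where "A = {p. sublinear_on G p \<and> (\<forall>u\<in>G. p u \<le> q1 u) \<and> (\<forall>u. u \<notin> G \<longrightarrow> p u = 0)}"
  define P where "P p p' \<longleftrightarrow> (\<forall>u. p' u \<le> p u)" for p p' :: "('a \<Rightarrow> complex) \<Rightarrow> real"
  have Alow: "- q1 (\<lambda>z. - u z) \<le> p u" if "p \<in> A" "u \<in> G" for p u
  proof -
    have "p (\<lambda>z. - u z) \<le> q1 (\<lambda>z. - u z)" using that Gc(4) by (auto simp: A_def)
    moreover have "- p (\<lambda>z. - u z) \<le> p u" using sublinear_on_neg[OF G _ that(2)] that by (auto simp: A_def)
    ultimately show ?thesis by simp
  qed
  have "\<exists>m\<in>A. \<forall>a\<in>A. P m a \<longrightarrow> a = m"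
  proof (rule predicate_Zorn)
    show "partial_order_on A (relation_of P A)"
      by (rule partial_order_on_relation_ofI) (auto simp: P_def fun_eq_iff intro: order_trans order_antisym)
    fix C assume C: "C \<in> Chains (relation_of P A)"
    then have CA: "C \<subseteq> A" and ch: "\<And>a b. a \<in> C \<Longrightarrow> b \<in> C \<Longrightarrow> P a b \<or> P b a"
      unfolding Chains_def relation_of_def by auto
    show "\<exists>u\<in>A. \<forall>a\<in>C. P a u"
    proof (cases "C = {}")
      case True
      have "q1 \<in> A" using q1 by (simp add: A_def)
      then show ?thesis using True by auto
    next
      case False
      define w where "w = (\<lambda>x. if x \<in> G then INF p\<in>C. p x else 0)"
      have bdd: "bdd_below ((\<lambda>p. p x) ` C)" if "x \<in> G" for x
        by (rule bdd_belowI2[where m = "- q1 (\<lambda>z. - x z)"]) (use Alow[OF _ that] CA in blast)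
      have le: "w x \<le> p x" if "x \<in> G" "p \<in> C" for x p
        using cINF_lower[OF bdd[OF that(1)] that(2)] that by (simp add: w_def)
      have ge: "m \<le> w x" if "x \<in> G" "\<And>p. p \<in> C \<Longrightarrow> m \<le> p x" for m x
        using cINF_greatest[OF False, of m "\<lambda>p. p x"] that by (simp add: w_def)
      have sub: "sublinear_on G p" if "p \<in> C" for p using that CA by (auto simp: A_def)
      have "sublinear_on G w"
      proof (rule sublinear_onI[OF G])
        fix u v assume u: "u \<in> G" and v: "v \<in> G"
        note uv = Gc(2)[OF u v]
        have key: "w (\<lambda>z. u z + v z) \<le> p u + p' v" if p: "p \<in> C" "p' \<in> C" for p p'
        proof -
          obtain s where s: "s \<in> C" "s u \<le> p u" "s v \<le> p' v"
            using ch[OF p] p unfolding P_def by blast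
          have "w (\<lambda>z. u z + v z) \<le> s (\<lambda>z. u z + v z)" by (rule le[OF uv s(1)])
          also have "\<dots> \<le> s u + s v" by (rule sublinear_onD(1)[OF sub[OF s(1)] u v])
          finally show ?thesis using s by simp
        qed
        have key': "w (\<lambda>z. u z + v z) - p u \<le> w v" if p: "p \<in> C" for p
        proof (rule ge[OF v])
          fix p' assume "p' \<in> C"
          then show "w (\<lambda>z. u z + v z) - p u \<le> p' v" using key[OF p, of p'] by linarith
        qed
        have "w (\<lambda>z. u z + v z) - w v \<le> w u"
        proof (rule ge[OF u])
          fix p assume "p \<in> C"
          then show "w (\<lambda>z. u z + v z) - w v \<le> p u" using key'[of p] by linarith
        qed
        then show "w (\<lambda>z. u z + v z) \<le> w u + w v" by simp
      next
        have z: "p (\<lambda>_. 0) = 0" if "p \<in> C" for p by (rule sublinear_on_zero[OF G sub[OF that]])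
        obtain p where "p \<in> C" using False by blast
        then have "w (\<lambda>_. 0) \<le> 0" using le[OF Gc(1)] z by fastforce
        moreover have "0 \<le> w (\<lambda>_. 0)" by (rule ge[OF Gc(1)]) (simp add: z)
        ultimately show "w (\<lambda>_. 0) = 0" by simp
      next
        fix r :: real and u assume r: "r > 0" and u: "u \<in> G"
        have "w (\<lambda>z. of_real r * u z) / r \<le> p u" if p: "p \<in> C" for p
        proof -
          have "w (\<lambda>z. of_real r * u z) \<le> p (\<lambda>z. of_real r * u z)" by (rule le[OF Gc(3)[OF u] p])
          also have "\<dots> = r * p u" by (rule sublinear_onD(2)[OF sub[OF p] _ u]) (use r in simp)
          finally show ?thesis using r by (simp add: field_simps)
        qed
        then have "w (\<lambda>z. of_real r * u z) / r \<le> w u" by (rule ge[OF u])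
        then show "w (\<lambda>z. of_real r * u z) \<le> r * w u" using r by (simp add: field_simps)
      qed
      moreover have "w u \<le> q1 u" if u: "u \<in> G" for u
      proof -
        obtain p where p: "p \<in> C" using False by blast
        have "w u \<le> p u" by (rule le[OF u p])
        also have "\<dots> \<le> q1 u" using p CA u by (auto simp: A_def)
        finally show ?thesis .
      qed
      ultimately have wA: "w \<in> A" by (simp add: A_def w_def)
      have "P p w" if p: "p \<in> C" for p
        unfolding P_def
      proof
        fix u show "w u \<le> p u"
        proof (cases "u \<in> G")
          case True
          then show ?thesis by (rule le[OF _ p])
        next
          case False
          then show ?thesis using p CA by (auto simp: w_def A_def)
        qed
      qed
      then show ?thesis using wA by blast
    qed
  qed
  then obtain F where FA: "F \<in> A" and Fmin: "\<And>a. a \<in> A \<Longrightarrow> P F a \<Longrightarrow> a = F" by blast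
  have Fs: "sublinear_on G F" and Fq: "\<And>u. u \<in> G \<Longrightarrow> F u \<le> q1 u" and F0: "\<And>u. u \<notin> G \<Longrightarrow> F u = 0"
    using FA by (auto simp: A_def)
  have neg: "F (\<lambda>z. - y z) = - F y" if y: "y \<in> G" for y
  proof -
    note l = low[OF Fs y]
    have "low F y \<in> A" using l Fq by (auto simp: A_def intro: order_trans)
    moreover have "low F y u \<le> F u" for u using l(2,4)[of u] F0[of u] by (cases "u \<in> G") auto
    then have "P F (low F y)" by (simp add: P_def)
    ultimately have "low F y = F" by (rule Fmin)
    then have "F (\<lambda>z. - y z) \<le> - F y" using l(3) by simp
    moreover have "- F (\<lambda>z. - y z) \<le> F y" by (rule sublinear_on_neg[OF G Fs y])
    ultimately show ?thesis by simp
  qed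
  show ?thesis
  proof (rule that[of F])
    show "F u \<le> q u" if "u \<in> G" for u using Fq[OF that] q1(2)[OF that] by simp
    show add: "F (\<lambda>z. u z + v z) = F u + F v" if u: "u \<in> G" and v: "v \<in> G" for u v
    proof (rule antisym)
      show "F (\<lambda>z. u z + v z) \<le> F u + F v" by (rule sublinear_onD(1)[OF Fs u v])
      have "F (\<lambda>z. - u z + - v z) \<le> F (\<lambda>z. - u z) + F (\<lambda>z. - v z)"
        by (rule sublinear_onD(1)[OF Fs Gc(4)[OF u] Gc(4)[OF v]])
      moreover have "F (\<lambda>z. - u z + - v z) = - F (\<lambda>z. u z + v z)"
        using neg[OF Gc(2)[OF u v]] by (simp add: add.commute)
      ultimately show "F u + F v \<le> F (\<lambda>z. u z + v z)" by (simp add: neg u v)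
    qed
    show "F (\<lambda>z. of_real r * u z) = r * F u" if u: "u \<in> G" for r u
    proof (cases "r \<ge> 0")
      case True
      then show ?thesis by (rule sublinear_onD(2)[OF Fs _ u])
    next
      case False
      then have "F (\<lambda>z. of_real (- r) * u z) = - r * F u" by (intro sublinear_onD(2)[OF Fs _ u]) simp
      moreover have "F (\<lambda>z. of_real (- r) * u z) = - F (\<lambda>z. of_real r * u z)"
        using neg[OF Gc(3)[OF u, of r]] by simp
      ultimately show ?thesis by simp
    qed
    have "- F h \<le> - q h" using Fq[OF Gc(4)[OF h]] q1(3) neg[OF h] by simp
    moreover have "F h \<le> q h" using Fq[OF h] q1(2)[OF h] by simp
    ultimately show "F h = q h" by simp
  qed
qed

section \<open>Closable multipliers are quotients\<close>

subsection \<open>Nuclear kernels\<close>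

definition nuclear_kernels :: "'a measure \<Rightarrow> 'b measure \<Rightarrow> ('a \<times> 'b \<Rightarrow> complex) set" where
  "nuclear_kernels M N = {h. \<exists>f g. nuclear_rep M N f g \<and> (AE p in M \<Otimes>\<^sub>M N. h p = rep_kernel f g p)}"

text \<open>The predual of the operators is the space of nuclear kernels; this is the domain of the adjoint of
  the multiplier, which acts there by multiplication with \<open>\<phi>\<close> as well.\<close>

definition adjoint_domain ::
    "'a measure \<Rightarrow> 'b measure \<Rightarrow> ('a \<times> 'b \<Rightarrow> complex) \<Rightarrow> ('a \<times> 'b \<Rightarrow> complex) set" where
  "adjoint_domain M N \<phi> = {h \<in> nuclear_kernels M N. (\<lambda>p. \<phi> p * h p) \<in> nuclear_kernels M N}"

definition rep_weight ::
    "'a measure \<Rightarrow> 'b measure \<Rightarrow> (nat \<Rightarrow> 'a \<Rightarrow> complex) \<Rightarrow> (nat \<Rightarrow> 'b \<Rightarrow> complex) \<Rightarrow> real" where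
  "rep_weight M N f g = (\<Sum>i. L2_norm M (f i) * L2_norm N (g i))"

lemma rep_weight_nonneg: "nuclear_rep M N f g \<Longrightarrow> 0 \<le> rep_weight M N f g"
  unfolding rep_weight_def by (rule suminf_nonneg) (auto dest: nuclear_repD(3))

lemma rep_weight_add:
  assumes r: "nuclear_rep M N f g" "nuclear_rep M N f' g'"
  shows "rep_weight M N (interleave f f') (interleave g g') = rep_weight M N f g + rep_weight M N f' g'"
proof -
  have "(\<lambda>n. if even n then L2_norm M (f (n div 2)) * L2_norm N (g (n div 2))
      else L2_norm M (f' ((n - 1) div 2)) * L2_norm N (g' ((n - 1) div 2))) sums
      (rep_weight M N f' g' + rep_weight M N f g)"
    unfolding rep_weight_def by (rule sums_if) (intro summable_sums nuclear_repD(3) r)+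
  moreover have "(\<lambda>n. if even n then L2_norm M (f (n div 2)) * L2_norm N (g (n div 2))
      else L2_norm M (f' ((n - 1) div 2)) * L2_norm N (g' ((n - 1) div 2))) =
      (\<lambda>n. L2_norm M (interleave f f' n) * L2_norm N (interleave g g' n))"
    by (auto simp: interleave_def)
  ultimately show ?thesis by (simp add: rep_weight_def sums_iff add.commute)
qed

lemma rep_weight_scale:
  assumes "nuclear_rep M N f g"
  shows "rep_weight M N (\<lambda>i x. c * f i x) g = cmod c * rep_weight M N f g"
  using suminf_mult[OF nuclear_repD(3)[OF assms], of "cmod c"] by (simp add: rep_weight_def mult.assoc)

lemma rep_weight_zero: "rep_weight M N (\<lambda>i x. 0) (\<lambda>i y. 0) = 0"
  by (simp add: rep_weight_def)

lemma nuclear_kernelsI: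
  "nuclear_rep M N f g \<Longrightarrow> AE p in M \<Otimes>\<^sub>M N. h p = rep_kernel f g p \<Longrightarrow> h \<in> nuclear_kernels M N"
  unfolding nuclear_kernels_def by (intro CollectI exI conjI)

lemma nuclear_kernelsE:
  assumes "h \<in> nuclear_kernels M N"
  obtains f g where "nuclear_rep M N f g" "AE p in M \<Otimes>\<^sub>M N. h p = rep_kernel f g p"
  using assms unfolding nuclear_kernels_def by (elim CollectE exE conjE) (rule that)

lemma nuclear_kernels_cong:
  assumes h: "h \<in> nuclear_kernels M N" and ae: "AE p in M \<Otimes>\<^sub>M N. h' p = h p"
  shows "h' \<in> nuclear_kernels M N"
proof -
  obtain f g where fg: "nuclear_rep M N f g" "AE p in M \<Otimes>\<^sub>M N. h p = rep_kernel f g p"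
    by (rule nuclear_kernelsE[OF h])
  have "AE p in M \<Otimes>\<^sub>M N. h' p = rep_kernel f g p" using ae fg(2) by eventually_elim simp
  then show ?thesis by (rule nuclear_kernelsI[OF fg(1)])
qed

lemma nuclear_kernels_add:
  assumes N: "sigma_finite_measure N" and h: "h \<in> nuclear_kernels M N" "h' \<in> nuclear_kernels M N"
  shows "(\<lambda>p. h p + h' p) \<in> nuclear_kernels M N"
proof -
  obtain f g where fg: "nuclear_rep M N f g" "AE p in M \<Otimes>\<^sub>M N. h p = rep_kernel f g p"
    by (rule nuclear_kernelsE[OF h(1)])
  obtain f' g' where fg': "nuclear_rep M N f' g'" "AE p in M \<Otimes>\<^sub>M N. h' p = rep_kernel f' g' p"
    by (rule nuclear_kernelsE[OF h(2)])
  note a = rep_add[OF N fg(1) fg'(1)]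
  have "AE p in M \<Otimes>\<^sub>M N. h p + h' p = rep_kernel (interleave f f') (interleave g g') p"
    using fg(2) fg'(2) a(2) by eventually_elim simp
  then show ?thesis by (rule nuclear_kernelsI[OF a(1)])
qed

lemma nuclear_kernels_scale:
  assumes N: "sigma_finite_measure N" and h: "h \<in> nuclear_kernels M N"
  shows "(\<lambda>p. c * h p) \<in> nuclear_kernels M N"
proof -
  obtain f g where fg: "nuclear_rep M N f g" "AE p in M \<Otimes>\<^sub>M N. h p = rep_kernel f g p"
    by (rule nuclear_kernelsE[OF h])
  note a = rep_scale[OF N fg(1), where c = c]
  have "AE p in M \<Otimes>\<^sub>M N. c * h p = rep_kernel (\<lambda>i x. c * f i x) g p"
    using fg(2) a(2) by eventually_elim simp
  then show ?thesis by (rule nuclear_kernelsI[OF a(1)])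
qed

lemma nuclear_kernels_zero: "(\<lambda>p. 0) \<in> nuclear_kernels M N"
  by (rule nuclear_kernelsI[OF rep_zero(1)]) (simp add: rep_zero(2))

lemma nuclear_kernels_subspace: "sigma_finite_measure N \<Longrightarrow> real_subspace (nuclear_kernels M N)"
  unfolding real_subspace_def
  by (intro conjI ballI allI nuclear_kernels_zero nuclear_kernels_add nuclear_kernels_scale)

lemma single_rep:
  assumes f: "f \<in> L2 M" and g: "g \<in> L2 N"
  defines "f' \<equiv> \<lambda>i::nat. if i = 0 then f else (\<lambda>_. 0)" and "g' \<equiv> \<lambda>i::nat. if i = 0 then g else (\<lambda>_. 0)"
  shows "nuclear_rep M N f' g'" and "rep_kernel f' g' = tensor f g"
    and "rep_weight M N f' g' = L2_norm M f * L2_norm N g"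
proof -
  have w: "(\<lambda>i. L2_norm M (f' i) * L2_norm N (g' i)) = (\<lambda>i. if i = 0 then L2_norm M f * L2_norm N g else 0)"
    by (auto simp: f'_def g'_def)
  have s: "(\<lambda>i. if i = (0::nat) then c else (0::'z::real_normed_vector)) sums c" for c
    using sums_single[of 0 "\<lambda>_. c"] by simp
  show "nuclear_rep M N f' g'"
    unfolding nuclear_rep_def w using f g sums_summable[OF s] by (simp add: f'_def g'_def)
  show "rep_weight M N f' g' = L2_norm M f * L2_norm N g"
    unfolding rep_weight_def w by (rule sums_unique[OF s, symmetric])
  show "rep_kernel f' g' = tensor f g"
  proof
    fix p
    have "(\<lambda>i. tensor (f' i) (g' i) p) = (\<lambda>i. if i = 0 then tensor f g p else 0)"
      by (auto simp: f'_def g'_def tensor_def)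
    then show "rep_kernel f' g' p = tensor f g p"
      unfolding rep_kernel_def using sums_unique[OF s, of "tensor f g p"] by simp
  qed
qed

lemma tensor_nuclear: "f \<in> L2 M \<Longrightarrow> g \<in> L2 N \<Longrightarrow> tensor f g \<in> nuclear_kernels M N"
  using single_rep[of f M g N] by (intro nuclear_kernelsI) auto

lemma adjoint_domain_cong:
  assumes h: "h \<in> adjoint_domain M N \<phi>" and ae: "AE p in M \<Otimes>\<^sub>M N. h' p = h p"
  shows "h' \<in> adjoint_domain M N \<phi>"
proof -
  have "AE p in M \<Otimes>\<^sub>M N. \<phi> p * h' p = \<phi> p * h p" using ae by eventually_elim simp
  then show ?thesis
    using h nuclear_kernels_cong[OF _ ae] nuclear_kernels_cong[of "\<lambda>p. \<phi> p * h p"] by (simp add: adjoint_domain_def)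
qed

lemma adjoint_domain_add:
  assumes N: "sigma_finite_measure N" and h: "h \<in> adjoint_domain M N \<phi>" "h' \<in> adjoint_domain M N \<phi>"
  shows "(\<lambda>p. h p + h' p) \<in> adjoint_domain M N \<phi>"
  using h nuclear_kernels_add[OF N, of h M h'] nuclear_kernels_add[OF N, of "\<lambda>p. \<phi> p * h p" M "\<lambda>p. \<phi> p * h' p"]
  by (simp add: adjoint_domain_def distrib_left)

lemma adjoint_domain_scale:
  assumes N: "sigma_finite_measure N" and h: "h \<in> adjoint_domain M N \<phi>"
  shows "(\<lambda>p. c * h p) \<in> adjoint_domain M N \<phi>"
  using h nuclear_kernels_scale[OF N, of h M c] nuclear_kernels_scale[OF N, of "\<lambda>p. \<phi> p * h p" M c]
  by (simp add: adjoint_domain_def mult.left_commute[of _ c])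

lemma adjoint_domain_zero: "(\<lambda>p. 0) \<in> adjoint_domain M N \<phi>"
  using nuclear_kernels_zero by (simp add: adjoint_domain_def)

subsection \<open>The distance to the adjoint domain\<close>

text \<open>The distance is taken in the projective tensor norm, the infimum of \<open>rep_weight M N f g\<close> over all
  representations.\<close>

definition adjoint_distance ::
    "'a measure \<Rightarrow> 'b measure \<Rightarrow> ('a \<times> 'b \<Rightarrow> complex) \<Rightarrow> ('a \<times> 'b \<Rightarrow> complex) \<Rightarrow> real" where
  "adjoint_distance M N \<phi> h = Inf {rep_weight M N f g | f g. nuclear_rep M N f g \<and>
     (\<lambda>p. h p - rep_kernel f g p) \<in> adjoint_domain M N \<phi>}"

lemma adjoint_distance_le:
  assumes "nuclear_rep M N f g" "(\<lambda>p. h p - rep_kernel f g p) \<in> adjoint_domain M N \<phi>"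
  shows "adjoint_distance M N \<phi> h \<le> rep_weight M N f g"
  unfolding adjoint_distance_def
  by (rule cInf_lower) (use assms in \<open>auto intro!: bdd_belowI[where m = 0] rep_weight_nonneg\<close>)

lemma adjoint_distance_le_norm:
  assumes r: "nuclear_rep M N f g" and ae: "AE p in M \<Otimes>\<^sub>M N. h p = rep_kernel f g p"
  shows "adjoint_distance M N \<phi> h \<le> rep_weight M N f g"
proof (rule adjoint_distance_le[OF r])
  have "AE p in M \<Otimes>\<^sub>M N. h p - rep_kernel f g p = 0" using ae by eventually_elim simp
  then show "(\<lambda>p. h p - rep_kernel f g p) \<in> adjoint_domain M N \<phi>"
    by (rule adjoint_domain_cong[OF adjoint_domain_zero])
qed

lemma adjoint_distance_ge:
  assumes h: "h \<in> nuclear_kernels M N"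
    and le: "\<And>f g. nuclear_rep M N f g \<Longrightarrow> (\<lambda>p. h p - rep_kernel f g p) \<in> adjoint_domain M N \<phi> \<Longrightarrow>
      m \<le> rep_weight M N f g"
  shows "m \<le> adjoint_distance M N \<phi> h"
  unfolding adjoint_distance_def
proof (rule cInf_greatest)
  obtain f g where fg: "nuclear_rep M N f g" "AE p in M \<Otimes>\<^sub>M N. h p = rep_kernel f g p"
    by (rule nuclear_kernelsE[OF h])
  have "AE p in M \<Otimes>\<^sub>M N. h p - rep_kernel f g p = 0" using fg(2) by eventually_elim simp
  then have "(\<lambda>p. h p - rep_kernel f g p) \<in> adjoint_domain M N \<phi>"
    by (rule adjoint_domain_cong[OF adjoint_domain_zero])
  then show "{rep_weight M N f g | f g. nuclear_rep M N f g \<and>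
     (\<lambda>p. h p - rep_kernel f g p) \<in> adjoint_domain M N \<phi>} \<noteq> {}" using fg(1) by blast
qed (use le in blast)

lemma adjoint_distance_domain:
  assumes d: "d \<in> adjoint_domain M N \<phi>"
  shows "adjoint_distance M N \<phi> d \<le> 0"
proof -
  have "(\<lambda>p. d p - rep_kernel (\<lambda>i x. 0) (\<lambda>i y. 0) p) \<in> adjoint_domain M N \<phi>"
    using d by (simp add: rep_zero(2))
  from adjoint_distance_le[OF rep_zero(1) this] show ?thesis by (simp add: rep_weight_zero)
qed

lemma adjoint_distance_sublinear:
  assumes N: "sigma_finite_measure N"
  shows "sublinear_on (nuclear_kernels M N) (adjoint_distance M N \<phi>)"
proof (rule sublinear_onI[OF nuclear_kernels_subspace[OF N]])
  let ?q = "adjoint_distance M N \<phi>"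
  fix u v assume u: "u \<in> nuclear_kernels M N" and v: "v \<in> nuclear_kernels M N"
  have key: "?q (\<lambda>z. u z + v z) \<le> rep_weight M N f g + rep_weight M N f' g'"
    if r: "nuclear_rep M N f g" "nuclear_rep M N f' g'"
      and d: "(\<lambda>p. u p - rep_kernel f g p) \<in> adjoint_domain M N \<phi>"
        "(\<lambda>p. v p - rep_kernel f' g' p) \<in> adjoint_domain M N \<phi>" for f g f' g'
  proof -
    note a = rep_add[OF N r]
    have "AE p in M \<Otimes>\<^sub>M N. u p + v p - rep_kernel (interleave f f') (interleave g g') p =
        (u p - rep_kernel f g p) + (v p - rep_kernel f' g' p)"
      using a(2) by eventually_elim simp
    then have "(\<lambda>p. u p + v p - rep_kernel (interleave f f') (interleave g g') p) \<in> adjoint_domain M N \<phi>"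
      by (rule adjoint_domain_cong[OF adjoint_domain_add[OF N d]])
    from adjoint_distance_le[OF a(1) this] show ?thesis by (simp add: rep_weight_add[OF r])
  qed
  have key': "?q (\<lambda>z. u z + v z) - rep_weight M N f g \<le> ?q v"
    if r: "nuclear_rep M N f g" "(\<lambda>p. u p - rep_kernel f g p) \<in> adjoint_domain M N \<phi>" for f g
  proof (rule adjoint_distance_ge[OF v])
    fix f' g' assume "nuclear_rep M N f' g'" "(\<lambda>p. v p - rep_kernel f' g' p) \<in> adjoint_domain M N \<phi>"
    from key[OF r(1) this(1) r(2) this(2)]
    show "?q (\<lambda>z. u z + v z) - rep_weight M N f g \<le> rep_weight M N f' g'" by linarith
  qed
  have "?q (\<lambda>z. u z + v z) - ?q v \<le> ?q u"
  proof (rule adjoint_distance_ge[OF u])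
    fix f g assume "nuclear_rep M N f g" "(\<lambda>p. u p - rep_kernel f g p) \<in> adjoint_domain M N \<phi>"
    from key'[OF this] show "?q (\<lambda>z. u z + v z) - ?q v \<le> rep_weight M N f g" by linarith
  qed
  then show "?q (\<lambda>z. u z + v z) \<le> ?q u + ?q v" by simp
next
  show "adjoint_distance M N \<phi> (\<lambda>_. 0) = 0"
  proof (rule antisym)
    show "adjoint_distance M N \<phi> (\<lambda>_. 0) \<le> 0" by (rule adjoint_distance_domain[OF adjoint_domain_zero])
    show "0 \<le> adjoint_distance M N \<phi> (\<lambda>_. 0)"
      by (rule adjoint_distance_ge[OF nuclear_kernels_zero rep_weight_nonneg])
  qed
next
  fix r :: real and u assume r: "r > 0" and u: "u \<in> nuclear_kernels M N"
  have "adjoint_distance M N \<phi> (\<lambda>z. of_real r * u z) / r \<le> adjoint_distance M N \<phi> u"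
  proof (rule adjoint_distance_ge[OF u])
    fix f g assume fg: "nuclear_rep M N f g" and d: "(\<lambda>p. u p - rep_kernel f g p) \<in> adjoint_domain M N \<phi>"
    note s = rep_scale[OF N fg, where c = "of_real r"]
    have "AE p in M \<Otimes>\<^sub>M N. of_real r * u p - rep_kernel (\<lambda>i x. of_real r * f i x) g p =
        of_real r * (u p - rep_kernel f g p)"
      using s(2) by eventually_elim (simp add: right_diff_distrib)
    then have "(\<lambda>p. of_real r * u p - rep_kernel (\<lambda>i x. of_real r * f i x) g p) \<in> adjoint_domain M N \<phi>"
      by (rule adjoint_domain_cong[OF adjoint_domain_scale[OF N d]])
    from adjoint_distance_le[OF s(1) this]
    show "adjoint_distance M N \<phi> (\<lambda>z. of_real r * u z) / r \<le> rep_weight M N f g"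
      using r by (simp add: rep_weight_scale[OF fg] field_simps)
  qed
  then show "adjoint_distance M N \<phi> (\<lambda>z. of_real r * u z) \<le> r * adjoint_distance M N \<phi> u"
    using r by (simp add: field_simps)
qed

subsection \<open>Bounded functionals on nuclear kernels are operators\<close>

lemma rep_kernel_tail_AE:
  assumes N: "sigma_finite_measure N" and r: "nuclear_rep M N f g"
  shows "nuclear_rep M N (\<lambda>i. f (i + n)) (\<lambda>i. g (i + n))"
    and "AE p in M \<Otimes>\<^sub>M N. rep_kernel f g p - (\<Sum>i<n. tensor (f i) (g i) p) =
      rep_kernel (\<lambda>i. f (i + n)) (\<lambda>i. g (i + n)) p"
proof -
  show "nuclear_rep M N (\<lambda>i. f (i + n)) (\<lambda>i. g (i + n))"
    using nuclear_repD[OF r] summable_iff_shift[of "\<lambda>i. L2_norm M (f i) * L2_norm N (g i)" n]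
    by (simp add: nuclear_rep_def)
  show "AE p in M \<Otimes>\<^sub>M N. rep_kernel f g p - (\<Sum>i<n. tensor (f i) (g i) p) =
      rep_kernel (\<lambda>i. f (i + n)) (\<lambda>i. g (i + n)) p"
    using rep_kernel_sums_AE[OF N r]
  proof eventually_elim
    case (elim p)
    then show ?case
      using suminf_minus_initial_segment[OF sums_summable[OF elim], of n] by (simp add: rep_kernel_def)
  qed
qed

text \<open>The real functional \<open>F\<close> is the real part of the complex linear functional
  \<open>\<Phi> h = F h - \<i> * F (\<i> * h)\<close>. By the Riesz representation, \<open>\<Phi>\<close> applied to elementary tensors is the
  form of a bounded operator \<open>T\<close>; by continuity, \<open>\<Phi>\<close> is the pairing with \<open>T\<close> on all nuclear kernels.\<close>

lemma functional_is_operator: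
  fixes M :: "'a measure" and N :: "'b measure"
  assumes N: "sigma_finite_measure N"
    and F: "\<And>h h'. h \<in> nuclear_kernels M N \<Longrightarrow> h' \<in> nuclear_kernels M N \<Longrightarrow> F (\<lambda>p. h p + h' p) = F h + F h'"
      "\<And>r h. h \<in> nuclear_kernels M N \<Longrightarrow> F (\<lambda>p. of_real r * h p) = r * F h"
    and le: "\<And>f g h. nuclear_rep M N f g \<Longrightarrow> AE p in M \<Otimes>\<^sub>M N. h p = rep_kernel f g p \<Longrightarrow>
      F h \<le> rep_weight M N f g"
  obtains T where "T \<in> bounded_ops M N"
    "\<And>f g. nuclear_rep M N f g \<Longrightarrow>
      pairing N T f g = of_real (F (rep_kernel f g)) - \<i> * of_real (F (\<lambda>p. \<i> * rep_kernel f g p))"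
    "\<And>f g. f \<in> L2 M \<Longrightarrow> g \<in> L2 N \<Longrightarrow> F (tensor f g) = Re (L2_inner N (T f) g)"
proof -
  let ?G = "nuclear_kernels M N"
  define \<Phi> where "\<Phi> h = complex_of_real (F h) - \<i> * complex_of_real (F (\<lambda>p. \<i> * h p))" for h
  note add = nuclear_kernels_add[OF N] and scale = nuclear_kernels_scale[OF N]
  have Fabs: "\<bar>F h\<bar> \<le> rep_weight M N f g" if r: "nuclear_rep M N f g" and ae: "AE p in M \<Otimes>\<^sub>M N. h p = rep_kernel f g p" for f g h
  proof -
    have hG: "h \<in> ?G" by (rule nuclear_kernelsI[OF r ae])
    note s = rep_scale[OF N r, where c = "-1"]
    have "AE p in M \<Otimes>\<^sub>M N. of_real (-1) * h p = rep_kernel (\<lambda>i x. -1 * f i x) g p"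
      using ae s(2) by eventually_elim simp
    from le[OF s(1) this] have "F (\<lambda>p. of_real (-1) * h p) \<le> rep_weight M N f g"
      unfolding rep_weight_scale[OF r] by simp
    then have "- F h \<le> rep_weight M N f g" unfolding F(2)[OF hG] by simp
    then show ?thesis using le[OF r ae] by linarith
  qed
  have \<Phi>add: "\<Phi> (\<lambda>p. h p + h' p) = \<Phi> h + \<Phi> h'" if h: "h \<in> ?G" "h' \<in> ?G" for h h'
    using F(1)[OF h] F(1)[OF scale[OF h(1), of \<i>] scale[OF h(2), of \<i>]] by (simp add: \<Phi>_def distrib_left)
  have \<Phi>scale: "\<Phi> (\<lambda>p. c * h p) = c * \<Phi> h" if h: "h \<in> ?G" for h c
  proof -
    obtain a b where c: "c = of_real a + \<i> * of_real b" using complex_eq[of c] by blast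
    note ih = scale[OF h, of \<i>]
    have "F (\<lambda>p. c * h p) = F (\<lambda>p. of_real a * h p + of_real b * (\<i> * h p))"
      by (simp add: c algebra_simps)
    also have "\<dots> = a * F h + b * F (\<lambda>p. \<i> * h p)"
      by (simp only: F(1)[OF scale[OF h] scale[OF ih]] F(2)[OF h] F(2)[OF ih])
    finally have 1: "F (\<lambda>p. c * h p) = a * F h + b * F (\<lambda>p. \<i> * h p)" .
    have ic: "\<i> * (c * z) = of_real a * (\<i> * z) + of_real (- b) * z" for z
      unfolding c by (simp add: algebra_simps)
    have "F (\<lambda>p. \<i> * (c * h p)) = a * F (\<lambda>p. \<i> * h p) + (- b) * F h"
      unfolding ic by (simp only: F(1)[OF scale[OF ih] scale[OF h]] F(2)[OF h] F(2)[OF ih])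
    with 1 show ?thesis
      unfolding \<Phi>_def c by (simp add: complex_eq_iff algebra_simps)
  qed
  have \<Phi>abs: "cmod (\<Phi> h) \<le> 2 * rep_weight M N f g"
    if r: "nuclear_rep M N f g" and ae: "AE p in M \<Otimes>\<^sub>M N. h p = rep_kernel f g p" for f g h
  proof -
    note s = rep_scale[OF N r, where c = \<i>]
    have "AE p in M \<Otimes>\<^sub>M N. \<i> * h p = rep_kernel (\<lambda>i x. \<i> * f i x) g p"
      using ae s(2) by eventually_elim simp
    from Fabs[OF s(1) this] have "\<bar>F (\<lambda>p. \<i> * h p)\<bar> \<le> rep_weight M N f g"
      unfolding rep_weight_scale[OF r] by simp
    moreover have "cmod (\<Phi> h) \<le> \<bar>F h\<bar> + \<bar>F (\<lambda>p. \<i> * h p)\<bar>"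
      unfolding \<Phi>_def by (rule order_trans[OF norm_triangle_ineq4]) (simp add: norm_mult)
    ultimately show ?thesis using Fabs[OF r ae] by linarith
  qed
  have \<Phi>t: "cmod (\<Phi> (tensor f g)) \<le> 2 * (L2_norm M f * L2_norm N g)" if "f \<in> L2 M" "g \<in> L2 N" for f g
    using \<Phi>abs[OF single_rep(1)[OF that], of "tensor f g"] by (simp add: single_rep[OF that])
  have tadd: "tensor (\<lambda>x. f x + f' x) g = (\<lambda>p. tensor f g p + tensor f' g p)"
    "tensor f (\<lambda>y. g y + g' y) = (\<lambda>p. tensor f g p + tensor f g' p)" for f f' :: "'a \<Rightarrow> complex" and g g' :: "'b \<Rightarrow> complex"
    by (simp_all add: tensor_def algebra_simps)
  have tscale: "tensor (\<lambda>x. c * f x) g = (\<lambda>p. c * tensor f g p)"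
    "tensor f (\<lambda>y. c * g y) = (\<lambda>p. cnj c * tensor f g p)" for f :: "'a \<Rightarrow> complex" and g :: "'b \<Rightarrow> complex" and c
    by (simp_all add: tensor_def algebra_simps)
  have "\<exists>u. u \<in> L2 N \<and> (\<forall>g\<in>L2 N. cnj (\<Phi> (tensor f g)) = L2_inner N g u)" if f: "f \<in> L2 M" for f
  proof -
    obtain u where "u \<in> L2 N" "\<And>g. g \<in> L2 N \<Longrightarrow> cnj (\<Phi> (tensor f g)) = L2_inner N g u"
    proof (rule Riesz_representation[of N "\<lambda>g. cnj (\<Phi> (tensor f g))" "2 * L2_norm M f"])
      show "cnj (\<Phi> (tensor f (\<lambda>x. g x + g' x))) = cnj (\<Phi> (tensor f g)) + cnj (\<Phi> (tensor f g'))"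
        if "g \<in> L2 N" "g' \<in> L2 N" for g g'
        unfolding tadd by (simp add: \<Phi>add tensor_nuclear f that)
      show "cnj (\<Phi> (tensor f (\<lambda>x. c * g x))) = c * cnj (\<Phi> (tensor f g))" if "g \<in> L2 N" for g c
        unfolding tscale by (simp add: \<Phi>scale tensor_nuclear f that)
      show "cmod (cnj (\<Phi> (tensor f g))) \<le> 2 * L2_norm M f * L2_norm N g" if "g \<in> L2 N" for g
        using \<Phi>t[OF f that] by (simp add: mult.assoc)
    qed (rule that)
    then show ?thesis by blast
  qed
  then have "\<forall>f. \<exists>u. f \<in> L2 M \<longrightarrow> u \<in> L2 N \<and> (\<forall>g\<in>L2 N. cnj (\<Phi> (tensor f g)) = L2_inner N g u)" by blast
  from choice[OF this] obtain T where T: "\<forall>f. f \<in> L2 M \<longrightarrow> T f \<in> L2 N \<and>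
      (\<forall>g\<in>L2 N. cnj (\<Phi> (tensor f g)) = L2_inner N g (T f))"
    by (elim exE) (rule that)
  have TL: "T f \<in> L2 N" if "f \<in> L2 M" for f using T that by simp
  have T\<Phi>: "L2_inner N (T f) g = \<Phi> (tensor f g)" if "f \<in> L2 M" "g \<in> L2 N" for f g
  proof -
    have "L2_inner N g (T f) = cnj (\<Phi> (tensor f g))" using T that by simp
    then show ?thesis using L2_inner_commute[of N "T f" g] by simp
  qed
  have TB: "T \<in> bounded_ops M N"
    unfolding bounded_ops_def
  proof (intro CollectI conjI ballI allI exI[of _ 2])
    fix f assume f: "f \<in> L2 M"
    show "T f \<in> L2 N" by (rule TL[OF f])
    show "L2_norm N (T f) \<le> 2 * L2_norm M f"
    proof -
      have "(L2_norm N (T f))\<^sup>2 = cmod (\<Phi> (tensor f (T f)))"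
        using T\<Phi>[OF f TL[OF f]] L2_inner_self[of N "T f"] by (metis norm_of_real abs_of_nonneg zero_le_power2)
      also have "\<dots> \<le> 2 * (L2_norm M f * L2_norm N (T f))" by (rule \<Phi>t[OF f TL[OF f]])
      finally have "L2_norm N (T f) * L2_norm N (T f) \<le> (2 * L2_norm M f) * L2_norm N (T f)"
        by (simp add: power2_eq_square)
      then show ?thesis
        using L2_norm_nonneg[of N "T f"] L2_norm_nonneg[of M f]
        by (cases "L2_norm N (T f) = 0") (auto simp: mult_le_cancel_right)
    qed
    show "AE y in N. T (\<lambda>x. c * f x) y = c * T f y" for c
    proof -
      have L: "T (\<lambda>x. c * f x) \<in> L2 N" "(\<lambda>y. c * T f y) \<in> L2 N" by (intro TL L2_scale f)+
      have "AE y in N. T (\<lambda>x. c * f x) y - c * T f y = 0"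
      proof (rule L2_inner_self_eq_0[OF L2_diff[OF L]])
        fix g assume g: "g \<in> L2 N"
        show "L2_inner N (\<lambda>y. T (\<lambda>x. c * f x) y - c * T f y) g = 0"
          unfolding L2_inner_diff_left[OF L g] L2_inner_scale_left T\<Phi>[OF L2_scale[OF f] g] T\<Phi>[OF f g] tscale
          by (simp add: \<Phi>scale tensor_nuclear f g)
      qed
      then show ?thesis by eventually_elim simp
    qed
    fix f' assume f': "f' \<in> L2 M"
    have L: "T (\<lambda>x. f x + f' x) \<in> L2 N" "(\<lambda>y. T f y + T f' y) \<in> L2 N" by (intro TL L2_add f f')+
    have "AE y in N. T (\<lambda>x. f x + f' x) y - (T f y + T f' y) = 0"
    proof (rule L2_inner_self_eq_0[OF L2_diff[OF L]])
      fix g assume g: "g \<in> L2 N"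
      show "L2_inner N (\<lambda>y. T (\<lambda>x. f x + f' x) y - (T f y + T f' y)) g = 0"
        unfolding L2_inner_diff_left[OF L g] L2_inner_add_left[OF TL[OF f] TL[OF f'] g]
          T\<Phi>[OF L2_add[OF f f'] g] T\<Phi>[OF f g] T\<Phi>[OF f' g] tadd
        by (simp add: \<Phi>add tensor_nuclear f f' g)
    qed
    then show "AE y in N. T (\<lambda>x. f x + f' x) y = T f y + T f' y" by eventually_elim simp
  qed
  have pair: "pairing N T f g = \<Phi> (rep_kernel f g)" if r: "nuclear_rep M N f g" for f g
  proof -
    note L = nuclear_repD[OF r]
    have sG: "(\<lambda>p. \<Sum>i<n. tensor (f i) (g i) p) \<in> ?G \<and>
        \<Phi> (\<lambda>p. \<Sum>i<n. tensor (f i) (g i) p) = (\<Sum>i<n. L2_inner N (T (f i)) (g i))" for n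
    proof (induction n)
      case 0
      have "\<Phi> (\<lambda>p. 0 * (0::complex)) = 0 * \<Phi> (\<lambda>p. 0)" by (rule \<Phi>scale[OF nuclear_kernels_zero])
      then show ?case using nuclear_kernels_zero by simp
    next
      case (Suc n)
      have t: "tensor (f n) (g n) \<in> ?G" by (rule tensor_nuclear[OF L(1,2)])
      show ?case
        using add[OF conjunct1[OF Suc.IH] t] \<Phi>add[OF conjunct1[OF Suc.IH] t] Suc.IH T\<Phi>[OF L(1,2), of n n] by simp
    qed
    have kG: "rep_kernel f g \<in> ?G" by (rule nuclear_kernelsI[OF r]) simp
    have bound: "cmod (\<Phi> (rep_kernel f g) - (\<Sum>i<n. L2_inner N (T (f i)) (g i))) \<le>
        2 * (\<Sum>i. L2_norm M (f (i + n)) * L2_norm N (g (i + n)))" for n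
    proof -
      let ?s = "\<lambda>p. \<Sum>i<n. tensor (f i) (g i) p"
      have sn: "?s \<in> ?G" and s\<Phi>: "\<Phi> ?s = (\<Sum>i<n. L2_inner N (T (f i)) (g i))" using sG[of n] by auto
      note t = rep_kernel_tail_AE[OF N r, of n]
      have "\<Phi> (\<lambda>p. rep_kernel f g p + -1 * ?s p) = \<Phi> (rep_kernel f g) + -1 * \<Phi> ?s"
        unfolding \<Phi>add[OF kG scale[OF sn]] \<Phi>scale[OF sn] ..
      then have "\<Phi> (rep_kernel f g) - (\<Sum>i<n. L2_inner N (T (f i)) (g i)) = \<Phi> (\<lambda>p. rep_kernel f g p - ?s p)"
        by (simp add: s\<Phi>)
      also have "cmod \<dots> \<le> 2 * rep_weight M N (\<lambda>i. f (i + n)) (\<lambda>i. g (i + n))"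
        by (rule \<Phi>abs[OF t])
      finally show ?thesis by (simp add: rep_weight_def)
    qed
    have lim: "(\<lambda>n. 2 * (\<Sum>i. L2_norm M (f (i + n)) * L2_norm N (g (i + n)))) \<longlonglongrightarrow> 2 * 0"
      by (intro tendsto_intros suminf_tail_tendsto_0 L(3))
    have "(\<lambda>n. \<Phi> (rep_kernel f g) - (\<Sum>i<n. L2_inner N (T (f i)) (g i))) \<longlonglongrightarrow> 0"
      by (rule Lim_null_comparison[OF always_eventually lim[unfolded mult_zero_right]]) (rule allI, rule bound)
    then have "(\<lambda>n. \<Sum>i<n. L2_inner N (T (f i)) (g i)) \<longlonglongrightarrow> \<Phi> (rep_kernel f g)"
      by (rule Lim_transform2[OF tendsto_const])
    then have "(\<lambda>i. L2_inner N (T (f i)) (g i)) sums \<Phi> (rep_kernel f g)" by (simp add: sums_def)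
    then show ?thesis by (simp add: pairing_def sums_iff)
  qed
  show ?thesis
  proof (rule that[OF TB])
    show "pairing N T f g = of_real (F (rep_kernel f g)) - \<i> * of_real (F (\<lambda>p. \<i> * rep_kernel f g p))"
      if "nuclear_rep M N f g" for f g
      using pair[OF that] by (simp add: \<Phi>_def)
    show "F (tensor f g) = Re (L2_inner N (T f) g)" if "f \<in> L2 M" "g \<in> L2 N" for f g
      unfolding T\<Phi>[OF that] by (simp add: \<Phi>_def)
  qed
qed

text \<open>Otherwise a functional that vanishes on the adjoint domain but not at \<open>tensor f g\<close> would give a nonzero
  operator that annihilates the adjoint domain.\<close>

lemma closable_imp_dense:
  assumes M: "sigma_finite_measure M" and N: "sigma_finite_measure N"
    and \<phi>: "\<phi> \<in> borel_measurable (M \<Otimes>\<^sub>M N)" and cl: "weak_star_closable_multiplier M N \<phi>"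
    and f: "f \<in> L2 M" and g: "g \<in> L2 N"
  shows "adjoint_distance M N \<phi> (tensor f g) = 0"
proof -
  obtain F where F: "\<And>u. u \<in> nuclear_kernels M N \<Longrightarrow> F u \<le> adjoint_distance M N \<phi> u"
    "\<And>u v. u \<in> nuclear_kernels M N \<Longrightarrow> v \<in> nuclear_kernels M N \<Longrightarrow> F (\<lambda>z. u z + v z) = F u + F v"
    "\<And>r u. u \<in> nuclear_kernels M N \<Longrightarrow> F (\<lambda>z. of_real r * u z) = r * F u"
    "F (tensor f g) = adjoint_distance M N \<phi> (tensor f g)"
    by (rule Hahn_Banach_sublinear[OF nuclear_kernels_subspace[OF N] adjoint_distance_sublinear[OF N, of M \<phi>]
          tensor_nuclear[OF f g]]) blast
  have F0: "F d = 0" if d: "d \<in> adjoint_domain M N \<phi>" for d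
  proof -
    have dG: "d \<in> nuclear_kernels M N" using d by (simp add: adjoint_domain_def)
    have le: "F e \<le> 0" if e: "e \<in> adjoint_domain M N \<phi>" for e
    proof -
      have "e \<in> nuclear_kernels M N" using e by (simp add: adjoint_domain_def)
      from F(1)[OF this] show ?thesis using adjoint_distance_domain[OF e] by simp
    qed
    have "F (\<lambda>p. of_real (-1) * d p) = -1 * F d" by (rule F(3)[OF dG])
    then show ?thesis using le[OF adjoint_domain_scale[OF N d, of "of_real (-1)"]] le[OF d] by simp
  qed
  obtain T where T: "T \<in> bounded_ops M N"
    and pair: "\<And>f g. nuclear_rep M N f g \<Longrightarrow>
      pairing N T f g = of_real (F (rep_kernel f g)) - \<i> * of_real (F (\<lambda>p. \<i> * rep_kernel f g p))"
    and FT: "\<And>f g. f \<in> L2 M \<Longrightarrow> g \<in> L2 N \<Longrightarrow> F (tensor f g) = Re (L2_inner N (T f) g)"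
  proof (rule functional_is_operator[OF N, where F = F])
    show "F (\<lambda>p. h p + h' p) = F h + F h'" if "h \<in> nuclear_kernels M N" "h' \<in> nuclear_kernels M N" for h h'
      by (rule F(2)[OF that])
    show "F (\<lambda>p. of_real r * h p) = r * F h" if "h \<in> nuclear_kernels M N" for r h by (rule F(3)[OF that])
    show "F h \<le> rep_weight M N f g"
      if r: "nuclear_rep M N f g" "AE p in M \<Otimes>\<^sub>M N. h p = rep_kernel f g p" for f g h
      using F(1)[OF nuclear_kernelsI[OF r]] adjoint_distance_le_norm[OF r, of \<phi>] by linarith
  qed (rule that)
  have ann: "pairing N T f g = 0" if r: "nuclear_rep M N f g" "nuclear_rep M N f' g'"
    and k: "AE p in M \<Otimes>\<^sub>M N. \<phi> p * rep_kernel f g p = rep_kernel f' g' p" for f g f' g'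
  proof -
    have "rep_kernel f g \<in> nuclear_kernels M N" by (rule nuclear_kernelsI[OF r(1)]) simp
    moreover have "(\<lambda>p. \<phi> p * rep_kernel f g p) \<in> nuclear_kernels M N" by (rule nuclear_kernelsI[OF r(2) k])
    ultimately have d: "rep_kernel f g \<in> adjoint_domain M N \<phi>" by (simp add: adjoint_domain_def)
    show ?thesis
      unfolding pair[OF r(1)] F0[OF d] F0[OF adjoint_domain_scale[OF N d]] by simp
  qed
  have "op_eq M N T (\<lambda>_ _. 0)"
    by (rule cl[unfolded closable_iff_annihilator_trivial[OF M N \<phi>], rule_format, OF T]) (rule ann)
  then have "AE y in N. T f y = 0" using f by (simp add: op_eq_def)
  then have "L2_norm N (T f) = 0" using L2_norm_eq_0_iff[OF bounded_ops_L2[OF T f]] by simp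
  then have "L2_inner N (T f) g = 0" using L2_inner_bound[OF bounded_ops_L2[OF T f] g] by simp
  then show ?thesis using FT[OF f g] F(4) by simp
qed

subsection \<open>Pointwise representation of nuclear kernels\<close>

text \<open>Rescaling the two factors of each term to the same norm turns absolute convergence of
  \<open>\<Sum>i. L2_norm M (f i) * L2_norm N (g i)\<close> into square-summability, first in norm and then
  pointwise almost everywhere.\<close>

lemma balanced_term:
  assumes N: "sigma_finite_measure N" and f: "f \<in> L2 M" and g: "g \<in> L2 N"
  shows "\<exists>f' g'. f' \<in> L2 M \<and> g' \<in> L2 N \<and> (L2_norm M f')\<^sup>2 = L2_norm M f * L2_norm N g \<and>
    (L2_norm N g')\<^sup>2 = L2_norm M f * L2_norm N g \<and> (AE p in M \<Otimes>\<^sub>M N. tensor f' g' p = tensor f g p)"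
proof (cases "L2_norm M f * L2_norm N g = 0")
  case True
  have "AE p in M \<Otimes>\<^sub>M N. tensor f g p = 0"
  proof -
    have "L2_norm (M \<Otimes>\<^sub>M N) (tensor f g) = 0"
      using tensor_L2(2)[OF N f g] True L2_norm_nonneg[of "M \<Otimes>\<^sub>M N" "tensor f g"] by linarith
    then show ?thesis using L2_norm_eq_0_iff[OF tensor_L2(1)[OF N f g]] by simp
  qed
  then have "AE p in M \<Otimes>\<^sub>M N. tensor (\<lambda>_. 0) (\<lambda>_. 0) p = tensor f g p"
    by eventually_elim (simp add: tensor_def)
  with True show ?thesis by (intro exI[of _ "\<lambda>_. 0"] conjI) (simp_all add: tensor_def)
next
  case False
  define u v where "u = L2_norm M f" and "v = L2_norm N g"
  have uv: "u > 0" "v > 0" using False by (auto simp: u_def v_def less_le)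
  define r where "r = sqrt (v / u)"
  have r: "r > 0" "r\<^sup>2 = v / u" using uv by (auto simp: r_def)
  let ?f = "\<lambda>x. complex_of_real r * f x" and ?g = "\<lambda>y. complex_of_real (1 / r) * g y"
  show ?thesis
  proof (intro exI conjI)
    show "?f \<in> L2 M" "?g \<in> L2 N" by (intro L2_scale f g)+
    show "(L2_norm M ?f)\<^sup>2 = L2_norm M f * L2_norm N g"
      unfolding L2_norm_scale power_mult_distrib norm_of_real power2_abs r(2) u_def[symmetric] v_def[symmetric]
      using uv by (simp add: power2_eq_square)
    have "(1 / r)\<^sup>2 = u / v" using r uv by (simp add: power_divide)
    then show "(L2_norm N ?g)\<^sup>2 = L2_norm M f * L2_norm N g"
      unfolding L2_norm_scale power_mult_distrib norm_of_real power2_abs u_def[symmetric] v_def[symmetric]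
      using uv by (simp add: power2_eq_square)
    show "AE p in M \<Otimes>\<^sub>M N. tensor ?f ?g p = tensor f g p"
      using r(1) by (intro AE_I2) (simp add: tensor_def)
  qed
qed

lemma square_summable_AE:
  assumes f: "\<And>i::nat. f i \<in> L2 M" and s: "summable (\<lambda>i. (L2_norm M (f i))\<^sup>2)"
  obtains c where "l2_family M c" "AE x in M. \<forall>i. c i x = f i x"
    "(\<integral>\<^sup>+x. ennreal ((l2_norm (\<lambda>i. c i x))\<^sup>2) \<partial>M) \<le> ennreal (\<Sum>i. (L2_norm M (f i))\<^sup>2)"
proof -
  note [measurable] = L2_measurable[OF f]
  have "(\<integral>\<^sup>+x. (\<Sum>i. ennreal ((cmod (f i x))\<^sup>2)) \<partial>M) = (\<Sum>i. \<integral>\<^sup>+x. ennreal ((cmod (f i x))\<^sup>2) \<partial>M)"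
    by (rule nn_integral_suminf) measurable
  also have "\<dots> = (\<Sum>i. ennreal ((L2_norm M (f i))\<^sup>2))" by (simp add: L2_nn_integral[OF f])
  also have "\<dots> = ennreal (\<Sum>i. (L2_norm M (f i))\<^sup>2)" by (rule suminf_ennreal2[OF _ s]) simp
  finally have int: "(\<integral>\<^sup>+x. (\<Sum>i. ennreal ((cmod (f i x))\<^sup>2)) \<partial>M) = ennreal (\<Sum>i. (L2_norm M (f i))\<^sup>2)" .
  have "AE x in M. (\<Sum>i. ennreal ((cmod (f i x))\<^sup>2)) \<noteq> \<infinity>"
    by (rule nn_integral_noteq_infinite) (use int in auto)
  then have "AE x in M. l2 (\<lambda>i. f i x)"
    by eventually_elim (auto intro: summable_suminf_not_top)
  then obtain c where c: "l2_family M c" "AE x in M. \<forall>i. c i x = f i x"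
    by (rule l2_family_modify[OF L2_measurable[OF f]])
  have "(\<integral>\<^sup>+x. ennreal ((l2_norm (\<lambda>i. c i x))\<^sup>2) \<partial>M) = (\<integral>\<^sup>+x. (\<Sum>i. ennreal ((cmod (f i x))\<^sup>2)) \<partial>M)"
  proof (rule nn_integral_cong_AE)
    show "AE x in M. ennreal ((l2_norm (\<lambda>i. c i x))\<^sup>2) = (\<Sum>i. ennreal ((cmod (f i x))\<^sup>2))"
      using c(2)
    proof eventually_elim
      case (elim x)
      have "ennreal ((l2_norm (\<lambda>i. c i x))\<^sup>2) = (\<Sum>i. ennreal ((cmod (c i x))\<^sup>2))"
        unfolding l2_norm_square[OF l2_familyD(2)[OF c(1)]]
        by (rule suminf_ennreal2[symmetric]) (simp_all add: l2_familyD(2)[OF c(1)])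
      then show ?case using elim by simp
    qed
  qed
  then show ?thesis using that[OF c] int by simp
qed

lemma nuclear_kernel_family:
  assumes N: "sigma_finite_measure N" and r: "nuclear_rep M N f g"
  obtains c d where "l2_family M c" "l2_family N d"
    "AE p in M \<Otimes>\<^sub>M N. rep_kernel f g p = family_product c d p"
    "(\<integral>\<^sup>+x. ennreal ((l2_norm (\<lambda>i. c i x))\<^sup>2) \<partial>M) \<le> ennreal (rep_weight M N f g)"
    "(\<integral>\<^sup>+y. ennreal ((l2_norm (\<lambda>i. d i y))\<^sup>2) \<partial>N) \<le> ennreal (rep_weight M N f g)"
proof -
  note L = nuclear_repD[OF r]
  have "\<forall>i. \<exists>fg. fst fg \<in> L2 M \<and> snd fg \<in> L2 N \<and> (L2_norm M (fst fg))\<^sup>2 = L2_norm M (f i) * L2_norm N (g i) \<and>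
    (L2_norm N (snd fg))\<^sup>2 = L2_norm M (f i) * L2_norm N (g i) \<and>
    (AE p in M \<Otimes>\<^sub>M N. tensor (fst fg) (snd fg) p = tensor (f i) (g i) p)"
  proof (rule allI)
    fix i
    from balanced_term[OF N L(1,2), of i i] obtain f' g' where
      "f' \<in> L2 M \<and> g' \<in> L2 N \<and> (L2_norm M f')\<^sup>2 = L2_norm M (f i) * L2_norm N (g i) \<and>
      (L2_norm N g')\<^sup>2 = L2_norm M (f i) * L2_norm N (g i) \<and>
      (AE p in M \<Otimes>\<^sub>M N. tensor f' g' p = tensor (f i) (g i) p)"
      by (elim exE) (rule that)
    then show "\<exists>fg. fst fg \<in> L2 M \<and> snd fg \<in> L2 N \<and> (L2_norm M (fst fg))\<^sup>2 = L2_norm M (f i) * L2_norm N (g i) \<and>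
      (L2_norm N (snd fg))\<^sup>2 = L2_norm M (f i) * L2_norm N (g i) \<and>
      (AE p in M \<Otimes>\<^sub>M N. tensor (fst fg) (snd fg) p = tensor (f i) (g i) p)"
      by (intro exI[of _ "(f', g')"]) simp
  qed
  from choice[OF this] obtain fg where fg: "\<forall>i. fst (fg i) \<in> L2 M \<and> snd (fg i) \<in> L2 N \<and>
    (L2_norm M (fst (fg i)))\<^sup>2 = L2_norm M (f i) * L2_norm N (g i) \<and>
    (L2_norm N (snd (fg i)))\<^sup>2 = L2_norm M (f i) * L2_norm N (g i) \<and>
    (AE p in M \<Otimes>\<^sub>M N. tensor (fst (fg i)) (snd (fg i)) p = tensor (f i) (g i) p)"
    by (elim exE) (rule that)
  define f1 where "f1 i = fst (fg i)" for i
  define g1 where "g1 i = snd (fg i)" for i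
  have f1: "f1 i \<in> L2 M" "(L2_norm M (f1 i))\<^sup>2 = L2_norm M (f i) * L2_norm N (g i)" for i
    using fg by (simp_all add: f1_def)
  have g1: "g1 i \<in> L2 N" "(L2_norm N (g1 i))\<^sup>2 = L2_norm M (f i) * L2_norm N (g i)" for i
    using fg by (simp_all add: g1_def)
  have t1: "AE p in M \<Otimes>\<^sub>M N. tensor (f1 i) (g1 i) p = tensor (f i) (g i) p" for i
    using fg by (simp add: f1_def g1_def)
  have sf: "summable (\<lambda>i. (L2_norm M (f1 i))\<^sup>2)" unfolding f1(2) by (rule L(3))
  have sg: "summable (\<lambda>i. (L2_norm N (\<lambda>y. cnj (g1 i y)))\<^sup>2)" unfolding L2_norm_cnj g1(2) by (rule L(3))
  obtain c where c: "l2_family M c" "AE x in M. \<forall>i. c i x = f1 i x"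
    "(\<integral>\<^sup>+x. ennreal ((l2_norm (\<lambda>i. c i x))\<^sup>2) \<partial>M) \<le> ennreal (\<Sum>i. (L2_norm M (f1 i))\<^sup>2)"
    by (rule square_summable_AE[OF f1(1) sf])
  obtain d where d: "l2_family N d" "AE y in N. \<forall>i. d i y = cnj (g1 i y)"
    "(\<integral>\<^sup>+y. ennreal ((l2_norm (\<lambda>i. d i y))\<^sup>2) \<partial>N) \<le> ennreal (\<Sum>i. (L2_norm N (\<lambda>y. cnj (g1 i y)))\<^sup>2)"
    by (rule square_summable_AE[OF L2_cnj[OF g1(1)] sg])
  have "AE p in M \<Otimes>\<^sub>M N. \<forall>i. tensor (f1 i) (g1 i) p = tensor (f i) (g i) p"
    unfolding AE_all_countable using t1 by (rule allI)
  then have "AE p in M \<Otimes>\<^sub>M N. rep_kernel f g p = family_product c d p"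
    using AE_fst[OF c(2) N] AE_snd[OF d(2) N]
  proof eventually_elim
    case (elim p)
    have "tensor (f i) (g i) p = c i (fst p) * d i (snd p)" for i
      using elim by (simp add: tensor_def)
    then show ?case by (simp add: rep_kernel_def family_product_def)
  qed
  moreover have "(\<integral>\<^sup>+x. ennreal ((l2_norm (\<lambda>i. c i x))\<^sup>2) \<partial>M) \<le> ennreal (rep_weight M N f g)"
    using c(3) by (simp add: f1(2) rep_weight_def)
  moreover have "(\<integral>\<^sup>+y. ennreal ((l2_norm (\<lambda>i. d i y))\<^sup>2) \<partial>N) \<le> ennreal (rep_weight M N f g)"
    using d(3) by (simp add: g1(2) rep_weight_def)
  ultimately show ?thesis using that[OF c(1) d(1)] by simp
qed

lemma AE_tendsto_0_of_summable_integrals: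
  assumes [measurable]: "\<And>n::nat. F n \<in> borel_measurable M" and nonneg: "\<And>n x. 0 \<le> (F n x :: real)"
    and le: "\<And>n. (\<integral>\<^sup>+x. ennreal (F n x) \<partial>M) \<le> ennreal ((1/2) ^ n)"
  shows "AE x in M. (\<lambda>n. F n x) \<longlonglongrightarrow> 0"
proof -
  have "(\<integral>\<^sup>+x. (\<Sum>n. ennreal (F n x)) \<partial>M) = (\<Sum>n. \<integral>\<^sup>+x. ennreal (F n x) \<partial>M)"
    by (rule nn_integral_suminf) measurable
  also have "\<dots> \<le> (\<Sum>n. ennreal ((1/2) ^ n))" by (rule suminf_le[OF le]) auto
  also have "\<dots> = ennreal (\<Sum>n. (1/2) ^ n)" by (rule suminf_ennreal2) (auto intro: summable_geometric)
  finally have "(\<integral>\<^sup>+x. (\<Sum>n. ennreal (F n x)) \<partial>M) \<noteq> \<infinity>" by (auto simp: top_unique)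
  then have "AE x in M. (\<Sum>n. ennreal (F n x)) \<noteq> \<infinity>" by (intro nn_integral_noteq_infinite) auto
  then show ?thesis
  proof eventually_elim
    case (elim x)
    then have "summable (\<lambda>n. F n x)" by (intro summable_suminf_not_top nonneg) auto
    then show ?case by (rule summable_LIMSEQ_zero)
  qed
qed

lemma positive_L2_function:
  assumes "sigma_finite_measure M"
  obtains a where "a \<in> L2 M" "\<And>x. x \<in> space M \<Longrightarrow> a x \<noteq> 0"
proof -
  obtain h where h: "h \<in> borel_measurable M" "integral\<^sup>N M h \<noteq> \<infinity>" "\<forall>x\<in>space M. 0 < h x \<and> h x < \<infinity>"
    using sigma_finite_measure.Ex_finite_integrable_function[OF assms] by (elim bexE conjE)
  note [measurable] = h(1)
  define a where "a x = complex_of_real (sqrt (enn2real (h x)))" for x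
  have am: "a \<in> borel_measurable M" unfolding a_def by measurable
  have "(\<integral>\<^sup>+x. ennreal ((cmod (a x))\<^sup>2) \<partial>M) = integral\<^sup>N M h"
    by (rule nn_integral_cong) (use h(3) in \<open>auto simp: a_def ennreal_enn2real\<close>)
  also have "\<dots> = ennreal ((sqrt (enn2real (integral\<^sup>N M h)))\<^sup>2)"
    using h(2) by (simp add: less_top)
  finally have "(\<integral>\<^sup>+x. ennreal ((cmod (a x))\<^sup>2) \<partial>M) \<le> ennreal ((sqrt (enn2real (integral\<^sup>N M h)))\<^sup>2)" by simp
  from L2_nn_integralI(1)[OF am _ this] have "a \<in> L2 M" by simp
  moreover have "a x \<noteq> 0" if "x \<in> space M" for x
    using h(3) that by (auto simp: a_def enn2real_eq_0_iff)
  ultimately show ?thesis by (rule that)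
qed

subsection \<open>The necessity of the condition\<close>

lemma prepend_family:
  assumes a: "a \<in> borel_measurable M" and c: "l2_family M c"
  shows "l2_family M (case_nat a c)"
proof -
  have "l2 (\<lambda>i. case_nat a c i x)" for x
    using summable_Suc_iff[of "\<lambda>i. (cmod (case_nat a c i x))\<^sup>2"] l2_familyD(2)[OF c, of x] by simp
  moreover have "case_nat a c i \<in> borel_measurable M" for i
    using a l2_familyD(1)[OF c] by (cases i) auto
  ultimately show ?thesis by (simp add: l2_family_def)
qed

text \<open>Choose \<open>h n\<close> in the adjoint domain converging to an elementary tensor \<open>tensor a b\<close> without
  zeros, fast enough that the convergence holds pointwise outside a marginally null set. There some
  \<open>h n\<close> does not vanish. Each \<open>h n\<close> is a denominator for \<open>\<phi>\<close> with the numerator \<open>\<phi> * h n\<close>, and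
  \<open>common_denominator\<close> combines them.\<close>

lemma closable_imp_quotient:
  assumes M: "sigma_finite_measure M" and N: "sigma_finite_measure N"
    and \<phi>: "\<phi> \<in> borel_measurable (M \<Otimes>\<^sub>M N)" and cl: "weak_star_closable_multiplier M N \<phi>"
  shows "\<exists>t s. t \<in> V_functions M N \<and> omega_continuous M N t \<and>
    s \<in> V_functions M N \<and> omega_continuous M N s \<and>
    marginally_null M N {p \<in> space (M \<Otimes>\<^sub>M N). s p = 0} \<and> (AE p in M \<Otimes>\<^sub>M N. \<phi> p = t p / s p)"
proof -
  obtain a where a: "a \<in> L2 M" "\<And>x. x \<in> space M \<Longrightarrow> a x \<noteq> 0" using positive_L2_function[OF M] by blast
  obtain b where b: "b \<in> L2 N" "\<And>y. y \<in> space N \<Longrightarrow> b y \<noteq> 0" using positive_L2_function[OF N] by blast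
  have dist: "adjoint_distance M N \<phi> (tensor a b) = 0" by (rule closable_imp_dense[OF M N \<phi> cl a(1) b(1)])
  have ex: "\<exists>f g. nuclear_rep M N f g \<and> rep_weight M N f g < (1/2) ^ n \<and>
      (\<lambda>p. tensor a b p - rep_kernel f g p) \<in> adjoint_domain M N \<phi>" for n :: nat
  proof (rule ccontr)
    assume neg: "\<not> ?thesis"
    have "(1/2) ^ n \<le> adjoint_distance M N \<phi> (tensor a b)"
      by (rule adjoint_distance_ge[OF tensor_nuclear[OF a(1) b(1)]]) (use neg in force)
    moreover have "(0::real) < (1/2) ^ n" by simp
    ultimately show False using dist by linarith
  qed
  define Z where "Z n = (\<lambda>(c, d, C, D). l2_family M c \<and> l2_family N d \<and> l2_family M C \<and> l2_family N D \<and>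
    (\<integral>\<^sup>+x. ennreal ((l2_norm (\<lambda>i. c i x))\<^sup>2) \<partial>M) \<le> ennreal ((1/2) ^ n) \<and>
    (\<integral>\<^sup>+y. ennreal ((l2_norm (\<lambda>i. d i y))\<^sup>2) \<partial>N) \<le> ennreal ((1/2) ^ n) \<and>
    (AE p in M \<Otimes>\<^sub>M N. \<phi> p * (tensor a b p - family_product c d p) = family_product C D p))"
    for n :: nat and q
  have "\<forall>n. \<exists>q. Z n q"
  proof (rule allI)
    fix n
    from ex[of n] obtain f g where r: "nuclear_rep M N f g" and w: "rep_weight M N f g < (1/2) ^ n"
      and dom: "(\<lambda>p. tensor a b p - rep_kernel f g p) \<in> adjoint_domain M N \<phi>"
      by (elim exE conjE)
    obtain c d where cd: "l2_family M c" "l2_family N d" "AE p in M \<Otimes>\<^sub>M N. rep_kernel f g p = family_product c d p"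
      "(\<integral>\<^sup>+x. ennreal ((l2_norm (\<lambda>i. c i x))\<^sup>2) \<partial>M) \<le> ennreal (rep_weight M N f g)"
      "(\<integral>\<^sup>+y. ennreal ((l2_norm (\<lambda>i. d i y))\<^sup>2) \<partial>N) \<le> ennreal (rep_weight M N f g)"
      by (rule nuclear_kernel_family[OF N r])
    have "(\<lambda>p. \<phi> p * (tensor a b p - rep_kernel f g p)) \<in> nuclear_kernels M N"
      using dom by (simp add: adjoint_domain_def)
    then obtain f' g' where r': "nuclear_rep M N f' g'"
      and k': "AE p in M \<Otimes>\<^sub>M N. \<phi> p * (tensor a b p - rep_kernel f g p) = rep_kernel f' g' p"
      by (rule nuclear_kernelsE)
    obtain C D where CD: "l2_family M C" "l2_family N D" "AE p in M \<Otimes>\<^sub>M N. rep_kernel f' g' p = family_product C D p"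
      by (rule nuclear_kernel_family[OF N r'])
    have le: "ennreal (rep_weight M N f g) \<le> ennreal ((1/2) ^ n)" using w by (intro ennreal_leI) simp
    have "AE p in M \<Otimes>\<^sub>M N. \<phi> p * (tensor a b p - family_product c d p) = family_product C D p"
      using cd(3) k' CD(3) by eventually_elim simp
    then have "Z n (c, d, C, D)"
      unfolding Z_def prod.case
      by (intro conjI cd(1,2) CD(1,2) order_trans[OF cd(4) le] order_trans[OF cd(5) le])
    then show "\<exists>q. Z n q" by (rule exI)
  qed
  from choice[OF this] obtain q where q: "\<forall>n. Z n (q n)" by (elim exE) (rule that)
  define c where "c n = fst (q n)" for n
  define d where "d n = fst (snd (q n))" for n
  define C where "C n = fst (snd (snd (q n)))" for n
  define D where "D n = snd (snd (snd (q n)))" for n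
  have qn: "Z n (c n, d n, C n, D n)" for n using q by (simp add: c_def d_def C_def D_def)
  have c: "l2_family M (c n)" and d: "l2_family N (d n)" and C: "l2_family M (C n)" and D: "l2_family N (D n)"
    and ci: "(\<integral>\<^sup>+x. ennreal ((l2_norm (\<lambda>i. c n i x))\<^sup>2) \<partial>M) \<le> ennreal ((1/2) ^ n)"
    and di: "(\<integral>\<^sup>+y. ennreal ((l2_norm (\<lambda>i. d n i y))\<^sup>2) \<partial>N) \<le> ennreal ((1/2) ^ n)"
    and quot: "AE p in M \<Otimes>\<^sub>M N. \<phi> p * (tensor a b p - family_product (c n) (d n) p) = family_product (C n) (D n) p"
    for n using qn[of n] unfolding Z_def prod.case by - (elim conjE, assumption)+
  note [measurable] = l2_familyD(1)[OF c] l2_familyD(1)[OF d]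
  have c0: "AE x in M. (\<lambda>n. (l2_norm (\<lambda>i. c n i x))\<^sup>2) \<longlonglongrightarrow> 0"
    by (rule AE_tendsto_0_of_summable_integrals[OF _ _ ci]) auto
  have d0: "AE y in N. (\<lambda>n. (l2_norm (\<lambda>i. d n i y))\<^sup>2) \<longlonglongrightarrow> 0"
    by (rule AE_tendsto_0_of_summable_integrals[OF _ _ di]) auto
  \<comment> \<open>These are the families whose product is \<open>h n = tensor a b - family_product (c n) (d n)\<close>.\<close>
  define A where "A n = case_nat a (c n)" for n
  define B where "B n = case_nat (\<lambda>y. cnj (b y)) (\<lambda>i y. - d n i y)" for n
  have dneg: "l2_family N (\<lambda>i y. - d n i y)" for n
    using l2_familyD[OF d] by (simp add: l2_family_def)
  have A: "l2_family M (A n)" for n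
    unfolding A_def by (rule prepend_family[OF L2_measurable[OF a(1)] c])
  have B: "l2_family N (B n)" for n
    unfolding B_def by (rule prepend_family[OF L2_measurable[OF L2_cnj[OF b(1)]] dneg])
  have AB: "family_product (A n) (B n) p = tensor a b p - family_product (c n) (d n) p" for n p
  proof -
    have "(\<lambda>i. A n (Suc i) (fst p) * B n (Suc i) (snd p)) sums (- family_product (c n) (d n) p)"
      using sums_minus[OF family_product_sums[OF c d, of n p]] by (simp add: A_def B_def)
    then have "(\<lambda>i. A n i (fst p) * B n i (snd p)) sums (- family_product (c n) (d n) p + A n 0 (fst p) * B n 0 (snd p))"
      by (rule sums_Suc)
    then show ?thesis by (simp add: family_product_def sums_iff A_def B_def tensor_def)
  qed
  obtain A' B' C' D' where fam: "l2_family M A'" "l2_family N B'" "l2_family M C'" "l2_family N D'"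
    and nz: "\<And>p n. family_product (A n) (B n) p \<noteq> 0 \<Longrightarrow> family_product A' B' p \<noteq> 0"
    and eq: "\<And>p z. (\<And>n. z * family_product (A n) (B n) p = family_product (C n) (D n) p) \<Longrightarrow>
       z * family_product A' B' p = family_product C' D' p"
    using common_denominator[where a = A and b = B and c = C and d = D, OF A B C D] by blast
  have null: "marginally_null M N {p \<in> space (M \<Otimes>\<^sub>M N). family_product A' B' p = 0}"
  proof (rule marginally_nullI_AE[OF c0 d0])
    fix x y assume xy: "(x, y) \<in> {p \<in> space (M \<Otimes>\<^sub>M N). family_product A' B' p = 0}"
    then have sp: "x \<in> space M" "y \<in> space N" by (auto simp: space_pair_measure)
    have False if l: "(\<lambda>n. (l2_norm (\<lambda>i. c n i x))\<^sup>2) \<longlonglongrightarrow> 0" "(\<lambda>n. (l2_norm (\<lambda>i. d n i y))\<^sup>2) \<longlonglongrightarrow> 0"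
    proof -
      have z: "family_product (A n) (B n) (x, y) = 0" for n using nz[of n "(x, y)"] xy by auto
      have "cmod (tensor a b (x, y)) \<le> l2_norm (\<lambda>i. c n i x) * l2_norm (\<lambda>i. d n i y)" for n
      proof -
        have "tensor a b (x, y) = family_product (c n) (d n) (x, y)"
          using z[of n] unfolding AB by simp
        then show ?thesis
          using l2_product(3)[OF l2_familyD(2)[OF c] l2_familyD(2)[OF d], of n x n y]
          by (simp add: family_product_def)
      qed
      then have le: "(cmod (tensor a b (x, y)))\<^sup>2 \<le> (l2_norm (\<lambda>i. c n i x))\<^sup>2 * (l2_norm (\<lambda>i. d n i y))\<^sup>2" for n
        unfolding power_mult_distrib[symmetric] by (intro power_mono) auto
      have "(\<lambda>n. (l2_norm (\<lambda>i. c n i x))\<^sup>2 * (l2_norm (\<lambda>i. d n i y))\<^sup>2) \<longlonglongrightarrow> 0 * 0"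
        by (rule tendsto_mult[OF l])
      then have "(cmod (tensor a b (x, y)))\<^sup>2 \<le> 0 * 0"
        by (rule LIMSEQ_le_const) (use le in auto)
      then have "tensor a b (x, y) = 0" by simp
      then show False using a(2)[OF sp(1)] b(2)[OF sp(2)] by (simp add: tensor_def)
    qed
    then show "x \<in> space M \<and> y \<in> space N \<and> \<not> ((\<lambda>n. (l2_norm (\<lambda>i. c n i x))\<^sup>2) \<longlonglongrightarrow> 0 \<and>
        (\<lambda>n. (l2_norm (\<lambda>i. d n i y))\<^sup>2) \<longlonglongrightarrow> 0)"
      using sp by blast
  qed
  have "AE p in M \<Otimes>\<^sub>M N. \<forall>n. \<phi> p * family_product (A n) (B n) p = family_product (C n) (D n) p"
    unfolding AE_all_countable AB using quot by (rule allI)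
  then have ae: "AE p in M \<Otimes>\<^sub>M N. \<phi> p = family_product C' D' p / family_product A' B' p"
    using marginally_null_imp_AE[OF N null] AE_space
  proof eventually_elim
    case (elim p)
    then have "\<phi> p * family_product A' B' p = family_product C' D' p" by (intro eq) simp
    moreover have "family_product A' B' p \<noteq> 0" using elim by simp
    ultimately show ?case by (simp add: eq_divide_eq)
  qed
  show ?thesis
    by (rule exI[of _ "family_product C' D'"], rule exI[of _ "family_product A' B'"])
      (intro conjI family_product_V[OF fam(3,4)] family_product_V[OF fam(1,2)] null ae
        family_product_omega_continuous[OF fam(3,4)] family_product_omega_continuous[OF fam(1,2)])
qed

section \<open>Closable multipliers and quotients\<close>

theorem theorem4p4:
  fixes M :: "'a measure" and N :: "'b measure" and \<phi> :: "'a \<times> 'b \<Rightarrow> complex"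
  assumes "standard_sigma_finite M" and "standard_sigma_finite N"
    and "\<phi> \<in> borel_measurable (M \<Otimes>\<^sub>M N)"
  shows "weak_star_closable_multiplier M N \<phi> \<longleftrightarrow>
    (\<exists>t s. t \<in> V_functions M N \<and> omega_continuous M N t \<and>
           s \<in> V_functions M N \<and> omega_continuous M N s \<and>
           marginally_null M N {p \<in> space (M \<Otimes>\<^sub>M N). s p = 0} \<and>
           (AE p in M \<Otimes>\<^sub>M N. \<phi> p = t p / s p))"
proof
  have "sigma_finite_measure M" "sigma_finite_measure N"
    using assms(1,2) by (auto simp: standard_sigma_finite_def)
  then show "weak_star_closable_multiplier M N \<phi> \<Longrightarrow>
    \<exists>t s. t \<in> V_functions M N \<and> omega_continuous M N t \<and>
           s \<in> V_functions M N \<and> omega_continuous M N s \<and>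
           marginally_null M N {p \<in> space (M \<Otimes>\<^sub>M N). s p = 0} \<and>
           (AE p in M \<Otimes>\<^sub>M N. \<phi> p = t p / s p)"
    by (rule closable_imp_quotient[OF _ _ assms(3)])
next
  assume "\<exists>t s. t \<in> V_functions M N \<and> omega_continuous M N t \<and>
           s \<in> V_functions M N \<and> omega_continuous M N s \<and>
           marginally_null M N {p \<in> space (M \<Otimes>\<^sub>M N). s p = 0} \<and>
           (AE p in M \<Otimes>\<^sub>M N. \<phi> p = t p / s p)"
  then show "weak_star_closable_multiplier M N \<phi>"
    by (elim exE conjE) (rule quotient_imp_closable[OF assms])
qed

end
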